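(* Let $!$ be one of $!_\emptyset$, $!_{\{\sigma\}}$, $!_{\{\sigma,\delta,\epsilon\}}$, respectively the free strict monoidal category, free symmetric strict monoidal category, and free cartesian category (category with specified finite products) monads on $\mathbf{Cat}$, extended to a (pseudo-)monad on the bicategory $\mathbf{Prof}$ of categories and profunctors, and let $?$ be the associated (pseudo-)comonad on $\mathbf{Prof}$. Then non-symmetric operads, symmetric operads, and clones (in $\mathbf{Set}$), respectively, are exactly the monoids in the monoidal category $\mathbf{Prof}_?[\mathbf 1,\mathbf 1]$ of endomorphisms of the terminal category $\mathbf 1$ in the coKleisli bicategory $\mathbf{Prof}_?$; that is, they are the functors $Z:{?}\mathbf 1\to\mathbf{Set}$ equipped with natural transformations $e:I\to Z$ and $m:Z\bullet Z\to Z$ satisfying the monoid laws, where $I$ and $\bullet$ are the identity and the composition of $\mathbf{Prof}_?$.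
   Context: Operads here are one-object (uncoloured) operads in $\mathbf{Set}$; clones are abstract clones. **The monads.** For $X\in\{\emptyset,\{\sigma\},\{\sigma,\delta,\epsilon\}\}$ and a category $\mathbf C$, ${!_X}\mathbf C$ has as objects the finite (possibly empty) sequences of objects of $\mathbf C$. A morphism $(C_1,\ldots,C_n)\to(D_1,\ldots,D_m)$ is a function $f:\{1,\ldots,m\}\to\{1,\ldots,n\}$ together with morphisms $g_j:C_{f(j)}\to D_j$ of $\mathbf C$, where $f$ ranges over identities, bijections, all functions, respectively. The unit sends $C$ to $(C)$ and the multiplication flattens sequences of sequences by concatenation. **The operation $?$.** ${?}\mathbf C=({!}(\mathbf C^{op}))^{op}$. The objects of ${?}\mathbf 1$ are written $0,1,2,\ldots$; a morphism $m\to n$ in ${?}\mathbf 1$ is a function from an $m$-element to an $n$-element set that is an identity, a bijection, an arbitrary function, respectively. **Profunctors.** All categories are small. A profunctor $\Phi$ from $\mathbf C$ to $\mathbf C'$ is a functor $\mathbf C\times\mathbf C'^{op}\to\mathbf{Set}$; composition is $(\Psi\circ\Phi)(C,C'')=\int^{C'}\Psi(C',C'')\times\Phi(C,C')$. For a profunctor $\Phi$ from $\mathbf C_1$ to $\mathbf C_2$, the profunctor $\Phi^{op}$ from $\mathbf C_2^{op}$ to $\mathbf C_1^{op}$ is $\Phi^{op}(C_2,C_1)=\Phi(C_1,C_2)$. **Extension to $\mathbf{Prof}$.** For $\Phi$ from $\mathbf C$ to $\mathbf C'$, ${!}\Phi$ from ${!}\mathbf C$ to ${!}\mathbf C'$ is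 $${!}\Phi((C_1,\ldots,C_n),\vec C')=\int^{D'_1,\ldots,D'_n\in\mathbf C'}\Phi(C_1,D'_1)\times\cdots\times\Phi(C_n,D'_n)\times{!}\mathbf C'[\vec C',(D'_1,\ldots,D'_n)],$$ with unit and multiplication the profunctors $(C,\vec D)\mapsto{!}\mathbf C[\vec D,(C)]$ and $((\vec C_1,\ldots,\vec C_n),\vec D)\mapsto{!}\mathbf C[\vec D,\vec C_1\cdots\vec C_n]$. By duality, $?$ is a comonad on $\mathbf{Prof}$: ${?}\Phi=({!}(\Phi^{op}))^{op}$, with counit $(\vec C,D)\mapsto{?}\mathbf C[(D),\vec C]$ and comultiplication $d$ from ${?}\mathbf C$ to ${??}\mathbf C$, $(\vec C,(\vec D_1,\ldots,\vec D_n))\mapsto{?}\mathbf C[\vec D_1\cdots\vec D_n,\vec C]$. **CoKleisli bicategory.** $\mathbf{Prof}_?$ has categories as objects, $\mathbf{Prof}_?[\mathbf C,\mathbf C']=\mathbf{Prof}[{?}\mathbf C,\mathbf C']$, composition $\Psi\bullet\Phi=\Psi\circ({?}\Phi)\circ d$, and the counits as identities. Objects of $\mathbf{Prof}_?[\mathbf 1,\mathbf 1]$ are identified with functors $Z:{?}\mathbf 1\to\mathbf{Set}$; it is a monoidal category under $\bullet$ with unit $I$. All equalities of profunctors are understood up to canonical natural isomorphism; coherence issues are ignored (the paper's convention). *)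

theory Defs
  imports "HOL-Library.FuncSet" "HOL-Combinatorics.Permutations"
begin

section \<open>Categories and set-valued functors\<close>

text \<open>\<open>cmp C a b c g f\<close> is the composite of \<open>f : a \<rightarrow> b\<close> followed by \<open>g : b \<rightarrow> c\<close>. Hom-sets need not be
  disjoint, which is why objects are passed explicitly. All structure below is extensional
  (equal to \<open>undefined\<close> outside its domain), so that equality of records is equality of the
  mathematical structures.\<close>

record ('o, 'm) category =
  obj :: "'o set"
  hom :: "'o \<Rightarrow> 'o \<Rightarrow> 'm set"
  ident :: "'o \<Rightarrow> 'm"
  cmp :: "'o \<Rightarrow> 'o \<Rightarrow> 'o \<Rightarrow> 'm \<Rightarrow> 'm \<Rightarrow> 'm"

definition one_cat :: "(unit, unit) category" where
  "one_cat = \<lparr>obj = UNIV, hom = (\<lambda>_ _. UNIV), ident = (\<lambda>_. ()), cmp = (\<lambda>_ _ _ _ _. ())\<rparr>"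

definition op_cat :: "('o, 'm) category \<Rightarrow> ('o, 'm) category" where
  "op_cat C = \<lparr>obj = obj C, hom = (\<lambda>a b. hom C b a), ident = ident C,
     cmp = (\<lambda>a b c g f. cmp C c b a f g)\<rparr>"

definition prod_cat ::
    "('o, 'm) category \<Rightarrow> ('p, 'n) category \<Rightarrow> ('o \<times> 'p, 'm \<times> 'n) category" where
  "prod_cat C D = \<lparr>obj = obj C \<times> obj D,
     hom = (\<lambda>(a, a') (b, b'). hom C a b \<times> hom D a' b'),
     ident = (\<lambda>(a, a'). (ident C a, ident D a')),
     cmp = (\<lambda>(a, a') (b, b') (c, c') (g, g') (f, f'). (cmp C a b c g f, cmp D a' b' c' g' f'))\<rparr>"

definition tuples :: "'a set list \<Rightarrow> 'a list set" where
  "tuples As = {xs. list_all2 (\<in>) xs As}"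

definition power_cat :: "nat \<Rightarrow> ('o, 'm) category \<Rightarrow> ('o list, 'm list) category" where
  "power_cat n C = \<lparr>obj = {as \<in> lists (obj C). length as = n},
     hom = (\<lambda>as bs. tuples (map2 (hom C) as bs)),
     ident = map (ident C),
     cmp = (\<lambda>as bs cs gs fs.
       map (\<lambda>i. cmp C (as ! i) (bs ! i) (cs ! i) (gs ! i) (fs ! i)) [0..<n])\<rparr>"

definition category_iso ::
    "('o, 'm) category \<Rightarrow> ('p, 'n) category \<Rightarrow> ('o \<Rightarrow> 'p) \<Rightarrow> ('m \<Rightarrow> 'n) \<Rightarrow> bool" where
  "category_iso C D F0 F1 \<longleftrightarrow>
     bij_betw F0 (obj C) (obj D) \<and>
     (\<forall>a\<in>obj C. \<forall>b\<in>obj C. bij_betw F1 (hom C a b) (hom D (F0 a) (F0 b))) \<and>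
     (\<forall>a\<in>obj C. F1 (ident C a) = ident D (F0 a)) \<and>
     (\<forall>a\<in>obj C. \<forall>b\<in>obj C. \<forall>c\<in>obj C. \<forall>f\<in>hom C a b. \<forall>g\<in>hom C b c.
        F1 (cmp C a b c g f) = cmp D (F0 a) (F0 b) (F0 c) (F1 g) (F1 f))"

record ('o, 'm, 'a) set_functor =
  fobj :: "'o \<Rightarrow> 'a set"
  fmap :: "'o \<Rightarrow> 'o \<Rightarrow> 'm \<Rightarrow> 'a \<Rightarrow> 'a"

definition is_set_functor :: "('o, 'm) category \<Rightarrow> ('o, 'm, 'a) set_functor \<Rightarrow> bool" where
  "is_set_functor C F \<longleftrightarrow>
     fobj F \<in> extensional (obj C) \<and>
     fmap F \<in> (\<Pi>\<^sub>E a\<in>obj C. \<Pi>\<^sub>E b\<in>obj C. \<Pi>\<^sub>E f\<in>hom C a b. fobj F a \<rightarrow>\<^sub>E fobj F b) \<and>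
     (\<forall>a\<in>obj C. \<forall>x\<in>fobj F a. fmap F a a (ident C a) x = x) \<and>
     (\<forall>a\<in>obj C. \<forall>b\<in>obj C. \<forall>c\<in>obj C. \<forall>f\<in>hom C a b. \<forall>g\<in>hom C b c. \<forall>x\<in>fobj F a.
        fmap F a c (cmp C a b c g f) x = fmap F b c g (fmap F a b f x))"

definition make_functor ::
    "('o, 'm) category \<Rightarrow> ('o \<Rightarrow> 'a set) \<Rightarrow> ('o \<Rightarrow> 'o \<Rightarrow> 'm \<Rightarrow> 'a \<Rightarrow> 'a) \<Rightarrow> ('o, 'm, 'a) set_functor" where
  "make_functor C X M = \<lparr>fobj = restrict X (obj C),
     fmap = (\<lambda>a\<in>obj C. \<lambda>b\<in>obj C. \<lambda>f\<in>hom C a b. restrict (M a b f) (X a))\<rparr>"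

definition natural ::
    "('o, 'm) category \<Rightarrow> ('o, 'm, 'a) set_functor \<Rightarrow> ('o, 'm, 'b) set_functor \<Rightarrow>
     ('o \<Rightarrow> 'a \<Rightarrow> 'b) \<Rightarrow> bool" where
  "natural C F G \<eta> \<longleftrightarrow>
     \<eta> \<in> (\<Pi>\<^sub>E a\<in>obj C. fobj F a \<rightarrow>\<^sub>E fobj G a) \<and>
     (\<forall>a\<in>obj C. \<forall>b\<in>obj C. \<forall>f\<in>hom C a b. \<forall>x\<in>fobj F a.
        \<eta> b (fmap F a b f x) = fmap G a b f (\<eta> a x))"


section \<open>Coends\<close>

text \<open>The coend of \<open>H : C\<^sup>o\<^sup>p \<times> C \<rightarrow> Set\<close> is the disjoint union of the sets \<open>H(c, c)\<close> modulo the
  equivalence relation generated by \<open>H(f, 1) x \<sim> H(1, f) x\<close> for \<open>f : c \<rightarrow> c'\<close> and \<open>x \<in> H(c', c)\<close>.\<close>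

definition coend_rel ::
    "('o, 'm) category \<Rightarrow> ('o \<times> 'o, 'm \<times> 'm, 'a) set_functor \<Rightarrow> (('o \<times> 'a) \<times> ('o \<times> 'a)) set" where
  "coend_rel C H =
     (let R = {((c, fmap H (c', c) (c, c) (f, ident C c) x),
                (c', fmap H (c', c) (c', c') (ident C c', f) x)) | c c' f x.
                c \<in> obj C \<and> c' \<in> obj C \<and> f \<in> hom C c c' \<and> x \<in> fobj H (c', c)}
      in (R \<union> R\<inverse>)\<^sup>*)"

definition coend ::
    "('o, 'm) category \<Rightarrow> ('o \<times> 'o, 'm \<times> 'm, 'a) set_functor \<Rightarrow> ('o \<times> 'a) set set" where
  "coend C H = (SIGMA c:obj C. fobj H (c, c)) // coend_rel C H"

definition coend_class ::
    "('o, 'm) category \<Rightarrow> ('o \<times> 'o, 'm \<times> 'm, 'a) set_functor \<Rightarrow> 'o \<times> 'a \<Rightarrow> ('o \<times> 'a) set" where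
  "coend_class C H p = coend_rel C H `` {p}"

text \<open>The map into the coend of \<open>H\<close> induced by a map \<open>\<phi>\<close> of representatives compatible with the
  relations.\<close>

definition coend_map ::
    "('o, 'm) category \<Rightarrow> ('o \<times> 'o, 'm \<times> 'm, 'a) set_functor \<Rightarrow> ('q \<Rightarrow> 'o \<times> 'a) \<Rightarrow>
     'q set \<Rightarrow> ('o \<times> 'a) set" where
  "coend_map C H \<phi> K = coend_rel C H `` (\<phi> ` K)"


section \<open>Profunctors\<close>

text \<open>A profunctor from \<open>C\<close> to \<open>D\<close> is a functor \<open>C \<times> D\<^sup>o\<^sup>p \<rightarrow> Set\<close>.\<close>

type_synonym ('c, 'm, 'd, 'n, 'a) prof = "('c \<times> 'd, 'm \<times> 'n, 'a) set_functor"

abbreviation prof_base ::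
    "('c, 'm) category \<Rightarrow> ('d, 'n) category \<Rightarrow> ('c \<times> 'd, 'm \<times> 'n) category" where
  "prof_base C D \<equiv> prod_cat C (op_cat D)"

definition op_prof :: "('c, 'm, 'd, 'n, 'a) prof \<Rightarrow> ('d, 'n, 'c, 'm, 'a) prof" where
  "op_prof \<Phi> = \<lparr>fobj = (\<lambda>(d, c). fobj \<Phi> (c, d)),
     fmap = (\<lambda>(d, c) (d', c') (g, f). fmap \<Phi> (c, d) (c', d') (f, g))\<rparr>"

text \<open>The profunctor \<open>(c, d) \<mapsto> D[d, F c]\<close> associated with a functor \<open>F\<close> from \<open>C\<close> to \<open>D\<close>.\<close>

definition functor_prof ::
    "('c, 'm) category \<Rightarrow> ('d, 'n) category \<Rightarrow> ('c \<Rightarrow> 'd) \<Rightarrow> ('c \<Rightarrow> 'c \<Rightarrow> 'm \<Rightarrow> 'n) \<Rightarrow>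
     ('c, 'm, 'd, 'n, 'n) prof" where
  "functor_prof C D F0 F1 = make_functor (prof_base C D)
     (\<lambda>(c, d). hom D d (F0 c))
     (\<lambda>(c, d) (c', d') (f, g) t.
        cmp D d' (F0 c) (F0 c') (F1 c c' f) (cmp D d' d (F0 c) t g))"

type_synonym ('d, 'b, 'a) prof_comp_elem = "('d \<times> ('b \<times> 'a)) set"

definition prof_comp_integrand ::
    "('c, 'm) category \<Rightarrow> ('d, 'n) category \<Rightarrow> ('e, 'l) category \<Rightarrow>
     ('d, 'n, 'e, 'l, 'b) prof \<Rightarrow> ('c, 'm, 'd, 'n, 'a) prof \<Rightarrow> 'c \<times> 'e \<Rightarrow>
     ('d \<times> 'd, 'n \<times> 'n, 'b \<times> 'a) set_functor" where
  "prof_comp_integrand C D E \<Psi> \<Phi> = (\<lambda>(c, e). make_functor (prod_cat (op_cat D) D)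
     (\<lambda>(d1, d2). fobj \<Psi> (d2, e) \<times> fobj \<Phi> (c, d1))
     (\<lambda>(d1, d2) (d1', d2') (f, g) (y, x).
        (fmap \<Psi> (d2, e) (d2', e) (g, ident E e) y, fmap \<Phi> (c, d1) (c, d1') (ident C c, f) x)))"

definition prof_comp ::
    "('c, 'm) category \<Rightarrow> ('d, 'n) category \<Rightarrow> ('e, 'l) category \<Rightarrow>
     ('d, 'n, 'e, 'l, 'b) prof \<Rightarrow> ('c, 'm, 'd, 'n, 'a) prof \<Rightarrow>
     ('c, 'm, 'e, 'l, ('d, 'b, 'a) prof_comp_elem) prof" where
  "prof_comp C D E \<Psi> \<Phi> = make_functor (prof_base C E)
     (\<lambda>p. coend D (prof_comp_integrand C D E \<Psi> \<Phi> p))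
     (\<lambda>(c, e) (c', e') (f, g). coend_map D (prof_comp_integrand C D E \<Psi> \<Phi> (c', e'))
        (\<lambda>(d, (y, x)). (d, (fmap \<Psi> (d, e) (d, e') (ident D d, g) y,
                            fmap \<Phi> (c, d) (c', d) (f, ident D d) x))))"

text \<open>The horizontal composite of 2-cells with target \<open>\<Psi> \<circ> \<Phi>\<close>.\<close>

definition prof_comp_2cell ::
    "('c, 'm) category \<Rightarrow> ('d, 'n) category \<Rightarrow> ('e, 'l) category \<Rightarrow>
     ('d, 'n, 'e, 'l, 'b) prof \<Rightarrow> ('c, 'm, 'd, 'n, 'a) prof \<Rightarrow>
     ('d \<times> 'e \<Rightarrow> 'b' \<Rightarrow> 'b) \<Rightarrow> ('c \<times> 'd \<Rightarrow> 'a' \<Rightarrow> 'a) \<Rightarrow>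
     'c \<times> 'e \<Rightarrow> ('d, 'b', 'a') prof_comp_elem \<Rightarrow> ('d, 'b, 'a) prof_comp_elem" where
  "prof_comp_2cell C D E \<Psi> \<Phi> \<beta> \<alpha> = (\<lambda>(c, e).
     coend_map D (prof_comp_integrand C D E \<Psi> \<Phi> (c, e))
       (\<lambda>(d, (y, x)). (d, (\<beta> (d, e) y, \<alpha> (c, d) x))))"


section \<open>The monads \<open>!\<close>\<close>

text \<open>\<open>Planar\<close>, \<open>Symmetric\<close> and \<open>Cartesian\<close> stand for the sets of structural rules \<open>\<emptyset>\<close>, \<open>{\<sigma>}\<close> and
  \<open>{\<sigma>, \<delta>, \<epsilon>}\<close>. A morphism \<open>(C\<^sub>1, \<dots>, C\<^sub>n) \<rightarrow> (D\<^sub>1, \<dots>, D\<^sub>m)\<close> of \<open>!C\<close> is encoded as the list of the \<open>m\<close> pairs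
  \<open>(f j, g\<^sub>j)\<close>, with positions counted from 0.\<close>

datatype kind = Planar | Symmetric | Cartesian

fun reindexing :: "kind \<Rightarrow> nat \<Rightarrow> nat \<Rightarrow> nat list \<Rightarrow> bool" where
  "reindexing Planar m n f \<longleftrightarrow> m = n \<and> f = [0..<n]"
| "reindexing Symmetric m n f \<longleftrightarrow> bij_betw ((!) f) {..<m} {..<n}"
| "reindexing Cartesian m n f \<longleftrightarrow> True"

type_synonym 'm seq_arr = "(nat \<times> 'm) list"

definition bang :: "kind \<Rightarrow> ('o, 'm) category \<Rightarrow> ('o list, 'm seq_arr) category" where
  "bang X C = \<lparr>obj = lists (obj C),
     hom = (\<lambda>cs ds. {l. length l = length ds \<and>
        (\<forall>j<length ds. fst (l ! j) < length cs \<and> snd (l ! j) \<in> hom C (cs ! fst (l ! j)) (ds ! j)) \<and>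
        reindexing X (length ds) (length cs) (map fst l)}),
     ident = (\<lambda>cs. map (\<lambda>i. (i, ident C (cs ! i))) [0..<length cs]),
     cmp = (\<lambda>as bs cs g f. map (\<lambda>k. case g ! k of (j, v) \<Rightarrow> case f ! j of (i, u) \<Rightarrow>
        (i, cmp C (as ! i) (bs ! j) (cs ! k) v u)) [0..<length cs])\<rparr>"

text \<open>The action of the multiplication (concatenation) on a morphism \<open>l\<close> of \<open>!!C\<close> with source \<open>css\<close>.\<close>

definition concat_arr :: "'o list list \<Rightarrow> 'm seq_arr seq_arr \<Rightarrow> 'm seq_arr" where
  "concat_arr css l =
     concat (map (\<lambda>(a, g). map (\<lambda>(i, h). (length (concat (take a css)) + i, h)) g) l)"

definition bang_unit ::
    "kind \<Rightarrow> ('o, 'm) category \<Rightarrow> ('o, 'm, 'o list, 'm seq_arr, 'm seq_arr) prof" where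
  "bang_unit X C = functor_prof C (bang X C) (\<lambda>c. [c]) (\<lambda>_ _ f. [(0, f)])"

definition bang_mult ::
    "kind \<Rightarrow> ('o, 'm) category \<Rightarrow>
     ('o list list, 'm seq_arr seq_arr, 'o list, 'm seq_arr, 'm seq_arr) prof" where
  "bang_mult X C = functor_prof (bang X (bang X C)) (bang X C) concat (\<lambda>css _ l. concat_arr css l)"

type_synonym ('d, 'n, 'a) bang_elem = "('d list \<times> ('a list \<times> 'n seq_arr)) set"

definition bang_integrand ::
    "kind \<Rightarrow> ('c, 'm) category \<Rightarrow> ('d, 'n) category \<Rightarrow> ('c, 'm, 'd, 'n, 'a) prof \<Rightarrow>
     'c list \<times> 'd list \<Rightarrow>
     ('d list \<times> 'd list, 'n list \<times> 'n list, 'a list \<times> 'n seq_arr) set_functor" where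
  "bang_integrand X C D \<Phi> = (\<lambda>(cs, ds). let n = length cs; P = power_cat n D in
     make_functor (prod_cat (op_cat P) P)
       (\<lambda>(as, bs). tuples (map2 (\<lambda>c a. fobj \<Phi> (c, a)) cs as) \<times> hom (bang X D) ds bs)
       (\<lambda>(as, bs) (as', bs') (fs, gs) (xs, t).
          (map (\<lambda>i. fmap \<Phi> (cs ! i, as ! i) (cs ! i, as' ! i) (ident C (cs ! i), fs ! i) (xs ! i)) [0..<n],
           cmp (bang X D) ds bs bs' (zip [0..<n] gs) t)))"

text \<open>A morphism \<open>F = (a, h)\<close> of \<open>!C\<close> acts on a class \<open>[es, (xs, t)]\<close> by reindexing \<open>es\<close> and \<open>xs\<close> along \<open>a\<close>,
  applying the components \<open>h\<close> to the \<open>xs\<close>, and composing \<open>t\<close> with the reindexing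
  \<open>es \<rightarrow> (es\<^bsub>a 1\<^esub>, es\<^bsub>a 2\<^esub>, \<dots>)\<close>.\<close>

definition bang_prof ::
    "kind \<Rightarrow> ('c, 'm) category \<Rightarrow> ('d, 'n) category \<Rightarrow> ('c, 'm, 'd, 'n, 'a) prof \<Rightarrow>
     ('c list, 'm seq_arr, 'd list, 'n seq_arr, ('d, 'n, 'a) bang_elem) prof" where
  "bang_prof X C D \<Phi> = make_functor (prof_base (bang X C) (bang X D))
     (\<lambda>(cs, ds). coend (power_cat (length cs) D) (bang_integrand X C D \<Phi> (cs, ds)))
     (\<lambda>(cs, ds) (cs', ds') (F, G).
        coend_map (power_cat (length cs') D) (bang_integrand X C D \<Phi> (cs', ds'))
          (\<lambda>(es, (xs, t)). let es' = map (\<lambda>(a, h). es ! a) F in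
             (es',
              (map (\<lambda>j. case F ! j of (a, h) \<Rightarrow>
                   fmap \<Phi> (cs ! a, es ! a) (cs' ! j, es ! a) (h, ident D (es ! a)) (xs ! a))
                 [0..<length cs'],
               cmp (bang X D) ds' es es' (map (\<lambda>(a, h). (a, ident D (es ! a))) F)
                 (cmp (bang X D) ds' ds es t G)))))"

definition bang_2cell ::
    "kind \<Rightarrow> ('c, 'm) category \<Rightarrow> ('d, 'n) category \<Rightarrow> ('c, 'm, 'd, 'n, 'a) prof \<Rightarrow>
     ('c \<times> 'd \<Rightarrow> 'a' \<Rightarrow> 'a) \<Rightarrow>
     'c list \<times> 'd list \<Rightarrow> ('d, 'n, 'a') bang_elem \<Rightarrow> ('d, 'n, 'a) bang_elem" where
  "bang_2cell X C D \<Phi> \<alpha> = (\<lambda>(cs, ds).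
     coend_map (power_cat (length cs) D) (bang_integrand X C D \<Phi> (cs, ds))
       (\<lambda>(es, (xs, t)).
          (es, (map (\<lambda>i. \<alpha> (cs ! i, es ! i) (xs ! i)) [0..<length cs], t))))"


section \<open>The comonads \<open>?\<close> and their coKleisli composition\<close>

definition quest :: "kind \<Rightarrow> ('o, 'm) category \<Rightarrow> ('o list, 'm seq_arr) category" where
  "quest X C = op_cat (bang X (op_cat C))"

definition quest_prof ::
    "kind \<Rightarrow> ('c, 'm) category \<Rightarrow> ('d, 'n) category \<Rightarrow> ('c, 'm, 'd, 'n, 'a) prof \<Rightarrow>
     ('c list, 'm seq_arr, 'd list, 'n seq_arr, ('c, 'm, 'a) bang_elem) prof" where
  "quest_prof X C D \<Phi> = op_prof (bang_prof X (op_cat D) (op_cat C) (op_prof \<Phi>))"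

definition quest_2cell ::
    "kind \<Rightarrow> ('c, 'm) category \<Rightarrow> ('d, 'n) category \<Rightarrow> ('c, 'm, 'd, 'n, 'a) prof \<Rightarrow>
     ('c \<times> 'd \<Rightarrow> 'a' \<Rightarrow> 'a) \<Rightarrow>
     'c list \<times> 'd list \<Rightarrow> ('c, 'm, 'a') bang_elem \<Rightarrow> ('c, 'm, 'a) bang_elem" where
  "quest_2cell X C D \<Phi> \<alpha> = (\<lambda>(cs, ds).
     bang_2cell X (op_cat D) (op_cat C) (op_prof \<Phi>) (\<lambda>(d, c). \<alpha> (c, d)) (ds, cs))"

definition quest_counit ::
    "kind \<Rightarrow> ('o, 'm) category \<Rightarrow> ('o list, 'm seq_arr, 'o, 'm, 'm seq_arr) prof" where
  "quest_counit X C = op_prof (bang_unit X (op_cat C))"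

definition quest_comult ::
    "kind \<Rightarrow> ('o, 'm) category \<Rightarrow>
     ('o list, 'm seq_arr, 'o list list, 'm seq_arr seq_arr, 'm seq_arr) prof" where
  "quest_comult X C = op_prof (bang_mult X (op_cat C))"

text \<open>A morphism of \<open>Prof\<^sub>?\<close> from \<open>C\<close> to \<open>D\<close> is a profunctor from \<open>?C\<close> to \<open>D\<close>. The composite \<open>\<Psi> \<bullet> \<Phi>\<close> is
  bracketed as \<open>\<Psi> \<circ> (?\<Phi> \<circ> d)\<close>.\<close>

type_synonym ('c, 'm, 'd, 'n, 'a) cokl = "('c list, 'm seq_arr, 'd, 'n, 'a) prof"

type_synonym ('c, 'm, 'd, 'b, 'a) cokl_elem =
  "('d list, 'b,
    ('c list list, ('c list, 'm seq_arr, 'a) bang_elem, 'm seq_arr) prof_comp_elem) prof_comp_elem"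

definition quest_lift ::
    "kind \<Rightarrow> ('c, 'm) category \<Rightarrow> ('d, 'n) category \<Rightarrow> ('c, 'm, 'd, 'n, 'a) cokl \<Rightarrow>
     ('c list, 'm seq_arr, 'd list, 'n seq_arr,
      ('c list list, ('c list, 'm seq_arr, 'a) bang_elem, 'm seq_arr) prof_comp_elem) prof" where
  "quest_lift X C D \<Phi> = prof_comp (quest X C) (quest X (quest X C)) (quest X D)
     (quest_prof X (quest X C) D \<Phi>) (quest_comult X C)"

definition cokl_comp ::
    "kind \<Rightarrow> ('c, 'm) category \<Rightarrow> ('d, 'n) category \<Rightarrow> ('e, 'l) category \<Rightarrow>
     ('d, 'n, 'e, 'l, 'b) cokl \<Rightarrow> ('c, 'm, 'd, 'n, 'a) cokl \<Rightarrow>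
     ('c, 'm, 'e, 'l, ('c, 'm, 'd, 'b, 'a) cokl_elem) cokl" where
  "cokl_comp X C D E \<Psi> \<Phi> =
     prof_comp (quest X C) (quest X D) E \<Psi> (quest_lift X C D \<Phi>)"

text \<open>The composite \<open>\<beta> \<bullet> \<alpha>\<close> of 2-cells with target \<open>\<Psi> \<bullet> \<Phi>\<close>.\<close>

definition cokl_2cell ::
    "kind \<Rightarrow> ('c, 'm) category \<Rightarrow> ('d, 'n) category \<Rightarrow> ('e, 'l) category \<Rightarrow>
     ('d, 'n, 'e, 'l, 'b) cokl \<Rightarrow> ('c, 'm, 'd, 'n, 'a) cokl \<Rightarrow>
     ('d list \<times> 'e \<Rightarrow> 'b' \<Rightarrow> 'b) \<Rightarrow> ('c list \<times> 'd \<Rightarrow> 'a' \<Rightarrow> 'a) \<Rightarrow>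
     'c list \<times> 'e \<Rightarrow> ('c, 'm, 'd, 'b', 'a') cokl_elem \<Rightarrow> ('c, 'm, 'd, 'b, 'a) cokl_elem" where
  "cokl_2cell X C D E \<Psi> \<Phi> \<beta> \<alpha> =
     prof_comp_2cell (quest X C) (quest X D) E \<Psi> (quest_lift X C D \<Phi>) \<beta>
       (prof_comp_2cell (quest X C) (quest X (quest X C)) (quest X D)
          (quest_prof X (quest X C) D \<Phi>) (quest_comult X C)
          (quest_2cell X (quest X C) D \<Phi> \<alpha>) (\<lambda>_ t. t))"


subsection \<open>The canonical isomorphisms\<close>

text \<open>By the co-Yoneda lemma every element of \<open>(\<Psi> \<bullet> \<Phi>)(cs, e)\<close> is the class \<open>\<langle>\<psi>; \<phi>\<^sub>1, \<dots>, \<phi>\<^sub>n; t\<rangle>\<close> of some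
  \<open>\<psi> \<in> \<Psi>((d\<^sub>1, \<dots>, d\<^sub>n), e)\<close>, \<open>\<phi>\<^sub>i \<in> \<Phi>(es\<^sub>i, d\<^sub>i)\<close> and \<open>t : es\<^sub>1 \<cdots> es\<^sub>n \<rightarrow> cs\<close> in \<open>?C\<close>: indeed
  \<open>(\<Psi> \<bullet> \<Phi>)(cs, e) = \<integral>\<^bsup>ds\<^esup> \<Psi>(ds, e) \<times> \<integral>\<^bsup>es\<^esup> \<Phi>(es\<^sub>1, d\<^sub>1) \<times> \<cdots> \<times> \<Phi>(es\<^sub>n, d\<^sub>n) \<times> ?C[es\<^sub>1 \<cdots> es\<^sub>n, cs]\<close>.
  The canonical isomorphisms are given by their values on these classes.\<close>

type_synonym ('c, 'm, 'd, 'b, 'a) cokl_rep =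
  "'d list \<times> 'b \<times> 'c list list \<times> 'a list \<times> 'm seq_arr"

definition cokl_reps ::
    "kind \<Rightarrow> ('c, 'm) category \<Rightarrow> ('d, 'n) category \<Rightarrow>
     ('d, 'n, 'e, 'l, 'b) cokl \<Rightarrow> ('c, 'm, 'd, 'n, 'a) cokl \<Rightarrow> 'c list \<times> 'e \<Rightarrow>
     ('c, 'm, 'd, 'b, 'a) cokl_rep set" where
  "cokl_reps X C D \<Psi> \<Phi> = (\<lambda>(cs, e). {(ds, \<psi>, ess, \<phi>s, t).
     ds \<in> obj (quest X D) \<and> \<psi> \<in> fobj \<Psi> (ds, e) \<and>
     ess \<in> obj (quest X (quest X C)) \<and> length ess = length ds \<and>
     \<phi>s \<in> tuples (map2 (\<lambda>es d. fobj \<Phi> (es, d)) ess ds) \<and>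
     t \<in> hom (quest X C) (concat ess) cs})"

definition cokl_class ::
    "kind \<Rightarrow> ('c, 'm) category \<Rightarrow> ('d, 'n) category \<Rightarrow> ('e, 'l) category \<Rightarrow>
     ('d, 'n, 'e, 'l, 'b) cokl \<Rightarrow> ('c, 'm, 'd, 'n, 'a) cokl \<Rightarrow> 'c list \<times> 'e \<Rightarrow>
     ('c, 'm, 'd, 'b, 'a) cokl_rep \<Rightarrow> ('c, 'm, 'd, 'b, 'a) cokl_elem" where
  "cokl_class X C D E \<Psi> \<Phi> = (\<lambda>(cs, e) (ds, \<psi>, ess, \<phi>s, t).
     coend_class (quest X D)
       (prof_comp_integrand (quest X C) (quest X D) E \<Psi> (quest_lift X C D \<Phi>) (cs, e))
       (ds, (\<psi>,
        coend_class (quest X (quest X C))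
          (prof_comp_integrand (quest X C) (quest X (quest X C)) (quest X D)
             (quest_prof X (quest X C) D \<Phi>) (quest_comult X C) (cs, ds))
          (ess,
           (coend_class (power_cat (length ds) (op_cat (quest X C)))
              (bang_integrand X (op_cat D) (op_cat (quest X C)) (op_prof \<Phi>) (ds, ess))
              (ess, (\<phi>s, ident (quest X (quest X C)) ess)),
            t)))))"

text \<open>\<open>I \<bullet> \<Phi> \<cong> \<Phi>\<close>. A morphism \<open>[(j, h)] : (e) \<rightarrow> ds\<close> of \<open>?D\<close> selects \<open>\<phi>\<^sub>j\<close>, which is transported along
  \<open>h : e \<rightarrow> d\<^sub>j\<close> and along \<open>es\<^sub>j \<rightarrow> es\<^sub>1 \<cdots> es\<^sub>n \<rightarrow> cs\<close>.\<close>

definition cokl_left_unitor ::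
    "kind \<Rightarrow> ('c, 'm) category \<Rightarrow> ('d, 'n) category \<Rightarrow> ('c, 'm, 'd, 'n, 'a) cokl \<Rightarrow>
     'c list \<times> 'd \<Rightarrow> ('c, 'm, 'd, 'n seq_arr, 'a) cokl_elem \<Rightarrow> 'a" where
  "cokl_left_unitor X C D \<Phi> = (\<lambda>(cs, e) K. THE y. \<exists>ds j h ess \<phi>s t.
     (ds, [(j, h)], ess, \<phi>s, t) \<in> cokl_reps X C D (quest_counit X D) \<Phi> (cs, e) \<and>
     K = cokl_class X C D D (quest_counit X D) \<Phi> (cs, e) (ds, [(j, h)], ess, \<phi>s, t) \<and>
     y = fmap \<Phi> (ess ! j, ds ! j) (cs, e)
           (cmp (quest X C) (ess ! j) (concat ess) cs t
              (concat_arr ess [(j, ident (quest X C) (ess ! j))]), h) (\<phi>s ! j))"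

text \<open>\<open>\<Psi> \<bullet> I \<cong> \<Psi>\<close>. The morphisms \<open>i\<^sub>j : (d\<^sub>j) \<rightarrow> es\<^sub>j\<close> of \<open>?C\<close> are juxtaposed to \<open>ds \<rightarrow> es\<^sub>1 \<cdots> es\<^sub>n\<close>.\<close>

definition cokl_right_unitor ::
    "kind \<Rightarrow> ('c, 'm) category \<Rightarrow> ('e, 'l) category \<Rightarrow> ('c, 'm, 'e, 'l, 'b) cokl \<Rightarrow>
     'c list \<times> 'e \<Rightarrow> ('c, 'm, 'c, 'b, 'm seq_arr) cokl_elem \<Rightarrow> 'b" where
  "cokl_right_unitor X C E \<Psi> = (\<lambda>(cs, e) K. THE y. \<exists>ds \<psi> ess is t.
     (ds, \<psi>, ess, is, t) \<in> cokl_reps X C C \<Psi> (quest_counit X C) (cs, e) \<and>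
     K = cokl_class X C C E \<Psi> (quest_counit X C) (cs, e) (ds, \<psi>, ess, is, t) \<and>
     y = fmap \<Psi> (ds, e) (cs, e)
           (cmp (quest X C) ds (concat ess) cs t (concat_arr ess (zip [0..<length is] is)), ident E e) \<psi>)"

fun chunks :: "nat list \<Rightarrow> 'a list \<Rightarrow> 'a list list" where
  "chunks [] xs = []"
| "chunks (n # ns) xs = take n xs # chunks ns (drop n xs)"

text \<open>\<open>(\<Xi> \<bullet> \<Psi>) \<bullet> \<Phi> \<cong> \<Xi> \<bullet> (\<Psi> \<bullet> \<Phi>)\<close> sends
  \<open>\<langle>\<langle>\<xi>; \<psi>\<^sub>1, \<dots>, \<psi>\<^sub>k; s\<rangle>; \<phi>\<^sub>1, \<dots>, \<phi>\<^sub>n; t\<rangle>\<close>, where \<open>\<psi>\<^sub>i \<in> \<Psi>(bs\<^sub>i, c\<^sub>i)\<close> and \<open>s : bs\<^sub>1 \<cdots> bs\<^sub>k \<rightarrow> bs\<close> in \<open>?B\<close>, to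
  \<open>\<langle>\<xi>; \<langle>\<psi>\<^sub>1; \<phi>'\<^sub>1; 1\<rangle>, \<dots>, \<langle>\<psi>\<^sub>k; \<phi>'\<^sub>k; 1\<rangle>; t'\<rangle>\<close>. Here the family \<open>\<phi>'\<close> obtained by transporting \<open>\<phi>\<close>
  along \<open>s\<close> (position \<open>p\<close> receives \<open>\<phi>\<^bsub>g p\<^esub>\<close> if \<open>s\<close> is \<open>g\<close> with components \<open>bs'\<^sub>p \<rightarrow> bs\<^bsub>g p\<^esub>\<close>) is cut into
  pieces \<open>\<phi>'\<^sub>i\<close> indexed by \<open>bs\<^sub>i\<close>, and \<open>t'\<close> is \<open>t\<close> composed with the induced map
  \<open>es\<^bsub>g 1\<^esub> es\<^bsub>g 2\<^esub> \<cdots> \<rightarrow> es\<^sub>1 \<cdots> es\<^sub>n\<close>.\<close>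

definition cokl_assoc_rep ::
    "kind \<Rightarrow> ('a, 'k) category \<Rightarrow> ('b, 'l) category \<Rightarrow> ('c, 'm) category \<Rightarrow>
     ('b, 'l, 'c, 'm, 'y) cokl \<Rightarrow> ('a, 'k, 'b, 'l, 'x) cokl \<Rightarrow> 'a list \<Rightarrow>
     ('b, 'l, 'c, 'z, 'y) cokl_rep \<Rightarrow>
     'b list \<Rightarrow> 'a list list \<Rightarrow> 'x list \<Rightarrow> 'k seq_arr \<Rightarrow>
     ('a, 'k, 'c, 'z, ('a, 'k, 'b, 'y, 'x) cokl_elem) cokl_rep" where
  "cokl_assoc_rep X A B C \<Psi> \<Phi> as = (\<lambda>(cs, \<xi>, bss, \<psi>s, s) bs ess \<phi>s t.
     let bs' = concat bss;
         ns = map length bss;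
         ess' = map (\<lambda>(g, u). ess ! g) s;
         \<phi>s' = map (\<lambda>p. case s ! p of (g, u) \<Rightarrow>
                 fmap \<Phi> (ess ! g, bs ! g) (ess ! g, bs' ! p) (ident (quest X A) (ess ! g), u) (\<phi>s ! g))
               [0..<length bs'];
         t' = cmp (quest X A) (concat ess') (concat ess) as t
                (concat_arr ess (map (\<lambda>(g, u). (g, ident (quest X A) (ess ! g))) s));
         esss = chunks ns ess';
         \<phi>ss = chunks ns \<phi>s'
     in (cs, \<xi>, map concat esss,
         map (\<lambda>i. cokl_class X A B C \<Psi> \<Phi> (concat (esss ! i), cs ! i)
                    (bss ! i, \<psi>s ! i, esss ! i, \<phi>ss ! i, ident (quest X A) (concat (esss ! i))))
           [0..<length cs],
         t'))"

definition cokl_associator ::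
    "kind \<Rightarrow> ('a, 'k) category \<Rightarrow> ('b, 'l) category \<Rightarrow> ('c, 'm) category \<Rightarrow> ('d, 'n) category \<Rightarrow>
     ('c, 'm, 'd, 'n, 'z) cokl \<Rightarrow> ('b, 'l, 'c, 'm, 'y) cokl \<Rightarrow> ('a, 'k, 'b, 'l, 'x) cokl \<Rightarrow>
     'a list \<times> 'd \<Rightarrow>
     ('a, 'k, 'b, ('b, 'l, 'c, 'z, 'y) cokl_elem, 'x) cokl_elem \<Rightarrow>
     ('a, 'k, 'c, 'z, ('a, 'k, 'b, 'y, 'x) cokl_elem) cokl_elem" where
  "cokl_associator X A B C D \<Xi> \<Psi> \<Phi> = (\<lambda>(as, d) K. THE L. \<exists>q bs \<chi> ess \<phi>s t.
     (bs, \<chi>, ess, \<phi>s, t) \<in> cokl_reps X A B (cokl_comp X B C D \<Xi> \<Psi>) \<Phi> (as, d) \<and>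
     q \<in> cokl_reps X B C \<Xi> \<Psi> (bs, d) \<and>
     \<chi> = cokl_class X B C D \<Xi> \<Psi> (bs, d) q \<and>
     K = cokl_class X A B D (cokl_comp X B C D \<Xi> \<Psi>) \<Phi> (as, d) (bs, \<chi>, ess, \<phi>s, t) \<and>
     L = cokl_class X A C D \<Xi> (cokl_comp X A B C \<Psi> \<Phi>) (as, d)
           (cokl_assoc_rep X A B C \<Psi> \<Phi> as q bs ess \<phi>s t))"


section \<open>Monoids in \<open>Prof\<^sub>?[A, A]\<close>\<close>

record ('o, 'm, 'a) endo_monoid =
  mcarrier :: "('o, 'm, 'o, 'm, 'a) cokl"
  munit :: "'o list \<times> 'o \<Rightarrow> 'm seq_arr \<Rightarrow> 'a"
  mmult :: "'o list \<times> 'o \<Rightarrow> ('o, 'm, 'o, 'a, 'a) cokl_elem \<Rightarrow> 'a"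

definition is_endo_monoid ::
    "kind \<Rightarrow> ('o, 'm) category \<Rightarrow> ('o, 'm, 'a) endo_monoid \<Rightarrow> bool" where
  "is_endo_monoid X A M \<longleftrightarrow>
     (let Z = mcarrier M; e = munit M; m = mmult M; I = quest_counit X A;
          B = prof_base (quest X A) A;
          ZZ = cokl_comp X A A A Z Z in
      is_set_functor B Z \<and> natural B I Z e \<and> natural B ZZ Z m \<and>
      (\<forall>p\<in>obj B. \<forall>K\<in>fobj (cokl_comp X A A A I Z) p.
         m p (cokl_2cell X A A A Z Z e (\<lambda>_ x. x) p K) = cokl_left_unitor X A A Z p K) \<and>
      (\<forall>p\<in>obj B. \<forall>K\<in>fobj (cokl_comp X A A A Z I) p.
         m p (cokl_2cell X A A A Z Z (\<lambda>_ x. x) e p K) = cokl_right_unitor X A A Z p K) \<and>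
      (\<forall>p\<in>obj B. \<forall>K\<in>fobj (cokl_comp X A A A ZZ Z) p.
         m p (cokl_2cell X A A A Z Z m (\<lambda>_ x. x) p K) =
         m p (cokl_2cell X A A A Z Z (\<lambda>_ x. x) m p (cokl_associator X A A A A Z Z Z p K))))"

definition is_endo_monoid_hom ::
    "kind \<Rightarrow> ('o, 'm) category \<Rightarrow> ('o, 'm, 'a) endo_monoid \<Rightarrow> ('o, 'm, 'a) endo_monoid \<Rightarrow>
     ('o list \<times> 'o \<Rightarrow> 'a \<Rightarrow> 'a) \<Rightarrow> bool" where
  "is_endo_monoid_hom X A M N h \<longleftrightarrow>
     (let Z = mcarrier M; Y = mcarrier N; B = prof_base (quest X A) A in
      natural B Z Y h \<and>
      (\<forall>p\<in>obj B. \<forall>i\<in>fobj (quest_counit X A) p. h p (munit M p i) = munit N p i) \<and>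
      (\<forall>p\<in>obj B. \<forall>K\<in>fobj (cokl_comp X A A A Z Z) p.
         h p (mmult M p K) = mmult N p (cokl_2cell X A A A Y Y h h p K)))"

definition endo_monoids ::
    "kind \<Rightarrow> ('o, 'm) category \<Rightarrow> (('o, 'm, 'a) endo_monoid, 'o list \<times> 'o \<Rightarrow> 'a \<Rightarrow> 'a) category" where
  "endo_monoids X A = \<lparr>obj = Collect (is_endo_monoid X A),
     hom = (\<lambda>M N. Collect (is_endo_monoid_hom X A M N)),
     ident = (\<lambda>M. \<lambda>p\<in>obj (prof_base (quest X A) A). \<lambda>x\<in>fobj (mcarrier M) p. x),
     cmp = (\<lambda>M N P k h. \<lambda>p\<in>obj (prof_base (quest X A) A).
        compose (fobj (mcarrier M) p) (k p) (h p))\<rparr>"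


section \<open>Operads and clones\<close>

subsection \<open>Non-symmetric operads\<close>

text \<open>\<open>ocomp P ns x ys\<close> is \<open>\<gamma>(x; y\<^sub>1, \<dots>, y\<^sub>k)\<close> for \<open>y\<^sub>i\<close> of arity \<open>ns\<^sub>i\<close>.\<close>

record 'a operad =
  ops :: "nat \<Rightarrow> 'a set"
  oid :: 'a
  ocomp :: "nat list \<Rightarrow> 'a \<Rightarrow> 'a list \<Rightarrow> 'a"

definition is_operad :: "('a, 'z) operad_scheme \<Rightarrow> bool" where
  "is_operad P \<longleftrightarrow>
     oid P \<in> ops P 1 \<and>
     ocomp P \<in> (\<Pi>\<^sub>E ns\<in>UNIV. ops P (length ns) \<rightarrow>\<^sub>E tuples (map (ops P) ns) \<rightarrow>\<^sub>E ops P (sum_list ns)) \<and>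
     (\<forall>n. \<forall>x\<in>ops P n. ocomp P [n] (oid P) [x] = x) \<and>
     (\<forall>n. \<forall>x\<in>ops P n. ocomp P (replicate n 1) x (replicate n (oid P)) = x) \<and>
     (\<forall>nss :: nat list list. \<forall>x\<in>ops P (length nss).
        \<forall>ys\<in>tuples (map (\<lambda>ns. ops P (length ns)) nss).
        \<forall>zss\<in>tuples (map (\<lambda>ns. tuples (map (ops P) ns)) nss).
        ocomp P (concat nss) (ocomp P (map length nss) x ys) (concat zss) =
        ocomp P (map sum_list nss) x
          (map (\<lambda>i. ocomp P (nss ! i) (ys ! i) (zss ! i)) [0..<length nss]))"

definition is_operad_hom ::
    "('a, 'z) operad_scheme \<Rightarrow> ('a, 'z) operad_scheme \<Rightarrow> (nat \<Rightarrow> 'a \<Rightarrow> 'a) \<Rightarrow> bool" where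
  "is_operad_hom P Q h \<longleftrightarrow>
     h \<in> (\<Pi>\<^sub>E n\<in>UNIV. ops P n \<rightarrow>\<^sub>E ops Q n) \<and>
     h 1 (oid P) = oid Q \<and>
     (\<forall>ns. \<forall>x\<in>ops P (length ns). \<forall>ys\<in>tuples (map (ops P) ns).
        h (sum_list ns) (ocomp P ns x ys) = ocomp Q ns (h (length ns) x) (map2 h ns ys))"

definition operads :: "('a operad, nat \<Rightarrow> 'a \<Rightarrow> 'a) category" where
  "operads = \<lparr>obj = Collect is_operad,
     hom = (\<lambda>P Q. Collect (is_operad_hom P Q)),
     ident = (\<lambda>P n. \<lambda>x\<in>ops P n. x),
     cmp = (\<lambda>P Q R k h n. compose (ops P n) (k n) (h n))\<rparr>"


subsection \<open>Symmetric operads\<close>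

text \<open>\<open>act P n \<sigma> x\<close> is \<open>x \<cdot> \<sigma>\<close>: as usual, the symmetric groups act on the right. The permutation
  \<open>direct_sum_perm ns \<tau>s\<close> is \<open>\<tau>\<^sub>1 \<oplus> \<cdots> \<oplus> \<tau>\<^sub>k\<close>, and \<open>block_perm ns \<sigma>\<close> is the permutation of
  \<open>n\<^sub>1 + \<cdots> + n\<^sub>k\<close> letters that moves the \<open>i\<close>-th block, of length \<open>n\<^sub>i\<close>, to block position \<open>\<sigma> i\<close>.\<close>

record 'a sym_operad = "'a operad" +
  act :: "nat \<Rightarrow> (nat \<Rightarrow> nat) \<Rightarrow> 'a \<Rightarrow> 'a"

definition perm_of_list :: "nat list \<Rightarrow> nat \<Rightarrow> nat" where
  "perm_of_list l p = (if p < length l then l ! p else p)"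

definition direct_sum_perm :: "nat list \<Rightarrow> (nat \<Rightarrow> nat) list \<Rightarrow> nat \<Rightarrow> nat" where
  "direct_sum_perm ns \<tau>s = perm_of_list (concat (map (\<lambda>i.
     map (\<lambda>j. sum_list (take i ns) + (\<tau>s ! i) j) [0..<ns ! i]) [0..<length ns]))"

definition permute_list_inv :: "(nat \<Rightarrow> nat) \<Rightarrow> 'b list \<Rightarrow> 'b list" where
  "permute_list_inv \<sigma> xs = map (\<lambda>i. xs ! (inv \<sigma> i)) [0..<length xs]"

definition block_perm :: "nat list \<Rightarrow> (nat \<Rightarrow> nat) \<Rightarrow> nat \<Rightarrow> nat" where
  "block_perm ns \<sigma> = perm_of_list (concat (map (\<lambda>i.
     map (\<lambda>j. sum_list (take (\<sigma> i) (permute_list_inv \<sigma> ns)) + j) [0..<ns ! i]) [0..<length ns]))"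

definition is_sym_operad :: "'a sym_operad \<Rightarrow> bool" where
  "is_sym_operad P \<longleftrightarrow>
     is_operad P \<and>
     act P \<in> (\<Pi>\<^sub>E n\<in>UNIV. \<Pi>\<^sub>E \<sigma>\<in>{\<sigma>. \<sigma> permutes {..<n}}. ops P n \<rightarrow>\<^sub>E ops P n) \<and>
     (\<forall>n. \<forall>x\<in>ops P n. act P n id x = x) \<and>
     (\<forall>n \<sigma> \<tau>. \<sigma> permutes {..<n} \<longrightarrow> \<tau> permutes {..<n} \<longrightarrow>
        (\<forall>x\<in>ops P n. act P n \<tau> (act P n \<sigma> x) = act P n (\<sigma> \<circ> \<tau>) x)) \<and>
     (\<forall>ns \<sigma>. \<sigma> permutes {..<length ns} \<longrightarrow>
        (\<forall>x\<in>ops P (length ns). \<forall>ys\<in>tuples (map (ops P) ns).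
           ocomp P ns (act P (length ns) \<sigma> x) ys =
           act P (sum_list ns) (block_perm ns \<sigma>)
             (ocomp P (permute_list_inv \<sigma> ns) x (permute_list_inv \<sigma> ys)))) \<and>
     (\<forall>ns \<tau>s. list_all2 (\<lambda>\<tau> n. \<tau> permutes {..<n}) \<tau>s ns \<longrightarrow>
        (\<forall>x\<in>ops P (length ns). \<forall>ys\<in>tuples (map (ops P) ns).
           ocomp P ns x (map (\<lambda>i. act P (ns ! i) (\<tau>s ! i) (ys ! i)) [0..<length ns]) =
           act P (sum_list ns) (direct_sum_perm ns \<tau>s) (ocomp P ns x ys)))"

definition is_sym_operad_hom ::
    "'a sym_operad \<Rightarrow> 'a sym_operad \<Rightarrow> (nat \<Rightarrow> 'a \<Rightarrow> 'a) \<Rightarrow> bool" where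
  "is_sym_operad_hom P Q h \<longleftrightarrow>
     is_operad_hom P Q h \<and>
     (\<forall>n \<sigma>. \<sigma> permutes {..<n} \<longrightarrow> (\<forall>x\<in>ops P n. h n (act P n \<sigma> x) = act Q n \<sigma> (h n x)))"

definition sym_operads :: "('a sym_operad, nat \<Rightarrow> 'a \<Rightarrow> 'a) category" where
  "sym_operads = \<lparr>obj = Collect is_sym_operad,
     hom = (\<lambda>P Q. Collect (is_sym_operad_hom P Q)),
     ident = (\<lambda>P n. \<lambda>x\<in>ops P n. x),
     cmp = (\<lambda>P Q R k h n. compose (ops P n) (k n) (h n))\<rparr>"


subsection \<open>Abstract clones\<close>

text \<open>\<open>cproj P n i\<close> is the \<open>i\<close>-th projection of arity \<open>n\<close> (with \<open>i < n\<close>), and \<open>csub P k n x ys\<close> is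
  \<open>x[y\<^sub>1, \<dots>, y\<^sub>k]\<close> for \<open>x\<close> of arity \<open>k\<close> and \<open>y\<^sub>1, \<dots>, y\<^sub>k\<close> of arity \<open>n\<close>. Arity 0 is allowed.\<close>

record 'a clone =
  cops :: "nat \<Rightarrow> 'a set"
  cproj :: "nat \<Rightarrow> nat \<Rightarrow> 'a"
  csub :: "nat \<Rightarrow> nat \<Rightarrow> 'a \<Rightarrow> 'a list \<Rightarrow> 'a"

definition is_clone :: "'a clone \<Rightarrow> bool" where
  "is_clone P \<longleftrightarrow>
     cproj P \<in> (\<Pi>\<^sub>E n\<in>UNIV. {..<n} \<rightarrow>\<^sub>E cops P n) \<and>
     csub P \<in> (\<Pi>\<^sub>E k\<in>UNIV. \<Pi>\<^sub>E n\<in>UNIV. cops P k \<rightarrow>\<^sub>E tuples (replicate k (cops P n)) \<rightarrow>\<^sub>E cops P n) \<and>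
     (\<forall>k n i. \<forall>ys\<in>tuples (replicate k (cops P n)). i < k \<longrightarrow> csub P k n (cproj P k i) ys = ys ! i) \<and>
     (\<forall>n. \<forall>x\<in>cops P n. csub P n n x (map (cproj P n) [0..<n]) = x) \<and>
     (\<forall>k m n. \<forall>x\<in>cops P k. \<forall>ys\<in>tuples (replicate k (cops P m)).
        \<forall>zs\<in>tuples (replicate m (cops P n)).
        csub P m n (csub P k m x ys) zs = csub P k n x (map (\<lambda>y. csub P m n y zs) ys))"

definition is_clone_hom :: "'a clone \<Rightarrow> 'a clone \<Rightarrow> (nat \<Rightarrow> 'a \<Rightarrow> 'a) \<Rightarrow> bool" where
  "is_clone_hom P Q h \<longleftrightarrow>
     h \<in> (\<Pi>\<^sub>E n\<in>UNIV. cops P n \<rightarrow>\<^sub>E cops Q n) \<and>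
     (\<forall>n i. i < n \<longrightarrow> h n (cproj P n i) = cproj Q n i) \<and>
     (\<forall>k n. \<forall>x\<in>cops P k. \<forall>ys\<in>tuples (replicate k (cops P n)).
        h n (csub P k n x ys) = csub Q k n (h k x) (map (h n) ys))"

definition clones :: "('a clone, nat \<Rightarrow> 'a \<Rightarrow> 'a) category" where
  "clones = \<lparr>obj = Collect is_clone,
     hom = (\<lambda>P Q. Collect (is_clone_hom P Q)),
     ident = (\<lambda>P n. \<lambda>x\<in>cops P n. x),
     cmp = (\<lambda>P Q R k h n. compose (cops P n) (k n) (h n))\<rparr>"


section \<open>The operad or clone underlying a monoid in \<open>Prof\<^sub>?[1, 1]\<close>\<close>

text \<open>A profunctor from \<open>?1\<close> to \<open>1\<close> is a functor \<open>Z : ?1 \<rightarrow> Set\<close>; the object \<open>n\<close> of \<open>?1\<close> is the sequence of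
  length \<open>n\<close>, and a map \<open>f\<close> from \<open>m\<close> elements to \<open>n\<close> elements is the list of its \<open>m\<close> values.\<close>

type_synonym 'a one_monoid = "(unit, unit, 'a) endo_monoid"

abbreviation numeral_obj :: "nat \<Rightarrow> unit list" where
  "numeral_obj n \<equiv> replicate n ()"

abbreviation num :: "nat \<Rightarrow> unit list \<times> unit" where
  "num n \<equiv> (numeral_obj n, ())"

definition function_arr :: "nat list \<Rightarrow> unit seq_arr" where
  "function_arr f = map (\<lambda>i. (i, ())) f"

definition underlying_ops :: "'a one_monoid \<Rightarrow> nat \<Rightarrow> 'a set" where
  "underlying_ops M n = fobj (mcarrier M) (num n)"

text \<open>\<open>m\<langle>x; y\<^sub>1, \<dots>, y\<^sub>k; f\<rangle>\<close>, with \<open>y\<^sub>i\<close> of arity \<open>ns\<^sub>i\<close> and \<open>f : n\<^sub>1 + \<cdots> + n\<^sub>k \<rightarrow> N\<close>.\<close>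

definition substitute ::
    "kind \<Rightarrow> 'a one_monoid \<Rightarrow> nat list \<Rightarrow> nat \<Rightarrow> 'a \<Rightarrow> 'a list \<Rightarrow> nat list \<Rightarrow> 'a" where
  "substitute X M ns N x ys f = mmult M (num N)
     (cokl_class X one_cat one_cat one_cat (mcarrier M) (mcarrier M) (num N)
        (numeral_obj (length ns), x, map numeral_obj ns, ys, function_arr f))"

definition underlying_operad :: "kind \<Rightarrow> 'a one_monoid \<Rightarrow> 'a operad" where
  "underlying_operad X M = \<lparr>ops = underlying_ops M,
     oid = munit M (num 1) (function_arr [0]),
     ocomp = (\<lambda>ns. \<lambda>x\<in>underlying_ops M (length ns). \<lambda>ys\<in>tuples (map (underlying_ops M) ns).
       substitute X M ns (sum_list ns) x ys [0..<sum_list ns])\<rparr>"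

text \<open>The right action of \<open>\<sigma>\<close> is the functorial action of its inverse.\<close>

definition underlying_sym_operad :: "'a one_monoid \<Rightarrow> 'a sym_operad" where
  "underlying_sym_operad M = operad.extend (underlying_operad Symmetric M)
     \<lparr>act = (\<lambda>n. \<lambda>\<sigma>\<in>{\<sigma>. \<sigma> permutes {..<n}}. \<lambda>x\<in>underlying_ops M n.
        fmap (mcarrier M) (num n) (num n) (function_arr (map (inv \<sigma>) [0..<n]), ()) x)\<rparr>"

definition underlying_clone :: "'a one_monoid \<Rightarrow> 'a clone" where
  "underlying_clone M = \<lparr>cops = underlying_ops M,
     cproj = (\<lambda>n. \<lambda>i\<in>{..<n}. munit M (num n) (function_arr [i])),
     csub = (\<lambda>k n. \<lambda>x\<in>underlying_ops M k. \<lambda>ys\<in>tuples (replicate k (underlying_ops M n)).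
       substitute Cartesian M (replicate k n) n x ys (concat (replicate k [0..<n])))\<rparr>"

definition underlying_hom :: "(unit list \<times> unit \<Rightarrow> 'a \<Rightarrow> 'a) \<Rightarrow> nat \<Rightarrow> 'a \<Rightarrow> 'a" where
  "underlying_hom h = (\<lambda>n. h (num n))"

end

theory Submission
  imports Defs
begin

text \<open>
  The category \<open>?1\<close> has the finite ordinals as objects and, as morphisms, the identities, the bijections or all
  functions between them. A functor \<open>Z\<close> from \<open>?1\<close> to sets is thus a family of sets \<open>Z n\<close> (operations of arity \<open>n\<close>) on
  which these functions act, and everything rests on an explicit description of \<open>(\<Psi> \<bullet> \<Phi>)(N)\<close>. It is a coend
  over a coend over a coend, but by the co-Yoneda lemma each element is a class \<open>\<langle>x; y\<^sub>1, \<dots>, y\<^sub>k; f\<rangle>\<close>, written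
  \<open>cls X \<Psi> \<Phi> N ns x ys f\<close>, with \<open>x \<in> \<Psi> k\<close>, \<open>y\<^sub>i \<in> \<Phi> n\<^sub>i\<close> and \<open>f\<close> a map from \<open>n\<^sub>1 + \<cdots> + n\<^sub>k\<close> to \<open>N\<close>. Two relations
  hold between such classes: a map acting on \<open>x\<close> can be traded for a rearrangement of the blocks in \<open>f\<close>
  (\<open>cls_blockf\<close>), and maps acting on the \<open>y\<^sub>i\<close> for their sum in \<open>f\<close> (\<open>cls_dsum\<close>). By \<open>cls_lift\<close> there are no others.
  This universal property also computes the canonical isomorphisms, which are given as definite descriptions
  ranging over all representatives (\<open>left_unitor_cls\<close>, \<open>right_unitor_cls\<close>, \<open>associator_cls\<close>).

  Let now \<open>(Z, e, m)\<close> be a monoid. Naturality determines \<open>e\<close> by one element of \<open>Z 1\<close> and \<open>m\<close> by its values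
  \<open>\<gamma>(x; y\<^sub>1, \<dots>, y\<^sub>k)\<close> on classes with \<open>f = 1\<close>. That \<open>m\<close> respects the two relations says that \<open>\<gamma>\<close> is natural in \<open>x\<close> and in
  the \<open>y\<^sub>i\<close>; the monoid laws on representatives (\<open>is_endo_monoid_iff\<close>) are the unit and associativity laws
  of a non-symmetric operad. For all three kinds at once, monoids are therefore the same as operads on which
  the maps of \<open>?1\<close> act compatibly (\<open>foperad\<close>, \<open>endo_monoids_iso_foperads\<close>).

  What remains is to recognize these operads. If only identities act, nothing has been added. If bijections
  act, turning the left action into a right action through inverses makes the two naturality conditions the
  two equivariance axioms of a symmetric operad. If all functions act, put
  \<open>x[y\<^sub>1, \<dots>, y\<^sub>k] = D \<gamma>(x; y\<^sub>1, \<dots>, y\<^sub>k)\<close>, where \<open>D\<close> is the codiagonal from \<open>n + \<cdots> + n\<close> to \<open>n\<close>, and let the maps from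
  \<open>1\<close> to \<open>n\<close> act on the operadic unit to give projections: this is a clone. Conversely, in a clone \<open>f\<close> acts by
  substituting projections, and \<open>\<gamma>(x; y\<^sub>1, \<dots>, y\<^sub>k) = x[y\<^sub>1 \<iota>\<^sub>1, \<dots>, y\<^sub>k \<iota>\<^sub>k]\<close> with \<open>\<iota>\<^sub>i\<close> the inclusion of the \<open>i\<close>-th block.
\<close>

section \<open>Lists as functions between finite ordinals\<close>

text \<open>Maps are lists of values, so that the composite of \<open>f\<close> followed by \<open>g\<close> is \<open>map ((!) g) f\<close>, and so is the
  reindexing along \<open>f\<close> of a family \<open>g\<close>.\<close>

definition xfun :: "kind \<Rightarrow> nat \<Rightarrow> nat \<Rightarrow> nat list set" where
  "xfun X m n = {f. length f = m \<and> set f \<subseteq> {..<n} \<and> reindexing X m n f}"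

lemma xfun_Planar: "xfun Planar m n = (if m = n then {[0..<n]} else {})"
  by (auto simp: xfun_def)

lemma bij_betw_nth_iff:
  assumes "length f = m" shows "bij_betw ((!) f) {..<m} {..<n} \<longleftrightarrow> distinct f \<and> set f = {..<n}"
proof -
  have "(!) f ` {..<m} = set f" using assms by (auto simp: set_conv_nth)
  moreover have "inj_on ((!) f) {..<m} \<longleftrightarrow> distinct f"
    using assms unfolding inj_on_def distinct_conv_nth by (metis lessThan_iff)
  ultimately show ?thesis by (simp add: bij_betw_def)
qed

lemma xfun_Symmetric:
  "xfun Symmetric m n = (if m = n then {f. length f = n \<and> distinct f \<and> set f = {..<n}} else {})"
proof -
  have "m = n" if "length f = m" "distinct f" "set f = {..<n}" for f
    using that distinct_card[of f] by simp
  then show ?thesis by (auto simp: xfun_def bij_betw_nth_iff)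
qed

lemma xfun_Cartesian: "xfun Cartesian m n = {f. length f = m \<and> set f \<subseteq> {..<n}}"
  by (auto simp: xfun_def)

lemma xfunD:
  assumes "f \<in> xfun X m n" shows "length f = m" "set f \<subseteq> {..<n}" "i < m \<Longrightarrow> f ! i < n"
  using assms by (auto simp: xfun_def dest: nth_mem)

lemma xfun_id [simp, intro]: "[0..<n] \<in> xfun X n n"
proof -
  have "set [0..<n] = {..<n}" by auto
  then show ?thesis by (cases X) (simp_all add: xfun_Planar xfun_Symmetric xfun_Cartesian)
qed

lemma map_nth_upt: "set f \<subseteq> {..<n} \<Longrightarrow> map ((!) [0..<n]) f = f"
  by (rule map_idI) auto

lemma map_nth_id: "length f = n \<Longrightarrow> map ((!) f) [0..<n] = f"
  by (auto intro: nth_equalityI)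

lemma map_nth_map_nth: "set g \<subseteq> {..<length f} \<Longrightarrow> map ((!) (map h f)) g = map h (map ((!) f) g)"
  by (auto simp: subset_iff)

lemma xfun_comp:
  assumes f: "f \<in> xfun X l m" and g: "g \<in> xfun X m n" shows "map ((!) g) f \<in> xfun X l n"
proof (cases X)
  case Planar
  with f g show ?thesis by (auto simp: xfun_Planar map_nth_id split: if_splits)
next
  case Symmetric
  with f g have eqs: "l = n" "m = n" "length f = n" "distinct f" "set f = {..<n}"
      "length g = n" "distinct g" "set g = {..<n}" by (auto simp: xfun_Symmetric split: if_splits)
  have "(!) g ` {..<n} = set g" using eqs by (auto simp: set_conv_nth)
  moreover have "inj_on ((!) g) (set f)" by (rule inj_on_nth) (use eqs in auto)
  ultimately have "distinct (map ((!) g) f)" "set (map ((!) g) f) = {..<n}"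
    using eqs(4,5,8) by (simp_all add: distinct_map)
  with eqs(1,3) Symmetric show ?thesis by (simp add: xfun_Symmetric)
next
  case Cartesian
  with f g show ?thesis by (auto simp: xfun_Cartesian subset_iff)
qed

lemma map_nth_comp: "set g \<subseteq> {..<length f} \<Longrightarrow> map ((!) h) (map ((!) f) g) = map ((!) (map ((!) h) f)) g"
  using map_nth_map_nth by metis

lemma tuples_iff: "xs \<in> tuples As \<longleftrightarrow> length xs = length As \<and> (\<forall>i<length As. xs ! i \<in> As ! i)"
  by (auto simp: tuples_def list_all2_conv_all_nth)

lemma tuples_Nil [simp]: "xs \<in> tuples [] \<longleftrightarrow> xs = []"
  by (auto simp: tuples_def)

lemma tuples_Cons: "x # xs \<in> tuples (A # As) \<longleftrightarrow> x \<in> A \<and> xs \<in> tuples As"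
  by (auto simp: tuples_def)

lemma tuples_concat:
  assumes "xss \<in> tuples (map tuples Ass)" shows "concat xss \<in> tuples (concat Ass)"
proof -
  have "list_all2 (list_all2 (\<in>)) xss Ass" using assms by (simp add: tuples_def list_all2_map2)
  then have "list_all2 (\<in>) (concat xss) (concat Ass)"
    by (induction rule: list_all2_induct) (auto intro: list_all2_appendI)
  then show ?thesis by (simp add: tuples_def)
qed


section \<open>Blocks\<close>

lemma sum_list_take_Suc: "a < length ns \<Longrightarrow> sum_list (take (Suc a) ns) = sum_list (take a ns) + (ns ! a :: nat)"
  by (simp add: take_Suc_conv_app_nth)

lemma offset_bound:
  assumes "a < length ns" "r < ns ! a" shows "sum_list (take a ns) + r < sum_list (ns :: nat list)"
proof -
  have "sum_list ns = sum_list (take (Suc a) ns) + sum_list (drop (Suc a) ns)"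
    by (metis append_take_drop_id sum_list_append)
  with assms show ?thesis by (simp add: sum_list_take_Suc)
qed

lemma offset_decompose:
  assumes "p < sum_list (ns :: nat list)"
  obtains a r where "a < length ns" "r < ns ! a" "p = sum_list (take a ns) + r"
proof -
  have "p < sum_list ns \<Longrightarrow> \<exists>a r. a < length ns \<and> r < ns ! a \<and> p = sum_list (take a ns) + r"
  proof (induction ns arbitrary: p)
    case (Cons n ns)
    show ?case
    proof (cases "p < n")
      case True then show ?thesis by (intro exI[of _ 0] exI[of _ p]) auto
    next
      case False
      with Cons obtain a r where "a < length ns" "r < ns ! a" "p - n = sum_list (take a ns) + r"
        by (metis add_diff_inverse_nat nat_add_left_cancel_less sum_list.Cons)
      with False show ?thesis by (intro exI[of _ "Suc a"] exI[of _ r]) auto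
    qed
  qed simp
  with assms that show thesis by blast
qed

lemma nth_concat_offset:
  assumes "a < length xss" "r < length (xss ! a)"
  shows "concat xss ! (sum_list (take a (map length xss)) + r) = xss ! a ! r"
  using assms
proof (induction xss arbitrary: a)
  case (Cons xs xss)
  then show ?case by (cases a) (auto simp: nth_append)
qed simp

lemma sum_list_take_concat:
  assumes "a < length pss" "i \<le> length (pss ! a)"
  shows "sum_list (take (sum_list (take a (map length pss)) + i) (concat pss))
       = sum_list (take a (map sum_list pss)) + sum_list (take i (pss ! a :: nat list))"
  using assms
proof (induction pss arbitrary: a)
  case (Cons ps pss)
  then show ?case by (cases a) auto
qed simp

lemma length_concat_take: "length (concat (take a xss)) = sum_list (take a (map length xss))"
  by (simp add: length_concat take_map)

text \<open>A family of families of maps: the \<open>i\<close>-th entry \<open>(a, h)\<close> of \<open>l\<close> maps the \<open>i\<close>-th source block into the \<open>a\<close>-th target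
  block along \<open>h\<close>, and \<open>wreath\<close> is the resulting map between the sums of the blocks. In \<open>blockf\<close> whole blocks are
  moved, copied or dropped; \<open>dsum\<close> is the sum of the maps \<open>fs\<close>.\<close>

definition wreath :: "nat list \<Rightarrow> (nat \<times> nat list) list \<Rightarrow> nat list" where
  "wreath ns l = concat (map (\<lambda>(a, h). map (\<lambda>i. sum_list (take a ns) + i) h) l)"

definition blockf :: "nat list \<Rightarrow> nat list \<Rightarrow> nat list" where
  "blockf ns g = wreath ns (map (\<lambda>a. (a, [0..<ns ! a])) g)"

definition dsum :: "nat list \<Rightarrow> nat list list \<Rightarrow> nat list" where
  "dsum ns fs = wreath ns (zip [0..<length fs] fs)"

text \<open>Since a wreath map is itself a concatenation, this single computation contains the composition law for
  wreath maps as well as the effect of \<open>blockf\<close> and \<open>dsum\<close> on concatenated families.\<close>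

lemma nth_concat_wreath:
  assumes "\<And>a h. (a, h) \<in> set l \<Longrightarrow> a < length zss \<and> set h \<subseteq> {..<length (zss ! a)}"
  shows "map ((!) (concat zss)) (wreath (map length zss) l) = concat (map (\<lambda>(a, h). map ((!) (zss ! a)) h) l)"
  unfolding wreath_def map_concat
  unfolding map_map
proof (intro arg_cong[where f = concat] map_cong refl)
  fix z assume z: "z \<in> set l"
  obtain a h where ah: "z = (a, h)" by (cases z)
  with z assms have "a < length zss" "set h \<subseteq> {..<length (zss ! a)}" by auto
  then show "(map ((!) (concat zss)) \<circ> (\<lambda>(a, h). map (\<lambda>i. sum_list (take a (map length zss)) + i) h)) z =
    (case z of (a, h) \<Rightarrow> map ((!) (zss ! a)) h)"
    unfolding ah by (auto simp: nth_concat_offset subset_iff simp del: take_map)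
qed

lemma wreath_comp:
  assumes len: "map (\<lambda>(a, h). length h) l = ms"
    and l': "\<And>a h. (a, h) \<in> set l' \<Longrightarrow> a < length ms \<and> set h \<subseteq> {..<ms ! a}"
  shows "map ((!) (wreath ns l)) (wreath ms l') =
    wreath ns (map (\<lambda>(a, h). (fst (l ! a), map ((!) (snd (l ! a))) h)) l')"
proof -
  let ?zss = "map (\<lambda>(a, h). map (\<lambda>i. sum_list (take a ns) + i) h) l"
  have ms: "ms = map length ?zss" using len by (auto simp: case_prod_beta)
  have *: "(a, h) \<in> set l' \<Longrightarrow> a < length ?zss \<and> set h \<subseteq> {..<length (?zss ! a)}" for a h
    using l'[of a h] len by (auto simp: case_prod_beta)
  have "map ((!) (wreath ns l)) (wreath ms l') = concat (map (\<lambda>(a, h). map ((!) (?zss ! a)) h) l')"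
    unfolding wreath_def[of ns l] ms by (rule nth_concat_wreath) (use * in blast)
  also have "\<dots> = wreath ns (map (\<lambda>(a, h). (fst (l ! a), map ((!) (snd (l ! a))) h)) l')"
    unfolding wreath_def
    by (rule arg_cong[where f = concat]) (use * in \<open>fastforce simp: case_prod_beta subset_iff\<close>)
  finally show ?thesis .
qed

lemma length_wreath: "length (wreath ns l) = sum_list (map (\<lambda>(a, h). length h) l)"
  by (simp add: wreath_def length_concat o_def split_def)

lemma length_blockf: "length (blockf ns g) = sum_list (map ((!) ns) g)"
  by (simp add: blockf_def length_wreath o_def)

lemma map_zip_upt: "length xs = n \<Longrightarrow> map f (zip [0..<n] xs) = map (\<lambda>i. f (i, xs ! i)) [0..<n]"
  by (rule nth_equalityI) auto

lemma set_zip_upt: "length xs = n \<Longrightarrow> (a, h) \<in> set (zip [0..<n] xs) \<longleftrightarrow> a < n \<and> h = xs ! a"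
  by (force simp: set_zip)

lemma map_plus_upt: "map ((+) k) [0..<n] = [k..<k + n]"
  by (rule nth_equalityI) auto

lemma concat_map_concat: "concat (map f (concat xss)) = concat (map (\<lambda>xs. concat (map f xs)) xss)"
  by (induction xss) auto

lemma wreath_id: "wreath ns (map (\<lambda>a. (a, [0..<ns ! a])) [0..<length ns]) = [0..<sum_list ns]"
proof (induction ns rule: rev_induct)
  case (snoc n ns)
  have "wreath (ns @ [n]) (map (\<lambda>a. (a, [0..<(ns @ [n]) ! a])) [0..<length ns]) =
      wreath ns (map (\<lambda>a. (a, [0..<ns ! a])) [0..<length ns])"
    unfolding wreath_def by (auto simp: nth_append intro!: arg_cong[where f = concat])
  moreover have "map ((+) (sum_list ns)) [0..<n] = [sum_list ns..<sum_list ns + n]"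
    by (rule map_plus_upt)
  ultimately show ?case using snoc upt_add_eq_append[of 0 "sum_list ns" n] by (simp add: wreath_def)
qed (simp add: wreath_def)

lemma blockf_id [simp]: "blockf ns [0..<length ns] = [0..<sum_list ns]"
  unfolding blockf_def by (rule wreath_id)

lemma dsum_id [simp]: "dsum ns (map (\<lambda>n. [0..<n]) ns) = [0..<sum_list ns]"
proof -
  have "zip [0..<length ns] (map (\<lambda>n. [0..<n]) ns) = map (\<lambda>a. (a, [0..<ns ! a])) [0..<length ns]"
    by (rule nth_equalityI) auto
  then show ?thesis by (simp add: dsum_def wreath_id)
qed

lemma nth_concat_blockf:
  assumes "set g \<subseteq> {..<length zss}"
  shows "map ((!) (concat zss)) (blockf (map length zss) g) = concat (map ((!) zss) g)"
proof -
  have "map ((!) (concat zss)) (blockf (map length zss) g) =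
    concat (map (\<lambda>(a, h). map ((!) (zss ! a)) h) (map (\<lambda>a. (a, [0..<map length zss ! a])) g))"
    unfolding blockf_def by (rule nth_concat_wreath) (use assms in auto)
  also have "\<dots> = concat (map ((!) zss) g)"
    using assms by (auto simp: o_def subset_iff map_nth intro!: arg_cong[where f = concat])
  finally show ?thesis .
qed

lemma nth_concat_dsum:
  assumes "length fs = length zss" "\<And>i. i < length fs \<Longrightarrow> set (fs ! i) \<subseteq> {..<length (zss ! i)}"
  shows "map ((!) (concat zss)) (dsum (map length zss) fs) =
    concat (map (\<lambda>i. map ((!) (zss ! i)) (fs ! i)) [0..<length zss])"
proof -
  have "map ((!) (concat zss)) (dsum (map length zss) fs) =
    concat (map (\<lambda>(a, h). map ((!) (zss ! a)) h) (zip [0..<length fs] fs))"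
    unfolding dsum_def by (rule nth_concat_wreath) (use assms in \<open>auto simp: set_zip_upt subset_iff\<close>)
  then show ?thesis using assms(1) by (simp add: map_zip_upt split_def)
qed

lemma blockf_comp:
  assumes "set s \<subseteq> {..<length ps}" "set h \<subseteq> {..<length s}"
  shows "map ((!) (blockf ps s)) (blockf (map ((!) ps) s) h) = blockf ps (map ((!) s) h)"
  unfolding blockf_def
  by (subst wreath_comp)
     (use assms in \<open>auto simp: subset_iff o_def map_nth_upt intro!: arg_cong[where f = "wreath ps"]\<close>)

text \<open>Both composites are the wreath map with entries \<open>(a, fs ! a)\<close> for \<open>a\<close> in \<open>s\<close>.\<close>

lemma dsum_blockf:
  assumes fs: "length fs = length ns" "\<And>i. i < length ns \<Longrightarrow> set (fs ! i) \<subseteq> {..<ns ! i}"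
    and s: "set s \<subseteq> {..<length ns}"
  shows "map ((!) (dsum ns fs)) (blockf (map length fs) s) =
         map ((!) (blockf ns s)) (dsum (map ((!) ns) s) (map ((!) fs) s))"
proof -
  have "map ((!) (dsum ns fs)) (blockf (map length fs) s) = wreath ns (map (\<lambda>a. (a, fs ! a)) s)"
    unfolding dsum_def blockf_def
    by (subst wreath_comp)
       (use assms in \<open>auto simp: subset_iff o_def map_zip_upt map_nth intro!: arg_cong[where f = "wreath ns"] nth_equalityI\<close>)
  moreover have "map ((!) (blockf ns s)) (dsum (map ((!) ns) s) (map ((!) fs) s)) = wreath ns (map (\<lambda>a. (a, fs ! a)) s)"
    unfolding dsum_def blockf_def
  proof (subst wreath_comp)
    show "map (\<lambda>(a, h). length h) (map (\<lambda>a. (a, [0..<ns ! a])) s) = map ((!) ns) s" by simp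
    show "a < length (map ((!) ns) s) \<and> set h \<subseteq> {..<map ((!) ns) s ! a}"
      if "(a, h) \<in> set (zip [0..<length (map ((!) fs) s)] (map ((!) fs) s))" for a h
      using that assms unfolding set_zip_upt[OF refl] by (auto simp: subset_iff)
    show "wreath ns (map (\<lambda>(a, h). (fst (map (\<lambda>a. (a, [0..<ns ! a])) s ! a), map ((!) (snd (map (\<lambda>a. (a, [0..<ns ! a])) s ! a))) h))
        (zip [0..<length (map ((!) fs) s)] (map ((!) fs) s))) = wreath ns (map (\<lambda>a. (a, fs ! a)) s)"
      by (rule arg_cong[where f = "wreath ns"], rule nth_equalityI)
         (use assms in \<open>auto simp: subset_iff intro!: map_nth_upt\<close>)
  qed
  ultimately show ?thesis by simp
qed

lemma dsum_comp:
  assumes "length fs = length ns" "length hs = length ns" "\<And>i. i < length ns \<Longrightarrow> set (hs ! i) \<subseteq> {..<length (fs ! i)}"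
  shows "map ((!) (dsum ns fs)) (dsum (map length fs) hs) = dsum ns (map (\<lambda>i. map ((!) (fs ! i)) (hs ! i)) [0..<length ns])"
  unfolding dsum_def
  by (subst wreath_comp)
     (use assms in \<open>auto simp: set_zip_upt subset_iff map_zip_upt map_nth_id intro!: arg_cong[where f = "wreath ns"] nth_equalityI\<close>)

lemma blockf_ones: "set g \<subseteq> {..<k} \<Longrightarrow> blockf (replicate k 1) g = g"
  by (induction g) (auto simp: blockf_def wreath_def sum_list_replicate min_def)

lemma dsum_single: "dsum [n] [f] = f"
  by (simp add: dsum_def wreath_def map_idI)

text \<open>Associativity of sums, for blocks of blocks: an entry of \<open>pss ! a\<close> starts, in the total sum, at the offset of
  the group \<open>a\<close> plus its offset inside the group.\<close>

lemma blockf_concat_wreath: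
  assumes "\<And>a h. (a, h) \<in> set l \<Longrightarrow> a < length pss \<and> set h \<subseteq> {..<length (pss ! a)}"
  shows "blockf (concat pss) (wreath (map length pss) l) =
    wreath (map sum_list pss) (map (\<lambda>(a, h). (a, blockf (pss ! a) h)) l)"
proof -
  have *: "concat (map (\<lambda>i. map ((+) (sum_list (take i (concat pss)))) [0..<concat pss ! i])
        (map ((+) (sum_list (take a (map length pss)))) h)) =
      map ((+) (sum_list (take a (map sum_list pss)))) (blockf (pss ! a) h)" if "(a, h) \<in> set l" for a h
  proof -
    have "sum_list (take (sum_list (take a (map length pss)) + i) (concat pss))
       = sum_list (take a (map sum_list pss)) + sum_list (take i (pss ! a))"
      "concat pss ! (sum_list (take a (map length pss)) + i) = pss ! a ! i" if "i \<in> set h" for i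
      using assms[OF \<open>(a, h) \<in> set l\<close>] that by (auto simp: sum_list_take_concat nth_concat_offset subset_iff less_imp_le)
    then show ?thesis
      by (auto simp: blockf_def wreath_def map_concat o_def add.assoc intro!: arg_cong[where f = concat])
  qed
  have "blockf (concat pss) (wreath (map length pss) l) =
    concat (map (\<lambda>(a, h). concat (map (\<lambda>i. map ((+) (sum_list (take i (concat pss)))) [0..<concat pss ! i])
        (map ((+) (sum_list (take a (map length pss)))) h))) l)"
    unfolding blockf_def wreath_def by (induction l) (auto simp: o_def)
  also have "\<dots> = concat (map (\<lambda>(a, h). map ((+) (sum_list (take a (map sum_list pss)))) (blockf (pss ! a) h)) l)"
    by (rule arg_cong[where f = concat]) (auto simp: * simp del: map_map)
  finally show ?thesis by (simp add: wreath_def o_def split_def)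
qed

lemma blockf_concat_blockf:
  assumes "set g \<subseteq> {..<length pss}"
  shows "blockf (concat pss) (blockf (map length pss) g) = blockf (map sum_list pss) g"
  unfolding blockf_def[of "map length pss"] blockf_def[of "map sum_list pss"]
  by (subst blockf_concat_wreath)
     (use assms in \<open>auto simp: subset_iff o_def intro!: arg_cong[where f = "wreath _"]\<close>)

lemma blockf_concat_dsum:
  assumes "length fs = length pss" "\<And>i. i < length fs \<Longrightarrow> set (fs ! i) \<subseteq> {..<length (pss ! i)}"
  shows "blockf (concat pss) (dsum (map length pss) fs) =
    dsum (map sum_list pss) (map (\<lambda>i. blockf (pss ! i) (fs ! i)) [0..<length pss])"
  unfolding dsum_def
  by (subst blockf_concat_wreath)
     (use assms in \<open>auto simp: set_zip_upt[OF assms(1)] set_zip_upt[OF refl] subset_iff intro!: arg_cong[where f = "wreath _"] nth_equalityI\<close>)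

lemma dsum_concat_dsum:
  assumes "map length fss = map length pss"
  shows "dsum (map sum_list pss) (map (\<lambda>i. dsum (pss ! i) (fss ! i)) [0..<length pss]) = dsum (concat pss) (concat fss)"
proof -
  have dsum': "dsum ns fs = concat (map (\<lambda>i. map ((+) (sum_list (take i ns))) (fs ! i)) [0..<length fs])" for ns fs
    by (simp add: dsum_def wreath_def map_zip_upt)
  have l: "length fss = length pss" and li: "\<And>i. i < length pss \<Longrightarrow> length (fss ! i) = length (pss ! i)"
    using assms by (auto dest: map_eq_imp_length_eq) (metis assms length_map nth_map)
  have idx: "[0..<length (concat fss)] = wreath (map length pss) (map (\<lambda>a. (a, [0..<length (pss ! a)])) [0..<length pss])"
  proof -
    have "map (\<lambda>a. (a, [0..<length (pss ! a)])) [0..<length pss] =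
        map (\<lambda>a. (a, [0..<map length pss ! a])) [0..<length (map length pss)]" by simp
    then show ?thesis by (simp only: wreath_id length_concat assms)
  qed
  have "dsum (concat pss) (concat fss) =
    concat (map (\<lambda>a. concat (map (\<lambda>i. map ((+) (sum_list (take (sum_list (take a (map length pss)) + i) (concat pss))))
      (concat fss ! (sum_list (take a (map length pss)) + i))) [0..<length (pss ! a)])) [0..<length pss])"
    unfolding dsum' idx wreath_def concat_map_concat by (simp add: o_def)
  also have "\<dots> = concat (map (\<lambda>a. map ((+) (sum_list (take a (map sum_list pss)))) (dsum (pss ! a) (fss ! a))) [0..<length pss])"
  proof (rule arg_cong[where f = concat], rule map_cong[OF refl])
    fix a assume "a \<in> set [0..<length pss]"
    then have a: "a < length pss" by simp
    have "sum_list (take (sum_list (take a (map length pss)) + i) (concat pss))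
       = sum_list (take a (map sum_list pss)) + sum_list (take i (pss ! a))"
      "concat fss ! (sum_list (take a (map length pss)) + i) = fss ! a ! i" if "i < length (pss ! a)" for i
      using sum_list_take_concat[of a pss i] nth_concat_offset[of a fss i] a that l li assms by auto
    then show "concat (map (\<lambda>i. map ((+) (sum_list (take (sum_list (take a (map length pss)) + i) (concat pss))))
      (concat fss ! (sum_list (take a (map length pss)) + i))) [0..<length (pss ! a)]) =
      map ((+) (sum_list (take a (map sum_list pss)))) (dsum (pss ! a) (fss ! a))"
      using li[OF a] by (auto simp: dsum' map_concat o_def add.assoc intro!: arg_cong[where f = concat])
  qed
  also have "\<dots> = dsum (map sum_list pss) (map (\<lambda>i. dsum (pss ! i) (fss ! i)) [0..<length pss])"
    by (auto simp: dsum'[of "map sum_list pss"] intro!: arg_cong[where f = concat])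
  finally show ?thesis by simp
qed

text \<open>For bijections surjectivity is seen block by block, and injectivity follows by counting.\<close>

lemma wreath_xfun:
  assumes l: "map fst l \<in> xfun X (length ms) (length ns)"
    and h: "\<And>i. i < length ms \<Longrightarrow> snd (l ! i) \<in> xfun X (ms ! i) (ns ! fst (l ! i))"
  shows "wreath ns l \<in> xfun X (sum_list ms) (sum_list ns)"
proof -
  have len: "length l = length ms" and fst: "\<And>i. i < length ms \<Longrightarrow> fst (l ! i) < length ns"
    using xfunD[OF l] by auto
  have ms: "map (\<lambda>(a, h). length h) l = ms"
    using xfunD(1)[OF h] len by (auto simp: case_prod_beta intro: nth_equalityI)
  have lw: "length (wreath ns l) = sum_list ms" by (simp add: length_wreath ms)
  have set: "set (wreath ns l) = {sum_list (take (fst (l ! i)) ns) + r | i r. i < length ms \<and> r \<in> set (snd (l ! i))}"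
    (is "_ = ?R")
  proof -
    have "set (wreath ns l) = (\<Union>p\<in>set l. (\<lambda>r. sum_list (take (fst p) ns) + r) ` set (snd p))"
      by (simp add: wreath_def split_def)
    also have "\<dots> = (\<Union>i<length ms. (\<lambda>r. sum_list (take (fst (l ! i)) ns) + r) ` set (snd (l ! i)))"
      unfolding set_conv_nth[of l] len by blast
    also have "\<dots> = ?R" by blast
    finally show ?thesis .
  qed
  have sub: "set (wreath ns l) \<subseteq> {..<sum_list ns}"
    unfolding set using fst xfunD(2)[OF h] by (auto intro!: offset_bound simp: subset_iff)
  show ?thesis
  proof (cases X)
    case Cartesian
    with lw sub show ?thesis by (simp add: xfun_Cartesian)
  next
    case Planar
    with l have ll: "map fst l = [0..<length ns]" and eq: "length ms = length ns" by (auto simp: xfun_Planar split: if_splits)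
    then have fi: "\<And>i. i < length ms \<Longrightarrow> fst (l ! i) = i" using len by (metis add_0 length_map map_nth nth_map nth_upt)
    have hi: "snd (l ! i) = [0..<ns ! i] \<and> ms ! i = ns ! i" if "i < length ms" for i
      using h[OF that] fi[OF that] Planar by (auto simp: xfun_Planar split: if_splits)
    then have "ms = ns" using eq by (auto intro: nth_equalityI)
    moreover have "l = map (\<lambda>a. (a, [0..<ns ! a])) [0..<length ns]"
      using hi fi len eq by (auto intro!: nth_equalityI prod_eqI)
    ultimately show ?thesis using wreath_id[of ns] by simp
  next
    case Symmetric
    with l have eq: "length ms = length ns" and d: "distinct (map fst l)" and s: "set (map fst l) = {..<length ns}"
      by (auto simp: xfun_Symmetric split: if_splits)
    have hi: "set (snd (l ! i)) = {..<ns ! fst (l ! i)} \<and> ms ! i = ns ! fst (l ! i)" if "i < length ms" for i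
      using h[OF that] Symmetric by (auto simp: xfun_Symmetric split: if_splits)
    have "{..<sum_list ns} \<subseteq> set (wreath ns l)"
    proof
      fix p assume "p \<in> {..<sum_list ns}"
      then obtain a r where ar: "a < length ns" "r < ns ! a" "p = sum_list (take a ns) + r"
        by (auto elim: offset_decompose)
      from ar(1) s obtain i where "i < length ms" "fst (l ! i) = a"
        using len by (metis in_set_conv_nth length_map lessThan_iff nth_map)
      with ar hi show "p \<in> set (wreath ns l)" unfolding set by blast
    qed
    with sub have surj: "set (wreath ns l) = {..<sum_list ns}" by blast
    have "ms = map ((!) ns) (map fst l)" using hi len by (auto intro: nth_equalityI)
    then have "sum_list ms = (\<Sum>a\<in>set (map fst l). ns ! a)" using d by (metis sum_list_distinct_conv_sum_set)
    also have "\<dots> = sum_list ns" unfolding s by (simp add: sum_list_sum_nth lessThan_atLeast0)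
    finally have eqs: "sum_list ms = sum_list ns" .
    have "distinct (wreath ns l)" by (rule card_distinct) (simp add: surj lw eqs)
    with surj lw eqs Symmetric show ?thesis by (simp add: xfun_Symmetric)
  qed
qed

lemma blockf_xfun:
  assumes "g \<in> xfun X k (length ns)"
  shows "blockf ns g \<in> xfun X (sum_list (map ((!) ns) g)) (sum_list ns)"
  unfolding blockf_def by (rule wreath_xfun) (use assms xfunD[OF assms] in \<open>auto simp: o_def\<close>)

lemma dsum_xfun:
  assumes "length fs = length ns" "length ms = length ns" "\<And>i. i < length ns \<Longrightarrow> fs ! i \<in> xfun X (ms ! i) (ns ! i)"
  shows "dsum ns fs \<in> xfun X (sum_list ms) (sum_list ns)"
  unfolding dsum_def by (rule wreath_xfun) (use assms in auto)

lemma concat_chunks: "length xs = sum_list ns \<Longrightarrow> concat (chunks ns xs) = xs"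
  by (induction ns arbitrary: xs) auto

lemma length_chunks: "length xs = sum_list ns \<Longrightarrow> map length (chunks ns xs) = ns"
  by (induction ns arbitrary: xs) auto

lemma chunks_concat: "map length xss = ns \<Longrightarrow> chunks ns (concat xss) = xss"
  by (induction xss arbitrary: ns) auto

lemma chunks_map: "chunks ns (map f xs) = map (map f) (chunks ns xs)"
  by (induction ns arbitrary: xs) (auto simp: take_map drop_map)

lemma sum_list_map_concat: "sum_list (map f (concat ss)) = sum_list (map (\<lambda>s. sum_list (map f s)) ss)"
  by (induction ss) auto

lemma chunks_xfun:
  assumes "s \<in> xfun X (sum_list ns) k"
  shows "map length (chunks ns s) = ns" "concat (chunks ns s) = s" "length (chunks ns s) = length ns"
    "i < length ns \<Longrightarrow> length (chunks ns s ! i) = ns ! i" "i < length ns \<Longrightarrow> set (chunks ns s ! i) \<subseteq> {..<k}"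
proof -
  show 1: "map length (chunks ns s) = ns" and 2: "concat (chunks ns s) = s"
    using xfunD(1)[OF assms] by (simp_all add: length_chunks concat_chunks)
  show 3: "length (chunks ns s) = length ns" using 1 by (metis length_map)
  show "length (chunks ns s ! i) = ns ! i" if "i < length ns" using 1 3 that nth_map by metis
  show "set (chunks ns s ! i) \<subseteq> {..<k}" if "i < length ns"
  proof -
    have "chunks ns s ! i \<in> set (chunks ns s)" using 3 that by simp
    then have "set (chunks ns s ! i) \<subseteq> set (concat (chunks ns s))" by auto
    then show ?thesis using xfunD(2)[OF assms] unfolding 2 by blast
  qed
qed


section \<open>The categories \<open>!C\<close>\<close>

definition is_category :: "('o, 'm) category \<Rightarrow> bool" where
  "is_category C \<longleftrightarrow>
     (\<forall>a\<in>obj C. ident C a \<in> hom C a a) \<and>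
     (\<forall>a\<in>obj C. \<forall>b\<in>obj C. \<forall>c\<in>obj C. \<forall>f\<in>hom C a b. \<forall>g\<in>hom C b c. cmp C a b c g f \<in> hom C a c) \<and>
     (\<forall>a\<in>obj C. \<forall>b\<in>obj C. \<forall>f\<in>hom C a b.
        cmp C a b b (ident C b) f = f \<and> cmp C a a b f (ident C a) = f) \<and>
     (\<forall>a\<in>obj C. \<forall>b\<in>obj C. \<forall>c\<in>obj C. \<forall>d\<in>obj C. \<forall>f\<in>hom C a b. \<forall>g\<in>hom C b c. \<forall>h\<in>hom C c d.
        cmp C a c d h (cmp C a b c g f) = cmp C a b d (cmp C b c d h g) f)"

lemma is_categoryD:
  assumes "is_category C"
  shows "a \<in> obj C \<Longrightarrow> ident C a \<in> hom C a a"
    and "\<lbrakk>a \<in> obj C; b \<in> obj C; c \<in> obj C; f \<in> hom C a b; g \<in> hom C b c\<rbrakk> \<Longrightarrow> cmp C a b c g f \<in> hom C a c"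
    and "\<lbrakk>a \<in> obj C; b \<in> obj C; f \<in> hom C a b\<rbrakk> \<Longrightarrow> cmp C a b b (ident C b) f = f"
    and "\<lbrakk>a \<in> obj C; b \<in> obj C; f \<in> hom C a b\<rbrakk> \<Longrightarrow> cmp C a a b f (ident C a) = f"
    and "\<lbrakk>a \<in> obj C; b \<in> obj C; c \<in> obj C; d \<in> obj C; f \<in> hom C a b; g \<in> hom C b c; h \<in> hom C c d\<rbrakk> \<Longrightarrow>
      cmp C a c d h (cmp C a b c g f) = cmp C a b d (cmp C b c d h g) f"
  using assms unfolding is_category_def by blast+

lemma is_category_one_cat: "is_category one_cat"
  by (simp add: is_category_def one_cat_def)

lemma op_cat_op_cat [simp]: "op_cat (op_cat C) = C"
  by (simp add: op_cat_def)

lemma op_cat_one_cat [simp]: "op_cat one_cat = one_cat"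
  by (simp add: op_cat_def one_cat_def)

lemma bang_obj: "obj (bang X C) = lists (obj C)"
  by (simp add: bang_def)

lemma bang_hom_iff:
  "l \<in> hom (bang X C) cs ds \<longleftrightarrow> map fst l \<in> xfun X (length ds) (length cs) \<and>
     (\<forall>j<length ds. snd (l ! j) \<in> hom C (cs ! fst (l ! j)) (ds ! j))"
proof -
  have "set (map fst l) \<subseteq> {..<n} \<longleftrightarrow> (\<forall>j<length l. fst (l ! j) < n)" for n
    using all_nth_imp_all_set[of l "\<lambda>p. fst p < n"] by (auto simp: subset_iff)
  then show ?thesis by (auto simp: bang_def xfun_def)
qed

lemma bang_homD:
  assumes "l \<in> hom (bang X C) cs ds"
  shows "length l = length ds" "map fst l \<in> xfun X (length ds) (length cs)"
    "j < length ds \<Longrightarrow> fst (l ! j) < length cs"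
    "j < length ds \<Longrightarrow> snd (l ! j) \<in> hom C (cs ! fst (l ! j)) (ds ! j)"
proof -
  show *: "length l = length ds" "map fst l \<in> xfun X (length ds) (length cs)"
    using assms xfunD(1)[of "map fst l" X "length ds" "length cs"] by (auto simp: bang_hom_iff)
  show "fst (l ! j) < length cs" if "j < length ds"
    using xfunD(3)[OF *(2) that] that *(1) by simp
  show "j < length ds \<Longrightarrow> snd (l ! j) \<in> hom C (cs ! fst (l ! j)) (ds ! j)"
    using assms by (simp add: bang_hom_iff)
qed

lemma bang_ident: "ident (bang X C) cs = map (\<lambda>i. (i, ident C (cs ! i))) [0..<length cs]"
  by (simp add: bang_def)

lemma bang_cmp: "cmp (bang X C) as bs cs g f = map (\<lambda>k. (fst (f ! fst (g ! k)),
    cmp C (as ! fst (f ! fst (g ! k))) (bs ! fst (g ! k)) (cs ! k) (snd (g ! k)) (snd (f ! fst (g ! k))))) [0..<length cs]"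
  by (simp add: bang_def case_prod_unfold)

lemma length_bang_cmp [simp]: "length (cmp (bang X C) as bs cs g f) = length cs"
  by (simp add: bang_cmp)

lemma map_fst_bang_cmp:
  assumes "length g = length cs" "set (map fst g) \<subseteq> {..<length f}"
  shows "map fst (cmp (bang X C) as bs cs g f) = map ((!) (map fst f)) (map fst g)"
  by (rule nth_equalityI) (use assms in \<open>auto simp: bang_cmp subset_iff\<close>)

lemma is_category_bang:
  assumes C: "is_category C" shows "is_category (bang X C)"
  unfolding is_category_def bang_obj
proof (intro conjI ballI)
  fix as assume as: "as \<in> lists (obj C)"
  show "ident (bang X C) as \<in> hom (bang X C) as as"
    using is_categoryD(1)[OF C] as by (auto simp: bang_hom_iff bang_ident o_def)
next
  fix as bs cs f g
  assume o: "as \<in> lists (obj C)" "bs \<in> lists (obj C)" "cs \<in> lists (obj C)"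
    and f: "f \<in> hom (bang X C) as bs" and g: "g \<in> hom (bang X C) bs cs"
  have "map fst (cmp (bang X C) as bs cs g f) \<in> xfun X (length cs) (length as)"
    using map_fst_bang_cmp[of g cs f] xfun_comp[OF bang_homD(2)[OF g] bang_homD(2)[OF f]]
      bang_homD(1)[OF f] bang_homD(1)[OF g] xfunD(2)[OF bang_homD(2)[OF g]] by simp
  then show "cmp (bang X C) as bs cs g f \<in> hom (bang X C) as cs"
    using bang_homD[OF f] bang_homD[OF g] o
    by (auto simp: bang_hom_iff bang_cmp intro!: is_categoryD(2)[OF C])
next
  fix as bs f
  assume o: "as \<in> lists (obj C)" "bs \<in> lists (obj C)" and f: "f \<in> hom (bang X C) as bs"
  show "cmp (bang X C) as bs bs (ident (bang X C) bs) f = f"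
    "cmp (bang X C) as as bs f (ident (bang X C) as) = f"
    using bang_homD[OF f] o
    by (auto simp: bang_ident bang_cmp is_categoryD(3,4)[OF C] intro!: nth_equalityI)
next
  fix as bs cs ds f g h
  assume o: "as \<in> lists (obj C)" "bs \<in> lists (obj C)" "cs \<in> lists (obj C)" "ds \<in> lists (obj C)"
    and f: "f \<in> hom (bang X C) as bs" and g: "g \<in> hom (bang X C) bs cs" and h: "h \<in> hom (bang X C) cs ds"
  show "cmp (bang X C) as cs ds h (cmp (bang X C) as bs cs g f) =
        cmp (bang X C) as bs ds (cmp (bang X C) bs cs ds h g) f"
    using bang_homD[OF f] bang_homD[OF g] bang_homD[OF h] o
    by (auto simp: bang_cmp intro!: is_categoryD(5)[OF C])
qed


section \<open>Coends\<close>

lemma coend_rel_refl [simp]: "(p, p) \<in> coend_rel C H"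
  by (simp add: coend_rel_def Let_def)

lemma coend_rel_equiv: "equiv UNIV (coend_rel C H)"
proof -
  have "sym ((R \<union> R\<inverse>)\<^sup>*)" for R :: "'x rel"
    by (rule sym_rtrancl) (auto simp: sym_def)
  then show ?thesis
    unfolding coend_rel_def Let_def equiv_def by (simp add: refl_rtrancl trans_rtrancl)
qed

lemma coend_class_eq_iff: "coend_class C H p = coend_class C H q \<longleftrightarrow> (p, q) \<in> coend_rel C H"
  unfolding coend_class_def using eq_equiv_class_iff[OF coend_rel_equiv] by blast

text \<open>The generating relation is all that is ever used of coends, in the form of this equation and of the
  factorization property \<open>coend_lift_class\<close>.\<close>

lemma coend_class_generator:
  assumes "c \<in> obj C" "c' \<in> obj C" "f \<in> hom C c c'" "x \<in> fobj H (c', c)"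
  shows "coend_class C H (c, fmap H (c', c) (c, c) (f, ident C c) x) =
         coend_class C H (c', fmap H (c', c) (c', c') (ident C c', f) x)"
  unfolding coend_class_eq_iff coend_rel_def Let_def
  by (rule r_into_rtrancl) (use assms in blast)

text \<open>The functions on representatives that are constant on the generating relation.\<close>

definition coend_compatible ::
    "('o, 'm) category \<Rightarrow> ('o \<times> 'o, 'm \<times> 'm, 'a) set_functor \<Rightarrow> ('o \<times> 'a \<Rightarrow> 'b) \<Rightarrow> bool" where
  "coend_compatible C H F \<longleftrightarrow>
     (\<forall>c\<in>obj C. \<forall>c'\<in>obj C. \<forall>f\<in>hom C c c'. \<forall>x\<in>fobj H (c', c).
        F (c, fmap H (c', c) (c, c) (f, ident C c) x) =
        F (c', fmap H (c', c) (c', c') (ident C c', f) x))"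

lemma coend_compatibleD:
  assumes F: "coend_compatible C H F" and pq: "(p, q) \<in> coend_rel C H" shows "F p = F q"
  using pq unfolding coend_rel_def Let_def
proof (induction rule: rtrancl_induct)
  case (step y z)
  from step.hyps(2) have "F y = F z"
    using F unfolding coend_compatible_def by (auto 4 3)
  with step.IH show ?case by simp
qed simp

text \<open>The factorization of a compatible function through the coend; compatibility makes the choice of the
  representative irrelevant.\<close>

definition coend_lift :: "('o \<times> 'a \<Rightarrow> 'b) \<Rightarrow> ('o \<times> 'a) set \<Rightarrow> 'b" where
  "coend_lift F K = F (SOME p. p \<in> K)"

lemma coend_lift_class:
  assumes "coend_compatible C H F" shows "coend_lift F (coend_class C H p) = F p"
proof -
  have "p \<in> coend_class C H p" by (simp add: coend_class_def)
  then have "(SOME q. q \<in> coend_class C H p) \<in> coend_class C H p" by (rule someI)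
  then show ?thesis
    unfolding coend_lift_def using coend_compatibleD[OF assms] by (simp add: coend_class_def)
qed

text \<open>\<open>coend_map\<close> collects the images of all representatives of a class. When \<open>\<phi>\<close> is compatible these images form
  one class, which any representative computes.\<close>

lemma coend_map_class:
  assumes "coend_compatible C' H' (\<lambda>p. coend_class C H (\<phi> p))"
  shows "coend_map C H \<phi> (coend_class C' H' p) = coend_class C H (\<phi> p)"
proof -
  have "coend_class C H (\<phi> q) = coend_class C H (\<phi> p)" if "q \<in> coend_class C' H' p" for q
    using coend_compatibleD[OF assms] that by (simp add: coend_class_def)
  then have "coend_map C H \<phi> (coend_class C' H' p) = (\<Union>q\<in>coend_class C' H' p. coend_class C H (\<phi> p))"
    unfolding coend_map_def coend_class_def by blast
  moreover have "p \<in> coend_class C' H' p" by (simp add: coend_class_def)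
  ultimately show ?thesis by blast
qed

lemma coend_eq: "coend C H = coend_class C H ` (SIGMA c:obj C. fobj H (c, c))"
  by (auto simp: coend_def coend_class_def quotient_def)

lemma coendE:
  assumes "K \<in> coend C H"
  obtains c x where "c \<in> obj C" "x \<in> fobj H (c, c)" "K = coend_class C H (c, x)"
  using assms unfolding coend_eq by blast

lemma coendI: "c \<in> obj C \<Longrightarrow> x \<in> fobj H (c, c) \<Longrightarrow> coend_class C H (c, x) \<in> coend C H"
  unfolding coend_eq by blast


section \<open>Functors on \<open>?1\<close>\<close>

lemma op_cat_sel [simp]:
  "obj (op_cat C) = obj C" "hom (op_cat C) a b = hom C b a" "ident (op_cat C) = ident C"
  "cmp (op_cat C) a b c g f = cmp C c b a f g"
  by (simp_all add: op_cat_def)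

lemma prod_cat_sel [simp]:
  "obj (prod_cat C D) = obj C \<times> obj D" "hom (prod_cat C D) (a, a') (b, b') = hom C a b \<times> hom D a' b'"
  "ident (prod_cat C D) (a, a') = (ident C a, ident D a')"
  "cmp (prod_cat C D) (a, a') (b, b') (c, c') (g, g') (f, f') = (cmp C a b c g f, cmp D a' b' c' g' f')"
  by (simp_all add: prod_cat_def)

lemma one_cat_sel [simp]: "obj one_cat = UNIV" "hom one_cat a b = UNIV"
  by (simp_all add: one_cat_def)

lemma op_prof_sel [simp]:
  "fobj (op_prof \<Phi>) (d, c) = fobj \<Phi> (c, d)"
  "fmap (op_prof \<Phi>) (d, c) (d', c') (g, f) = fmap \<Phi> (c, d) (c', d') (f, g)"
  by (simp_all add: op_prof_def)

lemma fobj_make_functor: "a \<in> obj C \<Longrightarrow> fobj (make_functor C F M) a = F a"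
  by (simp add: make_functor_def)

lemma fmap_make_functor:
  "\<lbrakk>a \<in> obj C; b \<in> obj C; f \<in> hom C a b; x \<in> F a\<rbrakk> \<Longrightarrow> fmap (make_functor C F M) a b f x = M a b f x"
  by (simp add: make_functor_def)

text \<open>Both \<open>?1\<close> and \<open>??1\<close> are opposites of iterates of \<open>!\<close> on the self-dual category \<open>1\<close>. The calculations take place
  in \<open>ordinals X = !1\<close> and \<open>families X = !!1\<close>, where a morphism is a list indexed by its target.\<close>

abbreviation ordinals :: "kind \<Rightarrow> (unit list, unit seq_arr) category" where
  "ordinals X \<equiv> bang X one_cat"

abbreviation families :: "kind \<Rightarrow> (unit list list, unit seq_arr seq_arr) category" where
  "families X \<equiv> bang X (ordinals X)"

abbreviation one_base :: "kind \<Rightarrow> (unit list \<times> unit, unit seq_arr \<times> unit) category" where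
  "one_base X \<equiv> prof_base (quest X one_cat) one_cat"

abbreviation one_functor :: "kind \<Rightarrow> (unit, unit, unit, unit, 'a) cokl \<Rightarrow> bool" where
  "one_functor X \<equiv> is_set_functor (one_base X)"

lemma quest_one: "quest X one_cat = op_cat (ordinals X)"
  by (simp add: quest_def)

lemma quest_quest_one: "quest X (quest X one_cat) = op_cat (families X)"
  by (simp add: quest_def)

lemmas is_category_ordinals = is_category_bang[OF is_category_one_cat]
lemmas is_category_families = is_category_bang[OF is_category_ordinals]

lemma obj_ordinals [simp]: "obj (ordinals X) = UNIV" "obj (families X) = UNIV"
  by (simp_all add: bang_obj)

lemma hom_ordinals [simp]: "l \<in> hom (ordinals X) us vs \<longleftrightarrow> map fst l \<in> xfun X (length vs) (length us)"
  by (simp add: bang_hom_iff)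

lemma unit_arr_eqI: "map fst (l :: unit seq_arr) = map fst l' \<Longrightarrow> l = l'"
  by (rule injD[OF inj_mapI[of fst]]) (auto intro: injI)

lemma map_fst_function_arr [simp]: "map fst (function_arr f) = f"
  by (simp add: function_arr_def o_def)

lemma function_arr_map_fst [simp]: "function_arr (map fst l) = l"
  by (rule unit_arr_eqI) simp

lemma ident_ordinals: "ident (ordinals X) us = function_arr [0..<length us]"
  by (rule unit_arr_eqI) (simp add: bang_ident o_def)

lemma cmp_ordinals:
  assumes "g \<in> hom (ordinals X) bs cs" "f \<in> hom (ordinals X) as bs"
  shows "cmp (ordinals X) as bs cs g f = function_arr (map ((!) (map fst f)) (map fst g))"
proof (rule unit_arr_eqI)
  have "length (map fst g) = length cs" "set (map fst g) \<subseteq> {..<length bs}" "length (map fst f) = length bs"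
    using bang_homD(1)[OF assms(1)] bang_homD(1)[OF assms(2)] xfunD(2)[OF bang_homD(2)[OF assms(1)]] by simp_all
  then show "map fst (cmp (ordinals X) as bs cs g f) = map fst (function_arr (map ((!) (map fst f)) (map fst g)))"
    by (simp add: map_fst_bang_cmp)
qed

lemma numeral_obj_length [simp]: "numeral_obj (length us) = us"
  by (induction us) auto

lemma map_numeral_obj_length [simp]: "map numeral_obj (map length uss) = uss"
  by (induction uss) auto

lemma map_length_numeral_obj [simp]: "map length (map numeral_obj ns) = ns"
  by (induction ns) auto

lemma one_objE: obtains n where "p = num n"
  by (cases p) (metis numeral_obj_length unit.exhaust)

lemma obj_one_base [simp]: "obj (one_base X) = UNIV"
  by (simp add: quest_one)

lemma
  assumes "one_functor X \<Phi>"
  shows functor_closed: "\<lbrakk>map fst l \<in> xfun X (length us) (length vs); x \<in> fobj \<Phi> (us, ())\<rbrakk> \<Longrightarrow>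
      fmap \<Phi> (us, ()) (vs, ()) (l, ()) x \<in> fobj \<Phi> (vs, ())"
    and functor_id: "x \<in> fobj \<Phi> (us, ()) \<Longrightarrow> fmap \<Phi> (us, ()) (us, ()) (ident (ordinals X) us, ()) x = x"
    and functor_comp: "\<lbrakk>map fst l \<in> xfun X (length us) (length vs); map fst l' \<in> xfun X (length vs) (length ws); x \<in> fobj \<Phi> (us, ())\<rbrakk> \<Longrightarrow>
      fmap \<Phi> (vs, ()) (ws, ()) (l', ()) (fmap \<Phi> (us, ()) (vs, ()) (l, ()) x) =
      fmap \<Phi> (us, ()) (ws, ()) (cmp (ordinals X) ws vs us l l', ()) x"
proof -
  note A = assms[unfolded is_set_functor_def obj_one_base quest_one]
  show "\<lbrakk>map fst l \<in> xfun X (length us) (length vs); x \<in> fobj \<Phi> (us, ())\<rbrakk> \<Longrightarrow>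
      fmap \<Phi> (us, ()) (vs, ()) (l, ()) x \<in> fobj \<Phi> (vs, ())"
    using A by (fastforce simp: PiE_iff)
  show "x \<in> fobj \<Phi> (us, ()) \<Longrightarrow> fmap \<Phi> (us, ()) (us, ()) (ident (ordinals X) us, ()) x = x"
    using A by auto
  show "\<lbrakk>map fst l \<in> xfun X (length us) (length vs); map fst l' \<in> xfun X (length vs) (length ws); x \<in> fobj \<Phi> (us, ())\<rbrakk> \<Longrightarrow>
      fmap \<Phi> (vs, ()) (ws, ()) (l', ()) (fmap \<Phi> (us, ()) (vs, ()) (l, ()) x) =
      fmap \<Phi> (us, ()) (ws, ()) (cmp (ordinals X) ws vs us l l', ()) x"
    using A by auto
qed

text \<open>The action of a functor on \<open>?1\<close>, in terms of lists of values.\<close>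

definition zact :: "(unit, unit, unit, unit, 'a) cokl \<Rightarrow> nat \<Rightarrow> nat \<Rightarrow> nat list \<Rightarrow> 'a \<Rightarrow> 'a" where
  "zact \<Phi> m n f = fmap \<Phi> (num m) (num n) (function_arr f, ())"

lemma fmap_eq_zact: "fmap \<Phi> (us, ()) (vs, ()) (l, ()) = zact \<Phi> (length us) (length vs) (map fst l)"
  by (simp add: zact_def)

lemma
  assumes "one_functor X \<Phi>"
  shows zact_closed: "\<lbrakk>f \<in> xfun X m n; x \<in> fobj \<Phi> (num m)\<rbrakk> \<Longrightarrow> zact \<Phi> m n f x \<in> fobj \<Phi> (num n)"
    and zact_id: "x \<in> fobj \<Phi> (num m) \<Longrightarrow> zact \<Phi> m m [0..<m] x = x"
    and zact_comp: "\<lbrakk>f \<in> xfun X l m; g \<in> xfun X m n; x \<in> fobj \<Phi> (num l)\<rbrakk> \<Longrightarrow>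
      zact \<Phi> m n g (zact \<Phi> l m f x) = zact \<Phi> l n (map ((!) g) f) x"
proof -
  show "\<lbrakk>f \<in> xfun X m n; x \<in> fobj \<Phi> (num m)\<rbrakk> \<Longrightarrow> zact \<Phi> m n f x \<in> fobj \<Phi> (num n)"
    unfolding zact_def by (rule functor_closed[OF assms]) auto
  show "x \<in> fobj \<Phi> (num m) \<Longrightarrow> zact \<Phi> m m [0..<m] x = x"
    unfolding zact_def using functor_id[OF assms, of x "numeral_obj m"] by (simp add: ident_ordinals)
  show "\<lbrakk>f \<in> xfun X l m; g \<in> xfun X m n; x \<in> fobj \<Phi> (num l)\<rbrakk> \<Longrightarrow>
      zact \<Phi> m n g (zact \<Phi> l m f x) = zact \<Phi> l n (map ((!) g) f) x"
    unfolding zact_def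
    by (subst functor_comp[OF assms]) (simp_all add: cmp_ordinals del: map_map)
qed

lemma zact_functorI:
  assumes ext: "\<And>us vs. fmap \<Phi> (us, ()) (vs, ()) \<in> extensional (hom (ordinals X) vs us \<times> UNIV)"
    and ext': "\<And>m n f. f \<in> xfun X m n \<Longrightarrow> zact \<Phi> m n f \<in> extensional (fobj \<Phi> (num m))"
    and cl: "\<And>m n f x. \<lbrakk>f \<in> xfun X m n; x \<in> fobj \<Phi> (num m)\<rbrakk> \<Longrightarrow> zact \<Phi> m n f x \<in> fobj \<Phi> (num n)"
    and id: "\<And>m x. x \<in> fobj \<Phi> (num m) \<Longrightarrow> zact \<Phi> m m [0..<m] x = x"
    and comp: "\<And>l m n f g x. \<lbrakk>f \<in> xfun X l m; g \<in> xfun X m n; x \<in> fobj \<Phi> (num l)\<rbrakk> \<Longrightarrow>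
      zact \<Phi> m n g (zact \<Phi> l m f x) = zact \<Phi> l n (map ((!) g) f) x"
  shows "one_functor X \<Phi>"
  unfolding is_set_functor_def obj_one_base
proof (intro conjI ballI)
  show "fobj \<Phi> \<in> extensional UNIV" by (simp add: extensional_def)
  show "fmap \<Phi> \<in> (\<Pi>\<^sub>E a\<in>UNIV. \<Pi>\<^sub>E b\<in>UNIV. \<Pi>\<^sub>E f\<in>hom (one_base X) a b. fobj \<Phi> a \<rightarrow>\<^sub>E fobj \<Phi> b)"
    unfolding PiE_iff
  proof (intro conjI ballI)
    fix a b :: "unit list \<times> unit"
    obtain us vs where ab: "a = (us, ())" "b = (vs, ())" by (cases a; cases b) auto
    show "fmap \<Phi> a b \<in> extensional (hom (one_base X) a b)"
      using ext[of us vs] by (simp add: quest_one ab)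
    fix f assume "f \<in> hom (one_base X) a b"
    then obtain l where l: "f = (l, ())" "map fst l \<in> xfun X (length us) (length vs)"
      by (cases f) (auto simp: ab quest_one)
    from ext'[OF l(2)] show "fmap \<Phi> a b f \<in> extensional (fobj \<Phi> a)"
      by (simp add: ab l(1) fmap_eq_zact)
    show "fmap \<Phi> a b f x \<in> fobj \<Phi> b" if "x \<in> fobj \<Phi> a" for x
      using cl[OF l(2)] that by (simp add: ab l(1) fmap_eq_zact)
  qed (simp_all add: extensional_def)
next
  fix a x assume "x \<in> fobj \<Phi> a"
  then show "fmap \<Phi> a a (ident (one_base X) a) x = x"
    using id[of x "length (fst a)"] by (cases a) (simp add: quest_one fmap_eq_zact ident_ordinals)
next
  fix a b c f g x assume fg: "f \<in> hom (one_base X) a b" "g \<in> hom (one_base X) b c" and x: "x \<in> fobj \<Phi> a"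
  obtain us vs ws l l' where "a = (us, ())" "b = (vs, ())" "c = (ws, ())" "f = (l, ())" "g = (l', ())"
    by (cases a; cases b; cases c; cases f; cases g) auto
  then show "fmap \<Phi> a c (cmp (one_base X) a b c g f) x = fmap \<Phi> b c g (fmap \<Phi> a b f x)"
    using fg x comp[of "map fst l" "length us" "length vs" "map fst l'" "length ws" x]
    by (simp add: quest_one fmap_eq_zact cmp_ordinals del: map_map)
qed


section \<open>Concatenation of arrows\<close>

text \<open>Forgetting the trivial components turns a morphism of \<open>!!1\<close> into the data of a wreath map, and its
  concatenation into that wreath map.\<close>

definition wreath_of :: "unit seq_arr seq_arr \<Rightarrow> (nat \<times> nat list) list" where
  "wreath_of l = map (\<lambda>p. (fst p, map fst (snd p))) l"

lemma fst_concat_arr: "map fst (concat_arr css l) = wreath (map length css) (wreath_of l)"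
  by (simp add: concat_arr_def wreath_def wreath_of_def map_concat o_def split_def length_concat_take
      length_concat take_map)

lemma families_hom_iff: "l \<in> hom (families X) css dss \<longleftrightarrow>
   map fst (wreath_of l) \<in> xfun X (length dss) (length css) \<and>
   (\<forall>i<length dss. snd (wreath_of l ! i) \<in> xfun X (length (dss ! i)) (length (css ! fst (wreath_of l ! i))))"
  (is "?L \<longleftrightarrow> ?R")
proof -
  have "length l = length dss" if "map fst l \<in> xfun X (length dss) (length css)"
    using xfunD(1)[OF that] by simp
  then show ?thesis by (auto simp: bang_hom_iff[of l] wreath_of_def o_def cong: map_cong)
qed

lemma families_homD:
  assumes "l \<in> hom (families X) css dss"
  shows "length l = length dss"
    and "i < length dss \<Longrightarrow> fst (l ! i) < length css"
    and "i < length dss \<Longrightarrow> map fst (snd (l ! i)) \<in> xfun X (length (dss ! i)) (length (css ! fst (l ! i)))"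
    and "map (\<lambda>(a, h). length h) (wreath_of l) = map length dss"
    and "(a, h) \<in> set (wreath_of l) \<Longrightarrow> a < length css \<and> set h \<subseteq> {..<length (css ! a)}"
proof -
  show 1: "length l = length dss"
    and 2: "i < length dss \<Longrightarrow> fst (l ! i) < length css"
    and 3: "i < length dss \<Longrightarrow> map fst (snd (l ! i)) \<in> xfun X (length (dss ! i)) (length (css ! fst (l ! i)))" for i
    using bang_homD[OF assms] by auto
  show "map (\<lambda>(a, h). length h) (wreath_of l) = map length dss"
    using 1 xfunD(1)[OF 3] by (auto intro!: nth_equalityI simp: wreath_of_def)
  show "a < length css \<and> set h \<subseteq> {..<length (css ! a)}" if "(a, h) \<in> set (wreath_of l)"
  proof -
    from that 1 obtain i where "i < length dss" "a = fst (l ! i)" "h = map fst (snd (l ! i))"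
      by (auto simp: wreath_of_def in_set_conv_nth)
    with 2 xfunD(2)[OF 3] show ?thesis by blast
  qed
qed

lemma concat_arr_hom:
  assumes "l \<in> hom (families X) css dss" shows "concat_arr css l \<in> hom (ordinals X) (concat css) (concat dss)"
proof -
  have "wreath (map length css) (wreath_of l) \<in> xfun X (sum_list (map length dss)) (sum_list (map length css))"
    using assms xfunD(3)[of "map fst (wreath_of l)" X "length dss" "length css"] xfunD(1)[of "map fst (wreath_of l)" X "length dss" "length css"]
    by (intro wreath_xfun) (auto simp: families_hom_iff)
  then show ?thesis by (simp add: fst_concat_arr length_concat)
qed

lemma wreath_of_cmp:
  assumes f: "f \<in> hom (families X) as bs" and g: "g \<in> hom (families X) bs cs"
  shows "wreath_of (cmp (families X) as bs cs g f) =
    map (\<lambda>(a, h). (fst (wreath_of f ! a), map ((!) (snd (wreath_of f ! a))) h)) (wreath_of g)"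
proof (rule nth_equalityI)
  show "length (wreath_of (cmp (families X) as bs cs g f)) =
    length (map (\<lambda>(a, h). (fst (wreath_of f ! a), map ((!) (snd (wreath_of f ! a))) h)) (wreath_of g))"
    using families_homD(1)[OF g] by (simp add: wreath_of_def)
  fix k assume "k < length (wreath_of (cmp (families X) as bs cs g f))"
  then have k: "k < length cs" by (simp add: wreath_of_def)
  then show "wreath_of (cmp (families X) as bs cs g f) ! k =
    map (\<lambda>(a, h). (fst (wreath_of f ! a), map ((!) (snd (wreath_of f ! a))) h)) (wreath_of g) ! k"
    using families_homD(1,2,3)[OF f] families_homD(1,2,3)[OF g]
      xfunD(1,2)[OF families_homD(3)[OF g k]]  xfunD(1)[OF families_homD(3)[OF f families_homD(2)[OF g k]]]
    by (simp add: wreath_of_def bang_cmp[of _ "ordinals X"] map_fst_bang_cmp del: map_map)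
qed

text \<open>Functoriality of concatenation is the composition law of wreath maps.\<close>

lemma concat_arr_cmp:
  assumes f: "f \<in> hom (families X) as bs" and g: "g \<in> hom (families X) bs cs"
  shows "map fst (concat_arr as (cmp (families X) as bs cs g f)) =
    map ((!) (map fst (concat_arr as f))) (map fst (concat_arr bs g))"
  unfolding fst_concat_arr wreath_of_cmp[OF f g]
  by (rule wreath_comp[symmetric]) (use families_homD(4,5)[OF f] families_homD(5)[OF g] in auto)

lemma concat_arr_ident: "concat_arr as (ident (families X) as) = ident (ordinals X) (concat as)"
proof (rule unit_arr_eqI)
  have "wreath_of (ident (families X) as) = map (\<lambda>a. (a, [0..<map length as ! a])) [0..<length (map length as)]"
    by (auto simp: wreath_of_def bang_ident[of _ "ordinals X"] ident_ordinals function_arr_def o_def)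
  then show "map fst (concat_arr as (ident (families X) as)) = map fst (ident (ordinals X) (concat as))"
    unfolding fst_concat_arr by (simp only: wreath_id ident_ordinals map_fst_function_arr length_concat)
qed


section \<open>The coends in a composite of functors on \<open>?1\<close>\<close>

text \<open>\<open>\<Psi> \<bullet> \<Phi>\<close> at \<open>cs\<close> consists of classes of \<open>(ds, \<psi>, L)\<close> with \<open>\<psi> \<in> \<Psi> ds\<close> and \<open>L\<close> in \<open>?\<Phi> \<circ> d\<close>; such \<open>L\<close> are classes of
  \<open>(ess, K, t)\<close> with \<open>K\<close> in \<open>?\<Phi>\<close> and \<open>t\<close> the map from the comultiplication; and such \<open>K\<close> are classes of \<open>(as, xs, u)\<close>
  with \<open>xs\<close> a family of elements of \<open>\<Phi>\<close> of arities \<open>as\<close>, and \<open>u\<close> a morphism of \<open>!!1\<close> from \<open>ess\<close> to \<open>as\<close>. From the inside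
  out, for each of the three coends one needs its generating relation on representatives, and the functorial
  action on representatives, whose compatibility uses the relation.\<close>

lemma
  assumes C: "is_category C" and o: "obj C = UNIV"
  shows cat_ident: "ident C a \<in> hom C a a"
    and cat_cmp: "\<lbrakk>f \<in> hom C a b; g \<in> hom C b c\<rbrakk> \<Longrightarrow> cmp C a b c g f \<in> hom C a c"
    and cat_left: "f \<in> hom C a b \<Longrightarrow> cmp C a b b (ident C b) f = f"
    and cat_right: "f \<in> hom C a b \<Longrightarrow> cmp C a a b f (ident C a) = f"
    and cat_assoc: "\<lbrakk>f \<in> hom C a b; g \<in> hom C b c; h \<in> hom C c d\<rbrakk> \<Longrightarrow>
      cmp C a c d h (cmp C a b c g f) = cmp C a b d (cmp C b c d h g) f"
  by (auto simp: o intro: is_categoryD[OF C])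

lemmas ord_ident = cat_ident[OF is_category_ordinals obj_ordinals(1)]
lemmas ord_cmp = cat_cmp[OF is_category_ordinals obj_ordinals(1)]
lemmas ord_left = cat_left[OF is_category_ordinals obj_ordinals(1)]
lemmas ord_right = cat_right[OF is_category_ordinals obj_ordinals(1)]
lemmas ord_assoc = cat_assoc[OF is_category_ordinals obj_ordinals(1)]
lemmas fam_ident = cat_ident[OF is_category_families obj_ordinals(2)]
lemmas fam_cmp = cat_cmp[OF is_category_families obj_ordinals(2)]
lemmas fam_left = cat_left[OF is_category_families obj_ordinals(2)]
lemmas fam_right = cat_right[OF is_category_families obj_ordinals(2)]
lemmas fam_assoc = cat_assoc[OF is_category_families obj_ordinals(2)]

declare hom_ordinals [simp del]

lemma quest_sel:
  "obj (quest X one_cat) = UNIV" "hom (quest X one_cat) a b = hom (ordinals X) b a"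
  "ident (quest X one_cat) = ident (ordinals X)"
  "obj (quest X (quest X one_cat)) = UNIV" "hom (quest X (quest X one_cat)) c d = hom (families X) d c"
  "ident (quest X (quest X one_cat)) = ident (families X)"
  by (simp_all add: quest_one quest_quest_one[unfolded quest_one] op_cat_sel)

subsection \<open>Families of elements\<close>

definition fam :: "(unit, unit, unit, unit, 'a) cokl \<Rightarrow> unit list list \<Rightarrow> 'a list set" where
  "fam \<Phi> as = tuples (map (\<lambda>a. fobj \<Phi> (a, ())) as)"

lemma fam_iff: "xs \<in> fam \<Phi> as \<longleftrightarrow> length xs = length as \<and> (\<forall>i<length as. xs ! i \<in> fobj \<Phi> (as ! i, ()))"
  by (auto simp: fam_def tuples_iff)

abbreviation fam_integrand where
  "fam_integrand X \<Phi> ds ess \<equiv> bang_integrand X one_cat (ordinals X) (op_prof \<Phi>) (ds, ess)"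

abbreviation fam_class where
  "fam_class X \<Phi> ds ess \<equiv> coend_class (power_cat (length ds) (ordinals X)) (fam_integrand X \<Phi> ds ess)"

text \<open>The maps \<open>fs\<close> go from \<open>c\<close> to \<open>c'\<close> in \<open>!1\<close>, hence backwards in \<open>?1\<close>.\<close>

definition fam_act where
  "fam_act \<Phi> c' c fs xs = map (\<lambda>i. fmap \<Phi> (c' ! i, ()) (c ! i, ()) (fs ! i, ()) (xs ! i)) [0..<length c]"

definition arrows :: "kind \<Rightarrow> unit list list \<Rightarrow> unit list list \<Rightarrow> unit seq_arr list set" where
  "arrows X c c' = {fs. length fs = length c \<and> length c' = length c \<and>
     (\<forall>i<length c. fs ! i \<in> hom (ordinals X) (c ! i) (c' ! i))}"

abbreviation parallel :: "'b list \<Rightarrow> (nat \<times> 'b) list" where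
  "parallel fs \<equiv> zip [0..<length fs] fs"

lemma power_cat_sel:
  "as \<in> obj (power_cat n (ordinals X)) \<longleftrightarrow> length as = n"
  "\<lbrakk>length as = n; length bs = n\<rbrakk> \<Longrightarrow> hom (power_cat n (ordinals X)) as bs = arrows X as bs"
  "ident (power_cat n (ordinals X)) as = map (ident (ordinals X)) as"
  by (auto simp: power_cat_def arrows_def tuples_iff)

lemma arrows_ident: "map (ident (ordinals X)) as \<in> arrows X as as"
  by (simp add: arrows_def ord_ident)

lemma parallel_hom:
  assumes "fs \<in> arrows X c c'" shows "parallel fs \<in> hom (families X) c c'"
  using assms by (auto simp: bang_hom_iff[of _ X "ordinals X"] arrows_def)

lemma parallel_ident: "parallel (map (ident (ordinals X)) as) = ident (families X) as"
  by (rule nth_equalityI) (auto simp: bang_ident[of X "ordinals X"])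

lemma fam_act_fam:
  assumes "one_functor X \<Phi>" "fs \<in> arrows X c c'" "xs \<in> fam \<Phi> c'"
  shows "fam_act \<Phi> c' c fs xs \<in> fam \<Phi> c"
  using assms(2,3) functor_closed[OF assms(1)] by (auto simp: fam_act_def fam_iff arrows_def hom_ordinals)

lemma fam_integrand_fobj:
  assumes "length as = length ds" "length bs = length ds"
  shows "fobj (fam_integrand X \<Phi> ds ess) (as, bs) = fam \<Phi> as \<times> hom (families X) ess bs"
proof -
  have "map2 (\<lambda>c a. fobj (op_prof \<Phi>) (c, a)) ds as = map (\<lambda>a. fobj \<Phi> (a, ())) as"
    using assms by (auto intro!: nth_equalityI)
  then show ?thesis using assms
    by (simp add: bang_integrand_def Let_def fobj_make_functor power_cat_sel fam_def)
qed

lemma fam_integrand_fmap: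
  assumes \<Phi>: "one_functor X \<Phi>"
    and l: "length c = length ds" "length c' = length ds" and fs: "fs \<in> arrows X c c'"
    and xs: "xs \<in> fam \<Phi> c'" and u: "u \<in> hom (families X) ess c"
  shows "fmap (fam_integrand X \<Phi> ds ess) (c', c) (c, c) (fs, ident (power_cat (length ds) (ordinals X)) c) (xs, u) =
      (fam_act \<Phi> c' c fs xs, u)"
    and "fmap (fam_integrand X \<Phi> ds ess) (c', c) (c', c') (ident (power_cat (length ds) (ordinals X)) c', fs) (xs, u) =
      (xs, cmp (families X) ess c c' (parallel fs) u)"
proof -
  have m: "(xs, u) \<in> tuples (map2 (\<lambda>c a. fobj (op_prof \<Phi>) (c, a)) ds c') \<times> hom (families X) ess c"
    using fam_integrand_fobj[OF l(2,1), of X \<Phi> ess] xs u l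
    by (simp add: bang_integrand_def Let_def fobj_make_functor power_cat_sel)
  have d: "length fs = length ds" using fs l by (simp add: arrows_def)
  have par: "zip [0..<length ds] (map (ident (ordinals X)) c) = ident (families X) c"
    using parallel_ident[of X c] l by simp
  have "map (\<lambda>i. fmap \<Phi> (c' ! i, ()) (c' ! i, ()) (ident (ordinals X) (c' ! i), ()) (xs ! i)) [0..<length ds] = xs"
    using xs l functor_id[OF \<Phi>] by (auto simp: fam_iff intro!: nth_equalityI)
  moreover have "map (\<lambda>i. fmap (op_prof \<Phi>) (ds ! i, c' ! i) (ds ! i, c' ! i) (ident one_cat (ds ! i), map (ident (ordinals X)) c' ! i) (xs ! i)) [0..<length ds] =
      map (\<lambda>i. fmap \<Phi> (c' ! i, ()) (c' ! i, ()) (ident (ordinals X) (c' ! i), ()) (xs ! i)) [0..<length ds]"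
    using l by (auto intro!: nth_equalityI)
  ultimately have id: "map (\<lambda>i. fmap (op_prof \<Phi>) (ds ! i, c' ! i) (ds ! i, c' ! i) (ident one_cat (ds ! i), map (ident (ordinals X)) c' ! i) (xs ! i)) [0..<length ds] = xs"
    by simp
  show "fmap (fam_integrand X \<Phi> ds ess) (c', c) (c, c) (fs, ident (power_cat (length ds) (ordinals X)) c) (xs, u) =
      (fam_act \<Phi> c' c fs xs, u)"
    using m fs l unfolding bang_integrand_def Let_def prod.case
    by (subst fmap_make_functor) (simp_all add: power_cat_sel arrows_ident par fam_left[OF u] fam_act_def)
  show "fmap (fam_integrand X \<Phi> ds ess) (c', c) (c', c') (ident (power_cat (length ds) (ordinals X)) c', fs) (xs, u) =
      (xs, cmp (families X) ess c c' (parallel fs) u)"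
    using m fs l d id unfolding bang_integrand_def Let_def prod.case
    by (subst fmap_make_functor) (simp_all add: power_cat_sel arrows_ident)
qed

lemma fam_compatibleI:
  assumes \<Phi>: "one_functor X \<Phi>"
    and F: "\<And>c c' fs xs u. \<lbrakk>length c = length ds; length c' = length ds; fs \<in> arrows X c c'; xs \<in> fam \<Phi> c';
        u \<in> hom (families X) ess c\<rbrakk> \<Longrightarrow>
      F (c, (fam_act \<Phi> c' c fs xs, u)) = F (c', (xs, cmp (families X) ess c c' (parallel fs) u))"
  shows "coend_compatible (power_cat (length ds) (ordinals X)) (fam_integrand X \<Phi> ds ess) F"
  unfolding coend_compatible_def
  by (auto simp: power_cat_sel(1,2) fam_integrand_fobj fam_integrand_fmap[OF \<Phi>] F)

lemma fam_class_parallel: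
  assumes \<Phi>: "one_functor X \<Phi>"
    and l: "length c = length ds" "length c' = length ds" and fs: "fs \<in> arrows X c c'"
    and xs: "xs \<in> fam \<Phi> c'" and u: "u \<in> hom (families X) ess c"
  shows "fam_class X \<Phi> ds ess (c, (fam_act \<Phi> c' c fs xs, u)) =
    fam_class X \<Phi> ds ess (c', (xs, cmp (families X) ess c c' (parallel fs) u))"
  using coend_class_generator[of c "power_cat (length ds) (ordinals X)" c' fs "(xs, u)" "fam_integrand X \<Phi> ds ess"] assms
  by (simp add: power_cat_sel(1,2) fam_integrand_fobj fam_integrand_fmap[OF \<Phi>])

abbreviation fam_prof where
  "fam_prof X \<Phi> \<equiv> quest_prof X (quest X one_cat) one_cat \<Phi>"

lemma fam_prof_fobj:
  "fobj (fam_prof X \<Phi>) (ess, ds) = coend (power_cat (length ds) (ordinals X)) (fam_integrand X \<Phi> ds ess)"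
  by (simp add: quest_prof_def quest_one bang_prof_def fobj_make_functor)

lemma fam_prof_fobjI:
  "\<lbrakk>length as = length ds; xs \<in> fam \<Phi> as; u \<in> hom (families X) ess as\<rbrakk> \<Longrightarrow>
    fam_class X \<Phi> ds ess (as, (xs, u)) \<in> fobj (fam_prof X \<Phi>) (ess, ds)"
  unfolding fam_prof_fobj by (rule coendI) (simp_all add: power_cat_sel fam_integrand_fobj)

lemma fam_prof_fobjE:
  assumes "K \<in> fobj (fam_prof X \<Phi>) (ess, ds)"
  obtains as xs u where "length as = length ds" "xs \<in> fam \<Phi> as" "u \<in> hom (families X) ess as"
    "K = fam_class X \<Phi> ds ess (as, (xs, u))"
  using assms unfolding fam_prof_fobj
  by (auto simp: power_cat_sel fam_integrand_fobj elim!: coendE)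

definition reindex :: "unit seq_arr \<Rightarrow> 'b list \<Rightarrow> 'b list" where
  "reindex F xs = map (\<lambda>p. xs ! fst p) F"

definition reindex_arr :: "kind \<Rightarrow> unit seq_arr \<Rightarrow> unit list list \<Rightarrow> unit seq_arr seq_arr" where
  "reindex_arr X F as = map (\<lambda>p. (fst p, ident (ordinals X) (as ! fst p))) F"

lemma length_reindex [simp]: "length (reindex F xs) = length F"
  by (simp add: reindex_def)

lemma reindex_ident: "length as = length ds \<Longrightarrow> reindex (ident (ordinals X) ds) as = as"
  by (auto simp: reindex_def ident_ordinals function_arr_def intro!: nth_equalityI)

lemma reindex_arr_ident: "length as = length ds \<Longrightarrow> reindex_arr X (ident (ordinals X) ds) as = ident (families X) as"
  by (auto simp: reindex_arr_def bang_ident[of X "ordinals X"] ident_ordinals function_arr_def intro!: nth_equalityI)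

lemma reindex_fam:
  assumes "F \<in> hom (ordinals X) ds ds'" "length as = length ds" "xs \<in> fam \<Phi> as"
  shows "reindex F xs \<in> fam \<Phi> (reindex F as)"
  using assms bang_homD(3)[OF assms(1)] bang_homD(1)[OF assms(1)] by (auto simp: fam_iff reindex_def)

lemma reindex_arr_hom:
  assumes "F \<in> hom (ordinals X) ds ds'" "length as = length ds"
  shows "reindex_arr X F as \<in> hom (families X) as (reindex F as)"
  using assms bang_homD[OF assms(1)]
  by (auto simp: bang_hom_iff[of _ X "ordinals X"] reindex_arr_def reindex_def o_def intro: ord_ident)

text \<open>Reindexing a family is natural in its components.\<close>

lemma reindex_parallel:
  assumes F: "F \<in> hom (ordinals X) ds ds'" and l: "length c = length ds" and fs: "fs \<in> arrows X c c'"
  shows "cmp (families X) c (reindex F c) (reindex F c') (parallel (reindex F fs)) (reindex_arr X F c) =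
    cmp (families X) c c' (reindex F c') (reindex_arr X F c') (parallel fs)"
  using fs l bang_homD(1,3)[OF F]
  by (auto simp: bang_cmp[of _ "ordinals X"] reindex_def reindex_arr_def arrows_def ord_left ord_right intro!: nth_equalityI)

lemma reindex_fam_act:
  assumes F: "F \<in> hom (ordinals X) ds ds'" and l: "length c = length ds" and fs: "fs \<in> arrows X c c'" and xs: "xs \<in> fam \<Phi> c'"
  shows "reindex F (fam_act \<Phi> c' c fs xs) = fam_act \<Phi> (reindex F c') (reindex F c) (reindex F fs) (reindex F xs)"
  using fs l xs bang_homD(1,3)[OF F]
  by (auto simp: fam_act_def reindex_def arrows_def fam_iff intro!: nth_equalityI)

lemma reindex_arrows:
  assumes F: "F \<in> hom (ordinals X) ds ds'" and l: "length c = length ds" and fs: "fs \<in> arrows X c c'"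
  shows "reindex F fs \<in> arrows X (reindex F c) (reindex F c')"
  using fs l bang_homD(1,3)[OF F] by (auto simp: reindex_def arrows_def)

text \<open>The formula for representatives respects the relation \<open>fam_class_parallel\<close> because of the commuting square
  \<open>reindex_parallel\<close>.\<close>

lemma fam_prof_fmap:
  assumes \<Phi>: "one_functor X \<Phi>"
    and F: "F \<in> hom (ordinals X) ds ds'" and G: "G \<in> hom (families X) ess' ess"
    and l: "length as = length ds" and xs: "xs \<in> fam \<Phi> as" and u: "u \<in> hom (families X) ess as"
  shows "fmap (fam_prof X \<Phi>) (ess, ds) (ess', ds') (G, F) (fam_class X \<Phi> ds ess (as, (xs, u))) =
    fam_class X \<Phi> ds' ess' (reindex F as, (reindex F xs,
      cmp (families X) ess' as (reindex F as) (reindex_arr X F as) (cmp (families X) ess' ess as u G)))"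
proof -
  define \<phi> :: "unit list list \<times> 'a list \<times> unit seq_arr seq_arr \<Rightarrow> _" where
    "\<phi> = (\<lambda>(es, (xs, t)). let es' = map (\<lambda>(a, h). es ! a) F in
             (es',
              (map (\<lambda>j. case F ! j of (a, h) \<Rightarrow>
                   fmap (op_prof \<Phi>) (ds ! a, es ! a) (ds' ! j, es ! a) (h, ident (ordinals X) (es ! a)) (xs ! a))
                 [0..<length ds'],
               cmp (families X) ess' es es' (map (\<lambda>(a, h). (a, ident (ordinals X) (es ! a))) F)
                 (cmp (families X) ess' ess es t G))))"
  have \<phi>: "\<phi> (es, (xs, t)) = (reindex F es, (reindex F xs,
      cmp (families X) ess' es (reindex F es) (reindex_arr X F es) (cmp (families X) ess' ess es t G)))"
    if "length es = length ds" "xs \<in> fam \<Phi> es" for es xs t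
    using that bang_homD(1,3)[OF F] functor_id[OF \<Phi>]
    by (auto simp: \<phi>_def reindex_def reindex_arr_def split_def fam_iff Let_def intro!: nth_equalityI)
  have "coend_compatible (power_cat (length ds) (ordinals X)) (fam_integrand X \<Phi> ds ess)
    (\<lambda>p. fam_class X \<Phi> ds' ess' (\<phi> p))"
  proof (rule fam_compatibleI[OF \<Phi>])
    fix c c' fs xs t
    assume l: "length c = length ds" "length c' = length ds" and fs: "fs \<in> arrows X c c'"
      and xs: "xs \<in> fam \<Phi> c'" and u: "t \<in> hom (families X) ess c"
    note rc = reindex_arr_hom[OF F l(1)] and rc' = reindex_arr_hom[OF F l(2)]
    note p = parallel_hom[OF fs] and rfs = reindex_arrows[OF F l(1) fs]
    note tG = fam_cmp[OF G u]
    have "cmp (families X) ess' (reindex F c) (reindex F c') (parallel (reindex F fs))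
           (cmp (families X) ess' c (reindex F c) (reindex_arr X F c) (cmp (families X) ess' ess c t G)) =
      cmp (families X) ess' c' (reindex F c') (reindex_arr X F c')
           (cmp (families X) ess' ess c' (cmp (families X) ess c c' (parallel fs) t) G)"
      by (simp only: fam_assoc[OF tG rc parallel_hom[OF rfs]] fam_assoc[OF G u p, symmetric]
            fam_assoc[OF tG p rc'] reindex_parallel[OF F l(1) fs])
    then show "fam_class X \<Phi> ds' ess' (\<phi> (c, fam_act \<Phi> c' c fs xs, t)) =
      fam_class X \<Phi> ds' ess' (\<phi> (c', xs, cmp (families X) ess c c' (parallel fs) t))"
      using fam_class_parallel[OF \<Phi> _ _ rfs reindex_fam[OF F l(2) xs] fam_cmp[OF tG rc], of ds'] bang_homD(1)[OF F]
      by (simp only: \<phi>[OF l(1) fam_act_fam[OF \<Phi> fs xs]] \<phi>[OF l(2) xs] reindex_fam_act[OF F l(1) fs xs] length_reindex)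
  qed
  note 1 = coend_map_class[OF this]
  have "fmap (fam_prof X \<Phi>) (ess, ds) (ess', ds') (G, F) (fam_class X \<Phi> ds ess (as, (xs, u))) =
    coend_map (power_cat (length ds') (ordinals X)) (fam_integrand X \<Phi> ds' ess') \<phi> (fam_class X \<Phi> ds ess (as, (xs, u)))"
    unfolding quest_prof_def op_prof_sel bang_prof_def quest_one op_cat_one_cat op_cat_op_cat
    by (subst fmap_make_functor) (use F G fam_prof_fobjI[OF l xs u] in \<open>simp_all add: fam_prof_fobj \<phi>_def\<close>)
  then show ?thesis unfolding 1 by (simp only: \<phi>[OF l xs])
qed


subsection \<open>Families with a concatenation\<close>

abbreviation comult where
  "comult X \<equiv> quest_comult X one_cat"

lemma comult_fobj: "fobj (comult X) (cs, ess) = hom (ordinals X) cs (concat ess)"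
  by (simp add: quest_comult_def bang_mult_def functor_prof_def fobj_make_functor)

lemma comult_fmap:
  assumes "F \<in> hom (families X) ess ess'" "G \<in> hom (ordinals X) cs' cs" "t \<in> hom (ordinals X) cs (concat ess)"
  shows "fmap (comult X) (cs, ess) (cs', ess') (G, F) t =
    cmp (ordinals X) cs' (concat ess) (concat ess') (concat_arr ess F) (cmp (ordinals X) cs' cs (concat ess) t G)"
  using assms by (simp add: quest_comult_def bang_mult_def functor_prof_def fmap_make_functor)

abbreviation lift_integrand where
  "lift_integrand X \<Phi> cs ds \<equiv>
     prof_comp_integrand (quest X one_cat) (quest X (quest X one_cat)) (quest X one_cat) (fam_prof X \<Phi>) (comult X) (cs, ds)"

abbreviation lift_class where
  "lift_class X \<Phi> cs ds \<equiv> coend_class (quest X (quest X one_cat)) (lift_integrand X \<Phi> cs ds)"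

lemma lift_integrand_fobj:
  "fobj (lift_integrand X \<Phi> cs ds) (c', c) = fobj (fam_prof X \<Phi>) (c, ds) \<times> hom (ordinals X) cs (concat c')"
  by (simp add: prof_comp_integrand_def fobj_make_functor quest_sel comult_fobj)

lemma fam_prof_fmap_ident_left:
  assumes "one_functor X \<Phi>" "G \<in> hom (families X) ess' ess"
    "length as = length ds" "xs \<in> fam \<Phi> as" "u \<in> hom (families X) ess as"
  shows "fmap (fam_prof X \<Phi>) (ess, ds) (ess', ds) (G, ident (ordinals X) ds) (fam_class X \<Phi> ds ess (as, (xs, u))) =
    fam_class X \<Phi> ds ess' (as, (xs, cmp (families X) ess' ess as u G))"
  using assms fam_left[OF fam_cmp[OF assms(2,5)]]
  by (simp add: fam_prof_fmap ord_ident reindex_ident reindex_arr_ident fam_iff)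

lemma fam_prof_fmap_ident_right:
  assumes "one_functor X \<Phi>" "F \<in> hom (ordinals X) ds ds'"
    "length as = length ds" "xs \<in> fam \<Phi> as" "u \<in> hom (families X) ess as"
  shows "fmap (fam_prof X \<Phi>) (ess, ds) (ess, ds') (ident (families X) ess, F) (fam_class X \<Phi> ds ess (as, (xs, u))) =
    fam_class X \<Phi> ds' ess (reindex F as, (reindex F xs, cmp (families X) ess as (reindex F as) (reindex_arr X F as) u))"
  using assms by (simp add: fam_prof_fmap fam_ident fam_right)

lemma comult_fmap_ident_left:
  assumes "F \<in> hom (families X) ess ess'" "t \<in> hom (ordinals X) cs (concat ess)"
  shows "fmap (comult X) (cs, ess) (cs, ess') (ident (ordinals X) cs, F) t =
    cmp (ordinals X) cs (concat ess) (concat ess') (concat_arr ess F) t"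
  using assms by (simp add: comult_fmap ord_ident ord_right)

lemma comult_fmap_ident_right:
  assumes "G \<in> hom (ordinals X) cs' cs" "t \<in> hom (ordinals X) cs (concat ess)"
  shows "fmap (comult X) (cs, ess) (cs', ess) (G, ident (families X) ess) t = cmp (ordinals X) cs' cs (concat ess) t G"
  using assms ord_left[OF ord_cmp[OF assms]] by (simp add: comult_fmap fam_ident concat_arr_ident)

lemma lift_integrand_fmap:
  assumes \<Phi>: "one_functor X \<Phi>" and f: "f \<in> hom (families X) c' c"
    and l: "length as = length ds" and xs: "xs \<in> fam \<Phi> as" and u: "u \<in> hom (families X) c as"
    and t: "t \<in> hom (ordinals X) cs (concat c')"
  shows "fmap (lift_integrand X \<Phi> cs ds) (c', c) (c, c) (f, ident (quest X (quest X one_cat)) c) (fam_class X \<Phi> ds c (as, (xs, u)), t) =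
      (fam_class X \<Phi> ds c (as, (xs, u)), cmp (ordinals X) cs (concat c') (concat c) (concat_arr c' f) t)"
    and "fmap (lift_integrand X \<Phi> cs ds) (c', c) (c', c') (ident (quest X (quest X one_cat)) c', f) (fam_class X \<Phi> ds c (as, (xs, u)), t) =
      (fam_class X \<Phi> ds c' (as, (xs, cmp (families X) c' c as u f)), t)"
proof -
  note m = fam_prof_fobjI[OF l xs u]
  note ct = ord_left[OF t] concat_arr_ident[of c' X]
  show "fmap (lift_integrand X \<Phi> cs ds) (c', c) (c, c) (f, ident (quest X (quest X one_cat)) c) (fam_class X \<Phi> ds c (as, (xs, u)), t) =
      (fam_class X \<Phi> ds c (as, (xs, u)), cmp (ordinals X) cs (concat c') (concat c) (concat_arr c' f) t)"
    unfolding prof_comp_integrand_def prod.case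
    by (subst fmap_make_functor)
       (use f m t fam_right[OF u] in \<open>simp_all add: quest_sel fam_ident comult_fobj
          fam_prof_fmap_ident_left[OF \<Phi> fam_ident l xs u] comult_fmap_ident_left\<close>)
  show "fmap (lift_integrand X \<Phi> cs ds) (c', c) (c', c') (ident (quest X (quest X one_cat)) c', f) (fam_class X \<Phi> ds c (as, (xs, u)), t) =
      (fam_class X \<Phi> ds c' (as, (xs, cmp (families X) c' c as u f)), t)"
    unfolding prof_comp_integrand_def prod.case
    by (subst fmap_make_functor)
       (use f m t in \<open>simp_all add: quest_sel fam_ident comult_fobj
          fam_prof_fmap_ident_left[OF \<Phi> f l xs u] comult_fmap_ident_left ct\<close>)
qed

lemma lift_compatibleI:
  assumes \<Phi>: "one_functor X \<Phi>"
    and F: "\<And>c c' f as xs u t. \<lbrakk>f \<in> hom (families X) c' c; length as = length ds; xs \<in> fam \<Phi> as;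
        u \<in> hom (families X) c as; t \<in> hom (ordinals X) cs (concat c')\<rbrakk> \<Longrightarrow>
      F (c, (fam_class X \<Phi> ds c (as, (xs, u)), cmp (ordinals X) cs (concat c') (concat c) (concat_arr c' f) t)) =
      F (c', (fam_class X \<Phi> ds c' (as, (xs, cmp (families X) c' c as u f)), t))"
  shows "coend_compatible (quest X (quest X one_cat)) (lift_integrand X \<Phi> cs ds) F"
  unfolding coend_compatible_def
  by (auto simp: lift_integrand_fobj quest_sel lift_integrand_fmap[OF \<Phi>, unfolded quest_sel] F
      elim!: fam_prof_fobjE)

text \<open>The map \<open>f\<close> of families passes from the map \<open>u\<close> in the inner coend to its concatenation next to \<open>t\<close>. For \<open>u = 1\<close>
  this removes the inner map altogether, which is the co-Yoneda step.\<close>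

lemma lift_class_concat:
  assumes \<Phi>: "one_functor X \<Phi>" and f: "f \<in> hom (families X) c' c"
    and l: "length as = length ds" and xs: "xs \<in> fam \<Phi> as" and u: "u \<in> hom (families X) c as"
    and t: "t \<in> hom (ordinals X) cs (concat c')"
  shows "lift_class X \<Phi> cs ds (c, (fam_class X \<Phi> ds c (as, (xs, u)), cmp (ordinals X) cs (concat c') (concat c) (concat_arr c' f) t)) =
      lift_class X \<Phi> cs ds (c', (fam_class X \<Phi> ds c' (as, (xs, cmp (families X) c' c as u f)), t))"
  using coend_class_generator[of c "quest X (quest X one_cat)" c' f "(fam_class X \<Phi> ds c (as, (xs, u)), t)" "lift_integrand X \<Phi> cs ds"]
    fam_prof_fobjI[OF l xs u] f t
  by (simp add: lift_integrand_fmap[OF assms, unfolded quest_sel] lift_integrand_fobj quest_sel)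

abbreviation lift_prof where
  "lift_prof X \<Phi> \<equiv> quest_lift X one_cat one_cat \<Phi>"

lemma lift_prof_fobj:
  "fobj (lift_prof X \<Phi>) (cs, ds) = coend (quest X (quest X one_cat)) (lift_integrand X \<Phi> cs ds)"
  by (simp add: quest_lift_def prof_comp_def fobj_make_functor quest_sel)

lemma lift_prof_fobjI:
  "\<lbrakk>length as = length ds; xs \<in> fam \<Phi> as; u \<in> hom (families X) ess as; t \<in> hom (ordinals X) cs (concat ess)\<rbrakk> \<Longrightarrow>
    lift_class X \<Phi> cs ds (ess, (fam_class X \<Phi> ds ess (as, (xs, u)), t)) \<in> fobj (lift_prof X \<Phi>) (cs, ds)"
  unfolding lift_prof_fobj
  by (rule coendI) (simp_all add: lift_integrand_fobj fam_prof_fobjI quest_sel)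

lemma lift_prof_fobjE:
  assumes "K \<in> fobj (lift_prof X \<Phi>) (cs, ds)"
  obtains ess as xs u t where "length as = length ds" "xs \<in> fam \<Phi> as" "u \<in> hom (families X) ess as"
    "t \<in> hom (ordinals X) cs (concat ess)"
    "K = lift_class X \<Phi> cs ds (ess, (fam_class X \<Phi> ds ess (as, (xs, u)), t))"
  using assms unfolding lift_prof_fobj
  by (auto simp: lift_integrand_fobj elim!: coendE fam_prof_fobjE)

lemma lift_prof_fmap:
  assumes \<Phi>: "one_functor X \<Phi>"
    and F: "F \<in> hom (ordinals X) ds ds'" and G: "G \<in> hom (ordinals X) cs' cs"
    and l: "length as = length ds" and xs: "xs \<in> fam \<Phi> as" and u: "u \<in> hom (families X) ess as"
    and t: "t \<in> hom (ordinals X) cs (concat ess)"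
  shows "fmap (lift_prof X \<Phi>) (cs, ds) (cs', ds') (G, F) (lift_class X \<Phi> cs ds (ess, (fam_class X \<Phi> ds ess (as, (xs, u)), t))) =
    lift_class X \<Phi> cs' ds' (ess, (fam_class X \<Phi> ds' ess (reindex F as, (reindex F xs,
        cmp (families X) ess as (reindex F as) (reindex_arr X F as) u)), cmp (ordinals X) cs' cs (concat ess) t G))"
proof -
  define \<phi> where "\<phi> = (\<lambda>(d, (y, x)). (d, (fmap (fam_prof X \<Phi>) (d, ds) (d, ds') (ident (quest X (quest X one_cat)) d, F) y,
                            fmap (comult X) (cs, d) (cs', d) (G, ident (quest X (quest X one_cat)) d) x)))"
  have \<phi>: "\<phi> (ess, (fam_class X \<Phi> ds ess (as, (xs, u)), t)) =
      (ess, (fam_class X \<Phi> ds' ess (reindex F as, (reindex F xs,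
        cmp (families X) ess as (reindex F as) (reindex_arr X F as) u)), cmp (ordinals X) cs' cs (concat ess) t G))"
    if "length as = length ds" "xs \<in> fam \<Phi> as" "u \<in> hom (families X) ess as" "t \<in> hom (ordinals X) cs (concat ess)"
    for ess as xs u t
    using that by (simp add: \<phi>_def quest_sel fam_prof_fmap_ident_right[OF \<Phi> F] comult_fmap_ident_right[OF G])
  have "coend_compatible (quest X (quest X one_cat)) (lift_integrand X \<Phi> cs ds) (\<lambda>p. lift_class X \<Phi> cs' ds' (\<phi> p))"
  proof (rule lift_compatibleI[OF \<Phi>])
    fix c c' f as xs u t
    assume f: "f \<in> hom (families X) c' c" and l: "length as = length ds" and xs: "xs \<in> fam \<Phi> as"
      and u: "u \<in> hom (families X) c as" and t: "t \<in> hom (ordinals X) cs (concat c')"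
    note r = reindex_arr_hom[OF F l] and cf = concat_arr_hom[OF f]
    show "lift_class X \<Phi> cs' ds' (\<phi> (c, fam_class X \<Phi> ds c (as, xs, u), cmp (ordinals X) cs (concat c') (concat c) (concat_arr c' f) t)) =
      lift_class X \<Phi> cs' ds' (\<phi> (c', fam_class X \<Phi> ds c' (as, xs, cmp (families X) c' c as u f), t))"
      unfolding \<phi>[OF l xs u ord_cmp[OF t cf]] \<phi>[OF l xs fam_cmp[OF f u] t] fam_assoc[OF f u r]
        ord_assoc[OF G t cf, symmetric]
      by (rule lift_class_concat[OF \<Phi> f _ reindex_fam[OF F l xs] fam_cmp[OF u r] ord_cmp[OF G t]])
         (use bang_homD(1)[OF F] in simp)
  qed
  note 1 = coend_map_class[OF this]
  have "fmap (lift_prof X \<Phi>) (cs, ds) (cs', ds') (G, F) (lift_class X \<Phi> cs ds (ess, (fam_class X \<Phi> ds ess (as, (xs, u)), t))) =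
    coend_map (quest X (quest X one_cat)) (lift_integrand X \<Phi> cs' ds') \<phi> (lift_class X \<Phi> cs ds (ess, (fam_class X \<Phi> ds ess (as, (xs, u)), t)))"
    unfolding quest_lift_def prof_comp_def
    by (subst fmap_make_functor) (use F G lift_prof_fobjI[OF l xs u t] in \<open>simp_all add: lift_prof_fobj \<phi>_def quest_sel\<close>)
  then show ?thesis unfolding 1 by (simp only: \<phi>[OF l xs u t])
qed


subsection \<open>The composite\<close>

abbreviation comp where
  "comp X \<Psi> \<Phi> \<equiv> cokl_comp X one_cat one_cat one_cat \<Psi> \<Phi>"

abbreviation comp_integrand where
  "comp_integrand X \<Psi> \<Phi> cs \<equiv>
     prof_comp_integrand (quest X one_cat) (quest X one_cat) one_cat \<Psi> (lift_prof X \<Phi>) (cs, ())"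

abbreviation comp_class where
  "comp_class X \<Psi> \<Phi> cs \<equiv> coend_class (quest X one_cat) (comp_integrand X \<Psi> \<Phi> cs)"

lemma comp_integrand_fobj:
  "fobj (comp_integrand X \<Psi> \<Phi> cs) (c', c) = fobj \<Psi> (c, ()) \<times> fobj (lift_prof X \<Phi>) (cs, c')"
  by (simp add: prof_comp_integrand_def fobj_make_functor quest_sel)

lemma lift_prof_fmap_ident_left:
  assumes "one_functor X \<Phi>" "F \<in> hom (ordinals X) ds ds'"
    "length as = length ds" "xs \<in> fam \<Phi> as" "u \<in> hom (families X) ess as" "t \<in> hom (ordinals X) cs (concat ess)"
  shows "fmap (lift_prof X \<Phi>) (cs, ds) (cs, ds') (ident (ordinals X) cs, F) (lift_class X \<Phi> cs ds (ess, (fam_class X \<Phi> ds ess (as, (xs, u)), t))) =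
    lift_class X \<Phi> cs ds' (ess, (fam_class X \<Phi> ds' ess (reindex F as, (reindex F xs,
        cmp (families X) ess as (reindex F as) (reindex_arr X F as) u)), t))"
  using assms by (simp add: lift_prof_fmap ord_ident ord_right)

lemma lift_prof_fmap_ident_right:
  assumes "one_functor X \<Phi>" "G \<in> hom (ordinals X) cs' cs"
    "length as = length ds" "xs \<in> fam \<Phi> as" "u \<in> hom (families X) ess as" "t \<in> hom (ordinals X) cs (concat ess)"
  shows "fmap (lift_prof X \<Phi>) (cs, ds) (cs', ds) (G, ident (ordinals X) ds) (lift_class X \<Phi> cs ds (ess, (fam_class X \<Phi> ds ess (as, (xs, u)), t))) =
    lift_class X \<Phi> cs' ds (ess, (fam_class X \<Phi> ds ess (as, (xs, u)), cmp (ordinals X) cs' cs (concat ess) t G))"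
  using assms by (simp add: lift_prof_fmap ord_ident reindex_ident reindex_arr_ident fam_iff fam_left)

lemma comp_integrand_fmap:
  assumes \<Psi>: "one_functor X \<Psi>" and \<Phi>: "one_functor X \<Phi>"
    and F: "F \<in> hom (ordinals X) c' c" and \<psi>: "\<psi> \<in> fobj \<Psi> (c, ())"
    and l: "length as = length c'" and xs: "xs \<in> fam \<Phi> as" and u: "u \<in> hom (families X) ess as"
    and t: "t \<in> hom (ordinals X) cs (concat ess)"
  shows "fmap (comp_integrand X \<Psi> \<Phi> cs) (c', c) (c, c) (F, ident (ordinals X) c)
        (\<psi>, lift_class X \<Phi> cs c' (ess, (fam_class X \<Phi> c' ess (as, (xs, u)), t))) =
      (\<psi>, lift_class X \<Phi> cs c (ess, (fam_class X \<Phi> c ess (reindex F as, (reindex F xs,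
        cmp (families X) ess as (reindex F as) (reindex_arr X F as) u)), t)))"
    and "fmap (comp_integrand X \<Psi> \<Phi> cs) (c', c) (c', c') (ident (ordinals X) c', F)
        (\<psi>, lift_class X \<Phi> cs c' (ess, (fam_class X \<Phi> c' ess (as, (xs, u)), t))) =
      (fmap \<Psi> (c, ()) (c', ()) (F, ()) \<psi>, lift_class X \<Phi> cs c' (ess, (fam_class X \<Phi> c' ess (as, (xs, u)), t)))"
proof -
  note m = lift_prof_fobjI[OF l xs u t]
  show "fmap (comp_integrand X \<Psi> \<Phi> cs) (c', c) (c, c) (F, ident (ordinals X) c)
        (\<psi>, lift_class X \<Phi> cs c' (ess, (fam_class X \<Phi> c' ess (as, (xs, u)), t))) =
      (\<psi>, lift_class X \<Phi> cs c (ess, (fam_class X \<Phi> c ess (reindex F as, (reindex F xs,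
        cmp (families X) ess as (reindex F as) (reindex_arr X F as) u)), t)))"
    unfolding prof_comp_integrand_def[of _ _ one_cat] prod.case
    by (subst fmap_make_functor)
       (use F m \<psi> in \<open>simp_all add: quest_sel ord_ident functor_id[OF \<Psi>] lift_prof_fmap_ident_left[OF \<Phi> F l xs u t]\<close>)
  show "fmap (comp_integrand X \<Psi> \<Phi> cs) (c', c) (c', c') (ident (ordinals X) c', F)
        (\<psi>, lift_class X \<Phi> cs c' (ess, (fam_class X \<Phi> c' ess (as, (xs, u)), t))) =
      (fmap \<Psi> (c, ()) (c', ()) (F, ()) \<psi>, lift_class X \<Phi> cs c' (ess, (fam_class X \<Phi> c' ess (as, (xs, u)), t)))"
    unfolding prof_comp_integrand_def[of _ _ one_cat] prod.case
    by (subst fmap_make_functor)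
       (use F m \<psi> l in \<open>simp_all add: quest_sel ord_ident ord_right[OF t] lift_prof_fmap_ident_right[OF \<Phi> _ l xs u t]\<close>)
qed

lemma comp_compatibleI:
  assumes \<Psi>: "one_functor X \<Psi>" and \<Phi>: "one_functor X \<Phi>"
    and H: "\<And>c c' F \<psi> ess as xs u t. \<lbrakk>F \<in> hom (ordinals X) c' c; \<psi> \<in> fobj \<Psi> (c, ()); length as = length c';
        xs \<in> fam \<Phi> as; u \<in> hom (families X) ess as; t \<in> hom (ordinals X) cs (concat ess)\<rbrakk> \<Longrightarrow>
      H (c, (\<psi>, lift_class X \<Phi> cs c (ess, (fam_class X \<Phi> c ess (reindex F as, (reindex F xs,
        cmp (families X) ess as (reindex F as) (reindex_arr X F as) u)), t)))) =
      H (c', (fmap \<Psi> (c, ()) (c', ()) (F, ()) \<psi>, lift_class X \<Phi> cs c' (ess, (fam_class X \<Phi> c' ess (as, (xs, u)), t))))"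
  shows "coend_compatible (quest X one_cat) (comp_integrand X \<Psi> \<Phi> cs) H"
  unfolding coend_compatible_def
  by (auto simp: comp_integrand_fobj quest_sel(1-3) comp_integrand_fmap[OF \<Psi> \<Phi>] H elim!: lift_prof_fobjE)

text \<open>A map \<open>F\<close> acting on \<open>\<psi>\<close> passes to the family \<open>xs\<close>, which it reindexes.\<close>

lemma comp_class_reindex:
  assumes \<Psi>: "one_functor X \<Psi>" and \<Phi>: "one_functor X \<Phi>"
    and F: "F \<in> hom (ordinals X) c' c" and \<psi>: "\<psi> \<in> fobj \<Psi> (c, ())"
    and l: "length as = length c'" and xs: "xs \<in> fam \<Phi> as" and u: "u \<in> hom (families X) ess as"
    and t: "t \<in> hom (ordinals X) cs (concat ess)"
  shows "comp_class X \<Psi> \<Phi> cs (c, (\<psi>, lift_class X \<Phi> cs c (ess, (fam_class X \<Phi> c ess (reindex F as, (reindex F xs,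
        cmp (families X) ess as (reindex F as) (reindex_arr X F as) u)), t)))) =
      comp_class X \<Psi> \<Phi> cs (c', (fmap \<Psi> (c, ()) (c', ()) (F, ()) \<psi>,
        lift_class X \<Phi> cs c' (ess, (fam_class X \<Phi> c' ess (as, (xs, u)), t))))"
  using coend_class_generator[of c "quest X one_cat" c' F
      "(\<psi>, lift_class X \<Phi> cs c' (ess, (fam_class X \<Phi> c' ess (as, (xs, u)), t)))" "comp_integrand X \<Psi> \<Phi> cs"]
    lift_prof_fobjI[OF l xs u t] F \<psi>
  by (simp add: quest_sel(1-3) comp_integrand_fobj comp_integrand_fmap[OF assms])

lemma comp_fobj: "fobj (comp X \<Psi> \<Phi>) (cs, ()) = coend (quest X one_cat) (comp_integrand X \<Psi> \<Phi> cs)"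
  by (simp add: cokl_comp_def prof_comp_def fobj_make_functor quest_sel)

lemma comp_fobjI:
  "\<lbrakk>\<psi> \<in> fobj \<Psi> (ds, ()); length as = length ds; xs \<in> fam \<Phi> as; u \<in> hom (families X) ess as; t \<in> hom (ordinals X) cs (concat ess)\<rbrakk> \<Longrightarrow>
    comp_class X \<Psi> \<Phi> cs (ds, (\<psi>, lift_class X \<Phi> cs ds (ess, (fam_class X \<Phi> ds ess (as, (xs, u)), t)))) \<in> fobj (comp X \<Psi> \<Phi>) (cs, ())"
  unfolding comp_fobj
  by (rule coendI) (simp_all add: comp_integrand_fobj lift_prof_fobjI quest_sel)

lemma comp_fobjE:
  assumes "K \<in> fobj (comp X \<Psi> \<Phi>) (cs, ())"
  obtains ds \<psi> ess as xs u t where "\<psi> \<in> fobj \<Psi> (ds, ())" "length as = length ds" "xs \<in> fam \<Phi> as" "u \<in> hom (families X) ess as"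
    "t \<in> hom (ordinals X) cs (concat ess)"
    "K = comp_class X \<Psi> \<Phi> cs (ds, (\<psi>, lift_class X \<Phi> cs ds (ess, (fam_class X \<Phi> ds ess (as, (xs, u)), t))))"
  using assms unfolding comp_fobj
  by (auto simp: comp_integrand_fobj elim!: coendE lift_prof_fobjE)

lemma comp_fmap:
  assumes \<Psi>: "one_functor X \<Psi>" and \<Phi>: "one_functor X \<Phi>"
    and G: "G \<in> hom (ordinals X) cs' cs" and \<psi>: "\<psi> \<in> fobj \<Psi> (ds, ())"
    and l: "length as = length ds" and xs: "xs \<in> fam \<Phi> as" and u: "u \<in> hom (families X) ess as"
    and t: "t \<in> hom (ordinals X) cs (concat ess)"
  shows "fmap (comp X \<Psi> \<Phi>) (cs, ()) (cs', ()) (G, ())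
      (comp_class X \<Psi> \<Phi> cs (ds, (\<psi>, lift_class X \<Phi> cs ds (ess, (fam_class X \<Phi> ds ess (as, (xs, u)), t))))) =
    comp_class X \<Psi> \<Phi> cs' (ds, (\<psi>, lift_class X \<Phi> cs' ds (ess, (fam_class X \<Phi> ds ess (as, (xs, u)), cmp (ordinals X) cs' cs (concat ess) t G))))"
proof -
  define \<phi> where "\<phi> = (\<lambda>(d, (y, x)). (d, (fmap \<Psi> (d, ()) (d, ()) (ident (quest X one_cat) d, ()) y,
                            fmap (lift_prof X \<Phi>) (cs, d) (cs', d) (G, ident (quest X one_cat) d) x)))"
  have \<phi>: "\<phi> (ds, (\<psi>, lift_class X \<Phi> cs ds (ess, (fam_class X \<Phi> ds ess (as, (xs, u)), t)))) =
      (ds, (\<psi>, lift_class X \<Phi> cs' ds (ess, (fam_class X \<Phi> ds ess (as, (xs, u)), cmp (ordinals X) cs' cs (concat ess) t G))))"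
    if "\<psi> \<in> fobj \<Psi> (ds, ())" "length as = length ds" "xs \<in> fam \<Phi> as" "u \<in> hom (families X) ess as" "t \<in> hom (ordinals X) cs (concat ess)"
    for \<psi> ds ess as xs u t
    using that by (simp add: \<phi>_def quest_sel(1-3) lift_prof_fmap_ident_right[OF \<Phi> G] functor_id[OF \<Psi>])
  have "coend_compatible (quest X one_cat) (comp_integrand X \<Psi> \<Phi> cs) (\<lambda>p. comp_class X \<Psi> \<Phi> cs' (\<phi> p))"
  proof (rule comp_compatibleI[OF \<Psi> \<Phi>])
    fix c c' F \<psi> ess as xs u t
    assume F: "F \<in> hom (ordinals X) c' c" and \<psi>: "\<psi> \<in> fobj \<Psi> (c, ())" and l: "length as = length c'" and xs: "xs \<in> fam \<Phi> as"
      and u: "u \<in> hom (families X) ess as" and t: "t \<in> hom (ordinals X) cs (concat ess)"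
    note r = reindex_arr_hom[OF F l]
    have lr: "length (reindex F as) = length c" using bang_homD(1)[OF F] by simp
    have Fp: "fmap \<Psi> (c, ()) (c', ()) (F, ()) \<psi> \<in> fobj \<Psi> (c', ())"
      using functor_closed[OF \<Psi> _ \<psi>] F by (simp add: hom_ordinals)
    show "comp_class X \<Psi> \<Phi> cs' (\<phi> (c, \<psi>, lift_class X \<Phi> cs c (ess, fam_class X \<Phi> c ess
           (reindex F as, reindex F xs, cmp (families X) ess as (reindex F as) (reindex_arr X F as) u), t))) =
       comp_class X \<Psi> \<Phi> cs' (\<phi> (c', fmap \<Psi> (c, ()) (c', ()) (F, ()) \<psi>,
          lift_class X \<Phi> cs c' (ess, fam_class X \<Phi> c' ess (as, xs, u), t)))"
      unfolding \<phi>[OF \<psi> lr reindex_fam[OF F l xs] fam_cmp[OF u r] t] \<phi>[OF Fp l xs u t]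
      by (rule comp_class_reindex[OF \<Psi> \<Phi> F \<psi> l xs u ord_cmp[OF G t]])
  qed
  note 1 = coend_map_class[OF this]
  have "fmap (comp X \<Psi> \<Phi>) (cs, ()) (cs', ()) (G, ()) (comp_class X \<Psi> \<Phi> cs (ds, (\<psi>, lift_class X \<Phi> cs ds (ess, (fam_class X \<Phi> ds ess (as, (xs, u)), t))))) =
    coend_map (quest X one_cat) (comp_integrand X \<Psi> \<Phi> cs') \<phi> (comp_class X \<Psi> \<Phi> cs (ds, (\<psi>, lift_class X \<Phi> cs ds (ess, (fam_class X \<Phi> ds ess (as, (xs, u)), t)))))"
    unfolding cokl_comp_def prof_comp_def
    by (subst fmap_make_functor) (use G comp_fobjI[OF \<psi> l xs u t] in \<open>simp_all add: comp_fobj \<phi>_def quest_sel(1-3)\<close>)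
  then show ?thesis unfolding 1 by (simp only: \<phi>[OF \<psi> l xs u t])
qed


abbreviation two_cell where
  "two_cell X \<equiv> cokl_2cell X one_cat one_cat one_cat"

abbreviation reps where
  "reps X \<equiv> cokl_reps X one_cat one_cat"

abbreviation rep_class where
  "rep_class X \<equiv> cokl_class X one_cat one_cat one_cat"

abbreviation left_unitor where
  "left_unitor X \<equiv> cokl_left_unitor X one_cat one_cat"

abbreviation right_unitor where
  "right_unitor X \<equiv> cokl_right_unitor X one_cat one_cat"

abbreviation assoc_rep where
  "assoc_rep X \<equiv> cokl_assoc_rep X one_cat one_cat one_cat"

abbreviation associator where
  "associator X \<equiv> cokl_associator X one_cat one_cat one_cat one_cat"


section \<open>Composites in terms of representatives\<close>

definition nfam :: "(unit, unit, unit, unit, 'a) cokl \<Rightarrow> nat list \<Rightarrow> 'a list set" where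
  "nfam \<Phi> ns = tuples (map (\<lambda>n. fobj \<Phi> (num n)) ns)"

lemma nfam_iff: "xs \<in> nfam \<Phi> ns \<longleftrightarrow> length xs = length ns \<and> (\<forall>i<length ns. xs ! i \<in> fobj \<Phi> (num (ns ! i)))"
  by (auto simp: nfam_def tuples_iff)

lemma fam_eq_nfam: "fam \<Phi> as = nfam \<Phi> (map length as)"
  by (simp add: fam_def nfam_def o_def)

text \<open>The class \<open>\<langle>x; ys; f\<rangle>\<close>, with all data given by numbers and lists.\<close>

definition cls where
  "cls X \<Psi> \<Phi> N ns x ys f = rep_class X \<Psi> \<Phi> (num N)
     (numeral_obj (length ns), x, map numeral_obj ns, ys, function_arr f)"

lemma cls_eq:
  "cls X \<Psi> \<Phi> N ns x ys f = comp_class X \<Psi> \<Phi> (numeral_obj N) (numeral_obj (length ns), (x,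
     lift_class X \<Phi> (numeral_obj N) (numeral_obj (length ns)) (map numeral_obj ns,
       (fam_class X \<Phi> (numeral_obj (length ns)) (map numeral_obj ns)
          (map numeral_obj ns, (ys, ident (families X) (map numeral_obj ns))), function_arr f))))"
  by (simp add: cls_def cokl_class_def quest_sel) (simp add: quest_one)

lemma lift_class_normal:
  assumes \<Phi>: "one_functor X \<Phi>"
    and l: "length as = length ds" and xs: "xs \<in> fam \<Phi> as" and u: "u \<in> hom (families X) ess as"
    and t: "t \<in> hom (ordinals X) cs (concat ess)"
  shows "lift_class X \<Phi> cs ds (ess, (fam_class X \<Phi> ds ess (as, (xs, u)), t)) =
    lift_class X \<Phi> cs ds (as, (fam_class X \<Phi> ds as (as, (xs, ident (families X) as)),
      function_arr (map ((!) (map fst t)) (map fst (concat_arr ess u)))))"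
  using lift_class_concat[OF \<Phi> u l xs fam_ident t]
  by (simp only: fam_left[OF u] cmp_ordinals[OF concat_arr_hom[OF u] t])

text \<open>Co-Yoneda: the two maps \<open>u\<close> and \<open>t\<close> of a general representative combine into one.\<close>

lemma comp_class_normal:
  assumes \<Phi>: "one_functor X \<Phi>"
    and l: "length as = length ds" and xs: "xs \<in> fam \<Phi> as" and u: "u \<in> hom (families X) ess as"
    and t: "t \<in> hom (ordinals X) cs (concat ess)"
  shows "comp_class X \<Psi> \<Phi> cs (ds, (\<psi>, lift_class X \<Phi> cs ds (ess, (fam_class X \<Phi> ds ess (as, (xs, u)), t)))) =
    cls X \<Psi> \<Phi> (length cs) (map length as) \<psi> xs (map ((!) (map fst t)) (map fst (concat_arr ess u)))"
  unfolding lift_class_normal[OF assms] cls_eq map_numeral_obj_length numeral_obj_length length_map l ..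

lemma normal_xfun:
  assumes u: "u \<in> hom (families X) ess as" and t: "t \<in> hom (ordinals X) cs (concat ess)"
  shows "map ((!) (map fst t)) (map fst (concat_arr ess u)) \<in> xfun X (sum_list (map length as)) (length cs)"
  using ord_cmp[OF t concat_arr_hom[OF u]] cmp_ordinals[OF concat_arr_hom[OF u] t]
  by (simp add: hom_ordinals length_concat del: map_map)

lemma cls_closed:
  assumes "x \<in> fobj \<Psi> (num (length ns))" "ys \<in> nfam \<Phi> ns" "f \<in> xfun X (sum_list ns) N"
  shows "cls X \<Psi> \<Phi> N ns x ys f \<in> fobj (comp X \<Psi> \<Phi>) (num N)"
  unfolding cls_eq
  by (rule comp_fobjI) (use assms in \<open>simp_all add: fam_eq_nfam fam_ident hom_ordinals length_concat o_def\<close>)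

lemma clsE:
  assumes \<Phi>: "one_functor X \<Phi>" and K: "K \<in> fobj (comp X \<Psi> \<Phi>) (num N)"
  obtains ns x ys f where "x \<in> fobj \<Psi> (num (length ns))" "ys \<in> nfam \<Phi> ns" "f \<in> xfun X (sum_list ns) N"
    "K = cls X \<Psi> \<Phi> N ns x ys f"
proof -
  from K obtain ds \<psi> ess as xs u t where *: "\<psi> \<in> fobj \<Psi> (ds, ())" "length as = length ds" "xs \<in> fam \<Phi> as" "u \<in> hom (families X) ess as"
    "t \<in> hom (ordinals X) (numeral_obj N) (concat ess)"
    "K = comp_class X \<Psi> \<Phi> (numeral_obj N) (ds, (\<psi>, lift_class X \<Phi> (numeral_obj N) ds (ess, (fam_class X \<Phi> ds ess (as, (xs, u)), t))))"
    by (elim comp_fobjE)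
  show thesis
  proof (rule that)
    show "\<psi> \<in> fobj \<Psi> (num (length (map length as)))" using *(1,2) by simp
    show "xs \<in> nfam \<Phi> (map length as)" using *(3) by (simp add: fam_eq_nfam)
    show "map ((!) (map fst t)) (map fst (concat_arr ess u)) \<in> xfun X (sum_list (map length as)) N"
      using normal_xfun[OF *(4,5)] by simp
    show "K = cls X \<Psi> \<Phi> N (map length as) \<psi> xs (map ((!) (map fst t)) (map fst (concat_arr ess u)))"
      using comp_class_normal[OF \<Phi> *(2-5), of \<Psi> \<psi>] *(6) by (simp del: map_map)
  qed
qed

lemma wreath_of_reindex_arr:
  assumes "F \<in> hom (ordinals X) ds ds'" "length as = length ds"
  shows "wreath (map length as) (wreath_of (reindex_arr X F as)) = blockf (map length as) (map fst F)"
proof -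
  have "wreath_of (reindex_arr X F as) = map (\<lambda>a. (a, [0..<map length as ! a])) (map fst F)"
    using xfunD(2)[OF bang_homD(2)[OF assms(1)]] assms(2)
    by (auto simp: wreath_of_def reindex_arr_def ident_ordinals intro!: nth_equalityI)
  then show ?thesis unfolding blockf_def by simp
qed

lemma map_length_reindex:
  assumes "F \<in> hom (ordinals X) ds ds'" "length as = length ds"
  shows "map length (reindex F as) = map ((!) (map length as)) (map fst F)"
  using xfunD(2)[OF bang_homD(2)[OF assms(1)]] assms(2) by (auto simp: reindex_def)

text \<open>The relation of the outer coend: \<open>g\<close> stops acting on \<open>x\<close> and reindexes the arguments, so that in \<open>f\<close> the blocks
  are moved along \<open>g\<close>.\<close>

lemma cls_blockf:
  assumes \<Psi>: "one_functor X \<Psi>" and \<Phi>: "one_functor X \<Phi>"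
    and g: "g \<in> xfun X k (length ns)" and x: "x \<in> fobj \<Psi> (num k)" and ys: "ys \<in> nfam \<Phi> ns"
    and f: "f \<in> xfun X (sum_list ns) N"
  shows "cls X \<Psi> \<Phi> N ns (zact \<Psi> k (length ns) g x) ys f =
    cls X \<Psi> \<Phi> N (map ((!) ns) g) x (map ((!) ys) g) (map ((!) f) (blockf ns g))"
proof -
  let ?as = "map numeral_obj ns" and ?F = "function_arr g"
  have F: "?F \<in> hom (ordinals X) (numeral_obj (length ns)) (numeral_obj k)" using g by (simp add: hom_ordinals)
  have l: "length ?as = length (numeral_obj (length ns))" by simp
  have ys': "ys \<in> fam \<Phi> ?as" using ys by (simp add: fam_eq_nfam o_def)
  have t: "function_arr f \<in> hom (ordinals X) (numeral_obj N) (concat ?as)"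
    using f by (simp add: hom_ordinals length_concat o_def)
  note r = reindex_arr_hom[OF F l]
  have lr: "length (reindex ?F ?as) = length (numeral_obj k)" using xfunD(1)[OF g] by (simp add: function_arr_def)
  have "cls X \<Psi> \<Phi> N ns (zact \<Psi> k (length ns) g x) ys f =
    comp_class X \<Psi> \<Phi> (numeral_obj N) (numeral_obj k, (x, lift_class X \<Phi> (numeral_obj N) (numeral_obj k) (?as,
      (fam_class X \<Phi> (numeral_obj k) ?as (reindex ?F ?as, (reindex ?F ys,
        cmp (families X) ?as ?as (reindex ?F ?as) (reindex_arr X ?F ?as) (ident (families X) ?as))), function_arr f))))"
    unfolding cls_eq zact_def by (rule comp_class_reindex[OF \<Psi> \<Phi> F x l ys' fam_ident t, symmetric])
  also have "\<dots> = cls X \<Psi> \<Phi> N (map ((!) ns) g) x (map ((!) ys) g) (map ((!) f) (blockf ns g))"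
    unfolding fam_right[OF r] comp_class_normal[OF \<Phi> lr reindex_fam[OF F l ys'] r t]
      fst_concat_arr wreath_of_reindex_arr[OF F l] map_length_reindex[OF F l]
    by (simp add: reindex_def function_arr_def o_def)
  finally show ?thesis .
qed

text \<open>The relation of the inner coend, pushed outwards by the co-Yoneda step.\<close>

lemma cls_dsum:
  assumes \<Phi>: "one_functor X \<Phi>"
    and fs: "length fs = length ns" "length ms = length ns" "\<And>i. i < length ns \<Longrightarrow> fs ! i \<in> xfun X (ms ! i) (ns ! i)"
    and ys: "ys \<in> nfam \<Phi> ms" and f: "f \<in> xfun X (sum_list ns) N"
  shows "cls X \<Psi> \<Phi> N ns x (map (\<lambda>i. zact \<Phi> (ms ! i) (ns ! i) (fs ! i) (ys ! i)) [0..<length ns]) f =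
    cls X \<Psi> \<Phi> N ms x ys (map ((!) f) (dsum ns fs))"
proof -
  let ?c = "map numeral_obj ns" and ?c' = "map numeral_obj ms" and ?fs = "map function_arr fs" and ?ds = "numeral_obj (length ns)"
  have arr: "?fs \<in> arrows X ?c ?c'" using fs by (auto simp: arrows_def hom_ordinals)
  have ys': "ys \<in> fam \<Phi> ?c'" using ys by (simp add: fam_eq_nfam o_def)
  have t: "function_arr f \<in> hom (ordinals X) (numeral_obj N) (concat ?c)"
    using f by (simp add: hom_ordinals length_concat o_def)
  have "fam_act \<Phi> ?c' ?c ?fs ys = map (\<lambda>i. zact \<Phi> (ms ! i) (ns ! i) (fs ! i) (ys ! i)) [0..<length ns]"
    using fs(1,2) by (auto simp: fam_act_def zact_def)
  then have "cls X \<Psi> \<Phi> N ns x (map (\<lambda>i. zact \<Phi> (ms ! i) (ns ! i) (fs ! i) (ys ! i)) [0..<length ns]) f =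
    comp_class X \<Psi> \<Phi> (numeral_obj N) (?ds, (x, lift_class X \<Phi> (numeral_obj N) ?ds (?c,
      (fam_class X \<Phi> ?ds ?c (?c', (ys, parallel ?fs)), function_arr f))))"
    unfolding cls_eq
    using fam_class_parallel[OF \<Phi> _ _ arr ys' fam_ident, of ?ds] fs(1,2) fam_right[OF parallel_hom[OF arr]]
    by simp
  also have "\<dots> = cls X \<Psi> \<Phi> N ms x ys (map ((!) f) (map fst (concat_arr ?c (parallel ?fs))))"
    using comp_class_normal[OF \<Phi> _ ys' parallel_hom[OF arr] t, of ?ds] fs(1,2) by (simp add: o_def)
  also have "map fst (concat_arr ?c (parallel ?fs)) = dsum ns fs"
  proof -
    have "wreath_of (parallel ?fs) = zip [0..<length fs] fs"
      by (rule nth_equalityI) (auto simp: wreath_of_def)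
    then show ?thesis unfolding dsum_def fst_concat_arr by (simp add: o_def)
  qed
  finally show ?thesis .
qed

definition cls_compatible where
  "cls_compatible X \<Psi> \<Phi> N F \<longleftrightarrow>
     (\<forall>ns k g x ys f. g \<in> xfun X k (length ns) \<longrightarrow> x \<in> fobj \<Psi> (num k) \<longrightarrow> ys \<in> nfam \<Phi> ns \<longrightarrow>
        f \<in> xfun X (sum_list ns) N \<longrightarrow>
        F ns (zact \<Psi> k (length ns) g x) ys f = F (map ((!) ns) g) x (map ((!) ys) g) (map ((!) f) (blockf ns g))) \<and>
     (\<forall>ns ms fs x ys f. length fs = length ns \<longrightarrow> length ms = length ns \<longrightarrow>
        (\<forall>i<length ns. fs ! i \<in> xfun X (ms ! i) (ns ! i)) \<longrightarrow> x \<in> fobj \<Psi> (num (length ns)) \<longrightarrow>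
        ys \<in> nfam \<Phi> ms \<longrightarrow> f \<in> xfun X (sum_list ns) N \<longrightarrow>
        F ns x (map (\<lambda>i. zact \<Phi> (ms ! i) (ns ! i) (fs ! i) (ys ! i)) [0..<length ns]) f =
        F ms x ys (map ((!) f) (dsum ns fs)))"

text \<open>The relations \<open>cls_blockf\<close> and \<open>cls_dsum\<close> generate all others. The function \<open>H\<close> is obtained by extending \<open>F\<close> to
  general representatives through the normal form of \<open>comp_class_normal\<close> and factorizing it through the three
  coends in turn: the inner coend uses compatibility with \<open>dsum\<close>, the middle one functoriality of concatenation, and
  the outer one compatibility with \<open>blockf\<close>.\<close>

lemma cls_lift:
  assumes \<Psi>: "one_functor X \<Psi>" and \<Phi>: "one_functor X \<Phi>"
    and F: "cls_compatible X \<Psi> \<Phi> N F"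
  obtains H where "\<And>ns x ys f. \<lbrakk>x \<in> fobj \<Psi> (num (length ns)); ys \<in> nfam \<Phi> ns; f \<in> xfun X (sum_list ns) N\<rbrakk> \<Longrightarrow>
    H (cls X \<Psi> \<Phi> N ns x ys f) = F ns x ys f"
proof -
  define F2 where "F2 = (\<lambda>\<psi> (ess :: unit list list) (t :: unit seq_arr) (as :: unit list list, (xs, u :: unit seq_arr seq_arr)). F (map length as) \<psi> xs (map ((!) (map fst t)) (map fst (concat_arr ess u))))"
  define F1 where "F1 = (\<lambda>\<psi> (ess, (K, t)). coend_lift (F2 \<psi> ess t) K)"
  define F0 where "F0 = (\<lambda>(ds :: unit list, (\<psi>, K)). coend_lift (F1 \<psi>) K)"
  let ?cs = "numeral_obj N"
  have F2_comp: "coend_compatible (power_cat (length ds) (ordinals X)) (fam_integrand X \<Phi> ds ess) (F2 \<psi> ess t)"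
    if \<psi>: "\<psi> \<in> fobj \<Psi> (ds, ())" and t: "t \<in> hom (ordinals X) ?cs (concat ess)" for ds ess \<psi> t
  proof (rule fam_compatibleI[OF \<Phi>])
    fix c c' fs xs u
    assume l: "length c = length ds" "length c' = length ds" and fs: "fs \<in> arrows X c c'"
      and xs: "xs \<in> fam \<Phi> c'" and u: "u \<in> hom (families X) ess c"
    let ?f = "map ((!) (map fst t)) (map fst (concat_arr ess u))"
    have d: "map fst (concat_arr c (parallel fs)) = dsum (map length c) (map (map fst) fs)"
    proof -
      have "wreath_of (parallel fs) = zip [0..<length fs] (map (map fst) fs)"
        by (rule nth_equalityI) (auto simp: wreath_of_def)
      then show ?thesis unfolding dsum_def fst_concat_arr by (simp add: o_def)
    qed
    have "fam_act \<Phi> c' c fs xs = map (\<lambda>i. zact \<Phi> (map length c' ! i) (map length c ! i) (map (map fst) fs ! i) (xs ! i)) [0..<length (map length c)]"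
      using l fs by (auto simp: fam_act_def fmap_eq_zact arrows_def)
    moreover have "F (map length c) \<psi> (map (\<lambda>i. zact \<Phi> (map length c' ! i) (map length c ! i) (map (map fst) fs ! i) (xs ! i)) [0..<length (map length c)]) ?f =
        F (map length c') \<psi> xs (map ((!) ?f) (dsum (map length c) (map (map fst) fs)))"
      using F[unfolded cls_compatible_def, THEN conjunct2, rule_format, of "map (map fst) fs" "map length c" "map length c'" \<psi> xs ?f]
        l fs xs \<psi> normal_xfun[OF u t] by (simp add: arrows_def hom_ordinals fam_eq_nfam)
    moreover have "map ((!) ?f) (dsum (map length c) (map (map fst) fs)) =
        map ((!) (map fst t)) (map fst (concat_arr ess (cmp (families X) ess c c' (parallel fs) u)))"
    proof -
      have s: "set (map fst (concat_arr c (parallel fs))) \<subseteq> {..<length (concat_arr ess u)}"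
        using xfunD(2) bang_homD(2)[OF concat_arr_hom[OF parallel_hom[OF fs]]] bang_homD(1)[OF concat_arr_hom[OF u]] by fastforce
      show ?thesis
        unfolding concat_arr_cmp[OF u parallel_hom[OF fs]] d[symmetric]
        by (rule map_nth_map_nth) (use s in simp)
    qed
    ultimately show "F2 \<psi> ess t (c, (fam_act \<Phi> c' c fs xs, u)) = F2 \<psi> ess t (c', (xs, cmp (families X) ess c c' (parallel fs) u))"
      by (simp only: F2_def prod.case)
  qed
  have F2_eq: "coend_lift (F2 \<psi> ess t) (fam_class X \<Phi> ds ess (as, (xs, u))) = F2 \<psi> ess t (as, (xs, u))"
    if "\<psi> \<in> fobj \<Psi> (ds, ())" "t \<in> hom (ordinals X) ?cs (concat ess)" for ds ess \<psi> t as xs u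
    by (rule coend_lift_class[OF F2_comp[OF that]])
  have F1_comp: "coend_compatible (quest X (quest X one_cat)) (lift_integrand X \<Phi> ?cs ds) (F1 \<psi>)"
    if \<psi>: "\<psi> \<in> fobj \<Psi> (ds, ())" for ds \<psi>
  proof (rule lift_compatibleI[OF \<Phi>])
    fix c c' f as xs u t
    assume f: "f \<in> hom (families X) c' c" and l: "length as = length ds" and xs: "xs \<in> fam \<Phi> as"
      and u: "u \<in> hom (families X) c as" and t: "t \<in> hom (ordinals X) ?cs (concat c')"
    have s: "set (map fst (concat_arr c u)) \<subseteq> {..<length (concat_arr c' f)}"
      using xfunD(2) bang_homD(2)[OF concat_arr_hom[OF u]] bang_homD(1)[OF concat_arr_hom[OF f]] by fastforce
    have "map ((!) (map fst (cmp (ordinals X) ?cs (concat c') (concat c) (concat_arr c' f) t))) (map fst (concat_arr c u)) =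
        map ((!) (map fst t)) (map fst (concat_arr c' (cmp (families X) c' c as u f)))"
      unfolding cmp_ordinals[OF concat_arr_hom[OF f] t] map_fst_function_arr concat_arr_cmp[OF f u]
      by (rule map_nth_map_nth) (use s in simp)
    then show "F1 \<psi> (c, (fam_class X \<Phi> ds c (as, (xs, u)), cmp (ordinals X) ?cs (concat c') (concat c) (concat_arr c' f) t)) =
      F1 \<psi> (c', (fam_class X \<Phi> ds c' (as, (xs, cmp (families X) c' c as u f)), t))"
      unfolding F1_def prod.case F2_eq[OF \<psi> t] F2_eq[OF \<psi> ord_cmp[OF t concat_arr_hom[OF f]]]
      by (simp only: F2_def prod.case)
  qed
  have F1_eq: "coend_lift (F1 \<psi>) (lift_class X \<Phi> ?cs ds (ess, (fam_class X \<Phi> ds ess (as, (xs, u)), t))) =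
      F (map length as) \<psi> xs (map ((!) (map fst t)) (map fst (concat_arr ess u)))"
    if \<psi>: "\<psi> \<in> fobj \<Psi> (ds, ())" and t: "t \<in> hom (ordinals X) ?cs (concat ess)" for ds ess \<psi> t as xs u
    unfolding coend_lift_class[OF F1_comp[OF \<psi>]]
    unfolding F1_def prod.case F2_eq[OF \<psi> t] by (simp only: F2_def prod.case)
  have F0_comp: "coend_compatible (quest X one_cat) (comp_integrand X \<Psi> \<Phi> ?cs) F0"
  proof (rule comp_compatibleI[OF \<Psi> \<Phi>])
    fix c c' G \<psi> ess as xs u t
    assume G: "G \<in> hom (ordinals X) c' c" and \<psi>: "\<psi> \<in> fobj \<Psi> (c, ())" and l: "length as = length c'" and xs: "xs \<in> fam \<Phi> as"
      and u: "u \<in> hom (families X) ess as" and t: "t \<in> hom (ordinals X) ?cs (concat ess)"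
    note r = reindex_arr_hom[OF G l]
    let ?f = "map ((!) (map fst t)) (map fst (concat_arr ess u))"
    have Fp: "fmap \<Psi> (c, ()) (c', ()) (G, ()) \<psi> \<in> fobj \<Psi> (c', ())"
      using functor_closed[OF \<Psi> _ \<psi>] G by (simp add: hom_ordinals)
    have s: "set (map fst (concat_arr as (reindex_arr X G as))) \<subseteq> {..<length (concat_arr ess u)}"
      using xfunD(2) bang_homD(2)[OF concat_arr_hom[OF r]] bang_homD(1)[OF concat_arr_hom[OF u]] by fastforce
    have rb: "map fst (concat_arr as (reindex_arr X G as)) = blockf (map length as) (map fst G)"
      unfolding fst_concat_arr wreath_of_reindex_arr[OF G l] ..
    have "F (map length as) (zact \<Psi> (length c) (length c') (map fst G) \<psi>) xs ?f =
        F (map ((!) (map length as)) (map fst G)) \<psi> (map ((!) xs) (map fst G)) (map ((!) ?f) (blockf (map length as) (map fst G)))"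
      using F[unfolded cls_compatible_def, THEN conjunct1, rule_format, of "map fst G" "length c" "map length as" \<psi> xs ?f]
        G \<psi> l xs normal_xfun[OF u t] by (simp add: hom_ordinals fam_eq_nfam del: map_map)
    moreover have "map ((!) ?f) (blockf (map length as) (map fst G)) =
       map ((!) (map fst t)) (map fst (concat_arr ess (cmp (families X) ess as (reindex G as) (reindex_arr X G as) u)))"
      unfolding concat_arr_cmp[OF u r] rb[symmetric]
      by (rule map_nth_map_nth) (use s in simp)
    ultimately show "F0 (c, (\<psi>, lift_class X \<Phi> ?cs c (ess, (fam_class X \<Phi> c ess (reindex G as, (reindex G xs,
        cmp (families X) ess as (reindex G as) (reindex_arr X G as) u)), t)))) =
      F0 (c', (fmap \<Psi> (c, ()) (c', ()) (G, ()) \<psi>, lift_class X \<Phi> ?cs c' (ess, (fam_class X \<Phi> c' ess (as, (xs, u)), t))))"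
      unfolding F0_def prod.case F1_eq[OF \<psi> t] F1_eq[OF Fp t]
      unfolding fmap_eq_zact map_length_reindex[OF G l]
      by (simp add: reindex_def o_def)
  qed
  show thesis
  proof (rule that[of "coend_lift F0"])
    fix ns x ys f
    assume x: "x \<in> fobj \<Psi> (num (length ns))" and ys: "ys \<in> nfam \<Phi> ns" and f: "f \<in> xfun X (sum_list ns) N"
    have t: "function_arr f \<in> hom (ordinals X) (numeral_obj N) (concat (map numeral_obj ns))"
      using f by (simp add: hom_ordinals length_concat o_def)
    show "coend_lift F0 (cls X \<Psi> \<Phi> N ns x ys f) = F ns x ys f"
      unfolding cls_eq coend_lift_class[OF F0_comp]
      unfolding F0_def prod.case F1_eq[OF x t] concat_arr_ident ident_ordinals map_fst_function_arr
      using xfunD(1)[OF f] by (simp add: length_concat o_def map_nth_id)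
  qed
qed

lemma comp_zact:
  assumes \<Psi>: "one_functor X \<Psi>" and \<Phi>: "one_functor X \<Phi>"
    and h: "h \<in> xfun X N N'" and x: "x \<in> fobj \<Psi> (num (length ns))" and ys: "ys \<in> nfam \<Phi> ns" and f: "f \<in> xfun X (sum_list ns) N"
  shows "zact (comp X \<Psi> \<Phi>) N N' h (cls X \<Psi> \<Phi> N ns x ys f) = cls X \<Psi> \<Phi> N' ns x ys (map ((!) h) f)"
proof -
  let ?as = "map numeral_obj ns"
  have ys': "ys \<in> fam \<Phi> ?as" using ys by (simp add: fam_eq_nfam o_def)
  have t: "function_arr f \<in> hom (ordinals X) (numeral_obj N) (concat ?as)"
    using f by (simp add: hom_ordinals length_concat o_def)
  have G: "function_arr h \<in> hom (ordinals X) (numeral_obj N') (numeral_obj N)" using h by (simp add: hom_ordinals)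
  show ?thesis
    unfolding zact_def cls_eq
    by (subst comp_fmap[OF \<Psi> \<Phi> G x _ ys' fam_ident t]) (simp_all add: cmp_ordinals[OF t G] del: map_map)
qed

lemma comp_functor:
  assumes \<Psi>: "one_functor X \<Psi>" and \<Phi>: "one_functor X \<Phi>"
  shows "one_functor X (comp X \<Psi> \<Phi>)"
proof (rule zact_functorI)
  fix us vs show "fmap (comp X \<Psi> \<Phi>) (us, ()) (vs, ()) \<in> extensional (hom (ordinals X) vs us \<times> UNIV)"
    by (simp add: cokl_comp_def prof_comp_def make_functor_def quest_sel)
next
  fix m n f assume "f \<in> xfun X m n"
  then show "zact (comp X \<Psi> \<Phi>) m n f \<in> extensional (fobj (comp X \<Psi> \<Phi>) (num m))"
    by (simp add: zact_def cokl_comp_def prof_comp_def make_functor_def quest_sel hom_ordinals)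
next
  fix m n f x assume "f \<in> xfun X m n" "x \<in> fobj (comp X \<Psi> \<Phi>) (num m)"
  then show "zact (comp X \<Psi> \<Phi>) m n f x \<in> fobj (comp X \<Psi> \<Phi>) (num n)"
    by (auto elim!: clsE[OF \<Phi>] simp: comp_zact[OF \<Psi> \<Phi>] intro!: cls_closed xfun_comp)
next
  fix m x assume "x \<in> fobj (comp X \<Psi> \<Phi>) (num m)"
  then show "zact (comp X \<Psi> \<Phi>) m m [0..<m] x = x"
    by (auto elim!: clsE[OF \<Phi>] simp: comp_zact[OF \<Psi> \<Phi>] map_nth_upt[OF xfunD(2)])
next
  fix l m n f g x assume fg: "f \<in> xfun X l m" "g \<in> xfun X m n" and x: "x \<in> fobj (comp X \<Psi> \<Phi>) (num l)"
  from x obtain ns y ys h where *: "y \<in> fobj \<Psi> (num (length ns))" "ys \<in> nfam \<Phi> ns" "h \<in> xfun X (sum_list ns) l" "x = cls X \<Psi> \<Phi> l ns y ys h"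
    by (elim clsE[OF \<Phi>])
  have "set h \<subseteq> {..<length f}" using xfunD(2)[OF *(3)] xfunD(1)[OF fg(1)] by simp
  from map_nth_map_nth[OF this, of "(!) g"]
  show "zact (comp X \<Psi> \<Phi>) m n g (zact (comp X \<Psi> \<Phi>) l m f x) = zact (comp X \<Psi> \<Phi>) l n (map ((!) g) f) x"
    using * fg by (simp add: comp_zact[OF \<Psi> \<Phi>] xfun_comp del: map_map)
qed


section \<open>Transformations\<close>

text \<open>Naturality without the requirement of extensionality, which the identity 2-cells \<open>\<lambda>_ x. x\<close> in the monoid laws
  do not meet.\<close>

definition nat_trans where
  "nat_trans X F G \<eta> \<longleftrightarrow>
     (\<forall>n. \<forall>x\<in>fobj F (num n). \<eta> (num n) x \<in> fobj G (num n)) \<and>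
     (\<forall>m n. \<forall>f\<in>xfun X m n. \<forall>x\<in>fobj F (num m). \<eta> (num n) (zact F m n f x) = zact G m n f (\<eta> (num m) x))"

lemma nat_trans_ident: "nat_trans X F F (\<lambda>_ x. x)"
  by (simp add: nat_trans_def)

lemma natural_iff: "natural (one_base X) F G \<eta> \<longleftrightarrow> (\<forall>p. \<eta> p \<in> extensional (fobj F p)) \<and> nat_trans X F G \<eta>"
proof -
  have 1: "(\<forall>p. P p) \<longleftrightarrow> (\<forall>n. P (num n))" for P :: "unit list \<times> unit \<Rightarrow> bool"
    using one_objE by metis
  have 2: "(\<forall>f\<in>hom (one_base X) (num m) (num n). P f) \<longleftrightarrow> (\<forall>f\<in>xfun X m n. P (function_arr f, ()))" for P m n
  proof (intro iffI ballI)
    fix f assume P: "\<forall>f\<in>xfun X m n. P (function_arr f, ())" and f: "f \<in> hom (one_base X) (num m) (num n)"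
    obtain l where l: "f = (l, ())" by (cases f) auto
    then have "map fst l \<in> xfun X m n" using f by (simp add: quest_sel hom_ordinals)
    with P have "P (function_arr (map fst l), ())" by blast
    then show "P f" by (simp only: l function_arr_map_fst)
  qed (auto simp: quest_sel hom_ordinals)
  have "natural (one_base X) F G \<eta> \<longleftrightarrow> (\<forall>p. \<eta> p \<in> extensional (fobj F p)) \<and> (\<forall>p. \<forall>x\<in>fobj F p. \<eta> p x \<in> fobj G p) \<and>
     (\<forall>a b. \<forall>f\<in>hom (one_base X) a b. \<forall>x\<in>fobj F a. \<eta> b (fmap F a b f x) = fmap G a b f (\<eta> a x))"
    unfolding natural_def obj_one_base by (auto simp: PiE_iff extensional_def)
  also have "\<dots> \<longleftrightarrow> (\<forall>p. \<eta> p \<in> extensional (fobj F p)) \<and> nat_trans X F G \<eta>"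
    unfolding nat_trans_def zact_def
    by (subst (2 3 4) 1, subst 2) (rule refl)
  finally show ?thesis .
qed

lemma
  assumes "nat_trans X F G \<eta>"
  shows nat_trans_closed: "x \<in> fobj F (us, ()) \<Longrightarrow> \<eta> (us, ()) x \<in> fobj G (us, ())"
    and nat_trans_fmap: "\<lbrakk>l \<in> hom (ordinals X) vs us; x \<in> fobj F (us, ())\<rbrakk> \<Longrightarrow>
      \<eta> (vs, ()) (fmap F (us, ()) (vs, ()) (l, ()) x) = fmap G (us, ()) (vs, ()) (l, ()) (\<eta> (us, ()) x)"
    and nat_trans_zact: "\<lbrakk>f \<in> xfun X m n; y \<in> fobj F (num m)\<rbrakk> \<Longrightarrow> \<eta> (num n) (zact F m n f y) = zact G m n f (\<eta> (num m) y)"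
proof -
  show "x \<in> fobj F (us, ()) \<Longrightarrow> \<eta> (us, ()) x \<in> fobj G (us, ())"
    using assms[unfolded nat_trans_def, THEN conjunct1, rule_format, of x "length us"] by simp
  show "\<lbrakk>l \<in> hom (ordinals X) vs us; x \<in> fobj F (us, ())\<rbrakk> \<Longrightarrow>
      \<eta> (vs, ()) (fmap F (us, ()) (vs, ()) (l, ()) x) = fmap G (us, ()) (vs, ()) (l, ()) (\<eta> (us, ()) x)"
    using assms[unfolded nat_trans_def, THEN conjunct2, rule_format, of "map fst l" "length us" "length vs" x]
    by (simp add: hom_ordinals fmap_eq_zact)
  show "\<lbrakk>f \<in> xfun X m n; y \<in> fobj F (num m)\<rbrakk> \<Longrightarrow> \<eta> (num n) (zact F m n f y) = zact G m n f (\<eta> (num m) y)"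
    using assms by (simp add: nat_trans_def)
qed

definition fam_map :: "(unit list \<times> unit \<Rightarrow> 'a \<Rightarrow> 'b) \<Rightarrow> unit list list \<Rightarrow> 'a list \<Rightarrow> 'b list" where
  "fam_map \<alpha> as xs = map (\<lambda>i. \<alpha> (as ! i, ()) (xs ! i)) [0..<length as]"

lemma fam_map_fam: "nat_trans X \<Phi> \<Phi>' \<alpha> \<Longrightarrow> xs \<in> fam \<Phi> as \<Longrightarrow> fam_map \<alpha> as xs \<in> fam \<Phi>' as"
  by (auto simp: fam_map_def fam_iff nat_trans_closed)

lemma fam_map_act:
  assumes "nat_trans X \<Phi> \<Phi>' \<alpha>" "fs \<in> arrows X c c'" "xs \<in> fam \<Phi> c'"
  shows "fam_map \<alpha> c (fam_act \<Phi> c' c fs xs) = fam_act \<Phi>' c' c fs (fam_map \<alpha> c' xs)"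
  using assms(2,3) by (auto simp: fam_map_def fam_act_def arrows_def fam_iff nat_trans_fmap[OF assms(1)])

lemma fam_map_reindex:
  assumes "F \<in> hom (ordinals X) ds ds'" "length as = length ds"
  shows "fam_map \<alpha> (reindex F as) (reindex F xs) = reindex F (fam_map \<alpha> as xs)"
  using bang_homD(1,3)[OF assms(1)] assms(2) by (auto simp: fam_map_def reindex_def intro!: nth_equalityI)

lemma fam_2cell:
  assumes \<Phi>: "one_functor X \<Phi>" and \<Phi>': "one_functor X \<Phi>'" and \<alpha>: "nat_trans X \<Phi> \<Phi>' \<alpha>"
    and l: "length as = length ds" and xs: "xs \<in> fam \<Phi> as" and u: "u \<in> hom (families X) ess as"
  shows "quest_2cell X (quest X one_cat) one_cat \<Phi>' \<alpha> (ess, ds) (fam_class X \<Phi> ds ess (as, (xs, u))) =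
    fam_class X \<Phi>' ds ess (as, (fam_map \<alpha> as xs, u))"
proof -
  define \<phi> :: "unit list list \<times> 'a list \<times> unit seq_arr seq_arr \<Rightarrow> _" where
    "\<phi> = (\<lambda>(es, (xs, t)). (es, (map (\<lambda>i. (\<lambda>(d, c). \<alpha> (c, d)) (ds ! i, es ! i) (xs ! i)) [0..<length ds], t)))"
  have \<phi>: "\<phi> (es, (xs, t)) = (es, (fam_map \<alpha> es xs, t))" if "length es = length ds" for es xs t
    using that by (simp add: \<phi>_def fam_map_def)
  have "coend_compatible (power_cat (length ds) (ordinals X)) (fam_integrand X \<Phi> ds ess) (\<lambda>p. fam_class X \<Phi>' ds ess (\<phi> p))"
  proof (rule fam_compatibleI[OF \<Phi>])
    fix c c' fs xs t
    assume l: "length c = length ds" "length c' = length ds" and fs: "fs \<in> arrows X c c'"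
      and xs: "xs \<in> fam \<Phi> c'" and u: "t \<in> hom (families X) ess c"
    show "fam_class X \<Phi>' ds ess (\<phi> (c, fam_act \<Phi> c' c fs xs, t)) =
      fam_class X \<Phi>' ds ess (\<phi> (c', xs, cmp (families X) ess c c' (parallel fs) t))"
      unfolding \<phi>[OF l(1)] \<phi>[OF l(2)] fam_map_act[OF \<alpha> fs xs]
      by (rule fam_class_parallel[OF \<Phi>' l fs fam_map_fam[OF \<alpha> xs] u])
  qed
  note 1 = coend_map_class[OF this]
  show ?thesis
    using 1[of "(as, (xs, u))"] unfolding quest_2cell_def bang_2cell_def quest_one op_cat_one_cat op_cat_op_cat prod.case \<phi>[OF l]
    unfolding \<phi>_def prod.case .
qed

lemma lift_2cell:
  assumes \<Phi>: "one_functor X \<Phi>" and \<Phi>': "one_functor X \<Phi>'" and \<alpha>: "nat_trans X \<Phi> \<Phi>' \<alpha>"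
    and l: "length as = length ds" and xs: "xs \<in> fam \<Phi> as" and u: "u \<in> hom (families X) ess as"
    and t: "t \<in> hom (ordinals X) cs (concat ess)"
  shows "prof_comp_2cell (quest X one_cat) (quest X (quest X one_cat)) (quest X one_cat) (fam_prof X \<Phi>') (comult X)
      (quest_2cell X (quest X one_cat) one_cat \<Phi>' \<alpha>) (\<lambda>_ t. t) (cs, ds)
      (lift_class X \<Phi> cs ds (ess, (fam_class X \<Phi> ds ess (as, (xs, u)), t))) =
    lift_class X \<Phi>' cs ds (ess, (fam_class X \<Phi>' ds ess (as, (fam_map \<alpha> as xs, u)), t))"
proof -
  define \<phi> where "\<phi> = (\<lambda>(d, (y, x)). (d, (quest_2cell X (quest X one_cat) one_cat \<Phi>' \<alpha> (d, ds) y, x :: unit seq_arr)))"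
  have \<phi>: "\<phi> (ess, (fam_class X \<Phi> ds ess (as, (xs, u)), t)) = (ess, (fam_class X \<Phi>' ds ess (as, (fam_map \<alpha> as xs, u)), t))"
    if "length as = length ds" "xs \<in> fam \<Phi> as" "u \<in> hom (families X) ess as" for ess as xs u t
    using that by (simp add: \<phi>_def fam_2cell[OF \<Phi> \<Phi>' \<alpha>])
  have "coend_compatible (quest X (quest X one_cat)) (lift_integrand X \<Phi> cs ds) (\<lambda>p. lift_class X \<Phi>' cs ds (\<phi> p))"
  proof (rule lift_compatibleI[OF \<Phi>])
    fix c c' f as xs u t
    assume f: "f \<in> hom (families X) c' c" and l: "length as = length ds" and xs: "xs \<in> fam \<Phi> as"
      and u: "u \<in> hom (families X) c as" and t: "t \<in> hom (ordinals X) cs (concat c')"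
    show "lift_class X \<Phi>' cs ds (\<phi> (c, fam_class X \<Phi> ds c (as, xs, u), cmp (ordinals X) cs (concat c') (concat c) (concat_arr c' f) t)) =
      lift_class X \<Phi>' cs ds (\<phi> (c', fam_class X \<Phi> ds c' (as, xs, cmp (families X) c' c as u f), t))"
      unfolding \<phi>[OF l xs u] \<phi>[OF l xs fam_cmp[OF f u]]
      by (rule lift_class_concat[OF \<Phi>' f l fam_map_fam[OF \<alpha> xs] u t])
  qed
  note 1 = coend_map_class[OF this]
  show ?thesis
    using 1[of "(ess, (fam_class X \<Phi> ds ess (as, (xs, u)), t))"] unfolding prof_comp_2cell_def prod.case \<phi>[OF l xs u]
    unfolding \<phi>_def .
qed

lemma comp_2cell:
  assumes \<Psi>: "one_functor X \<Psi>" and \<Psi>': "one_functor X \<Psi>'" and \<beta>: "nat_trans X \<Psi> \<Psi>' \<beta>"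
    and \<Phi>: "one_functor X \<Phi>" and \<Phi>': "one_functor X \<Phi>'" and \<alpha>: "nat_trans X \<Phi> \<Phi>' \<alpha>"
    and \<psi>: "\<psi> \<in> fobj \<Psi> (ds, ())" and l: "length as = length ds" and xs: "xs \<in> fam \<Phi> as" and u: "u \<in> hom (families X) ess as"
    and t: "t \<in> hom (ordinals X) cs (concat ess)"
  shows "two_cell X \<Psi>' \<Phi>' \<beta> \<alpha> (cs, ())
      (comp_class X \<Psi> \<Phi> cs (ds, (\<psi>, lift_class X \<Phi> cs ds (ess, (fam_class X \<Phi> ds ess (as, (xs, u)), t))))) =
    comp_class X \<Psi>' \<Phi>' cs (ds, (\<beta> (ds, ()) \<psi>, lift_class X \<Phi>' cs ds (ess, (fam_class X \<Phi>' ds ess (as, (fam_map \<alpha> as xs, u)), t))))"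
proof -
  define \<phi> where "\<phi> = (\<lambda>(d, (y, x)). (d, (\<beta> (d, ()) y,
    prof_comp_2cell (quest X one_cat) (quest X (quest X one_cat)) (quest X one_cat) (fam_prof X \<Phi>') (comult X)
      (quest_2cell X (quest X one_cat) one_cat \<Phi>' \<alpha>) (\<lambda>_ t. t) (cs, d) x)))"
  have \<phi>: "\<phi> (ds, (\<psi>, lift_class X \<Phi> cs ds (ess, (fam_class X \<Phi> ds ess (as, (xs, u)), t)))) =
      (ds, (\<beta> (ds, ()) \<psi>, lift_class X \<Phi>' cs ds (ess, (fam_class X \<Phi>' ds ess (as, (fam_map \<alpha> as xs, u)), t))))"
    if "length as = length ds" "xs \<in> fam \<Phi> as" "u \<in> hom (families X) ess as" "t \<in> hom (ordinals X) cs (concat ess)" for \<psi> ds ess as xs u t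
    using that by (simp add: \<phi>_def lift_2cell[OF \<Phi> \<Phi>' \<alpha>])
  have "coend_compatible (quest X one_cat) (comp_integrand X \<Psi> \<Phi> cs) (\<lambda>p. comp_class X \<Psi>' \<Phi>' cs (\<phi> p))"
  proof (rule comp_compatibleI[OF \<Psi> \<Phi>])
    fix c c' F \<psi> ess as xs u t
    assume F: "F \<in> hom (ordinals X) c' c" and \<psi>: "\<psi> \<in> fobj \<Psi> (c, ())" and l: "length as = length c'" and xs: "xs \<in> fam \<Phi> as"
      and u: "u \<in> hom (families X) ess as" and t: "t \<in> hom (ordinals X) cs (concat ess)"
    note r = reindex_arr_hom[OF F l]
    have lr: "length (reindex F as) = length c" using bang_homD(1)[OF F] by simp
    show "comp_class X \<Psi>' \<Phi>' cs (\<phi> (c, \<psi>, lift_class X \<Phi> cs c (ess, fam_class X \<Phi> c ess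
           (reindex F as, reindex F xs, cmp (families X) ess as (reindex F as) (reindex_arr X F as) u), t))) =
       comp_class X \<Psi>' \<Phi>' cs (\<phi> (c', fmap \<Psi> (c, ()) (c', ()) (F, ()) \<psi>,
          lift_class X \<Phi> cs c' (ess, fam_class X \<Phi> c' ess (as, xs, u), t)))"
      unfolding \<phi>[OF lr reindex_fam[OF F l xs] fam_cmp[OF u r] t] \<phi>[OF l xs u t] fam_map_reindex[OF F l]
        nat_trans_fmap[OF \<beta> F \<psi>]
      by (rule comp_class_reindex[OF \<Psi>' \<Phi>' F nat_trans_closed[OF \<beta> \<psi>] l fam_map_fam[OF \<alpha> xs] u t])
  qed
  note 1 = coend_map_class[OF this]
  show ?thesis
    using 1[of "(ds, (\<psi>, lift_class X \<Phi> cs ds (ess, (fam_class X \<Phi> ds ess (as, (xs, u)), t))))"]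
    unfolding cokl_2cell_def prof_comp_2cell_def[of "quest X one_cat" "quest X one_cat"] prod.case \<phi>[OF l xs u t]
    unfolding \<phi>_def .
qed

lemma cls_2cell:
  assumes \<Psi>: "one_functor X \<Psi>" and \<Psi>': "one_functor X \<Psi>'" and \<beta>: "nat_trans X \<Psi> \<Psi>' \<beta>"
    and \<Phi>: "one_functor X \<Phi>" and \<Phi>': "one_functor X \<Phi>'" and \<alpha>: "nat_trans X \<Phi> \<Phi>' \<alpha>"
    and x: "x \<in> fobj \<Psi> (num (length ns))" and ys: "ys \<in> nfam \<Phi> ns" and f: "f \<in> xfun X (sum_list ns) N"
  shows "two_cell X \<Psi>' \<Phi>' \<beta> \<alpha> (num N) (cls X \<Psi> \<Phi> N ns x ys f) =
    cls X \<Psi>' \<Phi>' N ns (\<beta> (num (length ns)) x) (map2 (\<lambda>n. \<alpha> (num n)) ns ys) f"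
proof -
  let ?as = "map numeral_obj ns"
  have ys': "ys \<in> fam \<Phi> ?as" using ys by (simp add: fam_eq_nfam o_def)
  have t: "function_arr f \<in> hom (ordinals X) (numeral_obj N) (concat ?as)"
    using f by (simp add: hom_ordinals length_concat o_def)
  have "fam_map \<alpha> ?as ys = map2 (\<lambda>n. \<alpha> (num n)) ns ys"
    using ys by (auto simp: fam_map_def nfam_iff intro!: nth_equalityI)
  then show ?thesis
    unfolding cls_eq by (subst comp_2cell[OF \<Psi> \<Psi>' \<beta> \<Phi> \<Phi>' \<alpha> x _ ys' fam_ident t]) simp_all
qed


section \<open>The canonical isomorphisms\<close>

lemma cokl_reps_num:
  assumes "(ds, \<psi>, ess, \<phi>s, t) \<in> reps X \<Psi> \<Phi> (num N)"
  obtains ns f where "ds = numeral_obj (length ns)" "ess = map numeral_obj ns" "t = function_arr f"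
    "\<psi> \<in> fobj \<Psi> (num (length ns))" "\<phi>s \<in> nfam \<Phi> ns" "f \<in> xfun X (sum_list ns) N"
proof (rule that)
  have l: "length ess = length ds" and \<psi>: "\<psi> \<in> fobj \<Psi> (ds, ())"
    and \<phi>: "\<phi>s \<in> tuples (map2 (\<lambda>es d. fobj \<Phi> (es, d)) ess ds)" and t: "t \<in> hom (ordinals X) (numeral_obj N) (concat ess)"
    using assms by (auto simp: cokl_reps_def quest_sel)
  show "ds = numeral_obj (length (map length ess))" "ess = map numeral_obj (map length ess)"
    "t = function_arr (map fst t)" using l by (simp_all del: map_map)
  show "\<psi> \<in> fobj \<Psi> (num (length (map length ess)))" using \<psi> l by simp
  show "\<phi>s \<in> nfam \<Phi> (map length ess)" using \<phi> l by (simp add: nfam_iff tuples_iff)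
  show "map fst t \<in> xfun X (sum_list (map length ess)) N" using t by (simp add: hom_ordinals length_concat)
qed

lemma cokl_repsI:
  assumes "x \<in> fobj \<Psi> (num (length ns))" "ys \<in> nfam \<Phi> ns" "f \<in> xfun X (sum_list ns) N"
  shows "(numeral_obj (length ns), x, map numeral_obj ns, ys, function_arr f) \<in> reps X \<Psi> \<Phi> (num N)"
  using assms by (auto simp: cokl_reps_def quest_sel hom_ordinals length_concat o_def nfam_iff tuples_iff)

abbreviation unit_functor where
  "unit_functor X \<equiv> quest_counit X one_cat"

lemma unit_fobj_raw: "fobj (unit_functor X) (us, ()) = hom (ordinals X) us [()]"
  by (simp add: quest_counit_def bang_unit_def functor_prof_def fobj_make_functor)

text \<open>The unit \<open>I\<close> is represented by the ordinal 1: its elements of arity \<open>n\<close> are the maps from 1 to \<open>n\<close>.\<close>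

lemma unit_fobj: "fobj (unit_functor X) (num n) = {function_arr [j] | j. [j] \<in> xfun X 1 n}"
proof -
  have "l \<in> hom (ordinals X) (numeral_obj n) [()] \<longleftrightarrow> (\<exists>j. l = function_arr [j] \<and> [j] \<in> xfun X 1 n)" for l
  proof
    assume l: "l \<in> hom (ordinals X) (numeral_obj n) [()]"
    then have "map fst l \<in> xfun X 1 n" by (simp add: hom_ordinals)
    moreover from xfunD(1)[OF this] obtain j where "map fst l = [j]" by (cases l) auto
    ultimately show "\<exists>j. l = function_arr [j] \<and> [j] \<in> xfun X 1 n" by (metis function_arr_map_fst)
  qed (auto simp: hom_ordinals)
  then show ?thesis by (auto simp: unit_fobj_raw)
qed

lemma unit_zact:
  assumes f: "f \<in> xfun X m n" and j: "[j] \<in> xfun X 1 m"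
  shows "zact (unit_functor X) m n f (function_arr [j]) = function_arr [f ! j]"
proof -
  have f': "function_arr f \<in> hom (ordinals X) (numeral_obj n) (numeral_obj m)"
    and j': "function_arr [j] \<in> hom (ordinals X) (numeral_obj m) [()]"
    using f j by (simp_all add: hom_ordinals)
  have e: "[(0, ())] = ident (ordinals X) [()]" by (simp add: bang_ident)
  have "zact (unit_functor X) m n f (function_arr [j]) = cmp (ordinals X) (numeral_obj n) [()] [()] [(0, ())]
      (cmp (ordinals X) (numeral_obj n) (numeral_obj m) [()] (function_arr [j]) (function_arr f))"
    unfolding zact_def quest_counit_def op_prof_sel bang_unit_def functor_prof_def op_cat_one_cat
    by (subst fmap_make_functor) (use f' j' in simp_all)
  also have "\<dots> = function_arr [f ! j]"
    unfolding e ord_left[OF ord_cmp[OF f' j']]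
    unfolding cmp_ordinals[OF j' f'] by simp
  finally show ?thesis .
qed

lemma unit_index: "[j] \<in> xfun X 1 n \<Longrightarrow> j < n"
  using xfunD(3)[of "[j]" X 1 n 0] by simp

lemma unit_functor: "one_functor X (unit_functor X)"
proof (rule zact_functorI)
  fix us vs show "fmap (unit_functor X) (us, ()) (vs, ()) \<in> extensional (hom (ordinals X) vs us \<times> UNIV)"
    by (auto simp: quest_counit_def bang_unit_def functor_prof_def make_functor_def extensional_def)
next
  fix m n f assume "f \<in> xfun X m n"
  then show "zact (unit_functor X) m n f \<in> extensional (fobj (unit_functor X) (num m))"
    by (simp add: zact_def quest_counit_def bang_unit_def functor_prof_def make_functor_def hom_ordinals)
next
  fix m n f x assume f: "f \<in> xfun X m n" and "x \<in> fobj (unit_functor X) (num m)"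
  then obtain j where "x = function_arr [j]" "[j] \<in> xfun X 1 m" by (auto simp: unit_fobj)
  with f show "zact (unit_functor X) m n f x \<in> fobj (unit_functor X) (num n)"
    using xfun_comp[of "[j]" X 1 m f n] by (auto simp: unit_zact[OF f] unit_fobj)
next
  fix m x assume "x \<in> fobj (unit_functor X) (num m)"
  then obtain j where j: "x = function_arr [j]" "[j] \<in> xfun X 1 m" by (auto simp: unit_fobj)
  then show "zact (unit_functor X) m m [0..<m] x = x"
    using unit_index[OF j(2)] by (simp add: unit_zact)
next
  fix l m n f g x assume f: "f \<in> xfun X l m" and g: "g \<in> xfun X m n" and "x \<in> fobj (unit_functor X) (num l)"
  then obtain j where j: "x = function_arr [j]" "[j] \<in> xfun X 1 l" by (auto simp: unit_fobj)
  have "[f ! j] \<in> xfun X 1 m" using xfun_comp[OF j(2) f] by simp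
  with j f g show "zact (unit_functor X) m n g (zact (unit_functor X) l m f x) = zact (unit_functor X) l n (map ((!) g) f) x"
    using unit_index[OF j(2)] xfunD(1)[OF f] by (simp add: unit_zact[OF f] unit_zact[OF g] unit_zact[OF xfun_comp[OF f g]])
qed

lemma blockf_single_xfun: "[j] \<in> xfun X 1 (length ns) \<Longrightarrow> blockf ns [j] \<in> xfun X (ns ! j) (sum_list ns)"
  using blockf_xfun[of "[j]" X 1 ns] by simp

text \<open>The unitor is defined by a description over all representatives of the given class. Its formula is
  compatible with the two relations, hence factorizes through a function \<open>H\<close> of the class, and so every
  representative yields the same value. The other canonical isomorphisms are computed in the same way.\<close>

lemma left_unitor_cls:
  assumes \<Phi>: "one_functor X \<Phi>"
    and j: "[j] \<in> xfun X 1 (length ns)" and ys: "ys \<in> nfam \<Phi> ns" and f: "f \<in> xfun X (sum_list ns) N"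
  shows "left_unitor X \<Phi> (num N) (cls X (unit_functor X) \<Phi> N ns (function_arr [j]) ys f) =
    zact \<Phi> (ns ! j) N (map ((!) f) (blockf ns [j])) (ys ! j)"
proof -
  define F where "F = (\<lambda>ns (i :: unit seq_arr) ys f. let j = fst (hd i) in zact \<Phi> (ns ! j) N (map ((!) f) (blockf ns [j])) (ys ! j))"
  have F: "F ns (function_arr [j]) ys f = zact \<Phi> (ns ! j) N (map ((!) f) (blockf ns [j])) (ys ! j)" for ns j ys f
    by (simp add: F_def function_arr_def)
  have "cls_compatible X (unit_functor X) \<Phi> N F"
    unfolding cls_compatible_def
  proof (intro conjI allI impI)
    fix ns k g x ys f
    assume g: "g \<in> xfun X k (length ns)" and "x \<in> fobj (unit_functor X) (num k)" and ys: "ys \<in> nfam \<Phi> ns"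
      and f: "f \<in> xfun X (sum_list ns) N"
    then obtain j where j: "x = function_arr [j]" "[j] \<in> xfun X 1 k" by (auto simp: unit_fobj)
    have jk: "j < length g" using unit_index[OF j(2)] xfunD(1)[OF g] by simp
    have "set (blockf (map ((!) ns) g) [j]) \<subseteq> {..<length (blockf ns g)}"
      using xfunD(2)[OF blockf_single_xfun[of j X "map ((!) ns) g"]] j(2) xfunD(1)[OF g]
      by (simp add: length_blockf)
    then have "map ((!) (map ((!) f) (blockf ns g))) (blockf (map ((!) ns) g) [j]) = map ((!) f) (blockf ns [g ! j])"
      using blockf_comp[OF xfunD(2)[OF g], of "[j]"] jk map_nth_comp[of "blockf (map ((!) ns) g) [j]" "blockf ns g" f] by simp
    then show "F ns (zact (unit_functor X) k (length ns) g x) ys f =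
        F (map ((!) ns) g) x (map ((!) ys) g) (map ((!) f) (blockf ns g))"
      using jk by (simp add: j(1) unit_zact[OF g j(2)] F)
  next
    fix ns ms fs x ys f
    assume fs: "length fs = length ns" "length ms = length ns" "\<forall>i<length ns. fs ! i \<in> xfun X (ms ! i) (ns ! i)"
      and "x \<in> fobj (unit_functor X) (num (length ns))" and ys: "ys \<in> nfam \<Phi> ms" and f: "f \<in> xfun X (sum_list ns) N"
    then obtain j where j: "x = function_arr [j]" "[j] \<in> xfun X 1 (length ns)" by (auto simp: unit_fobj)
    have jk: "j < length ns" using unit_index[OF j(2)] .
    have ms: "map length fs = ms" using fs xfunD(1) by (auto intro!: nth_equalityI)
    have b: "blockf ns [j] \<in> xfun X (ns ! j) (sum_list ns)" "blockf ms [j] \<in> xfun X (ms ! j) (sum_list ms)"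
      using blockf_single_xfun j(2) fs(2) by metis+
    have d: "dsum ns fs \<in> xfun X (sum_list ms) (sum_list ns)" using dsum_xfun fs by blast
    have "map ((!) (dsum ns fs)) (blockf ms [j]) = map ((!) (blockf ns [j])) (fs ! j)"
      using dsum_blockf[of fs ns "[j]"] fs jk xfunD(2) unfolding ms by (fastforce simp: dsum_single)
    then have "map ((!) (map ((!) f) (dsum ns fs))) (blockf ms [j]) = map ((!) (map ((!) f) (blockf ns [j]))) (fs ! j)"
      using map_nth_comp[of "blockf ms [j]" "dsum ns fs" f] map_nth_comp[of "fs ! j" "blockf ns [j]" f]
        xfunD[OF b(1)] xfunD[OF b(2)] xfunD[OF d] xfunD(2) fs(3) jk by metis
    then show "F ns x (map (\<lambda>i. zact \<Phi> (ms ! i) (ns ! i) (fs ! i) (ys ! i)) [0..<length ns]) f =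
        F ms x ys (map ((!) f) (dsum ns fs))"
      using zact_comp[OF \<Phi> _ xfun_comp[OF b(1) f], of "fs ! j" "ms ! j" "ys ! j"] fs ys jk
      by (simp add: j(1) F nfam_iff)
  qed
  then obtain H where H: "\<And>ns x ys f. \<lbrakk>x \<in> fobj (unit_functor X) (num (length ns)); ys \<in> nfam \<Phi> ns; f \<in> xfun X (sum_list ns) N\<rbrakk> \<Longrightarrow>
    H (cls X (unit_functor X) \<Phi> N ns x ys f) = F ns x ys f"
    by (rule cls_lift[OF unit_functor \<Phi>]) blast
  have val_eq: "fmap \<Phi> (map numeral_obj ns ! j, numeral_obj (length ns) ! j) (num N)
      (cmp (quest X one_cat) (map numeral_obj ns ! j) (concat (map numeral_obj ns)) (numeral_obj N) (function_arr f)
        (concat_arr (map numeral_obj ns) [(j, ident (quest X one_cat) (map numeral_obj ns ! j))]), ()) (ys ! j) =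
      F ns (function_arr [j]) ys f"
    if "[j] \<in> xfun X 1 (length ns)" "f \<in> xfun X (sum_list ns) N" for ns j f ys
  proof -
    let ?as = "map numeral_obj ns"
    have J: "function_arr [j] \<in> hom (ordinals X) (numeral_obj (length ns)) (numeral_obj 1)"
      using that(1) by (simp add: hom_ordinals)
    have jk: "j < length ns" using unit_index[OF that(1)] .
    have e: "[(j, ident (quest X one_cat) (?as ! j))] = reindex_arr X (function_arr [j]) ?as"
      by (simp add: reindex_arr_def quest_sel function_arr_def)
    have c: "concat_arr ?as (reindex_arr X (function_arr [j]) ?as) \<in> hom (ordinals X) (concat ?as) (?as ! j)"
      using concat_arr_hom[OF reindex_arr_hom[OF J], of ?as] by (simp add: reindex_def function_arr_def)
    have t: "function_arr f \<in> hom (ordinals X) (numeral_obj N) (concat ?as)"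
      using that(2) by (simp add: hom_ordinals length_concat o_def)
    have b: "map fst (concat_arr ?as (reindex_arr X (function_arr [j]) ?as)) = blockf ns [j]"
      using wreath_of_reindex_arr[OF J, of ?as] by (simp add: fst_concat_arr o_def)
    show ?thesis
      unfolding e F
      unfolding quest_one op_cat_sel cmp_ordinals[OF c t] using jk by (simp add: b fmap_eq_zact)
  qed
  show ?thesis
    unfolding cokl_left_unitor_def prod.case F[symmetric]
  proof (rule the_equality)
    show "\<exists>ds j' h ess \<phi>s t.
      (ds, [(j', h)], ess, \<phi>s, t) \<in> reps X (unit_functor X) \<Phi> (num N) \<and>
      cls X (unit_functor X) \<Phi> N ns (function_arr [j]) ys f =
        rep_class X (unit_functor X) \<Phi> (num N) (ds, [(j', h)], ess, \<phi>s, t) \<and>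
      F ns (function_arr [j]) ys f = fmap \<Phi> (ess ! j', ds ! j') (num N)
         (cmp (quest X one_cat) (ess ! j') (concat ess) (numeral_obj N) t
           (concat_arr ess [(j', ident (quest X one_cat) (ess ! j'))]), h) (\<phi>s ! j')"
      using cokl_repsI[of "function_arr [j]" "unit_functor X" ns ys \<Phi> f X N] j ys f val_eq[OF j f, of ys]
      by (intro exI[of _ "numeral_obj (length ns)"] exI[of _ j] exI[of _ "()"] exI[of _ "map numeral_obj ns"] exI[of _ ys]
          exI[of _ "function_arr f"]) (auto simp: unit_fobj cls_def function_arr_def)
  next
    fix y assume "\<exists>ds j' h ess \<phi>s t.
      (ds, [(j', h)], ess, \<phi>s, t) \<in> reps X (unit_functor X) \<Phi> (num N) \<and>
      cls X (unit_functor X) \<Phi> N ns (function_arr [j]) ys f =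
        rep_class X (unit_functor X) \<Phi> (num N) (ds, [(j', h)], ess, \<phi>s, t) \<and>
      y = fmap \<Phi> (ess ! j', ds ! j') (num N)
         (cmp (quest X one_cat) (ess ! j') (concat ess) (numeral_obj N) t
           (concat_arr ess [(j', ident (quest X one_cat) (ess ! j'))]), h) (\<phi>s ! j')"
    then obtain ds j' ess \<phi>s t where r: "(ds, [(j', ())], ess, \<phi>s, t) \<in> reps X (unit_functor X) \<Phi> (num N)"
      and K: "cls X (unit_functor X) \<Phi> N ns (function_arr [j]) ys f =
        rep_class X (unit_functor X) \<Phi> (num N) (ds, [(j', ())], ess, \<phi>s, t)"
      and y: "y = fmap \<Phi> (ess ! j', ds ! j') (num N)
         (cmp (quest X one_cat) (ess ! j') (concat ess) (numeral_obj N) t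
           (concat_arr ess [(j', ident (quest X one_cat) (ess ! j'))]), ()) (\<phi>s ! j')" by auto
    from cokl_reps_num[OF r] obtain ns' f' where r': "ds = numeral_obj (length ns')" "ess = map numeral_obj ns'" "t = function_arr f'"
      "[(j', ())] \<in> fobj (unit_functor X) (num (length ns'))" "\<phi>s \<in> nfam \<Phi> ns'" "f' \<in> xfun X (sum_list ns') N" by metis
    have fa: "[(j', ())] = function_arr [j']" by (simp add: function_arr_def)
    have j': "[j'] \<in> xfun X 1 (length ns')" using r'(4) unfolding fa unit_fobj by (auto simp: function_arr_def)
    have "y = F ns' (function_arr [j']) \<phi>s f'" unfolding y r'(1-3) by (rule val_eq[OF j' r'(6)])
    also have "\<dots> = H (cls X (unit_functor X) \<Phi> N ns (function_arr [j]) ys f)"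
      unfolding K r'(1-3) using H[OF r'(4-6)] by (simp add: cls_def fa)
    also have "\<dots> = F ns (function_arr [j]) ys f" by (rule H) (use j ys f in \<open>auto simp: unit_fobj\<close>)
    finally show "y = F ns (function_arr [j]) ys f" .
  qed
qed


lemma unit_nfam_iff:
  "js \<in> nfam (unit_functor X) ns \<longleftrightarrow> length js = length ns \<and> (\<forall>i<length ns. map fst (js ! i) \<in> xfun X 1 (ns ! i))"
  by (auto simp: nfam_iff unit_fobj_raw hom_ordinals)

lemma unit_dsum_xfun:
  assumes "js \<in> nfam (unit_functor X) ns"
  shows "dsum ns (map (map fst) js) \<in> xfun X (length ns) (sum_list ns)"
  using dsum_xfun[of "map (map fst) js" ns "replicate (length ns) 1" X] assms
  by (simp add: unit_nfam_iff sum_list_replicate)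

lemma unit_nfam_ones:
  assumes "js \<in> nfam (unit_functor X) ns" shows "map length (map (map fst) js) = replicate (length ns) 1"
proof (rule nth_equalityI)
  fix i assume "i < length (map length (map (map fst) js))"
  with assms have "i < length ns" "map fst (js ! i) \<in> xfun X 1 (ns ! i)" "length js = length ns" by (auto simp: unit_nfam_iff)
  with xfunD(1)[OF this(2)] show "map length (map (map fst) js) ! i = replicate (length ns) 1 ! i" by simp
qed (use assms in \<open>simp add: unit_nfam_iff\<close>)

lemma unit_zact_raw:
  assumes "f \<in> xfun X m n" "map fst i \<in> xfun X 1 m"
  shows "map fst (zact (unit_functor X) m n f i) = map ((!) f) (map fst i)"
proof -
  from assms(2) have "i \<in> fobj (unit_functor X) (num m)" by (simp add: unit_fobj_raw hom_ordinals)
  then obtain j where "i = function_arr [j]" "[j] \<in> xfun X 1 m" by (auto simp: unit_fobj)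
  then show ?thesis by (simp add: unit_zact[OF assms(1)] del: map_map)
qed

lemma right_unitor_cls:
  assumes \<Psi>: "one_functor X \<Psi>"
    and x: "x \<in> fobj \<Psi> (num (length ns))" and js: "js \<in> nfam (unit_functor X) ns" and f: "f \<in> xfun X (sum_list ns) N"
  shows "right_unitor X \<Psi> (num N) (cls X \<Psi> (unit_functor X) N ns x js f) =
    zact \<Psi> (length ns) N (map ((!) f) (dsum ns (map (map fst) js))) x"
proof -
  define F where "F = (\<lambda>ns x (js :: unit seq_arr list) f. zact \<Psi> (length ns) N (map ((!) f) (dsum ns (map (map fst) js))) x)"
  have "cls_compatible X \<Psi> (unit_functor X) N F"
    unfolding cls_compatible_def
  proof (intro conjI allI impI)
    fix ns k g x js f
    assume g: "g \<in> xfun X k (length ns)" and x: "x \<in> fobj \<Psi> (num k)" and js: "js \<in> nfam (unit_functor X) ns"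
      and f: "f \<in> xfun X (sum_list ns) N"
    let ?D = "dsum ns (map (map fst) js)" and ?D' = "dsum (map ((!) ns) g) (map ((!) (map (map fst) js)) g)"
    note D = unit_dsum_xfun[OF js]
    have li: "length js = length ns" and isi: "\<And>i. i < length ns \<Longrightarrow> map fst (js ! i) \<in> xfun X 1 (ns ! i)"
      using js by (auto simp: unit_nfam_iff)
    have m: "map (map fst) (map ((!) js) g) = map ((!) (map (map fst) js)) g"
      using xfunD(2)[OF g] li by (auto simp: subset_iff)
    have "map ((!) ?D) (blockf (map length (map (map fst) js)) g) = map ((!) (blockf ns g)) ?D'"
      by (rule dsum_blockf) (use li isi xfunD(2) xfunD(2)[OF g] in \<open>fastforce+\<close>)
    then have e: "map ((!) ?D) g = map ((!) (blockf ns g)) ?D'"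
      unfolding unit_nfam_ones[OF js] blockf_ones[OF xfunD(2)[OF g]] .
    have js_fam: "map ((!) js) g \<in> nfam (unit_functor X) (map ((!) ns) g)"
      using xfunD(2)[OF g] li isi by (auto simp: unit_nfam_iff subset_iff)
    have s: "set ?D' \<subseteq> {..<length (blockf ns g)}"
      using xfunD(2)[OF unit_dsum_xfun[OF js_fam]] unfolding m by (simp add: length_blockf)
    have "map ((!) (map ((!) f) ?D)) g = map ((!) (map ((!) f) (blockf ns g))) ?D'"
      using map_nth_comp[of g ?D f] map_nth_comp[OF s, of f] e xfunD(1)[OF D] xfunD(2)[OF g] by simp
    then show "F ns (zact \<Psi> k (length ns) g x) js f = F (map ((!) ns) g) x (map ((!) js) g) (map ((!) f) (blockf ns g))"
      using zact_comp[OF \<Psi> g xfun_comp[OF D f] x] xfunD(1)[OF g] unfolding F_def m by (simp del: map_map)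
  next
    fix ns ms fs x js f
    assume fs: "length fs = length ns" "length ms = length ns" "\<forall>i<length ns. fs ! i \<in> xfun X (ms ! i) (ns ! i)"
      and x: "x \<in> fobj \<Psi> (num (length ns))" and js: "js \<in> nfam (unit_functor X) ms" and f: "f \<in> xfun X (sum_list ns) N"
    have li: "length js = length ms" and isi: "\<And>i. i < length ms \<Longrightarrow> map fst (js ! i) \<in> xfun X 1 (ms ! i)"
      using js by (auto simp: unit_nfam_iff)
    have ms: "map length fs = ms" using fs xfunD(1) by (auto intro!: nth_equalityI)
    have d: "dsum ns fs \<in> xfun X (sum_list ms) (sum_list ns)" using dsum_xfun fs by blast
    have z: "map (map fst) (map (\<lambda>i. zact (unit_functor X) (ms ! i) (ns ! i) (fs ! i) (js ! i)) [0..<length ns]) =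
      map (\<lambda>i. map ((!) (fs ! i)) (map (map fst) js ! i)) [0..<length ns]"
      using fs li isi by (auto simp: unit_zact_raw simp del: map_map intro!: nth_equalityI)
    have "map ((!) (dsum ns fs)) (dsum ms (map (map fst) js)) =
        dsum ns (map (\<lambda>i. map ((!) (fs ! i)) (map (map fst) js ! i)) [0..<length ns])"
      unfolding ms[symmetric]
    proof (rule dsum_comp)
      fix i assume i: "i < length ns"
      have "set (map fst (js ! i)) \<subseteq> {..<ms ! i}" "length (fs ! i) = ms ! i"
        using xfunD(2)[OF isi, of i] xfunD(1)[OF fs(3)[rule_format, OF i]] i fs(2) by auto
      then show "set (map (map fst) js ! i) \<subseteq> {..<length (fs ! i)}" using i li fs(2) by simp
    qed (use li fs in simp_all)
    with map_nth_comp[of "dsum ms (map (map fst) js)" "dsum ns fs" f] xfunD(2)[OF unit_dsum_xfun[OF js]] xfunD(1)[OF d]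
    show "F ns x (map (\<lambda>i. zact (unit_functor X) (ms ! i) (ns ! i) (fs ! i) (js ! i)) [0..<length ns]) f =
        F ms x js (map ((!) f) (dsum ns fs))"
      unfolding F_def z using fs(2) by simp
  qed
  then obtain H where H: "\<And>ns x js f. \<lbrakk>x \<in> fobj \<Psi> (num (length ns)); js \<in> nfam (unit_functor X) ns; f \<in> xfun X (sum_list ns) N\<rbrakk> \<Longrightarrow>
    H (cls X \<Psi> (unit_functor X) N ns x js f) = F ns x js f"
    by (rule cls_lift[OF \<Psi> unit_functor]) blast
  have val_eq: "fmap \<Psi> (numeral_obj (length ns), ()) (num N)
      (cmp (quest X one_cat) (numeral_obj (length ns)) (concat (map numeral_obj ns)) (numeral_obj N) (function_arr f)
        (concat_arr (map numeral_obj ns) (parallel js)), ident one_cat ()) x = F ns x js f"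
    if "js \<in> nfam (unit_functor X) ns" "f \<in> xfun X (sum_list ns) N" for ns x js f
  proof -
    let ?as = "map numeral_obj ns"
    have a: "js \<in> arrows X ?as (replicate (length ns) [()])"
      using that(1) by (auto simp: arrows_def unit_nfam_iff hom_ordinals)
    have "concat (replicate (length ns) [()]) = numeral_obj (length ns)" by (induction ns) auto
    then have c: "concat_arr ?as (parallel js) \<in> hom (ordinals X) (concat ?as) (numeral_obj (length ns))"
      using concat_arr_hom[OF parallel_hom[OF a]] by simp
    have t: "function_arr f \<in> hom (ordinals X) (numeral_obj N) (concat ?as)"
      using that(2) by (simp add: hom_ordinals length_concat o_def)
    have "wreath_of (parallel js) = zip [0..<length js] (map (map fst) js)"
      by (rule nth_equalityI) (auto simp: wreath_of_def)
    then have b: "map fst (concat_arr ?as (parallel js)) = dsum ns (map (map fst) js)"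
      by (simp add: fst_concat_arr dsum_def o_def)
    show ?thesis
      unfolding F_def quest_one op_cat_sel cmp_ordinals[OF c t] by (simp add: b fmap_eq_zact del: map_map)
  qed
  show ?thesis
    unfolding cokl_right_unitor_def prod.case F_def[THEN fun_cong, THEN fun_cong, THEN fun_cong, THEN fun_cong, symmetric]
  proof (rule the_equality)
    show "\<exists>ds \<psi> ess js' t.
      (ds, \<psi>, ess, js', t) \<in> reps X \<Psi> (unit_functor X) (num N) \<and>
      cls X \<Psi> (unit_functor X) N ns x js f =
        rep_class X \<Psi> (unit_functor X) (num N) (ds, \<psi>, ess, js', t) \<and>
      F ns x js f = fmap \<Psi> (ds, ()) (num N)
         (cmp (quest X one_cat) ds (concat ess) (numeral_obj N) t (concat_arr ess (parallel js')), ident one_cat ()) \<psi>"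
      using cokl_repsI[OF x js f] val_eq[OF js f, of x]
      by (intro exI[of _ "numeral_obj (length ns)"] exI[of _ x] exI[of _ "map numeral_obj ns"] exI[of _ js]
          exI[of _ "function_arr f"]) (auto simp: cls_def)
  next
    fix y assume "\<exists>ds \<psi> ess js' t.
      (ds, \<psi>, ess, js', t) \<in> reps X \<Psi> (unit_functor X) (num N) \<and>
      cls X \<Psi> (unit_functor X) N ns x js f =
        rep_class X \<Psi> (unit_functor X) (num N) (ds, \<psi>, ess, js', t) \<and>
      y = fmap \<Psi> (ds, ()) (num N)
         (cmp (quest X one_cat) ds (concat ess) (numeral_obj N) t (concat_arr ess (parallel js')), ident one_cat ()) \<psi>"
    then obtain ds \<psi> ess js' t where r: "(ds, \<psi>, ess, js', t) \<in> reps X \<Psi> (unit_functor X) (num N)"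
      and K: "cls X \<Psi> (unit_functor X) N ns x js f =
        rep_class X \<Psi> (unit_functor X) (num N) (ds, \<psi>, ess, js', t)"
      and y: "y = fmap \<Psi> (ds, ()) (num N)
         (cmp (quest X one_cat) ds (concat ess) (numeral_obj N) t (concat_arr ess (parallel js')), ident one_cat ()) \<psi>" by auto
    from cokl_reps_num[OF r] obtain ns' f' where r': "ds = numeral_obj (length ns')" "ess = map numeral_obj ns'" "t = function_arr f'"
      "\<psi> \<in> fobj \<Psi> (num (length ns'))" "js' \<in> nfam (unit_functor X) ns'" "f' \<in> xfun X (sum_list ns') N" by metis
    have "y = F ns' \<psi> js' f'" unfolding y r'(1-3) by (rule val_eq[OF r'(5,6)])
    also have "\<dots> = H (cls X \<Psi> (unit_functor X) N ns x js f)"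
      unfolding K r'(1-3) using H[OF r'(4-6)] by (simp add: cls_def)
    also have "\<dots> = F ns x js f" by (rule H[OF x js f])
    finally show "y = F ns x js f" .
  qed
qed


subsection \<open>The associator\<close>

lemma concat_numeral_obj: "concat (map numeral_obj ns) = numeral_obj (sum_list ns)"
  by (induction ns) (auto simp: replicate_add)

text \<open>The class to which the associator sends \<open>\<langle>\<langle>x; ys; s\<rangle>; zs; t\<rangle>\<close> when the values of \<open>s\<close> are cut into the blocks \<open>ss\<close>:
  the block of \<open>zs\<close> selected by \<open>ss ! i\<close> becomes the list of arguments of \<open>ys ! i\<close>.\<close>

definition assoc_cls where
  "assoc_cls X \<Xi> \<Psi> \<Phi> N x ys ps zs ss t = cls X \<Xi> (comp X \<Psi> \<Phi>) N (map (\<lambda>s. sum_list (map ((!) ps) s)) ss) x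
     (map2 (\<lambda>y s. cls X \<Psi> \<Phi> (sum_list (map ((!) ps) s)) (map ((!) ps) s) y (map ((!) zs) s) [0..<sum_list (map ((!) ps) s)]) ys ss)
     (map ((!) t) (blockf ps (concat ss)))"

lemma assoc_rep_cls:
  assumes \<Phi>: "one_functor X \<Phi>"
    and ys: "ys \<in> nfam \<Psi> ns" and s: "s \<in> xfun X (sum_list ns) (length ps)"
    and zs: "zs \<in> nfam \<Phi> ps" and t: "t \<in> xfun X (sum_list ps) N"
  shows "rep_class X \<Xi> (comp X \<Psi> \<Phi>) (num N)
      (assoc_rep X \<Psi> \<Phi> (numeral_obj N)
        (numeral_obj (length ns), x, map numeral_obj ns, ys, function_arr s)
        (numeral_obj (length ps)) (map numeral_obj ps) zs (function_arr t)) =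
    assoc_cls X \<Xi> \<Psi> \<Phi> N x ys ps zs (chunks ns s) t"
proof -
  let ?as = "map numeral_obj ps" and ?ss = "chunks ns s"
  have ls: "length s = sum_list ns" and ss: "set s \<subseteq> {..<length ps}" using xfunD[OF s] by auto
  have lss: "map length ?ss = ns" and css: "concat ?ss = s" using length_chunks[OF ls] concat_chunks[OF ls] by auto
  have lenss: "length ?ss = length ns" and lssi: "\<And>i. i < length ns \<Longrightarrow> length (?ss ! i) = ns ! i"
    using lss by (metis length_map) (metis lss length_map nth_map)
  have sssi: "set (?ss ! i) \<subseteq> {..<length ps}" if "i < length ns" for i
  proof -
    have "?ss ! i \<in> set ?ss" using lenss that by simp
    then have "set (?ss ! i) \<subseteq> set (concat ?ss)" by auto
    then show ?thesis using ss unfolding css by blast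
  qed
  have J: "function_arr s \<in> hom (ordinals X) (numeral_obj (length ps)) (numeral_obj (sum_list ns))"
    using s by (simp add: hom_ordinals)
  have ess': "map (\<lambda>(g, u). ?as ! g) (function_arr s) = map numeral_obj (map ((!) ps) s)"
    using ss by (auto simp: function_arr_def subset_iff)
  have re: "reindex (function_arr s) ?as = map numeral_obj (map ((!) ps) s)"
    using ss by (auto simp: function_arr_def reindex_def subset_iff)
  have e: "map (\<lambda>(g, u). (g, ident (quest X one_cat) (?as ! g))) (function_arr s) = reindex_arr X (function_arr s) ?as"
    by (simp add: reindex_arr_def quest_sel function_arr_def)
  have c: "concat_arr ?as (reindex_arr X (function_arr s) ?as) \<in> hom (ordinals X) (concat ?as) (concat (map numeral_obj (map ((!) ps) s)))"
    using concat_arr_hom[OF reindex_arr_hom[OF J], of ?as] unfolding re by simp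
  have t': "function_arr t \<in> hom (ordinals X) (numeral_obj N) (concat ?as)"
    using t by (simp add: hom_ordinals length_concat o_def)
  have b: "map fst (concat_arr ?as (reindex_arr X (function_arr s) ?as)) = blockf ps s"
    using wreath_of_reindex_arr[OF J, of ?as] by (simp add: fst_concat_arr o_def)
  have T: "cmp (quest X one_cat) (concat (map numeral_obj (map ((!) ps) s))) (concat ?as) (numeral_obj N) (function_arr t)
      (concat_arr ?as (map (\<lambda>(g, u). (g, ident (quest X one_cat) (?as ! g))) (function_arr s))) =
      function_arr (map ((!) t) (blockf ps s))"
    unfolding e
    unfolding quest_one op_cat_sel cmp_ordinals[OF c t'] b map_fst_function_arr ..
  have Z: "map (\<lambda>p. case function_arr s ! p of (g, u) \<Rightarrow>
      fmap \<Phi> (?as ! g, numeral_obj (length ps) ! g) (?as ! g, concat (map numeral_obj ns) ! p) (ident (quest X one_cat) (?as ! g), u) (zs ! g))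
      [0..<length (concat (map numeral_obj ns))] = map ((!) zs) s"
    unfolding concat_numeral_obj length_replicate
  proof (rule nth_equalityI, goal_cases)
    case 1 then show ?case by (simp add: ls)
  next
    case (2 p)
    then have p: "p < sum_list ns" by simp
    then have "s ! p < length ps" using ls ss by (simp add: subset_iff)
    moreover from this have "zs ! (s ! p) \<in> fobj \<Phi> (num (ps ! (s ! p)))" using zs by (simp add: nfam_iff)
    ultimately show ?case
      using p ls functor_id[OF \<Phi>] by (simp add: function_arr_def quest_sel)
  qed
  have E: "map concat (map (map numeral_obj) (map (map ((!) ps)) ?ss)) = map numeral_obj (map (\<lambda>s. sum_list (map ((!) ps) s)) ?ss)"
    using concat_numeral_obj[of "map ((!) ps) _"] by (simp add: o_def)
  have L: "map (\<lambda>i. rep_class X \<Psi> \<Phi>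
      (concat (map (map numeral_obj) (map (map ((!) ps)) ?ss) ! i), numeral_obj (length ns) ! i)
      (map numeral_obj ns ! i, ys ! i, map (map numeral_obj) (map (map ((!) ps)) ?ss) ! i, map (map ((!) zs)) ?ss ! i,
        ident (quest X one_cat) (concat (map (map numeral_obj) (map (map ((!) ps)) ?ss) ! i)))) [0..<length (numeral_obj (length ns))] =
    map2 (\<lambda>y s. cls X \<Psi> \<Phi> (sum_list (map ((!) ps) s)) (map ((!) ps) s) y (map ((!) zs) s) [0..<sum_list (map ((!) ps) s)]) ys ?ss"
  proof (rule nth_equalityI, goal_cases)
    case 1 then show ?case using lenss ys by (simp add: nfam_iff)
  next
    case (2 i)
    then have i: "i < length ns" by simp
    have c: "concat (map numeral_obj (map ((!) ps) (?ss ! i))) = numeral_obj (sum_list (map ((!) ps) (?ss ! i)))"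
      by (rule concat_numeral_obj)
    show ?case using i lenss lssi[OF i] ys c by (simp add: nfam_iff cls_def quest_sel ident_ordinals)
  qed
  show ?thesis
    unfolding cokl_assoc_rep_def Let_def prod.case Z ess' T
    unfolding map_map[symmetric, of length] chunks_map
    unfolding map_length_numeral_obj chunks_map E L assoc_cls_def cls_def[of X \<Xi>] css
    using lenss by simp
qed

lemma
  assumes "ys \<in> nfam \<Psi> ns" "map length ss = ns" "set (concat ss) \<subseteq> {..<length ps}" "zs \<in> nfam \<Phi> ps"
  shows assoc_cls_fam: "map2 (\<lambda>y s. cls X \<Psi> \<Phi> (sum_list (map ((!) ps) s)) (map ((!) ps) s) y (map ((!) zs) s) [0..<sum_list (map ((!) ps) s)]) ys ss
      \<in> nfam (comp X \<Psi> \<Phi>) (map (\<lambda>s. sum_list (map ((!) ps) s)) ss)" (is ?A)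
    and assoc_cls_chunk_fam: "i < length ns \<Longrightarrow> map ((!) zs) (ss ! i) \<in> nfam \<Phi> (map ((!) ps) (ss ! i))" (is "_ \<Longrightarrow> ?B i")
proof -
  have l: "length ss = length ns" "length ys = length ns" using assms(1,2) by (auto simp: nfam_iff)
  have D: "set (ss ! i) \<subseteq> {..<length ps}" if "i < length ns" for i
    using assms(3) l that nth_mem[of i ss] by (fastforce simp: subset_iff)
  have C: "ys ! i \<in> fobj \<Psi> (num (length (ss ! i)))" if "i < length ns" for i
  proof -
    have "ns ! i = length (ss ! i)" using that l(1) nth_map[of i ss length] assms(2) by metis
    moreover have "ys ! i \<in> fobj \<Psi> (num (ns ! i))" using assms(1) that by (simp add: nfam_iff)
    ultimately show ?thesis by metis
  qed
  show B: "?B i" if "i < length ns" for i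
    using D[OF that] assms(4) by (auto simp: nfam_iff subset_iff)
  show ?A
    using l B C by (auto simp: nfam_iff[of _ "comp X \<Psi> \<Phi>"] intro!: cls_closed)
qed


lemma blockf_precomp:
  assumes s: "s \<in> xfun X (sum_list ns) (length ps)" and h: "h \<in> xfun X m (sum_list ns)"
  shows "map ((!) t) (blockf ps (map ((!) s) h)) =
    map ((!) (map ((!) t) (blockf ps s))) (blockf (map ((!) ps) s) h)"
proof -
  have hl: "set h \<subseteq> {..<length s}" using xfunD(2)[OF h] xfunD(1)[OF s] by simp
  have "h \<in> xfun X m (length (map ((!) ps) s))" using h xfunD(1)[OF s] by simp
  from xfunD(2)[OF blockf_xfun[OF this]]
  have "set (blockf (map ((!) ps) s) h) \<subseteq> {..<length (blockf ps s)}" by (simp add: length_blockf)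
  then show ?thesis
    by (simp only: map_nth_comp[symmetric] blockf_comp[OF xfunD(2)[OF s] hl])
qed

text \<open>Independence of the representative of the inner class. Reindexing \<open>x\<close> moves blocks of blocks
  (\<open>blockf_concat_blockf\<close>), while a map acting on \<open>ys ! i\<close> becomes a block map inside the \<open>i\<close>-th group of arguments
  (\<open>blockf_concat_dsum\<close>), hence an action on the \<open>i\<close>-th new argument.\<close>

lemma assoc_inner:
  assumes \<Xi>: "one_functor X \<Xi>" and \<Psi>: "one_functor X \<Psi>" and \<Phi>: "one_functor X \<Phi>"
    and zs: "zs \<in> nfam \<Phi> ps" and t: "t \<in> xfun X (sum_list ps) N"
  shows "cls_compatible X \<Xi> \<Psi> (length ps) (\<lambda>ns x ys s. assoc_cls X \<Xi> \<Psi> \<Phi> N x ys ps zs (chunks ns s) t)"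
  unfolding cls_compatible_def
proof (intro conjI allI impI)
  fix ns k g x ys s
  assume g: "g \<in> xfun X k (length ns)" and x: "x \<in> fobj \<Xi> (num k)" and ys: "ys \<in> nfam \<Psi> ns"
    and s: "s \<in> xfun X (sum_list ns) (length ps)"
  note ch = chunks_xfun[OF s]
  define ss where "ss = chunks ns s"
  note ch = ch[folded ss_def]
  define SS where "SS = map (\<lambda>s. sum_list (map ((!) ps) s)) ss"
  define w where "w = (\<lambda>y s. cls X \<Psi> \<Phi> (sum_list (map ((!) ps) s)) (map ((!) ps) s) y (map ((!) zs) s) [0..<sum_list (map ((!) ps) s)])"
  let ?T = "map ((!) t) (blockf ps s)" and ?b = "blockf ns g"
  have gl: "set g \<subseteq> {..<length ss}" using xfunD(2)[OF g] ch(3) by simp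
  have gy: "set g \<subseteq> {..<length ys}" using xfunD(2)[OF g] ys by (simp add: nfam_iff)
  have sSS: "sum_list SS = sum_list (map ((!) ps) s)"
    using sum_list_map_concat[of "(!) ps" ss] ch(2) by (simp add: SS_def)
  have T: "?T \<in> xfun X (sum_list SS) N" unfolding sSS by (rule xfun_comp[OF blockf_xfun[OF s] t])
  have W: "map2 w ys ss \<in> nfam (comp X \<Psi> \<Phi>) SS"
    unfolding w_def SS_def
    by (rule assoc_cls_fam[OF ys ch(1) _ zs]) (use ch(2) xfunD(2)[OF s] in simp)
  have b: "?b \<in> xfun X (sum_list (map ((!) ns) g)) (sum_list ns)" by (rule blockf_xfun[OF g])
  have c': "concat (map ((!) ss) g) = map ((!) s) ?b" using nth_concat_blockf[OF gl] unfolding ch(1,2) by simp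
  have "map length (map ((!) ss) g) = map ((!) ns) g" using gl ch(3,4) by (auto simp: subset_iff)
  then have chg: "chunks (map ((!) ns) g) (map ((!) s) ?b) = map ((!) ss) g"
    unfolding c'[symmetric] by (rule chunks_concat)
  have gSS: "g \<in> xfun X k (length SS)" using g ch(3) by (simp add: SS_def)
  have e1: "map ((!) SS) g = map (\<lambda>s. sum_list (map ((!) ps) s)) (map ((!) ss) g)"
    using gl by (auto simp: SS_def subset_iff)
  have e2: "map ((!) (map2 w ys ss)) g = map2 w (map ((!) ys) g) (map ((!) ss) g)"
    using gl gy by (auto simp: subset_iff intro!: nth_equalityI)
  have "blockf (concat (map (map ((!) ps)) ss)) (blockf (map length (map (map ((!) ps)) ss)) g) =
      blockf (map sum_list (map (map ((!) ps)) ss)) g"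
    by (rule blockf_concat_blockf) (use gl in simp)
  then have "blockf (map ((!) ps) s) ?b = blockf SS g"
    unfolding map_concat[symmetric] ch(2) by (simp add: SS_def o_def ch(1)[simplified])
  then have e3: "map ((!) ?T) (blockf SS g) = map ((!) t) (blockf ps (map ((!) s) ?b))"
    unfolding blockf_precomp[OF s b] by simp
  have "assoc_cls X \<Xi> \<Psi> \<Phi> N (zact \<Xi> k (length ns) g x) ys ps zs ss t =
    cls X \<Xi> (comp X \<Psi> \<Phi>) N SS (zact \<Xi> k (length SS) g x) (map2 w ys ss) ?T"
    unfolding assoc_cls_def ch(2) w_def SS_def by (simp add: ch(3))
  also have "\<dots> = cls X \<Xi> (comp X \<Psi> \<Phi>) N (map ((!) SS) g) x (map ((!) (map2 w ys ss)) g) (map ((!) ?T) (blockf SS g))"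
    by (rule cls_blockf[OF \<Xi> comp_functor[OF \<Psi> \<Phi>] gSS x W T])
  also have "\<dots> = assoc_cls X \<Xi> \<Psi> \<Phi> N x (map ((!) ys) g) ps zs (map ((!) ss) g) t"
    unfolding assoc_cls_def c' e1 e2 e3 by (simp only: w_def)
  finally show "assoc_cls X \<Xi> \<Psi> \<Phi> N (zact \<Xi> k (length ns) g x) ys ps zs (chunks ns s) t =
     assoc_cls X \<Xi> \<Psi> \<Phi> N x (map ((!) ys) g) ps zs (chunks (map ((!) ns) g) (map ((!) s) ?b)) t"
    unfolding chg ss_def .
next
  fix ns ms fs x ys s
  assume fs: "length fs = length ns" "length ms = length ns" "\<forall>i<length ns. fs ! i \<in> xfun X (ms ! i) (ns ! i)"
    and x: "x \<in> fobj \<Xi> (num (length ns))" and ys: "ys \<in> nfam \<Psi> ms" and s: "s \<in> xfun X (sum_list ns) (length ps)"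
  note ch = chunks_xfun[OF s]
  define ss where "ss = chunks ns s"
  note ch = ch[folded ss_def]
  define SS where "SS = map (\<lambda>s. sum_list (map ((!) ps) s)) ss"
  define w where "w = (\<lambda>y s. cls X \<Psi> \<Phi> (sum_list (map ((!) ps) s)) (map ((!) ps) s) y (map ((!) zs) s) [0..<sum_list (map ((!) ps) s)])"
  define ss' where "ss' = map (\<lambda>i. map ((!) (ss ! i)) (fs ! i)) [0..<length ns]"
  define SS' where "SS' = map (\<lambda>s. sum_list (map ((!) ps) s)) ss'"
  let ?T = "map ((!) t) (blockf ps s)" and ?d = "dsum ns fs"
  let ?ys = "map (\<lambda>i. zact \<Psi> (ms ! i) (ns ! i) (fs ! i) (ys ! i)) [0..<length ns]"
  have fi: "fs ! i \<in> xfun X (ms ! i) (ns ! i)" if "i < length ns" for i using fs(3) that by blast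
  have yi: "ys ! i \<in> fobj \<Psi> (num (ms ! i))" if "i < length ns" for i using ys that fs(2) by (simp add: nfam_iff)
  have fsi: "set (fs ! i) \<subseteq> {..<length (ss ! i)}" if "i < length ns" for i
    using xfunD(2)[OF fi[OF that]] ch(4)[OF that] by simp
  have d: "?d \<in> xfun X (sum_list ms) (sum_list ns)" by (rule dsum_xfun[OF fs(1,2) fi])
  have sSS: "sum_list SS = sum_list (map ((!) ps) s)"
    using sum_list_map_concat[of "(!) ps" ss] ch(2) by (simp add: SS_def)
  have T: "?T \<in> xfun X (sum_list SS) N" unfolding sSS by (rule xfun_comp[OF blockf_xfun[OF s] t])
  have css': "concat ss' = map ((!) s) ?d"
    using nth_concat_dsum[of fs ss] fs(1) fsi unfolding ch(1,2,3) ss'_def by simp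
  have lss': "map length ss' = ms"
    using fs xfunD(1)[OF fi] by (auto simp: ss'_def intro!: nth_equalityI)
  have chd: "chunks ms (map ((!) s) ?d) = ss'" unfolding css'[symmetric] by (rule chunks_concat[OF lss'])
  have sd: "set (concat ss') \<subseteq> {..<length ps}" unfolding css' using xfunD(2)[OF xfun_comp[OF d s]] .
  have W': "map2 w ys ss' \<in> nfam (comp X \<Psi> \<Phi>) SS'"
    unfolding w_def SS'_def by (rule assoc_cls_fam[OF ys lss' sd zs])
  let ?B = "map (\<lambda>i. blockf (map (map ((!) ps)) ss ! i) (fs ! i)) [0..<length ns]"
  have ss'i: "map ((!) ps) (ss' ! i) = map ((!) (map ((!) ps) (ss ! i))) (fs ! i)"
      "map ((!) zs) (ss' ! i) = map ((!) (map ((!) zs) (ss ! i))) (fs ! i)" if "i < length ns" for i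
  proof -
    have "ss' ! i = map ((!) (ss ! i)) (fs ! i)" using that by (simp add: ss'_def)
    then show "map ((!) ps) (ss' ! i) = map ((!) (map ((!) ps) (ss ! i))) (fs ! i)"
      "map ((!) zs) (ss' ! i) = map ((!) (map ((!) zs) (ss ! i))) (fs ! i)"
      by (simp_all only: map_nth_comp[OF fsi[OF that]])
  qed
  have Bi: "?B ! i \<in> xfun X (SS' ! i) (SS ! i)" if i: "i < length ns" for i
  proof -
    have "fs ! i \<in> xfun X (ms ! i) (length (map ((!) ps) (ss ! i)))" using fi[OF i] ch(4)[OF i] by simp
    from blockf_xfun[OF this] show ?thesis
      using i ch(3) ss'i(1)[OF i] by (simp add: SS'_def SS_def ss'_def del: map_map)
  qed
  have Wi: "w (zact \<Psi> (ms ! i) (ns ! i) (fs ! i) (ys ! i)) (ss ! i) =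
      zact (comp X \<Psi> \<Phi>) (SS' ! i) (SS ! i) (?B ! i) (w (ys ! i) (ss' ! i))" if i: "i < length ns" for i
  proof -
    let ?p = "map ((!) ps) (ss ! i)" and ?z = "map ((!) zs) (ss ! i)" and ?p' = "map ((!) ps) (ss' ! i)" and ?z' = "map ((!) zs) (ss' ! i)"
    have f': "fs ! i \<in> xfun X (ms ! i) (length ?p)" using fi[OF i] ch(4)[OF i] by simp
    have B: "?B ! i = blockf ?p (fs ! i)" using i ch(3) by simp
    have SSi: "SS ! i = sum_list ?p" "SS' ! i = sum_list ?p'" using i ch(3) by (simp_all add: SS_def SS'_def ss'_def)
    have p': "map ((!) ?p) (fs ! i) = ?p'" "map ((!) ?z) (fs ! i) = ?z'" using ss'i[OF i] by simp_all
    have z: "?z \<in> nfam \<Phi> ?p" using ch(5)[OF i] zs by (auto simp: nfam_iff subset_iff)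
    have z': "?z' \<in> nfam \<Phi> ?p'" using i by (intro assoc_cls_chunk_fam[OF ys lss' sd zs]) (simp add: fs(2))
    have l': "length ?p' = ms ! i" using i lss' fs(2) by (metis length_map nth_map)
    have bx: "blockf ?p (fs ! i) \<in> xfun X (sum_list ?p') (sum_list ?p)" using blockf_xfun[OF f'] unfolding p' .
    have "w (zact \<Psi> (ms ! i) (ns ! i) (fs ! i) (ys ! i)) (ss ! i) =
        cls X \<Psi> \<Phi> (sum_list ?p) ?p (zact \<Psi> (ms ! i) (length ?p) (fs ! i) (ys ! i)) ?z [0..<sum_list ?p]"
      unfolding w_def using ch(4)[OF i] by simp
    also have "\<dots> = cls X \<Psi> \<Phi> (sum_list ?p) ?p' (ys ! i) ?z' (blockf ?p (fs ! i))"
      unfolding cls_blockf[OF \<Psi> \<Phi> f' yi[OF i] z xfun_id] p' map_nth_upt[OF xfunD(2)[OF bx]] ..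
    also have "\<dots> = zact (comp X \<Psi> \<Phi>) (sum_list ?p') (sum_list ?p) (blockf ?p (fs ! i)) (w (ys ! i) (ss' ! i))"
      unfolding w_def using comp_zact[OF \<Psi> \<Phi> bx _ z' xfun_id, of "ys ! i"] yi[OF i] l' xfunD(1)[OF bx]
      by (simp add: map_nth_id)
    finally show ?thesis unfolding B SSi .
  qed
  have lz: "length ys = length ns" using ys fs(2) by (simp add: nfam_iff)
  have W: "map2 w ?ys ss = map (\<lambda>i. zact (comp X \<Psi> \<Phi>) (SS' ! i) (SS ! i) (?B ! i) (map2 w ys ss' ! i)) [0..<length SS]"
    using Wi ch(3) lz by (intro nth_equalityI) (auto simp: SS_def ss'_def)
  have "blockf (concat (map (map ((!) ps)) ss)) (dsum (map length (map (map ((!) ps)) ss)) fs) =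
      dsum (map sum_list (map (map ((!) ps)) ss)) (map (\<lambda>i. blockf (map (map ((!) ps)) ss ! i) (fs ! i)) [0..<length (map (map ((!) ps)) ss)])"
    by (rule blockf_concat_dsum) (use fs(1) ch(3) fsi in simp_all)
  then have "blockf (map ((!) ps) s) ?d = dsum SS ?B"
    unfolding map_concat[symmetric] ch(2) by (simp add: SS_def o_def ch(1)[simplified] ch(3))
  then have e3: "map ((!) ?T) (dsum SS ?B) = map ((!) t) (blockf ps (map ((!) s) ?d))"
    unfolding blockf_precomp[OF s d] by simp
  have "assoc_cls X \<Xi> \<Psi> \<Phi> N x ?ys ps zs ss t = cls X \<Xi> (comp X \<Psi> \<Phi>) N SS x (map2 w ?ys ss) ?T"
    unfolding assoc_cls_def ch(2) w_def SS_def ..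
  also have "\<dots> = cls X \<Xi> (comp X \<Psi> \<Phi>) N SS' x (map2 w ys ss') (map ((!) ?T) (dsum SS ?B))"
    unfolding W
    by (rule cls_dsum[OF comp_functor[OF \<Psi> \<Phi>] _ _ _ W' T]) (use ch(3) Bi in \<open>auto simp: SS_def SS'_def ss'_def\<close>)
  also have "\<dots> = assoc_cls X \<Xi> \<Psi> \<Phi> N x ys ps zs ss' t"
    unfolding assoc_cls_def css' e3 by (simp only: w_def SS'_def)
  finally show "assoc_cls X \<Xi> \<Psi> \<Phi> N x ?ys ps zs (chunks ns s) t =
     assoc_cls X \<Xi> \<Psi> \<Phi> N x ys ps zs (chunks ms (map ((!) s) ?d)) t"
    unfolding chd ss_def .
qed


text \<open>The associator as a function of the inner class; \<open>assoc_inner\<close> shows that it exists.\<close>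

definition assoc_lift where
  "assoc_lift X \<Xi> \<Psi> \<Phi> N ps zs t = (SOME H. \<forall>ns x ys s. x \<in> fobj \<Xi> (num (length ns)) \<longrightarrow> ys \<in> nfam \<Psi> ns \<longrightarrow>
     s \<in> xfun X (sum_list ns) (length ps) \<longrightarrow>
     H (cls X \<Xi> \<Psi> (length ps) ns x ys s) = assoc_cls X \<Xi> \<Psi> \<Phi> N x ys ps zs (chunks ns s) t)"

lemma assoc_lift:
  assumes \<Xi>: "one_functor X \<Xi>" and \<Psi>: "one_functor X \<Psi>" and \<Phi>: "one_functor X \<Phi>"
    and zs: "zs \<in> nfam \<Phi> ps" and t: "t \<in> xfun X (sum_list ps) N"
    and x: "x \<in> fobj \<Xi> (num (length ns))" and ys: "ys \<in> nfam \<Psi> ns" and s: "s \<in> xfun X (sum_list ns) (length ps)"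
  shows "assoc_lift X \<Xi> \<Psi> \<Phi> N ps zs t (cls X \<Xi> \<Psi> (length ps) ns x ys s) =
    assoc_cls X \<Xi> \<Psi> \<Phi> N x ys ps zs (chunks ns s) t"
proof -
  obtain H where "\<And>ns x ys s. \<lbrakk>x \<in> fobj \<Xi> (num (length ns)); ys \<in> nfam \<Psi> ns; s \<in> xfun X (sum_list ns) (length ps)\<rbrakk> \<Longrightarrow>
     H (cls X \<Xi> \<Psi> (length ps) ns x ys s) = assoc_cls X \<Xi> \<Psi> \<Phi> N x ys ps zs (chunks ns s) t"
    by (rule cls_lift[OF \<Xi> \<Psi> assoc_inner[OF \<Xi> \<Psi> \<Phi> zs t]]) blast
  then have "\<exists>H. \<forall>ns x ys s. x \<in> fobj \<Xi> (num (length ns)) \<longrightarrow> ys \<in> nfam \<Psi> ns \<longrightarrow>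
     s \<in> xfun X (sum_list ns) (length ps) \<longrightarrow>
     H (cls X \<Xi> \<Psi> (length ps) ns x ys s) = assoc_cls X \<Xi> \<Psi> \<Phi> N x ys ps zs (chunks ns s) t"
    by blast
  from someI_ex[OF this, folded assoc_lift_def] x ys s show ?thesis by blast
qed

text \<open>Independence of the representative of the outer class. Here an action on the inner class only changes its
  map \<open>s\<close> (\<open>comp_zact\<close>), and actions on the \<open>zs\<close> pass to the new arguments, where their sums add up to one sum
  (\<open>dsum_concat_dsum\<close>) that can be moved past the block map of \<open>s\<close> (\<open>dsum_blockf\<close>).\<close>

lemma assoc_outer:
  assumes \<Xi>: "one_functor X \<Xi>" and \<Psi>: "one_functor X \<Psi>" and \<Phi>: "one_functor X \<Phi>"
  shows "cls_compatible X (comp X \<Xi> \<Psi>) \<Phi> N (\<lambda>ps \<chi> zs t. assoc_lift X \<Xi> \<Psi> \<Phi> N ps zs t \<chi>)"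
  unfolding cls_compatible_def
proof (intro conjI allI impI)
  fix ps k g \<chi> zs t
  assume g: "g \<in> xfun X k (length ps)" and \<chi>: "\<chi> \<in> fobj (comp X \<Xi> \<Psi>) (num k)" and zs: "zs \<in> nfam \<Phi> ps"
    and t: "t \<in> xfun X (sum_list ps) N"
  from \<chi> obtain ns x ys s where x: "x \<in> fobj \<Xi> (num (length ns))" and ys: "ys \<in> nfam \<Psi> ns"
    and s: "s \<in> xfun X (sum_list ns) k" and \<chi>: "\<chi> = cls X \<Xi> \<Psi> k ns x ys s"
    by (elim clsE[OF \<Psi>])
  let ?ps = "map ((!) ps) g" and ?zs = "map ((!) zs) g" and ?t = "map ((!) t) (blockf ps g)"
  define ss where "ss = chunks ns s"
  note ch = chunks_xfun[OF s, folded ss_def]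
  have lps: "length ?ps = k" using xfunD(1)[OF g] by simp
  have zs': "?zs \<in> nfam \<Phi> ?ps" using zs xfunD(2)[OF g] by (auto simp: nfam_iff subset_iff)
  have t': "?t \<in> xfun X (sum_list ?ps) N" by (rule xfun_comp[OF blockf_xfun[OF g] t])
  have gs: "map ((!) g) s \<in> xfun X (sum_list ns) (length ps)" by (rule xfun_comp[OF s g])
  have eq: "map ((!) ps) (map ((!) g) s') = map ((!) ?ps) s'" "map ((!) zs) (map ((!) g) s') = map ((!) ?zs) s'"
    if "s' \<in> set ss" for s'
  proof -
    have "set s' \<subseteq> {..<length g}" using that ch(2) xfunD(2)[OF s] xfunD(1)[OF g] by fastforce
    then show "map ((!) ps) (map ((!) g) s') = map ((!) ?ps) s'" "map ((!) zs) (map ((!) g) s') = map ((!) ?zs) s'"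
      by (rule map_nth_comp)+
  qed
  have sg: "set s \<subseteq> {..<length g}" using xfunD(2)[OF s] xfunD(1)[OF g] by simp
  have "set (blockf ?ps s) \<subseteq> {..<length (blockf ps g)}"
    using xfunD(2)[OF blockf_xfun[of s X "sum_list ns" ?ps]] s lps by (simp add: length_blockf)
  then have e3: "map ((!) ?t) (blockf ?ps s) = map ((!) t) (blockf ps (map ((!) g) s))"
    by (simp only: map_nth_comp[symmetric] blockf_comp[OF xfunD(2)[OF g] sg])
  have e1: "map (\<lambda>s. sum_list (map ((!) ps) s)) (map (map ((!) g)) ss) = map (\<lambda>s. sum_list (map ((!) ?ps) s)) ss"
    by (rule nth_equalityI) (simp_all add: eq del: map_map)
  have e2: "map2 (\<lambda>y s. cls X \<Psi> \<Phi> (sum_list (map ((!) ps) s)) (map ((!) ps) s) y (map ((!) zs) s) [0..<sum_list (map ((!) ps) s)])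
      ys (map (map ((!) g)) ss) =
    map2 (\<lambda>y s. cls X \<Psi> \<Phi> (sum_list (map ((!) ?ps) s)) (map ((!) ?ps) s) y (map ((!) ?zs) s) [0..<sum_list (map ((!) ?ps) s)]) ys ss"
    by (rule nth_equalityI) (simp_all add: eq del: map_map)
  have "assoc_lift X \<Xi> \<Psi> \<Phi> N ps zs t (zact (comp X \<Xi> \<Psi>) k (length ps) g \<chi>) =
    assoc_cls X \<Xi> \<Psi> \<Phi> N x ys ps zs (map (map ((!) g)) ss) t"
    unfolding \<chi> comp_zact[OF \<Xi> \<Psi> g x ys s] assoc_lift[OF \<Xi> \<Psi> \<Phi> zs t x ys gs] chunks_map ss_def ..
  also have "\<dots> = assoc_cls X \<Xi> \<Psi> \<Phi> N x ys ?ps ?zs ss ?t"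
    unfolding assoc_cls_def map_concat[symmetric] ch(2) e3 e1 e2 ..
  also have "\<dots> = assoc_lift X \<Xi> \<Psi> \<Phi> N ?ps ?zs ?t \<chi>"
    using assoc_lift[OF \<Xi> \<Psi> \<Phi> zs' t' x ys, unfolded lps, OF s] unfolding \<chi> ss_def by simp
  finally show "assoc_lift X \<Xi> \<Psi> \<Phi> N ps zs t (zact (comp X \<Xi> \<Psi>) k (length ps) g \<chi>) = assoc_lift X \<Xi> \<Psi> \<Phi> N ?ps ?zs ?t \<chi>" .
next
  fix ps ms fs \<chi> zs t
  assume fs: "length fs = length ps" "length ms = length ps" "\<forall>i<length ps. fs ! i \<in> xfun X (ms ! i) (ps ! i)"
    and \<chi>: "\<chi> \<in> fobj (comp X \<Xi> \<Psi>) (num (length ps))" and zs: "zs \<in> nfam \<Phi> ms" and t: "t \<in> xfun X (sum_list ps) N"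
  from \<chi> obtain ns x ys s where x: "x \<in> fobj \<Xi> (num (length ns))" and ys: "ys \<in> nfam \<Psi> ns"
    and s: "s \<in> xfun X (sum_list ns) (length ps)" and \<chi>: "\<chi> = cls X \<Xi> \<Psi> (length ps) ns x ys s"
    by (elim clsE[OF \<Psi>])
  define ss where "ss = chunks ns s"
  note ch = chunks_xfun[OF s, folded ss_def]
  let ?zs = "map (\<lambda>i. zact \<Phi> (ms ! i) (ps ! i) (fs ! i) (zs ! i)) [0..<length ps]"
  let ?t = "map ((!) t) (dsum ps fs)"
  have fi: "fs ! i \<in> xfun X (ms ! i) (ps ! i)" if "i < length ps" for i using fs(3) that by blast
  have zi: "zs ! i \<in> fobj \<Phi> (num (ms ! i))" if "i < length ps" for i using zs that fs(2) by (simp add: nfam_iff)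
  have zs': "?zs \<in> nfam \<Phi> ps" using fi zi by (auto simp: nfam_iff intro: zact_closed[OF \<Phi>])
  have d: "dsum ps fs \<in> xfun X (sum_list ms) (sum_list ps)" by (rule dsum_xfun[OF fs(1,2) fi])
  have t': "?t \<in> xfun X (sum_list ms) N" by (rule xfun_comp[OF d t])
  have s': "s \<in> xfun X (sum_list ns) (length ms)" using s fs(2) by simp
  define SP where "SP = map (\<lambda>s. sum_list (map ((!) ps) s)) ss"
  define SM where "SM = map (\<lambda>s. sum_list (map ((!) ms) s)) ss"
  define w where "w = (\<lambda>y s. cls X \<Psi> \<Phi> (sum_list (map ((!) ps) s)) (map ((!) ps) s) y (map ((!) ?zs) s) [0..<sum_list (map ((!) ps) s)])"
  define w' where "w' = (\<lambda>y s. cls X \<Psi> \<Phi> (sum_list (map ((!) ms) s)) (map ((!) ms) s) y (map ((!) zs) s) [0..<sum_list (map ((!) ms) s)])"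
  let ?D = "map (\<lambda>i. dsum (map (map ((!) ps)) ss ! i) (map (map ((!) fs)) ss ! i)) [0..<length ns]"
  have ly: "length ys = length ns" using ys by (simp add: nfam_iff)
  have W': "map2 w' ys ss \<in> nfam (comp X \<Psi> \<Phi>) SM"
    unfolding w'_def SM_def by (rule assoc_cls_fam[OF ys ch(1) _ zs]) (use ch(2) xfunD(2)[OF s'] in simp)
  have Di: "?D ! i \<in> xfun X (SM ! i) (SP ! i)" if i: "i < length ns" for i
  proof -
    have "dsum (map ((!) ps) (ss ! i)) (map ((!) fs) (ss ! i)) \<in>
      xfun X (sum_list (map ((!) ms) (ss ! i))) (sum_list (map ((!) ps) (ss ! i)))"
      by (rule dsum_xfun) (use ch(5)[OF i] fi in \<open>auto simp: subset_iff\<close>)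
    then show ?thesis using i ch(3) by (simp add: SM_def SP_def)
  qed
  have Wi: "w (ys ! i) (ss ! i) = zact (comp X \<Psi> \<Phi>) (SM ! i) (SP ! i) (?D ! i) (w' (ys ! i) (ss ! i))" if i: "i < length ns" for i
  proof -
    let ?p = "map ((!) ps) (ss ! i)" and ?m = "map ((!) ms) (ss ! i)" and ?f = "map ((!) fs) (ss ! i)" and ?z = "map ((!) zs) (ss ! i)"
    have D: "?D ! i = dsum ?p ?f" using i ch(3) by simp
    have S: "SP ! i = sum_list ?p" "SM ! i = sum_list ?m" using i ch(3) by (simp_all add: SM_def SP_def)
    have z: "?z \<in> nfam \<Phi> ?m" using ch(5)[OF i] zi by (auto simp: nfam_iff subset_iff)
    have zz: "map ((!) ?zs) (ss ! i) = map (\<lambda>j. zact \<Phi> (?m ! j) (?p ! j) (?f ! j) (?z ! j)) [0..<length ?p]"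
      using ch(5)[OF i] by (intro nth_equalityI) (auto simp: subset_iff)
    have fj: "?f ! j \<in> xfun X (?m ! j) (?p ! j)" if "j < length ?p" for j
      using that ch(5)[OF i] fi by (auto simp: subset_iff)
    have dx: "dsum ?p ?f \<in> xfun X (sum_list ?m) (sum_list ?p)" using Di[OF i] unfolding D S .
    have y: "ys ! i \<in> fobj \<Psi> (num (length ?m))" using ys i ch(4)[OF i] by (simp add: nfam_iff)
    have "w (ys ! i) (ss ! i) = cls X \<Psi> \<Phi> (sum_list ?p) ?m (ys ! i) ?z (dsum ?p ?f)"
      unfolding w_def zz
      using cls_dsum[OF \<Phi> _ _ fj z xfun_id, where x = "ys ! i" and \<Psi> = \<Psi>] map_nth_upt[OF xfunD(2)[OF dx]] by simp
    also have "\<dots> = zact (comp X \<Psi> \<Phi>) (sum_list ?m) (sum_list ?p) (dsum ?p ?f) (w' (ys ! i) (ss ! i))"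
      unfolding w'_def comp_zact[OF \<Psi> \<Phi> dx y z xfun_id] map_nth_id[OF xfunD(1)[OF dx]] ..
    finally show ?thesis unfolding D S .
  qed
  have W: "map2 w ys ss = map (\<lambda>i. zact (comp X \<Psi> \<Phi>) (SM ! i) (SP ! i) (?D ! i) (map2 w' ys ss ! i)) [0..<length SP]"
    using Wi ch(3) ly by (intro nth_equalityI) (auto simp: SP_def)
  have T: "map ((!) t) (blockf ps s) \<in> xfun X (sum_list SP) N"
    using xfun_comp[OF blockf_xfun[OF s] t] sum_list_map_concat[of "(!) ps" ss] ch(2) by (simp add: SP_def)
  have lfs: "map length fs = ms" using fs xfunD(1) by (auto intro!: nth_equalityI)
  have "dsum (map sum_list (map (map ((!) ps)) ss)) (map (\<lambda>i. dsum (map (map ((!) ps)) ss ! i) (map (map ((!) fs)) ss ! i)) [0..<length (map (map ((!) ps)) ss)]) =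
      dsum (concat (map (map ((!) ps)) ss)) (concat (map (map ((!) fs)) ss))"
    by (rule dsum_concat_dsum) simp
  then have dd: "dsum SP ?D = dsum (map ((!) ps) s) (map ((!) fs) s)"
    unfolding map_concat[symmetric] ch(2) by (simp add: SP_def o_def ch(3))
  have e: "map ((!) (dsum ps fs)) (blockf ms s) = map ((!) (blockf ps s)) (dsum SP ?D)"
    unfolding dd lfs[symmetric] by (rule dsum_blockf[OF fs(1) _ xfunD(2)[OF s]]) (use xfunD(2)[OF fi] in blast)
  have dSP: "dsum SP ?D \<in> xfun X (sum_list SM) (sum_list SP)"
    by (rule dsum_xfun) (use Di ch(3) in \<open>auto simp: SP_def SM_def\<close>)
  have s1: "set (blockf ms s) \<subseteq> {..<length (dsum ps fs)}"
    using xfunD(2)[OF blockf_xfun[OF s']] xfunD(1)[OF d] by simp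
  have s2: "set (dsum SP ?D) \<subseteq> {..<length (blockf ps s)}"
    using xfunD(2)[OF dSP] xfunD(1)[OF T] by simp
  have e3: "map ((!) (map ((!) t) (blockf ps s))) (dsum SP ?D) = map ((!) ?t) (blockf ms s)"
    unfolding map_nth_comp[OF s1, symmetric] map_nth_comp[OF s2, symmetric] e ..
  have "assoc_lift X \<Xi> \<Psi> \<Phi> N ps ?zs t \<chi> = cls X \<Xi> (comp X \<Psi> \<Phi>) N SP x (map2 w ys ss) (map ((!) t) (blockf ps s))"
    unfolding \<chi> assoc_lift[OF \<Xi> \<Psi> \<Phi> zs' t x ys s] assoc_cls_def ch(2) w_def SP_def ss_def[symmetric] ..
  also have "\<dots> = cls X \<Xi> (comp X \<Psi> \<Phi>) N SM x (map2 w' ys ss) (map ((!) (map ((!) t) (blockf ps s))) (dsum SP ?D))"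
    unfolding W
    by (rule cls_dsum[OF comp_functor[OF \<Psi> \<Phi>] _ _ _ W' T]) (use ch(3) Di in \<open>auto simp: SP_def SM_def\<close>)
  also have "\<dots> = assoc_cls X \<Xi> \<Psi> \<Phi> N x ys ms zs ss ?t"
    unfolding e3 assoc_cls_def ch(2) w'_def SM_def ..
  also have "\<dots> = assoc_lift X \<Xi> \<Psi> \<Phi> N ms zs ?t \<chi>"
    using assoc_lift[OF \<Xi> \<Psi> \<Phi> zs t' x ys s'] unfolding \<chi> ss_def fs(2) by simp
  finally show "assoc_lift X \<Xi> \<Psi> \<Phi> N ps ?zs t \<chi> = assoc_lift X \<Xi> \<Psi> \<Phi> N ms zs ?t \<chi>" .
qed

lemma associator_cls:
  assumes \<Xi>: "one_functor X \<Xi>" and \<Psi>: "one_functor X \<Psi>" and \<Phi>: "one_functor X \<Phi>"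
    and x: "x \<in> fobj \<Xi> (num (length ns))" and ys: "ys \<in> nfam \<Psi> ns" and s: "s \<in> xfun X (sum_list ns) (length ps)"
    and zs: "zs \<in> nfam \<Phi> ps" and t: "t \<in> xfun X (sum_list ps) N"
  shows "associator X \<Xi> \<Psi> \<Phi> (num N)
      (cls X (comp X \<Xi> \<Psi>) \<Phi> N ps (cls X \<Xi> \<Psi> (length ps) ns x ys s) zs t) =
    assoc_cls X \<Xi> \<Psi> \<Phi> N x ys ps zs (chunks ns s) t"
proof -
  let ?K = "cls X (comp X \<Xi> \<Psi>) \<Phi> N ps (cls X \<Xi> \<Psi> (length ps) ns x ys s) zs t"
  obtain H where H: "\<And>ps \<chi> zs t. \<lbrakk>\<chi> \<in> fobj (comp X \<Xi> \<Psi>) (num (length ps)); zs \<in> nfam \<Phi> ps; t \<in> xfun X (sum_list ps) N\<rbrakk> \<Longrightarrow>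
      H (cls X (comp X \<Xi> \<Psi>) \<Phi> N ps \<chi> zs t) = assoc_lift X \<Xi> \<Psi> \<Phi> N ps zs t \<chi>"
    by (rule cls_lift[OF comp_functor[OF \<Xi> \<Psi>] \<Phi> assoc_outer[OF \<Xi> \<Psi> \<Phi>]]) blast
  have H': "H (cls X (comp X \<Xi> \<Psi>) \<Phi> N ps (cls X \<Xi> \<Psi> (length ps) ns x ys s) zs t) = assoc_cls X \<Xi> \<Psi> \<Phi> N x ys ps zs (chunks ns s) t"
    if "x \<in> fobj \<Xi> (num (length ns))" "ys \<in> nfam \<Psi> ns" "s \<in> xfun X (sum_list ns) (length ps)" "zs \<in> nfam \<Phi> ps" "t \<in> xfun X (sum_list ps) N"
    for ps ns x ys s zs t
    using that by (simp add: H cls_closed assoc_lift[OF \<Xi> \<Psi> \<Phi>])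
  show ?thesis
    unfolding cokl_associator_def prod.case
  proof (rule the_equality)
    show "\<exists>q bs \<chi> ess \<phi>s t'.
     (bs, \<chi>, ess, \<phi>s, t') \<in> reps X (comp X \<Xi> \<Psi>) \<Phi> (num N) \<and>
     q \<in> reps X \<Xi> \<Psi> (bs, ()) \<and>
     \<chi> = rep_class X \<Xi> \<Psi> (bs, ()) q \<and>
     ?K = rep_class X (comp X \<Xi> \<Psi>) \<Phi> (num N) (bs, \<chi>, ess, \<phi>s, t') \<and>
     assoc_cls X \<Xi> \<Psi> \<Phi> N x ys ps zs (chunks ns s) t = rep_class X \<Xi> (comp X \<Psi> \<Phi>) (num N)
           (assoc_rep X \<Psi> \<Phi> (numeral_obj N) q bs ess \<phi>s t')"
      using cokl_repsI[OF cls_closed[OF x ys s] zs t] cokl_repsI[OF x ys s] assoc_rep_cls[OF \<Phi> ys s zs t, of \<Xi> x]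
      by (intro exI[of _ "(numeral_obj (length ns), x, map numeral_obj ns, ys, function_arr s)"] exI[of _ "numeral_obj (length ps)"]
          exI[of _ "cls X \<Xi> \<Psi> (length ps) ns x ys s"] exI[of _ "map numeral_obj ps"] exI[of _ zs] exI[of _ "function_arr t"])
         (simp add: cls_def)
  next
    fix L assume "\<exists>q bs \<chi> ess \<phi>s t'.
     (bs, \<chi>, ess, \<phi>s, t') \<in> reps X (comp X \<Xi> \<Psi>) \<Phi> (num N) \<and>
     q \<in> reps X \<Xi> \<Psi> (bs, ()) \<and>
     \<chi> = rep_class X \<Xi> \<Psi> (bs, ()) q \<and>
     ?K = rep_class X (comp X \<Xi> \<Psi>) \<Phi> (num N) (bs, \<chi>, ess, \<phi>s, t') \<and>
     L = rep_class X \<Xi> (comp X \<Psi> \<Phi>) (num N)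
           (assoc_rep X \<Psi> \<Phi> (numeral_obj N) q bs ess \<phi>s t')"
    then obtain q bs \<chi> ess \<phi>s t' where r: "(bs, \<chi>, ess, \<phi>s, t') \<in> reps X (comp X \<Xi> \<Psi>) \<Phi> (num N)"
      and q: "q \<in> reps X \<Xi> \<Psi> (bs, ())"
      and \<chi>: "\<chi> = rep_class X \<Xi> \<Psi> (bs, ()) q"
      and K: "?K = rep_class X (comp X \<Xi> \<Psi>) \<Phi> (num N) (bs, \<chi>, ess, \<phi>s, t')"
      and L: "L = rep_class X \<Xi> (comp X \<Psi> \<Phi>) (num N)
           (assoc_rep X \<Psi> \<Phi> (numeral_obj N) q bs ess \<phi>s t')" by blast
    from cokl_reps_num[OF r] obtain ps' f' where r': "bs = numeral_obj (length ps')" "ess = map numeral_obj ps'" "t' = function_arr f'"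
      "\<phi>s \<in> nfam \<Phi> ps'" "f' \<in> xfun X (sum_list ps') N" by metis
    obtain cs \<xi> bss \<psi>s s0 where q0: "q = (cs, \<xi>, bss, \<psi>s, s0)" by (cases q) auto
    from cokl_reps_num[OF q[unfolded q0 r'(1)]] obtain ns' s' where q': "cs = numeral_obj (length ns')" "bss = map numeral_obj ns'"
      "s0 = function_arr s'" "\<xi> \<in> fobj \<Xi> (num (length ns'))" "\<psi>s \<in> nfam \<Psi> ns'" "s' \<in> xfun X (sum_list ns') (length ps')" by metis
    have \<chi>': "\<chi> = cls X \<Xi> \<Psi> (length ps') ns' \<xi> \<psi>s s'" unfolding \<chi> r'(1) q0 q'(1-3) cls_def ..
    have "L = assoc_cls X \<Xi> \<Psi> \<Phi> N \<xi> \<psi>s ps' \<phi>s (chunks ns' s') f'"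
      unfolding L q0 q'(1-3) r'(1-3) by (rule assoc_rep_cls[OF \<Phi> q'(5,6) r'(4,5)])
    also have "\<dots> = H ?K" unfolding K r'(1-3) using H'[OF q'(4-6) r'(4,5)] by (simp add: cls_def[of X "comp X \<Xi> \<Psi>"] \<chi>')
    also have "\<dots> = assoc_cls X \<Xi> \<Psi> \<Phi> N x ys ps zs (chunks ns s) t" by (rule H'[OF x ys s zs t])
    finally show "L = assoc_cls X \<Xi> \<Psi> \<Phi> N x ys ps zs (chunks ns s) t" .
  qed
qed


section \<open>Monoids in terms of representatives\<close>

lemma ball_num: "(\<forall>p\<in>obj (one_base X). P p) \<longleftrightarrow> (\<forall>n. P (num n))"
  using one_objE by (metis UNIV_I obj_one_base)

lemma ball_cls:
  assumes \<Phi>: "one_functor X \<Phi>"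
  shows "(\<forall>p\<in>obj (one_base X). \<forall>K\<in>fobj (comp X \<Psi> \<Phi>) p. P p K) \<longleftrightarrow>
    (\<forall>N ns. \<forall>x\<in>fobj \<Psi> (num (length ns)). \<forall>ys\<in>nfam \<Phi> ns. \<forall>f\<in>xfun X (sum_list ns) N. P (num N) (cls X \<Psi> \<Phi> N ns x ys f))"
  unfolding ball_num using cls_closed by (metis clsE[OF \<Phi>])

text \<open>The three monoid laws, evaluated on representatives by means of the formulas for 2-cells and canonical
  isomorphisms.\<close>

definition left_law where
  "left_law X Z e m \<longleftrightarrow>
     (\<forall>N ns j. [j] \<in> xfun X 1 (length ns) \<longrightarrow> (\<forall>ys\<in>nfam Z ns. \<forall>f\<in>xfun X (sum_list ns) N.
        m (num N) (cls X Z Z N ns (e (num (length ns)) (function_arr [j])) ys f) =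
        zact Z (ns ! j) N (map ((!) f) (blockf ns [j])) (ys ! j)))"

definition right_law where
  "right_law X Z e m \<longleftrightarrow>
     (\<forall>N ns. \<forall>x\<in>fobj Z (num (length ns)). \<forall>js\<in>nfam (unit_functor X) ns. \<forall>f\<in>xfun X (sum_list ns) N.
        m (num N) (cls X Z Z N ns x (map2 (\<lambda>n. e (num n)) ns js) f) =
        zact Z (length ns) N (map ((!) f) (dsum ns (map (map fst) js))) x)"

definition assoc_law where
  "assoc_law X Z m \<longleftrightarrow>
     (\<forall>N ps ns. \<forall>x\<in>fobj Z (num (length ns)). \<forall>ys\<in>nfam Z ns. \<forall>s\<in>xfun X (sum_list ns) (length ps). \<forall>zs\<in>nfam Z ps. \<forall>t\<in>xfun X (sum_list ps) N.
        m (num N) (cls X Z Z N ps (m (num (length ps)) (cls X Z Z (length ps) ns x ys s)) zs t) =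
        m (num N) (cls X Z Z N (map (\<lambda>s. sum_list (map ((!) ps) s)) (chunks ns s)) x
          (map2 (\<lambda>y s. m (num (sum_list (map ((!) ps) s)))
             (cls X Z Z (sum_list (map ((!) ps) s)) (map ((!) ps) s) y (map ((!) zs) s) [0..<sum_list (map ((!) ps) s)])) ys (chunks ns s))
          (map ((!) t) (blockf ps s))))"

lemma is_endo_monoid_iff:
  "is_endo_monoid X one_cat M \<longleftrightarrow>
    (let Z = mcarrier M; e = munit M; m = mmult M in
     one_functor X Z \<and> natural (one_base X) (unit_functor X) Z e \<and> natural (one_base X) (comp X Z Z) Z m \<and>
     left_law X Z e m \<and> right_law X Z e m \<and> assoc_law X Z m)"
proof (cases "one_functor X (mcarrier M) \<and> natural (one_base X) (unit_functor X) (mcarrier M) (munit M) \<and>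
    natural (one_base X) (comp X (mcarrier M) (mcarrier M)) (mcarrier M) (mmult M)")
  case True
  define Z where "Z = mcarrier M"
  define e where "e = munit M"
  define m where "m = mmult M"
  have Z: "one_functor X Z" and e: "nat_trans X (unit_functor X) Z e" and m: "nat_trans X (comp X Z Z) Z m"
    using True unfolding natural_iff Z_def e_def m_def by blast+
  note ZZ = comp_functor[OF Z Z]
  have id2: "map2 (\<lambda>n x. x) ns ys = ys" if "length ys = length ns" for ns :: "nat list" and ys :: "'a list"
    using that by (auto intro: nth_equalityI)
  have L: "(\<forall>p\<in>obj (one_base X). \<forall>K\<in>fobj (comp X (unit_functor X) Z) p.
         m p (two_cell X Z Z e (\<lambda>_ x. x) p K) = left_unitor X Z p K) \<longleftrightarrow>
     left_law X Z e m"
  proof -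
    have "m (num N) (two_cell X Z Z e (\<lambda>_ x. x) (num N) (cls X (unit_functor X) Z N ns (function_arr [j]) ys f)) =
        left_unitor X Z (num N) (cls X (unit_functor X) Z N ns (function_arr [j]) ys f) \<longleftrightarrow>
      m (num N) (cls X Z Z N ns (e (num (length ns)) (function_arr [j])) ys f) =
        zact Z (ns ! j) N (map ((!) f) (blockf ns [j])) (ys ! j)"
      if "[j] \<in> xfun X 1 (length ns)" "ys \<in> nfam Z ns" "f \<in> xfun X (sum_list ns) N" for N ns j ys f
    proof -
      have x: "function_arr [j] \<in> fobj (unit_functor X) (num (length ns))" using that(1) by (auto simp: unit_fobj)
      have l: "length ys = length ns" using that(2) by (simp add: nfam_iff)
      show ?thesis
        unfolding left_unitor_cls[OF Z that] cls_2cell[OF unit_functor Z e Z Z nat_trans_ident x that(2,3)] id2[OF l] ..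
    qed
    then show ?thesis unfolding ball_cls[OF Z] unit_fobj left_law_def by blast
  qed
  have R: "(\<forall>p\<in>obj (one_base X). \<forall>K\<in>fobj (comp X Z (unit_functor X)) p.
         m p (two_cell X Z Z (\<lambda>_ x. x) e p K) = right_unitor X Z p K) \<longleftrightarrow>
     right_law X Z e m"
    unfolding ball_cls[OF unit_functor] right_law_def
    by (simp add: right_unitor_cls[OF Z] cls_2cell[OF Z Z nat_trans_ident unit_functor Z e])
  have A: "(\<forall>p\<in>obj (one_base X). \<forall>K\<in>fobj (comp X (comp X Z Z) Z) p.
         m p (two_cell X Z Z m (\<lambda>_ x. x) p K) =
         m p (two_cell X Z Z (\<lambda>_ x. x) m p (associator X Z Z Z p K))) \<longleftrightarrow>
     assoc_law X Z m"
    (is "?A \<longleftrightarrow> ?A'")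
  proof -
    have eq: "m (num N) (two_cell X Z Z m (\<lambda>_ x. x) (num N) (cls X (comp X Z Z) Z N ps (cls X Z Z (length ps) ns x ys s) zs t)) =
         m (num N) (two_cell X Z Z (\<lambda>_ x. x) m (num N)
            (associator X Z Z Z (num N) (cls X (comp X Z Z) Z N ps (cls X Z Z (length ps) ns x ys s) zs t))) \<longleftrightarrow>
        m (num N) (cls X Z Z N ps (m (num (length ps)) (cls X Z Z (length ps) ns x ys s)) zs t) =
        m (num N) (cls X Z Z N (map (\<lambda>s. sum_list (map ((!) ps) s)) (chunks ns s)) x
          (map2 (\<lambda>y s. m (num (sum_list (map ((!) ps) s)))
             (cls X Z Z (sum_list (map ((!) ps) s)) (map ((!) ps) s) y (map ((!) zs) s) [0..<sum_list (map ((!) ps) s)])) ys (chunks ns s))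
          (map ((!) t) (blockf ps s)))"
      if x: "x \<in> fobj Z (num (length ns))" and ys: "ys \<in> nfam Z ns" and s: "s \<in> xfun X (sum_list ns) (length ps)"
        and zs: "zs \<in> nfam Z ps" and t: "t \<in> xfun X (sum_list ps) N" for N ps ns x ys s zs t
    proof -
      let ?ss = "chunks ns s"
      note ch = chunks_xfun[OF s]
      have l: "length zs = length ps" "length ys = length ns" using zs ys by (auto simp: nfam_iff)
      have cs: "set (concat ?ss) \<subseteq> {..<length ps}" unfolding ch(2) using xfunD(2)[OF s] .
      note W = assoc_cls_fam[OF ys ch(1) cs zs, of X]
      have x': "x \<in> fobj Z (num (length (map (\<lambda>s. sum_list (map ((!) ps) s)) ?ss)))" using x ch(3) by simp
      have T: "map ((!) t) (blockf ps (concat ?ss)) \<in> xfun X (sum_list (map (\<lambda>s. sum_list (map ((!) ps) s)) ?ss)) N"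
        using xfun_comp[OF blockf_xfun[OF s] t] sum_list_map_concat[of "(!) ps" ?ss] ch(2) by simp
      have M: "map2 (\<lambda>n. m (num n)) (map (\<lambda>s. sum_list (map ((!) ps) s)) ?ss)
          (map2 (\<lambda>y s. cls X Z Z (sum_list (map ((!) ps) s)) (map ((!) ps) s) y (map ((!) zs) s) [0..<sum_list (map ((!) ps) s)]) ys ?ss) =
        map2 (\<lambda>y s. m (num (sum_list (map ((!) ps) s)))
             (cls X Z Z (sum_list (map ((!) ps) s)) (map ((!) ps) s) y (map ((!) zs) s) [0..<sum_list (map ((!) ps) s)])) ys ?ss"
        using ch(3) l(2) by (intro nth_equalityI) simp_all
      show ?thesis
        unfolding cls_2cell[OF ZZ Z m Z Z nat_trans_ident cls_closed[OF x ys s] zs t] id2[OF l(1)]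
          associator_cls[OF Z Z Z x ys s zs t] assoc_cls_def
          cls_2cell[OF Z Z nat_trans_ident ZZ Z m x' W T] M
        unfolding ch(2) length_map ch(3) ..
    qed
    show ?thesis
    proof
      assume ?A
      show ?A'
        unfolding assoc_law_def
      proof (intro allI ballI)
        fix N ps ns x ys s zs t
        assume h: "x \<in> fobj Z (num (length ns))" "ys \<in> nfam Z ns" "s \<in> xfun X (sum_list ns) (length ps)"
          "zs \<in> nfam Z ps" "t \<in> xfun X (sum_list ps) N"
        show "m (num N) (cls X Z Z N ps (m (num (length ps)) (cls X Z Z (length ps) ns x ys s)) zs t) =
          m (num N) (cls X Z Z N (map (\<lambda>s. sum_list (map ((!) ps) s)) (chunks ns s)) x
          (map2 (\<lambda>y s. m (num (sum_list (map ((!) ps) s)))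
             (cls X Z Z (sum_list (map ((!) ps) s)) (map ((!) ps) s) y (map ((!) zs) s) [0..<sum_list (map ((!) ps) s)])) ys (chunks ns s))
          (map ((!) t) (blockf ps s)))"
          using \<open>?A\<close>[unfolded ball_cls[OF Z], rule_format, OF cls_closed[OF h(1-3)] h(4,5)] unfolding eq[OF h] .
      qed
    next
      assume A': ?A'
      show ?A
        unfolding ball_cls[OF Z]
      proof (intro allI ballI)
        fix N ps \<chi> zs t
        assume \<chi>: "\<chi> \<in> fobj (comp X Z Z) (num (length ps))" and h: "zs \<in> nfam Z ps" "t \<in> xfun X (sum_list ps) N"
        from clsE[OF Z \<chi>] obtain ns x ys s where h': "x \<in> fobj Z (num (length ns))" "ys \<in> nfam Z ns" "s \<in> xfun X (sum_list ns) (length ps)"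
          and \<chi>: "\<chi> = cls X Z Z (length ps) ns x ys s" by metis
        show "m (num N) (two_cell X Z Z m (\<lambda>_ x. x) (num N) (cls X (comp X Z Z) Z N ps \<chi> zs t)) =
         m (num N) (two_cell X Z Z (\<lambda>_ x. x) m (num N)
            (associator X Z Z Z (num N) (cls X (comp X Z Z) Z N ps \<chi> zs t)))"
          unfolding \<chi> eq[OF h' h] using A' h h' unfolding assoc_law_def by blast
      qed
    qed
  qed
  show ?thesis
    using True unfolding is_endo_monoid_def Let_def L[unfolded Z_def e_def m_def] R[unfolded Z_def e_def m_def] A[unfolded Z_def e_def m_def]
    by blast
next
  case False
  then show ?thesis by (auto simp: is_endo_monoid_def Let_def)
qed


section \<open>Operads with a functorial action\<close>

text \<open>A non-symmetric operad on which the maps of \<open>?1\<close> act functorially; \<open>ract P m n f\<close> takes arity \<open>m\<close> to arity \<open>n\<close>. The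
  last two axioms express naturality of the composition in its outer and inner arguments, and mirror the
  relations between representatives.\<close>

record 'a foperad = "'a operad" +
  ract :: "nat \<Rightarrow> nat \<Rightarrow> nat list \<Rightarrow> 'a \<Rightarrow> 'a"

definition is_foperad :: "kind \<Rightarrow> 'a foperad \<Rightarrow> bool" where
  "is_foperad X P \<longleftrightarrow>
     is_operad P \<and>
     ract P \<in> (\<Pi>\<^sub>E m\<in>UNIV. \<Pi>\<^sub>E n\<in>UNIV. \<Pi>\<^sub>E f\<in>xfun X m n. ops P m \<rightarrow>\<^sub>E ops P n) \<and>
     (\<forall>n. \<forall>x\<in>ops P n. ract P n n [0..<n] x = x) \<and>
     (\<forall>l m n. \<forall>f\<in>xfun X l m. \<forall>g\<in>xfun X m n. \<forall>x\<in>ops P l.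
        ract P m n g (ract P l m f x) = ract P l n (map ((!) g) f) x) \<and>
     (\<forall>ns k. \<forall>g\<in>xfun X k (length ns). \<forall>x\<in>ops P k. \<forall>ys\<in>tuples (map (ops P) ns).
        ocomp P ns (ract P k (length ns) g x) ys =
        ract P (sum_list (map ((!) ns) g)) (sum_list ns) (blockf ns g) (ocomp P (map ((!) ns) g) x (map ((!) ys) g))) \<and>
     (\<forall>ns ms fs. length fs = length ns \<longrightarrow> length ms = length ns \<longrightarrow> (\<forall>i<length ns. fs ! i \<in> xfun X (ms ! i) (ns ! i)) \<longrightarrow>
        (\<forall>x\<in>ops P (length ns). \<forall>ys\<in>tuples (map (ops P) ms).
          ocomp P ns x (map (\<lambda>i. ract P (ms ! i) (ns ! i) (fs ! i) (ys ! i)) [0..<length ns]) =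
          ract P (sum_list ms) (sum_list ns) (dsum ns fs) (ocomp P ms x ys)))"

definition is_foperad_hom :: "kind \<Rightarrow> 'a foperad \<Rightarrow> 'a foperad \<Rightarrow> (nat \<Rightarrow> 'a \<Rightarrow> 'a) \<Rightarrow> bool" where
  "is_foperad_hom X P Q h \<longleftrightarrow>
     is_operad_hom P Q h \<and>
     (\<forall>m n. \<forall>f\<in>xfun X m n. \<forall>x\<in>ops P m. h n (ract P m n f x) = ract Q m n f (h m x))"

definition foperads :: "kind \<Rightarrow> ('a foperad, nat \<Rightarrow> 'a \<Rightarrow> 'a) category" where
  "foperads X = \<lparr>obj = Collect (is_foperad X),
     hom = (\<lambda>P Q. Collect (is_foperad_hom X P Q)),
     ident = (\<lambda>P n. \<lambda>x\<in>ops P n. x),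
     cmp = (\<lambda>P Q R k h n. compose (ops P n) (k n) (h n))\<rparr>"

definition foperad_of :: "kind \<Rightarrow> 'a one_monoid \<Rightarrow> 'a foperad" where
  "foperad_of X M = operad.extend (underlying_operad X M)
     \<lparr>ract = (\<lambda>m n. \<lambda>f\<in>xfun X m n. \<lambda>x\<in>underlying_ops M m. zact (mcarrier M) m n f x)\<rparr>"

lemma substitute_cls: "substitute X M ns N x ys f = mmult M (num N) (cls X (mcarrier M) (mcarrier M) N ns x ys f)"
  by (simp add: substitute_def cls_def)

lemma tuples_underlying_ops: "tuples (map (underlying_ops M) ns) = nfam (mcarrier M) ns"
  by (simp add: nfam_def underlying_ops_def[abs_def])

lemma foperad_of_sel:
  "ops (foperad_of X M) = (\<lambda>n. fobj (mcarrier M) (num n))"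
  "oid (foperad_of X M) = munit M (num 1) (function_arr [0])"
  "ocomp (foperad_of X M) = (\<lambda>ns. \<lambda>x\<in>fobj (mcarrier M) (num (length ns)). \<lambda>ys\<in>nfam (mcarrier M) ns.
     mmult M (num (sum_list ns)) (cls X (mcarrier M) (mcarrier M) (sum_list ns) ns x ys [0..<sum_list ns]))"
  "ract (foperad_of X M) = (\<lambda>m n. \<lambda>f\<in>xfun X m n. \<lambda>x\<in>fobj (mcarrier M) (num m). zact (mcarrier M) m n f x)"
  by (simp_all add: foperad_of_def operad.extend_def underlying_operad_def tuples_underlying_ops substitute_cls
      underlying_ops_def[abs_def] nfam_def)

lemma tuples_foperad_of: "tuples (map (ops (foperad_of X M)) ns) = nfam (mcarrier M) ns"
  by (simp add: foperad_of_sel nfam_def)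

lemma
  assumes "is_endo_monoid X one_cat M"
  shows monoid_functor: "one_functor X (mcarrier M)"
    and monoid_unit: "nat_trans X (unit_functor X) (mcarrier M) (munit M)" "munit M p \<in> extensional (fobj (unit_functor X) p)"
    and monoid_mult: "nat_trans X (comp X (mcarrier M) (mcarrier M)) (mcarrier M) (mmult M)"
      "mmult M p \<in> extensional (fobj (comp X (mcarrier M) (mcarrier M)) p)"
  using assms unfolding is_endo_monoid_iff Let_def natural_iff by blast+

lemma zero_xfun [simp]: "[0] \<in> xfun X 1 1"
  using xfun_id[of 1 X] by simp

declare zero_xfun[unfolded One_nat_def, simp]

lemma zero_unit: "function_arr [0] \<in> fobj (unit_functor X) (num 1)"
  unfolding unit_fobj using zero_xfun by blast

text \<open>Yoneda: \<open>I\<close> is represented by 1, so the unit of a monoid is determined by one element of arity 1.\<close>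

lemma monoid_unit_eq:
  assumes M: "is_endo_monoid X one_cat M" and j: "[j] \<in> xfun X 1 n"
  shows "munit M (num n) (function_arr [j]) = zact (mcarrier M) 1 n [j] (munit M (num 1) (function_arr [0]))"
proof -
  from nat_trans_zact[OF monoid_unit(1)[OF M] j zero_unit] show ?thesis
    using unit_zact[OF j zero_xfun] by simp
qed

text \<open>Since \<open>f\<close> acts on the class \<open>\<langle>x; ys; 1\<rangle>\<close> with result \<open>\<langle>x; ys; f\<rangle>\<close>, naturality reduces the multiplication to classes with
  trivial map.\<close>

lemma monoid_mult_eq:
  assumes M: "is_endo_monoid X one_cat M"
    and x: "x \<in> fobj (mcarrier M) (num (length ns))" and ys: "ys \<in> nfam (mcarrier M) ns" and f: "f \<in> xfun X (sum_list ns) N"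
  shows "mmult M (num N) (cls X (mcarrier M) (mcarrier M) N ns x ys f) =
    zact (mcarrier M) (sum_list ns) N f (ocomp (foperad_of X M) ns x ys)"
  using nat_trans_zact[OF monoid_mult(1)[OF M] f cls_closed[OF x ys xfun_id]]
    comp_zact[OF monoid_functor[OF M] monoid_functor[OF M] f x ys xfun_id] x ys
  by (simp add: map_nth_id[OF xfunD(1)[OF f]] foperad_of_sel)

lemma monoid_ocomp_closed:
  assumes M: "is_endo_monoid X one_cat M"
    and x: "x \<in> fobj (mcarrier M) (num (length ns))" and ys: "ys \<in> nfam (mcarrier M) ns"
  shows "ocomp (foperad_of X M) ns x ys \<in> fobj (mcarrier M) (num (sum_list ns))"
  using nat_trans_closed[OF monoid_mult(1)[OF M] cls_closed[OF x ys xfun_id]] x ys by (simp add: foperad_of_sel)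

lemma chunks_upt:
  assumes "length xs = sum_list ns"
  shows "map (map ((!) xs)) (chunks ns [0..<sum_list ns]) = chunks ns xs"
  unfolding chunks_map[symmetric] using assms by (simp add: map_nth_id)

text \<open>All axioms are instances, with identity maps, of the monoid laws and of the two relations between classes.\<close>

lemma foperad_of_foperad:
  assumes M: "is_endo_monoid X one_cat M" shows "is_foperad X (foperad_of X M)"
proof -
  define Z where "Z = mcarrier M"
  define P where "P = foperad_of X M"
  note Z = monoid_functor[OF M, folded Z_def]
  have ops: "ops P n = fobj Z (num n)" for n by (simp add: P_def foperad_of_sel Z_def)
  have tup: "tuples (map (ops P) ns) = nfam Z ns" for ns unfolding P_def Z_def by (rule tuples_foperad_of)
  have ract: "ract P m n f x = zact Z m n f x" if "f \<in> xfun X m n" "x \<in> fobj Z (num m)" for m n f x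
    using that by (simp add: P_def foperad_of_sel Z_def)
  note mult = monoid_mult_eq[OF M, folded Z_def P_def]
  note closed = monoid_ocomp_closed[OF M, folded Z_def P_def]
  have oid: "oid P = munit M (num 1) (function_arr [0])" by (simp add: P_def foperad_of_sel)
  note laws = M[unfolded is_endo_monoid_iff Let_def, folded Z_def, THEN conjunct2, THEN conjunct2, THEN conjunct2]
  note lawL = laws[THEN conjunct1, unfolded left_law_def, rule_format] and lawR = laws[THEN conjunct2, THEN conjunct1, unfolded right_law_def, rule_format]
    and lawA = laws[THEN conjunct2, THEN conjunct2, unfolded assoc_law_def, rule_format]
  have zid: "zact Z n n [0..<n] x = x" if "x \<in> fobj Z (num n)" for n x using zact_id[OF Z that] .
  have oid_op: "oid P \<in> ops P 1"
    unfolding oid ops Z_def by (rule nat_trans_closed[OF monoid_unit(1)[OF M] zero_unit])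
  have F1: "is_operad P"
    unfolding is_operad_def tup
  proof (intro conjI allI ballI)
    show "oid P \<in> ops P 1" by (rule oid_op)
    show "ocomp P \<in> (\<Pi>\<^sub>E ns\<in>UNIV. ops P (length ns) \<rightarrow>\<^sub>E nfam Z ns \<rightarrow>\<^sub>E ops P (sum_list ns))"
    proof (intro PiE_I)
      fix ns x ys assume "x \<in> ops P (length ns)" "ys \<in> nfam Z ns"
      then show "ocomp P ns x ys \<in> ops P (sum_list ns)" using closed by (simp add: ops)
    qed (simp_all add: ops, simp_all add: P_def foperad_of_sel Z_def)
  next
    fix n x assume x: "x \<in> ops P n"
    then have x': "[x] \<in> nfam Z [n]" by (simp add: nfam_iff ops)
    have b: "blockf [n] [0] = [0..<n]" using blockf_id[of "[n]"] by simp
    have "mmult M (num n) (cls X Z Z n [n] (oid P) [x] [0..<n]) = x"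
      using lawL[of 0 "[n]" "[x]" "[0..<n]" n] x x' zid[of x n] unfolding oid by (simp add: b ops map_nth_id)
    then show "ocomp P [n] (oid P) [x] = x"
      using mult[of "oid P" "[n]" "[x]" "[0..<n]" n] closed[of "oid P" "[n]" "[x]"] oid_op x' zid by (simp add: ops)
  next
    fix n x assume x: "x \<in> ops P n"
    let ?ns = "replicate n (1 :: nat)" and ?js = "replicate n (function_arr [0])"
    have s: "sum_list ?ns = n" by (simp add: sum_list_replicate)
    have js: "?js \<in> nfam (unit_functor X) ?ns" by (simp add: unit_nfam_iff)
    have d: "dsum ?ns (map (map fst) ?js) = [0..<n]"
      using dsum_id[of ?ns] s by simp
    have o: "map2 (\<lambda>n. munit M (num n)) ?ns ?js = replicate n (oid P)"
      by (rule nth_equalityI) (simp_all add: oid)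
    have ys: "replicate n (oid P) \<in> nfam Z ?ns" using oid_op by (simp add: nfam_iff ops)
    have "mmult M (num n) (cls X Z Z n ?ns x (replicate n (oid P)) [0..<n]) = x"
      using lawR[of x ?ns ?js "[0..<n]" n] x js unfolding o d s by (simp add: ops zid map_nth_id)
    then show "ocomp P ?ns x (replicate n (oid P)) = x"
      using mult[of x ?ns "replicate n (oid P)" "[0..<n]" n] closed[of x ?ns "replicate n (oid P)"] x ys zid unfolding s by (simp add: ops)
  next
    fix nss x ys zss
    assume x: "x \<in> ops P (length nss)" and ys: "ys \<in> tuples (map (\<lambda>ns. ops P (length ns)) nss)"
      and zss: "zss \<in> tuples (map (\<lambda>ns. nfam Z ns) nss)"
    let ?ns = "map length nss" and ?ps = "concat nss" and ?zs = "concat zss"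
    define ss where "ss = chunks ?ns [0..<length ?ps]"
    have lp: "length ?ps = sum_list ?ns" by (simp add: length_concat)
    have ys': "ys \<in> nfam Z ?ns" using ys by (simp add: tuples_iff nfam_iff ops)
    have zl: "length zss = length nss" and zi: "\<And>i. i < length nss \<Longrightarrow> zss ! i \<in> nfam Z (nss ! i)"
      using zss by (auto simp: tuples_iff)
    have mlz: "map length zss = ?ns" using zl zi by (auto simp: nfam_iff intro!: nth_equalityI)
    have zs': "?zs \<in> nfam Z ?ps"
      using zss tuples_concat[of zss "map (map (\<lambda>n. fobj Z (num n))) nss"] by (simp add: nfam_def map_concat o_def)
    have pss: "map (map ((!) ?ps)) ss = nss"
      unfolding ss_def lp by (subst chunks_upt) (simp_all add: lp chunks_concat)
    have zzs: "map (map ((!) ?zs)) ss = zss"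
      unfolding ss_def lp by (subst chunks_upt) (simp_all add: length_concat mlz chunks_concat)
    have lss: "length ss = length nss" using pss by (metis length_map)
    have pi: "map ((!) ?ps) (ss ! i) = nss ! i" "map ((!) ?zs) (ss ! i) = zss ! i" if "i < length nss" for i
      using pss zzs that lss by (metis nth_map)+
    have SS: "map (\<lambda>s. sum_list (map ((!) ?ps) s)) ss = map sum_list nss"
      by (rule nth_equalityI) (simp_all add: lss pi)
    have x': "x \<in> fobj Z (num (length ?ns))" using x by (simp add: ops)
    have c1: "ocomp P ?ns x ys \<in> fobj Z (num (length ?ps))" using closed[OF x' ys'] lp by simp
    have W: "map2 (\<lambda>y s. mmult M (num (sum_list (map ((!) ?ps) s)))
        (cls X Z Z (sum_list (map ((!) ?ps) s)) (map ((!) ?ps) s) y (map ((!) ?zs) s) [0..<sum_list (map ((!) ?ps) s)])) ys ss =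
      map (\<lambda>i. ocomp P (nss ! i) (ys ! i) (zss ! i)) [0..<length nss]"
    proof (rule nth_equalityI, goal_cases)
      case 1 then show ?case using ys' lss by (simp add: nfam_iff)
    next
      case (2 i)
      then have i: "i < length nss" using lss by simp
      have y: "ys ! i \<in> fobj Z (num (length (nss ! i)))" using ys i by (simp add: tuples_iff ops)
      show ?case
        using i lss ys' mult[OF y zi[OF i] xfun_id] zid[OF closed[OF y zi[OF i]]] by (simp add: nfam_iff pi)
    qed
    have W': "map (\<lambda>i. ocomp P (nss ! i) (ys ! i) (zss ! i)) [0..<length nss] \<in> nfam Z (map sum_list nss)"
      using ys zi closed by (auto simp: nfam_iff[of _ _ "map sum_list nss"] tuples_iff ops)
    have ssum: "sum_list ?ps = sum_list (map sum_list nss)" by (induction nss) auto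
    have s0: "[0..<length ?ps] \<in> xfun X (sum_list ?ns) (length ?ps)" unfolding lp by (rule xfun_id)
    have "mmult M (num (sum_list ?ps)) (cls X Z Z (sum_list ?ps) ?ps (mmult M (num (length ?ps)) (cls X Z Z (length ?ps) ?ns x ys [0..<length ?ps])) ?zs [0..<sum_list ?ps]) =
      mmult M (num (sum_list ?ps)) (cls X Z Z (sum_list ?ps) (map sum_list nss) x
        (map (\<lambda>i. ocomp P (nss ! i) (ys ! i) (zss ! i)) [0..<length nss]) [0..<sum_list ?ps])"
      using lawA[OF x' ys' s0 zs' xfun_id] unfolding ss_def[symmetric] SS W blockf_id by (simp add: map_nth_id)
    moreover have "mmult M (num (length ?ps)) (cls X Z Z (length ?ps) ?ns x ys [0..<length ?ps]) = ocomp P ?ns x ys"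
      using mult[OF x' ys' s0] zid[OF c1] lp by simp
    ultimately show "ocomp P ?ps (ocomp P ?ns x ys) ?zs =
      ocomp P (map sum_list nss) x (map (\<lambda>i. ocomp P (nss ! i) (ys ! i) (zss ! i)) [0..<length nss])"
      using mult[OF c1 zs' xfun_id] zid[OF closed[OF c1 zs']]
        mult[OF _ W', of x "[0..<sum_list ?ps]" "sum_list ?ps"] zid[OF closed[OF _ W'], of x] x ssum by (simp add: ops)
  qed
  have F2: "ract P \<in> (\<Pi>\<^sub>E m\<in>UNIV. \<Pi>\<^sub>E n\<in>UNIV. \<Pi>\<^sub>E f\<in>xfun X m n. ops P m \<rightarrow>\<^sub>E ops P n)"
  proof (intro PiE_I)
    fix m n f x assume "f \<in> xfun X m n" "x \<in> ops P m"
    then show "ract P m n f x \<in> ops P n" using zact_closed[OF Z] by (simp add: ops ract)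
  qed (simp_all add: ops, simp_all add: P_def foperad_of_sel Z_def)
  have F3: "ract P n n [0..<n] x = x" if "x \<in> ops P n" for n x using that by (simp add: ops ract zid)
  have F4: "ract P m n g (ract P l m f x) = ract P l n (map ((!) g) f) x"
    if "f \<in> xfun X l m" "g \<in> xfun X m n" "x \<in> ops P l" for l m n f g x
    using that by (simp add: ops ract zact_closed[OF Z] zact_comp[OF Z] xfun_comp del: map_map)
  have F5: "ocomp P ns (ract P k (length ns) g x) ys =
      ract P (sum_list (map ((!) ns) g)) (sum_list ns) (blockf ns g) (ocomp P (map ((!) ns) g) x (map ((!) ys) g))"
    if g: "g \<in> xfun X k (length ns)" and x: "x \<in> ops P k" and ys: "ys \<in> nfam Z ns" for ns k g x ys
  proof -
    have gx: "zact Z k (length ns) g x \<in> fobj Z (num (length ns))" using zact_closed[OF Z g] x by (simp add: ops)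
    have x': "x \<in> fobj Z (num (length (map ((!) ns) g)))" using x xfunD(1)[OF g] by (simp add: ops)
    have ys': "map ((!) ys) g \<in> nfam Z (map ((!) ns) g)" using ys xfunD(2)[OF g] by (auto simp: nfam_iff subset_iff)
    note b = blockf_xfun[OF g]
    have "ocomp P ns (zact Z k (length ns) g x) ys = mmult M (num (sum_list ns)) (cls X Z Z (sum_list ns) ns (zact Z k (length ns) g x) ys [0..<sum_list ns])"
      using mult[OF gx ys xfun_id] zid[OF closed[OF gx ys]] by simp
    also have "\<dots> = zact Z (sum_list (map ((!) ns) g)) (sum_list ns) (blockf ns g) (ocomp P (map ((!) ns) g) x (map ((!) ys) g))"
      unfolding cls_blockf[OF Z Z g x[unfolded ops] ys xfun_id] map_nth_upt[OF xfunD(2)[OF b]] by (rule mult[OF x' ys' b])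
    finally show ?thesis using g x ract[OF b closed[OF x' ys']] by (simp add: ract ops)
  qed
  have F6: "ocomp P ns x (map (\<lambda>i. ract P (ms ! i) (ns ! i) (fs ! i) (ys ! i)) [0..<length ns]) =
      ract P (sum_list ms) (sum_list ns) (dsum ns fs) (ocomp P ms x ys)"
    if fs: "length fs = length ns" "length ms = length ns" "\<forall>i<length ns. fs ! i \<in> xfun X (ms ! i) (ns ! i)"
      and x: "x \<in> ops P (length ns)" and ys: "ys \<in> nfam Z ms" for ns ms fs x ys
  proof -
    have fi: "fs ! i \<in> xfun X (ms ! i) (ns ! i)" if "i < length ns" for i using fs(3) that by blast
    have yi: "ys ! i \<in> fobj Z (num (ms ! i))" if "i < length ns" for i using ys fs(2) that by (simp add: nfam_iff)
    let ?ys = "map (\<lambda>i. zact Z (ms ! i) (ns ! i) (fs ! i) (ys ! i)) [0..<length ns]"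
    have ys': "?ys \<in> nfam Z ns" using fi yi by (auto simp: nfam_iff intro: zact_closed[OF Z])
    have e: "map (\<lambda>i. ract P (ms ! i) (ns ! i) (fs ! i) (ys ! i)) [0..<length ns] = ?ys"
      using fi yi by (auto simp: ract)
    have d: "dsum ns fs \<in> xfun X (sum_list ms) (sum_list ns)" by (rule dsum_xfun[OF fs(1,2) fi])
    have x': "x \<in> fobj Z (num (length ns))" "x \<in> fobj Z (num (length ms))" using x fs(2) by (simp_all add: ops)
    have "ocomp P ns x ?ys = mmult M (num (sum_list ns)) (cls X Z Z (sum_list ns) ns x ?ys [0..<sum_list ns])"
      using mult[OF x'(1) ys' xfun_id] zid[OF closed[OF x'(1) ys']] by simp
    also have "\<dots> = zact Z (sum_list ms) (sum_list ns) (dsum ns fs) (ocomp P ms x ys)"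
    proof -
      have "cls X Z Z (sum_list ns) ns x ?ys [0..<sum_list ns] = cls X Z Z (sum_list ns) ms x ys (map ((!) [0..<sum_list ns]) (dsum ns fs))"
        by (rule cls_dsum[OF Z fs(1,2) _ ys xfun_id]) (rule fi)
      then show ?thesis unfolding map_nth_upt[OF xfunD(2)[OF d]] using mult[OF x'(2) ys d] by simp
    qed
    finally show ?thesis unfolding e using ract[OF d closed[OF x'(2) ys]] by simp
  qed
  have "is_foperad X P"
    unfolding is_foperad_def tup
    by (intro conjI allI ballI impI F1 F2; (rule F3 F4 F5 F6; assumption))
  then show ?thesis by (simp add: P_def)
qed


lemma
  assumes "is_foperad X P"
  shows foperad_operad: "is_operad P"
    and foperad_oid: "oid P \<in> ops P 1"
    and foperad_ocomp: "\<lbrakk>x \<in> ops P (length ns); ys \<in> tuples (map (ops P) ns)\<rbrakk> \<Longrightarrow> ocomp P ns x ys \<in> ops P (sum_list ns)"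
    and foperad_left: "x \<in> ops P n \<Longrightarrow> ocomp P [n] (oid P) [x] = x"
    and foperad_right: "x \<in> ops P n \<Longrightarrow> ocomp P (replicate n 1) x (replicate n (oid P)) = x"
    and foperad_assoc: "\<lbrakk>x \<in> ops P (length nss); ys \<in> tuples (map (\<lambda>ns. ops P (length ns)) nss);
        zss \<in> tuples (map (\<lambda>ns. tuples (map (ops P) ns)) nss)\<rbrakk> \<Longrightarrow>
        ocomp P (concat nss) (ocomp P (map length nss) x ys) (concat zss) =
        ocomp P (map sum_list nss) x (map (\<lambda>i. ocomp P (nss ! i) (ys ! i) (zss ! i)) [0..<length nss])"
    and foperad_ract: "\<lbrakk>f \<in> xfun X m n; x \<in> ops P m\<rbrakk> \<Longrightarrow> ract P m n f x \<in> ops P n"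
    and foperad_ract_id: "x \<in> ops P n \<Longrightarrow> ract P n n [0..<n] x = x"
    and foperad_ract_comp: "\<lbrakk>f \<in> xfun X l m; g \<in> xfun X m n; x \<in> ops P l\<rbrakk> \<Longrightarrow>
        ract P m n g (ract P l m f x) = ract P l n (map ((!) g) f) x"
    and foperad_blockf: "\<lbrakk>g \<in> xfun X k (length ns); x \<in> ops P k; ys \<in> tuples (map (ops P) ns)\<rbrakk> \<Longrightarrow>
        ocomp P ns (ract P k (length ns) g x) ys =
        ract P (sum_list (map ((!) ns) g)) (sum_list ns) (blockf ns g) (ocomp P (map ((!) ns) g) x (map ((!) ys) g))"
    and foperad_dsum: "\<lbrakk>length fs = length ns; length ms = length ns; \<And>i. i < length ns \<Longrightarrow> fs ! i \<in> xfun X (ms ! i) (ns ! i);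
        x \<in> ops P (length ns); ys \<in> tuples (map (ops P) ms)\<rbrakk> \<Longrightarrow>
        ocomp P ns x (map (\<lambda>i. ract P (ms ! i) (ns ! i) (fs ! i) (ys ! i)) [0..<length ns]) =
        ract P (sum_list ms) (sum_list ns) (dsum ns fs) (ocomp P ms x ys)"
proof -
  note F = assms[unfolded is_foperad_def]
  show O: "is_operad P" using F by blast
  note O = O[unfolded is_operad_def]
  show "oid P \<in> ops P 1"
    using O by blast
  show "\<lbrakk>x \<in> ops P (length ns); ys \<in> tuples (map (ops P) ns)\<rbrakk> \<Longrightarrow> ocomp P ns x ys \<in> ops P (sum_list ns)"
    using O[THEN conjunct2, THEN conjunct1] by (simp add: PiE_iff)
  show "x \<in> ops P n \<Longrightarrow> ocomp P [n] (oid P) [x] = x"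
    using O by blast
  show "x \<in> ops P n \<Longrightarrow> ocomp P (replicate n 1) x (replicate n (oid P)) = x"
    using O by blast
  show "\<lbrakk>x \<in> ops P (length nss); ys \<in> tuples (map (\<lambda>ns. ops P (length ns)) nss);
        zss \<in> tuples (map (\<lambda>ns. tuples (map (ops P) ns)) nss)\<rbrakk> \<Longrightarrow>
        ocomp P (concat nss) (ocomp P (map length nss) x ys) (concat zss) =
        ocomp P (map sum_list nss) x (map (\<lambda>i. ocomp P (nss ! i) (ys ! i) (zss ! i)) [0..<length nss])"
    using O by blast
  show "\<lbrakk>f \<in> xfun X m n; x \<in> ops P m\<rbrakk> \<Longrightarrow> ract P m n f x \<in> ops P n"
    using F[THEN conjunct2, THEN conjunct1] by (simp add: PiE_iff)
  show "x \<in> ops P n \<Longrightarrow> ract P n n [0..<n] x = x"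
    using F by blast
  show "\<lbrakk>f \<in> xfun X l m; g \<in> xfun X m n; x \<in> ops P l\<rbrakk> \<Longrightarrow>
        ract P m n g (ract P l m f x) = ract P l n (map ((!) g) f) x"
    using F by blast
  show "\<lbrakk>g \<in> xfun X k (length ns); x \<in> ops P k; ys \<in> tuples (map (ops P) ns)\<rbrakk> \<Longrightarrow>
        ocomp P ns (ract P k (length ns) g x) ys =
        ract P (sum_list (map ((!) ns) g)) (sum_list ns) (blockf ns g) (ocomp P (map ((!) ns) g) x (map ((!) ys) g))"
    using F by blast
  show "\<lbrakk>length fs = length ns; length ms = length ns; \<And>i. i < length ns \<Longrightarrow> fs ! i \<in> xfun X (ms ! i) (ns ! i);
        x \<in> ops P (length ns); ys \<in> tuples (map (ops P) ms)\<rbrakk> \<Longrightarrow>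
        ocomp P ns x (map (\<lambda>i. ract P (ms ! i) (ns ! i) (fs ! i) (ys ! i)) [0..<length ns]) =
        ract P (sum_list ms) (sum_list ns) (dsum ns fs) (ocomp P ms x ys)"
    using F by blast
qed

lemma foperad_extensional:
  assumes "is_foperad X P"
  shows "ract P m n \<in> extensional (xfun X m n)" "f \<in> xfun X m n \<Longrightarrow> ract P m n f \<in> extensional (ops P m)"
proof -
  have "ract P \<in> (\<Pi>\<^sub>E m\<in>UNIV. \<Pi>\<^sub>E n\<in>UNIV. \<Pi>\<^sub>E f\<in>xfun X m n. ops P m \<rightarrow>\<^sub>E ops P n)"
    by (rule assms[unfolded is_foperad_def, THEN conjunct2, THEN conjunct1])
  then show "ract P m n \<in> extensional (xfun X m n)" "f \<in> xfun X m n \<Longrightarrow> ract P m n f \<in> extensional (ops P m)"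
    by (auto simp: PiE_iff)
qed

lemma foperad_ocomp_extensional:
  assumes "is_foperad X P"
  shows "ocomp P ns \<in> extensional (ops P (length ns))"
    "x \<in> ops P (length ns) \<Longrightarrow> ocomp P ns x \<in> extensional (tuples (map (ops P) ns))"
proof -
  have "ocomp P \<in> (\<Pi>\<^sub>E ns\<in>UNIV. ops P (length ns) \<rightarrow>\<^sub>E tuples (map (ops P) ns) \<rightarrow>\<^sub>E ops P (sum_list ns))"
    using foperad_operad[OF assms] unfolding is_operad_def by blast
  then show "ocomp P ns \<in> extensional (ops P (length ns))"
    "x \<in> ops P (length ns) \<Longrightarrow> ocomp P ns x \<in> extensional (tuples (map (ops P) ns))"
    by (auto simp: PiE_iff)
qed

definition functor_of :: "kind \<Rightarrow> 'a foperad \<Rightarrow> (unit, unit, unit, unit, 'a) cokl" where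
  "functor_of X P = make_functor (one_base X) (\<lambda>(us, _). ops P (length us))
     (\<lambda>(us, _) (vs, _) (l, _). ract P (length us) (length vs) (map fst l))"

text \<open>The multiplication has to be given by \<open>f \<cdot> \<gamma>(x; ys)\<close> on \<open>\<langle>x; ys; f\<rangle>\<close>. The choice operator picks a function on classes
  with these values, which exists by \<open>cls_lift\<close> thanks to the naturality axioms (\<open>monoid_of_mult\<close>).\<close>

definition monoid_of :: "kind \<Rightarrow> 'a foperad \<Rightarrow> 'a one_monoid" where
  "monoid_of X P = \<lparr>mcarrier = functor_of X P,
     munit = (\<lambda>p. \<lambda>i\<in>fobj (unit_functor X) p. ract P 1 (length (fst p)) (map fst i) (oid P)),
     mmult = (\<lambda>p. \<lambda>K\<in>fobj (comp X (functor_of X P) (functor_of X P)) p.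
       (SOME H. \<forall>ns. \<forall>x\<in>ops P (length ns). \<forall>ys\<in>tuples (map (ops P) ns). \<forall>f\<in>xfun X (sum_list ns) (length (fst p)).
          H (cls X (functor_of X P) (functor_of X P) (length (fst p)) ns x ys f) =
          ract P (sum_list ns) (length (fst p)) f (ocomp P ns x ys)) K)\<rparr>"

lemma functor_of_fobj: "fobj (functor_of X P) p = ops P (length (fst p))"
  by (cases p) (simp add: functor_of_def fobj_make_functor quest_sel)

lemma functor_of_zact: "f \<in> xfun X m n \<Longrightarrow> x \<in> ops P m \<Longrightarrow> zact (functor_of X P) m n f x = ract P m n f x"
  unfolding zact_def functor_of_def by (subst fmap_make_functor) (simp_all add: quest_sel hom_ordinals)

lemma functor_of_nfam: "nfam (functor_of X P) ns = tuples (map (ops P) ns)"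
  by (simp add: nfam_def functor_of_fobj)

lemma functor_of: assumes P: "is_foperad X P" shows "one_functor X (functor_of X P)"
proof (rule zact_functorI)
  fix us vs show "fmap (functor_of X P) (us, ()) (vs, ()) \<in> extensional (hom (ordinals X) vs us \<times> UNIV)"
    by (simp add: functor_of_def make_functor_def quest_sel)
next
  fix m n f assume "f \<in> xfun X m n"
  then show "zact (functor_of X P) m n f \<in> extensional (fobj (functor_of X P) (num m))"
    by (simp add: zact_def functor_of_def make_functor_def quest_sel hom_ordinals)
next
  fix m n f x assume "f \<in> xfun X m n" "x \<in> fobj (functor_of X P) (num m)"
  then show "zact (functor_of X P) m n f x \<in> fobj (functor_of X P) (num n)"
    by (simp add: functor_of_fobj functor_of_zact foperad_ract[OF P])
next
  fix m x assume "x \<in> fobj (functor_of X P) (num m)"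
  then show "zact (functor_of X P) m m [0..<m] x = x"
    by (simp add: functor_of_fobj functor_of_zact foperad_ract_id[OF P])
next
  fix l m n f g x assume "f \<in> xfun X l m" "g \<in> xfun X m n" "x \<in> fobj (functor_of X P) (num l)"
  then show "zact (functor_of X P) m n g (zact (functor_of X P) l m f x) = zact (functor_of X P) l n (map ((!) g) f) x"
    by (simp add: functor_of_fobj functor_of_zact foperad_ract[OF P] foperad_ract_comp[OF P] xfun_comp del: map_map)
qed

lemma monoid_of_unit:
  assumes P: "is_foperad X P" and j: "[j] \<in> xfun X 1 n"
  shows "munit (monoid_of X P) (num n) (function_arr [j]) = ract P 1 n [j] (oid P)"
proof -
  have "function_arr [j] \<in> fobj (unit_functor X) (num n)" using j unfolding unit_fobj by blast
  then show ?thesis by (simp add: monoid_of_def)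
qed

lemma tuples_nthI:
  assumes "ys \<in> tuples (map A ns)" "set g \<subseteq> {..<length ns}"
  shows "map ((!) ys) g \<in> tuples (map A (map ((!) ns) g))"
  using assms by (auto simp: tuples_iff subset_iff)

lemma monoid_of_mult:
  assumes P: "is_foperad X P" and x: "x \<in> ops P (length ns)" and ys: "ys \<in> tuples (map (ops P) ns)" and f: "f \<in> xfun X (sum_list ns) N"
  shows "mmult (monoid_of X P) (num N) (cls X (functor_of X P) (functor_of X P) N ns x ys f) = ract P (sum_list ns) N f (ocomp P ns x ys)"
proof -
  let ?Z = "functor_of X P"
  note Z = functor_of[OF P]
  have "cls_compatible X ?Z ?Z N (\<lambda>ns x ys f. ract P (sum_list ns) N f (ocomp P ns x ys))"
    unfolding cls_compatible_def functor_of_nfam functor_of_fobj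
  proof (intro conjI allI impI)
    fix ns k g x ys f
    assume g: "g \<in> xfun X k (length ns)" and "x \<in> ops P (length (fst (num k)))" and ys: "ys \<in> tuples (map (ops P) ns)"
      and f: "f \<in> xfun X (sum_list ns) N"
    then have x: "x \<in> ops P k" by simp
    have "ocomp P (map ((!) ns) g) x (map ((!) ys) g) \<in> ops P (sum_list (map ((!) ns) g))"
      by (rule foperad_ocomp[OF P]) (use x xfunD(1)[OF g] tuples_nthI[OF ys xfunD(2)[OF g]] in simp_all)
    then show "ract P (sum_list ns) N f (ocomp P ns (zact ?Z k (length ns) g x) ys) =
        ract P (sum_list (map ((!) ns) g)) N (map ((!) f) (blockf ns g)) (ocomp P (map ((!) ns) g) x (map ((!) ys) g))"
      unfolding functor_of_zact[OF g x] foperad_blockf[OF P g x ys] by (rule foperad_ract_comp[OF P blockf_xfun[OF g] f])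
  next
    fix ns ms fs x ys f
    assume fs: "length fs = length ns" "length ms = length ns" "\<forall>i<length ns. fs ! i \<in> xfun X (ms ! i) (ns ! i)"
      and "x \<in> ops P (length (fst (num (length ns))))" and ys: "ys \<in> tuples (map (ops P) ms)" and f: "f \<in> xfun X (sum_list ns) N"
    then have x: "x \<in> ops P (length ns)" "x \<in> ops P (length ms)" by simp_all
    have fi: "fs ! i \<in> xfun X (ms ! i) (ns ! i)" if "i < length ns" for i using fs(3) that by blast
    have "map (\<lambda>i. zact ?Z (ms ! i) (ns ! i) (fs ! i) (ys ! i)) [0..<length ns] = map (\<lambda>i. ract P (ms ! i) (ns ! i) (fs ! i) (ys ! i)) [0..<length ns]"
      using fi ys fs(2) by (auto simp: tuples_iff functor_of_zact)
    note e = this and d = foperad_dsum[OF P fs(1,2) fi x(1) ys]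
      and r = foperad_ract_comp[OF P dsum_xfun[OF fs(1,2) fi] f foperad_ocomp[OF P x(2) ys]]
    show "ract P (sum_list ns) N f (ocomp P ns x (map (\<lambda>i. zact ?Z (ms ! i) (ns ! i) (fs ! i) (ys ! i)) [0..<length ns])) =
        ract P (sum_list ms) N (map ((!) f) (dsum ns fs)) (ocomp P ms x ys)"
      unfolding e using d r by metis
  qed
  then obtain H where "\<And>ns x ys f. \<lbrakk>x \<in> fobj ?Z (num (length ns)); ys \<in> nfam ?Z ns; f \<in> xfun X (sum_list ns) N\<rbrakk> \<Longrightarrow>
    H (cls X ?Z ?Z N ns x ys f) = ract P (sum_list ns) N f (ocomp P ns x ys)"
    by (rule cls_lift[OF Z Z]) blast
  then have "\<exists>H. \<forall>ns. \<forall>x\<in>ops P (length ns). \<forall>ys\<in>tuples (map (ops P) ns). \<forall>f\<in>xfun X (sum_list ns) N.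
          H (cls X ?Z ?Z N ns x ys f) = ract P (sum_list ns) N f (ocomp P ns x ys)"
    by (intro exI[of _ H]) (simp add: functor_of_fobj functor_of_nfam)
  note H = someI_ex[OF this, rule_format, OF x ys f]
  have "cls X ?Z ?Z N ns x ys f \<in> fobj (comp X ?Z ?Z) (num N)"
    by (rule cls_closed) (use x ys f in \<open>simp_all add: functor_of_fobj functor_of_nfam\<close>)
  then show ?thesis using H by (simp add: monoid_of_def)
qed

text \<open>Each monoid law for general representatives reduces to the corresponding operad law by moving the maps in the
  representative out of the composition with the naturality axioms.\<close>

lemma monoid_of_monoid:
  assumes P: "is_foperad X P" shows "is_endo_monoid X one_cat (monoid_of X P)"
proof -
  let ?Z = "functor_of X P"
  note Z = functor_of[OF P]
  define e where "e = munit (monoid_of X P)"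
  define m where "m = mmult (monoid_of X P)"
  have c: "mcarrier (monoid_of X P) = ?Z" by (simp add: monoid_of_def)
  note e = monoid_of_unit[OF P, folded e_def] and m = monoid_of_mult[OF P, folded m_def]
  note fo = functor_of_fobj[of X P] and nf = functor_of_nfam[of X P]
  have opn: "fobj ?Z (num n) = ops P n" for n by (simp add: fo)
  have ridx: "ract P n n [0..<n] x = x" if "x \<in> ops P n" for n x by (rule foperad_ract_id[OF P that])
  have "nat_trans X (unit_functor X) ?Z e"
    unfolding nat_trans_def opn
  proof (intro conjI allI ballI)
    fix n x assume "x \<in> fobj (unit_functor X) (num n)"
    then obtain j where j: "x = function_arr [j]" "[j] \<in> xfun X 1 n" unfolding unit_fobj by blast
    show "e (num n) x \<in> ops P n" unfolding j(1) e[OF j(2)] by (rule foperad_ract[OF P j(2) foperad_oid[OF P]])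
  next
    fix n k f x assume f: "f \<in> xfun X n k" and "x \<in> fobj (unit_functor X) (num n)"
    then obtain j where j: "x = function_arr [j]" "[j] \<in> xfun X 1 n" unfolding unit_fobj by blast
    have fj: "[f ! j] \<in> xfun X 1 k" using xfun_comp[OF j(2) f] by simp
    show "e (num k) (zact (unit_functor X) n k f x) = zact ?Z n k f (e (num n) x)"
      unfolding j(1) unit_zact[OF f j(2)] e[OF j(2)] e[OF fj]
        functor_of_zact[OF f foperad_ract[OF P j(2) foperad_oid[OF P]]] foperad_ract_comp[OF P j(2) f foperad_oid[OF P]] by simp
  qed
  moreover have "e p \<in> extensional (fobj (unit_functor X) p)" for p by (simp add: e_def monoid_of_def)
  ultimately have ne: "natural (one_base X) (unit_functor X) ?Z e" unfolding natural_iff by blast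
  have "nat_trans X (comp X ?Z ?Z) ?Z m"
    unfolding nat_trans_def opn
  proof (intro conjI allI ballI)
    fix n K assume "K \<in> fobj (comp X ?Z ?Z) (num n)"
    from clsE[OF Z this] obtain ns x ys f where h: "x \<in> ops P (length ns)" "ys \<in> tuples (map (ops P) ns)" "f \<in> xfun X (sum_list ns) n"
      and K: "K = cls X ?Z ?Z n ns x ys f" unfolding opn nf by metis
    show "m (num n) K \<in> ops P n" unfolding K m[OF h] by (rule foperad_ract[OF P h(3) foperad_ocomp[OF P h(1,2)]])
  next
    fix n k g K assume g: "g \<in> xfun X n k" and "K \<in> fobj (comp X ?Z ?Z) (num n)"
    from clsE[OF Z this(2)] obtain ns x ys f where h: "x \<in> ops P (length ns)" "ys \<in> tuples (map (ops P) ns)" "f \<in> xfun X (sum_list ns) n"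
      and K: "K = cls X ?Z ?Z n ns x ys f" unfolding opn nf by metis
    note o = foperad_ocomp[OF P h(1,2)]
    show "m (num k) (zact (comp X ?Z ?Z) n k g K) = zact ?Z n k g (m (num n) K)"
      unfolding K comp_zact[OF Z Z g h[folded opn nf]] m[OF h] m[OF h(1,2) xfun_comp[OF h(3) g]]
        functor_of_zact[OF g foperad_ract[OF P h(3) o]] foperad_ract_comp[OF P h(3) g o] ..
  qed
  moreover have "m p \<in> extensional (fobj (comp X ?Z ?Z) p)" for p by (simp add: m_def monoid_of_def)
  ultimately have nm: "natural (one_base X) (comp X ?Z ?Z) ?Z m" unfolding natural_iff by blast
  show ?thesis
    unfolding is_endo_monoid_iff Let_def c e_def[symmetric] m_def[symmetric] left_law_def right_law_def assoc_law_def nf opn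
  proof (intro conjI allI impI ballI Z ne nm)
    fix N ns j ys f
    assume j: "[j] \<in> xfun X 1 (length ns)" and ys: "ys \<in> tuples (map (ops P) ns)" and f: "f \<in> xfun X (sum_list ns) N"
    have jn: "j < length ns" using unit_index[OF j] .
    have yj: "ys ! j \<in> ops P (ns ! j)" using ys jn by (simp add: tuples_iff)
    note b = blockf_single_xfun[OF j]
    note o = foperad_oid[OF P]
    have "m (num N) (cls X ?Z ?Z N ns (e (num (length ns)) (function_arr [j])) ys f) =
        ract P (sum_list ns) N f (ocomp P ns (ract P 1 (length ns) [j] (oid P)) ys)"
      unfolding e[OF j] by (rule m[OF foperad_ract[OF P j o] ys f])
    also have "\<dots> = ract P (sum_list ns) N f (ract P (ns ! j) (sum_list ns) (blockf ns [j]) (ys ! j))"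
      using foperad_blockf[OF P j o ys] foperad_left[OF P yj] by simp
    also have "\<dots> = zact ?Z (ns ! j) N (map ((!) f) (blockf ns [j])) (ys ! j)"
      unfolding foperad_ract_comp[OF P b f yj] functor_of_zact[OF xfun_comp[OF b f] yj] ..
    finally show "m (num N) (cls X ?Z ?Z N ns (e (num (length ns)) (function_arr [j])) ys f) =
        zact ?Z (ns ! j) N (map ((!) f) (blockf ns [j])) (ys ! j)" .
  next
    fix N ns x js f
    assume x: "x \<in> ops P (length ns)" and js: "js \<in> nfam (unit_functor X) ns" and f: "f \<in> xfun X (sum_list ns) N"
    note o = foperad_oid[OF P]
    let ?k = "length ns"
    have jl: "length js = ?k" and ji: "\<And>i. i < ?k \<Longrightarrow> map fst (js ! i) \<in> xfun X 1 (ns ! i)"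
      using js by (auto simp: unit_nfam_iff)
    have eji: "e (num (ns ! i)) (js ! i) = ract P 1 (ns ! i) (map fst (js ! i)) (oid P)" if "i < ?k" for i
      using js that by (simp add: e_def monoid_of_def nfam_iff)
    have E: "map2 (\<lambda>n. e (num n)) ns js =
        map (\<lambda>i. ract P (replicate ?k 1 ! i) (ns ! i) (map (map fst) js ! i) (replicate ?k (oid P) ! i)) [0..<?k]"
      using jl by (intro nth_equalityI) (simp_all add: eji)
    have ms: "replicate ?k (oid P) \<in> tuples (map (ops P) (replicate ?k 1))" using o by (simp add: tuples_iff)
    have E': "map2 (\<lambda>n. e (num n)) ns js \<in> tuples (map (ops P) ns)"
      using jl by (simp add: tuples_iff eji[unfolded One_nat_def] foperad_ract[OF P ji o, unfolded One_nat_def])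
    have d: "dsum ns (map (map fst) js) \<in> xfun X ?k (sum_list ns)" by (rule unit_dsum_xfun[OF js])
    have "ocomp P ns x (map2 (\<lambda>n. e (num n)) ns js) = ract P (sum_list (replicate ?k 1)) (sum_list ns) (dsum ns (map (map fst) js))
        (ocomp P (replicate ?k 1) x (replicate ?k (oid P)))"
      unfolding E by (rule foperad_dsum[OF P _ _ _ x ms]) (use jl ji in simp_all)
    then have "ocomp P ns x (map2 (\<lambda>n. e (num n)) ns js) = ract P ?k (sum_list ns) (dsum ns (map (map fst) js)) x"
      using foperad_right[OF P x] by (simp add: sum_list_replicate)
    then show "m (num N) (cls X ?Z ?Z N ns x (map2 (\<lambda>n. e (num n)) ns js) f) =
        zact ?Z (length ns) N (map ((!) f) (dsum ns (map (map fst) js))) x"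
      unfolding m[OF x E' f] functor_of_zact[OF xfun_comp[OF d f] x] by (simp only: foperad_ract_comp[OF P d f x])
  next
    fix N ps ns x ys s zs t
    assume x: "x \<in> ops P (length ns)" and ys: "ys \<in> tuples (map (ops P) ns)" and s: "s \<in> xfun X (sum_list ns) (length ps)"
      and zs: "zs \<in> tuples (map (ops P) ps)" and t: "t \<in> xfun X (sum_list ps) N"
    define ss where "ss = chunks ns s"
    note ch = chunks_xfun[OF s, folded ss_def]
    define pss where "pss = map (map ((!) ps)) ss"
    define zss where "zss = map (map ((!) zs)) ss"
    have lps: "length pss = length ns" "length zss = length ns" using ch(3) by (simp_all add: pss_def zss_def)
    have cps: "concat pss = map ((!) ps) s" "concat zss = map ((!) zs) s"
      unfolding pss_def zss_def map_concat[symmetric] ch(2) by simp_all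
    have mps: "map length pss = ns" unfolding pss_def using ch(1) by (simp add: o_def)
    have ly: "length ys = length ns" using ys by (simp add: tuples_iff)
    have nsi: "ns ! i = length (pss ! i)" if "i < length ns" for i using that ch(3,4) by (simp add: pss_def)
    have ys': "ys \<in> tuples (map (\<lambda>ns. ops P (length ns)) pss)" using ys nsi lps by (simp add: tuples_iff)
    have zi: "zss ! i \<in> tuples (map (ops P) (pss ! i))" if "i < length ns" for i
      using tuples_nthI[OF zs ch(5)[OF that]] that ch(3) by (simp add: pss_def zss_def del: map_map)
    have zss': "zss \<in> tuples (map (\<lambda>ns. tuples (map (ops P) ns)) pss)" using zi lps by (simp add: tuples_iff[of zss])
    have yi: "ys ! i \<in> ops P (length (pss ! i))" if "i < length ns" for i
    proof -
      have "ys ! i \<in> ops P (ns ! i)" using ys that by (simp add: tuples_iff)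
      then show ?thesis unfolding nsi[OF that] .
    qed
    have W: "map2 (\<lambda>y s. m (num (sum_list (map ((!) ps) s)))
             (cls X ?Z ?Z (sum_list (map ((!) ps) s)) (map ((!) ps) s) y (map ((!) zs) s) [0..<sum_list (map ((!) ps) s)])) ys ss =
        map (\<lambda>i. ocomp P (pss ! i) (ys ! i) (zss ! i)) [0..<length pss]"
    proof (rule nth_equalityI, goal_cases)
      case 1 then show ?case using ly ch(3) lps by simp
    next
      case (2 i)
      then have i: "i < length ns" using ch(3) by simp
      have p: "map ((!) ps) (ss ! i) = pss ! i" "map ((!) zs) (ss ! i) = zss ! i" using i ch(3) by (simp_all add: pss_def zss_def)
      show ?case
        using i ly ch(3) lps(1) m[OF yi[OF i] zi[OF i] xfun_id] ridx[OF foperad_ocomp[OF P yi[OF i] zi[OF i]]]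
        by (simp add: p)
    qed
    have W': "map (\<lambda>i. ocomp P (pss ! i) (ys ! i) (zss ! i)) [0..<length pss] \<in> tuples (map (ops P) (map sum_list pss))"
      by (subst tuples_iff) (simp add: foperad_ocomp[OF P] yi zi lps)
    have SS: "map (\<lambda>s. sum_list (map ((!) ps) s)) ss = map sum_list pss" by (simp add: pss_def)
    have sS: "sum_list (map sum_list pss) = sum_list (map ((!) ps) s)"
      unfolding cps(1)[symmetric] by (induction pss) auto
    have x': "x \<in> ops P (length pss)" "x \<in> ops P (length (map sum_list pss))" using x lps by simp_all
    have xy: "ocomp P ns x ys \<in> ops P (sum_list ns)" by (rule foperad_ocomp[OF P x ys])
    have zs': "map ((!) zs) s \<in> tuples (map (ops P) (map ((!) ps) s))" by (rule tuples_nthI[OF zs xfunD(2)[OF s]])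
    have xy': "ocomp P ns x ys \<in> ops P (length (map ((!) ps) s))" using xy xfunD(1)[OF s] by simp
    note b = blockf_xfun[OF s]
    have T: "map ((!) t) (blockf ps s) \<in> xfun X (sum_list (map sum_list pss)) N" unfolding sS by (rule xfun_comp[OF b t])
    have "m (num N) (cls X ?Z ?Z N ps (m (num (length ps)) (cls X ?Z ?Z (length ps) ns x ys s)) zs t) =
        ract P (sum_list ps) N t (ocomp P ps (ract P (sum_list ns) (length ps) s (ocomp P ns x ys)) zs)"
      unfolding m[OF x ys s] by (rule m[OF foperad_ract[OF P s xy] zs t])
    also have "\<dots> = ract P (sum_list (map ((!) ps) s)) N (map ((!) t) (blockf ps s)) (ocomp P (map ((!) ps) s) (ocomp P ns x ys) (map ((!) zs) s))"
      unfolding foperad_blockf[OF P s xy zs] by (rule foperad_ract_comp[OF P b t foperad_ocomp[OF P xy' zs']])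
    also have "ocomp P (map ((!) ps) s) (ocomp P ns x ys) (map ((!) zs) s) =
        ocomp P (map sum_list pss) x (map (\<lambda>i. ocomp P (pss ! i) (ys ! i) (zss ! i)) [0..<length pss])"
      using foperad_assoc[OF P x'(1) ys' zss'] unfolding cps mps .
    finally show "m (num N) (cls X ?Z ?Z N ps (m (num (length ps)) (cls X ?Z ?Z (length ps) ns x ys s)) zs t) =
        m (num N) (cls X ?Z ?Z N (map (\<lambda>s. sum_list (map ((!) ps) s)) (chunks ns s)) x
          (map2 (\<lambda>y s. m (num (sum_list (map ((!) ps) s)))
             (cls X ?Z ?Z (sum_list (map ((!) ps) s)) (map ((!) ps) s) y (map ((!) zs) s) [0..<sum_list (map ((!) ps) s)])) ys (chunks ns s))
          (map ((!) t) (blockf ps s)))"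
      unfolding ss_def[symmetric] SS W m[OF x'(2) W' T] sS .
  qed
qed

lemma foperad_of_monoid_of:
  assumes P: "is_foperad X P" shows "foperad_of X (monoid_of X P) = P"
proof -
  have c: "mcarrier (monoid_of X P) = functor_of X P" by (simp add: monoid_of_def)
  have ops: "ops (foperad_of X (monoid_of X P)) = ops P"
    by (simp add: foperad_of_sel c functor_of_fobj fun_eq_iff)
  have "munit (monoid_of X P) (num 1) (function_arr [0]) = oid P"
    using monoid_of_unit[OF P zero_xfun] foperad_ract_id[OF P foperad_oid[OF P]] by simp
  then have oid: "oid (foperad_of X (monoid_of X P)) = oid P" by (simp add: foperad_of_sel)
  note oext = foperad_ocomp_extensional[OF P]
  have ocomp: "ocomp (foperad_of X (monoid_of X P)) = ocomp P"
  proof (intro ext)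
    fix ns x ys
    show "ocomp (foperad_of X (monoid_of X P)) ns x ys = ocomp P ns x ys"
      using extensional_arb[OF oext(1), of x ns] extensional_arb[OF oext(2), of x ns ys]
        monoid_of_mult[OF P, of x ns ys "[0..<sum_list ns]" "sum_list ns"] foperad_ract_id[OF P] foperad_ocomp[OF P, of x ns ys]
      by (cases "x \<in> ops P (length ns)"; cases "ys \<in> tuples (map (ops P) ns)")
         (simp_all add: foperad_of_sel c functor_of_fobj functor_of_nfam)
  qed
  note rext = foperad_extensional[OF P]
  have ract: "ract (foperad_of X (monoid_of X P)) = ract P"
  proof (intro ext)
    fix m n f x
    show "ract (foperad_of X (monoid_of X P)) m n f x = ract P m n f x"
      using extensional_arb[OF rext(1), of f m n] extensional_arb[OF rext(2), of f m n x]
      by (cases "f \<in> xfun X m n"; cases "x \<in> ops P m")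
         (simp_all add: foperad_of_sel c functor_of_fobj functor_of_zact)
  qed
  show ?thesis
    using ops oid ocomp ract by (intro foperad.equality) simp_all
qed

lemma foperad_of_inject:
  assumes M: "is_endo_monoid X one_cat M" and N: "is_endo_monoid X one_cat N" and eq: "foperad_of X M = foperad_of X N"
  shows "M = N"
proof -
  let ?Z = "mcarrier M" and ?Y = "mcarrier N"
  note Z = monoid_functor[OF M] and Y = monoid_functor[OF N]
  have fo: "fobj ?Z (num n) = fobj ?Y (num n)" for n
    using arg_cong[OF eq, of ops] by (simp add: foperad_of_sel fun_eq_iff)
  have fobj: "fobj ?Z p = fobj ?Y p" for p using fo by (metis one_objE)
  have za: "zact ?Z m n f x = zact ?Y m n f x" if "f \<in> xfun X m n" "x \<in> fobj ?Z (num m)" for m n f x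
    using arg_cong[OF eq, of ract, THEN fun_cong, of m, THEN fun_cong, of n, THEN fun_cong, of f, THEN fun_cong, of x] that fo
    by (simp add: foperad_of_sel)
  have fmap: "fmap ?Z = fmap ?Y"
  proof (intro ext)
    fix p q :: "unit list \<times> unit" and g :: "unit seq_arr \<times> unit" and x
    obtain us vs l where pq: "p = (us, ())" "q = (vs, ())" "g = (l, ())" by (cases p; cases q; cases g) auto
    have F: "fmap F \<in> (\<Pi>\<^sub>E a\<in>UNIV. \<Pi>\<^sub>E b\<in>UNIV. \<Pi>\<^sub>E f\<in>hom (one_base X) a b. fobj F a \<rightarrow>\<^sub>E fobj F b)"
      if "one_functor X F" for F :: "(unit, unit, unit, unit, 'a) cokl"
      using that unfolding is_set_functor_def obj_one_base by blast
    have e1: "fmap F p q \<in> extensional (hom (one_base X) p q)"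
      and e2: "g \<in> hom (one_base X) p q \<Longrightarrow> fmap F p q g \<in> extensional (fobj F p)"
      if "one_functor X F" for F :: "(unit, unit, unit, unit, 'a) cokl"
      using F[OF that] by (simp_all only: PiE_iff) blast+
    show "fmap ?Z p q g x = fmap ?Y p q g x"
    proof (cases "g \<in> hom (one_base X) p q")
      case False
      then show ?thesis using extensional_arb[OF e1[OF Z]] extensional_arb[OF e1[OF Y]] by metis
    next
      case True
      then have l: "map fst l \<in> xfun X (length us) (length vs)" by (simp add: pq quest_sel hom_ordinals)
      show ?thesis
      proof (cases "x \<in> fobj ?Z p")
        case False
        then show ?thesis
          using extensional_arb[OF e2[OF Z True]] extensional_arb[OF e2[OF Y True]] fobj by metis
      next
        case x: True
        then show ?thesis using za[OF l, of x] unfolding pq fmap_eq_zact by simp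
      qed
    qed
  qed
  have c: "?Z = ?Y" using fobj fmap by (intro set_functor.equality) (auto simp: fun_eq_iff)
  have u: "munit M = munit N"
  proof (rule ext)
    fix p :: "unit list \<times> unit" obtain n where p: "p = num n" by (rule one_objE)
    have "munit M p i = munit N p i" if "i \<in> fobj (unit_functor X) p" for i
    proof -
      from that obtain j where j: "i = function_arr [j]" "[j] \<in> xfun X 1 n" unfolding p unit_fobj by blast
      have "oid (foperad_of X M) = oid (foperad_of X N)" using eq by simp
      then show ?thesis unfolding p j(1) monoid_unit_eq[OF M j(2)] monoid_unit_eq[OF N j(2)] c foperad_of_sel by simp
    qed
    then show "munit M p = munit N p" by (rule extensionalityI[OF monoid_unit(2)[OF M] monoid_unit(2)[OF N]])
  qed
  have m: "mmult M = mmult N"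
  proof (rule ext)
    fix p :: "unit list \<times> unit" obtain n where p: "p = num n" by (rule one_objE)
    have "mmult M p K = mmult N p K" if "K \<in> fobj (comp X ?Z ?Z) p" for K
    proof -
      from clsE[OF Z that[unfolded p]] obtain ns x ys f where h: "x \<in> fobj ?Z (num (length ns))" "ys \<in> nfam ?Z ns" "f \<in> xfun X (sum_list ns) n"
        and K: "K = cls X ?Z ?Z n ns x ys f" by metis
      show ?thesis unfolding p K using monoid_mult_eq[OF M h] monoid_mult_eq[OF N h[unfolded c]] eq c by simp
    qed
    then show "mmult M p = mmult N p"
      by (rule extensionalityI[OF monoid_mult(2)[OF M] monoid_mult(2)[OF N, folded c]])
  qed
  show ?thesis using c u m by simp
qed

lemma endo_monoid_hom_iff:
  assumes M: "is_endo_monoid X one_cat M" and N: "is_endo_monoid X one_cat N"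
  shows "is_endo_monoid_hom X one_cat M N h \<longleftrightarrow> is_foperad_hom X (foperad_of X M) (foperad_of X N) (underlying_hom h)"
proof -
  define Z where "Z = mcarrier M"
  define Y where "Y = mcarrier N"
  define P where "P = foperad_of X M"
  define Q where "Q = foperad_of X N"
  note Z = monoid_functor[OF M, folded Z_def] and Y = monoid_functor[OF N, folded Y_def]
  note multM = monoid_mult_eq[OF M, folded Z_def P_def] and multN = monoid_mult_eq[OF N, folded Y_def Q_def]
  have opsP: "ops P n = fobj Z (num n)" and opsQ: "ops Q n = fobj Y (num n)" for n by (simp_all add: P_def Q_def foperad_of_sel Z_def Y_def)
  have tup: "tuples (map (ops P) ns) = nfam Z ns" for ns unfolding P_def Z_def by (rule tuples_foperad_of)
  have ractP: "ract P m n f x = zact Z m n f x" if "f \<in> xfun X m n" "x \<in> fobj Z (num m)" for m n f x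
    using that by (simp add: P_def foperad_of_sel Z_def)
  have ractQ: "ract Q m n f x = zact Y m n f x" if "f \<in> xfun X m n" "x \<in> fobj Y (num m)" for m n f x
    using that by (simp add: Q_def foperad_of_sel Y_def)
  have oidP: "oid P = munit M (num 1) (function_arr [0])" and oidQ: "oid Q = munit N (num 1) (function_arr [0])"
    by (simp_all add: P_def Q_def foperad_of_sel)
  note FP = foperad_of_foperad[OF M, folded P_def]
  have h_ext: "(\<forall>p. h p \<in> extensional (fobj Z p)) \<longleftrightarrow> (\<forall>n. h (num n) \<in> extensional (fobj Z (num n)))"
    by (metis one_objE)
  have nat: "natural (one_base X) Z Y h \<longleftrightarrow> underlying_hom h \<in> (\<Pi>\<^sub>E n\<in>UNIV. ops P n \<rightarrow>\<^sub>E ops Q n) \<and>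
      (\<forall>m n. \<forall>f\<in>xfun X m n. \<forall>x\<in>ops P m. underlying_hom h n (ract P m n f x) = ract Q m n f (underlying_hom h m x))"
    (is "?N \<longleftrightarrow> ?A \<and> ?B")
  proof -
    have A: "?A \<longleftrightarrow> (\<forall>n. h (num n) \<in> extensional (fobj Z (num n))) \<and> (\<forall>n. \<forall>x\<in>fobj Z (num n). h (num n) x \<in> fobj Y (num n))"
      unfolding PiE_iff opsP opsQ underlying_hom_def by (auto simp: extensional_def)
    have "?B \<longleftrightarrow> (\<forall>m n. \<forall>f\<in>xfun X m n. \<forall>x\<in>fobj Z (num m). h (num n) (zact Z m n f x) = zact Y m n f (h (num m) x))"
      if "\<forall>n. \<forall>x\<in>fobj Z (num n). h (num n) x \<in> fobj Y (num n)"
      unfolding opsP underlying_hom_def using that by (simp add: ractP ractQ)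
    with A show ?thesis unfolding natural_iff nat_trans_def h_ext by blast
  qed
  have unit: "(\<forall>p\<in>obj (one_base X). \<forall>i\<in>fobj (unit_functor X) p. h p (munit M p i) = munit N p i) \<longleftrightarrow> underlying_hom h 1 (oid P) = oid Q"
    if n: "natural (one_base X) Z Y h"
  proof
    assume "\<forall>p\<in>obj (one_base X). \<forall>i\<in>fobj (unit_functor X) p. h p (munit M p i) = munit N p i"
    then show "underlying_hom h 1 (oid P) = oid Q" unfolding ball_num underlying_hom_def oidP oidQ using zero_unit by blast
  next
    assume u: "underlying_hom h 1 (oid P) = oid Q"
    have o: "munit M (num 1) (function_arr [0]) \<in> fobj Z (num 1)" using foperad_oid[OF FP] unfolding opsP oidP .
    show "\<forall>p\<in>obj (one_base X). \<forall>i\<in>fobj (unit_functor X) p. h p (munit M p i) = munit N p i"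
      unfolding ball_num
    proof (intro allI ballI)
      fix k i assume "i \<in> fobj (unit_functor X) (num k)"
      then obtain j where j: "i = function_arr [j]" "[j] \<in> xfun X 1 k" unfolding unit_fobj by blast
      show "h (num k) (munit M (num k) i) = munit N (num k) i"
        unfolding j(1) monoid_unit_eq[OF M j(2), folded Z_def] monoid_unit_eq[OF N j(2), folded Y_def]
        using nat_trans_zact[OF _ j(2) o, of Y h] n u unfolding natural_iff underlying_hom_def oidP oidQ by simp
    qed
  qed
  have mult: "(\<forall>p\<in>obj (one_base X). \<forall>K\<in>fobj (comp X Z Z) p.
      h p (mmult M p K) = mmult N p (two_cell X Y Y h h p K)) \<longleftrightarrow>
    (\<forall>ns. \<forall>x\<in>ops P (length ns). \<forall>ys\<in>tuples (map (ops P) ns).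
        underlying_hom h (sum_list ns) (ocomp P ns x ys) = ocomp Q ns (underlying_hom h (length ns) x) (map2 (underlying_hom h) ns ys))"
    (is "?L \<longleftrightarrow> ?R") if n: "natural (one_base X) Z Y h"
  proof -
    have nt: "nat_trans X Z Y h" using n unfolding natural_iff by blast
    have eq: "h (num N') (mmult M (num N') (cls X Z Z N' ns x ys f)) =
        mmult N (num N') (two_cell X Y Y h h (num N') (cls X Z Z N' ns x ys f)) \<longleftrightarrow>
      zact Y (sum_list ns) N' f (h (num (sum_list ns)) (ocomp P ns x ys)) =
      zact Y (sum_list ns) N' f (ocomp Q ns (h (num (length ns)) x) (map2 (\<lambda>n. h (num n)) ns ys))"
      if v: "x \<in> fobj Z (num (length ns))" "ys \<in> nfam Z ns" "f \<in> xfun X (sum_list ns) N'" for N' ns x ys f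
    proof -
      have x': "h (num (length ns)) x \<in> fobj Y (num (length ns))" by (rule nat_trans_closed[OF nt v(1)])
      have ys': "map2 (\<lambda>n. h (num n)) ns ys \<in> nfam Y ns" using v(2) nat_trans_closed[OF nt] by (auto simp: nfam_iff)
      have o: "ocomp P ns x ys \<in> fobj Z (num (sum_list ns))" using foperad_ocomp[OF FP] v(1,2) unfolding opsP tup by blast
      show ?thesis
        unfolding cls_2cell[OF Z Y nt Z Y nt v] multM[OF v] multN[OF x' ys' v(3)] nat_trans_zact[OF nt v(3) o] ..
    qed
    have R: "?R \<longleftrightarrow> (\<forall>ns. \<forall>x\<in>fobj Z (num (length ns)). \<forall>ys\<in>nfam Z ns.
        h (num (sum_list ns)) (ocomp P ns x ys) = ocomp Q ns (h (num (length ns)) x) (map2 (\<lambda>n. h (num n)) ns ys))"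
      unfolding opsP tup underlying_hom_def ..
    have L: "?L \<longleftrightarrow> (\<forall>N' ns. \<forall>x\<in>fobj Z (num (length ns)). \<forall>ys\<in>nfam Z ns. \<forall>f\<in>xfun X (sum_list ns) N'.
      zact Y (sum_list ns) N' f (h (num (sum_list ns)) (ocomp P ns x ys)) =
      zact Y (sum_list ns) N' f (ocomp Q ns (h (num (length ns)) x) (map2 (\<lambda>n. h (num n)) ns ys)))"
      unfolding ball_cls[OF Z] by (simp add: eq)
    show ?thesis
      unfolding L R
    proof (intro iffI allI ballI)
      fix ns x ys
      assume H: "\<forall>N' ns. \<forall>x\<in>fobj Z (num (length ns)). \<forall>ys\<in>nfam Z ns. \<forall>f\<in>xfun X (sum_list ns) N'.
        zact Y (sum_list ns) N' f (h (num (sum_list ns)) (ocomp P ns x ys)) =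
        zact Y (sum_list ns) N' f (ocomp Q ns (h (num (length ns)) x) (map2 (\<lambda>n. h (num n)) ns ys))"
        and v: "x \<in> fobj Z (num (length ns))" "ys \<in> nfam Z ns"
      have x': "h (num (length ns)) x \<in> fobj Y (num (length ns))" by (rule nat_trans_closed[OF nt v(1)])
      have ys': "map2 (\<lambda>n. h (num n)) ns ys \<in> nfam Y ns" using v(2) nat_trans_closed[OF nt] by (auto simp: nfam_iff)
      have o: "ocomp P ns x ys \<in> fobj Z (num (sum_list ns))" using foperad_ocomp[OF FP] v unfolding opsP tup by blast
      have o': "ocomp Q ns (h (num (length ns)) x) (map2 (\<lambda>n. h (num n)) ns ys) \<in> fobj Y (num (sum_list ns))"
        using monoid_ocomp_closed[OF N x'[unfolded Y_def] ys'[unfolded Y_def]] unfolding Y_def Q_def .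
      show "h (num (sum_list ns)) (ocomp P ns x ys) = ocomp Q ns (h (num (length ns)) x) (map2 (\<lambda>n. h (num n)) ns ys)"
        using H[rule_format, OF v xfun_id] unfolding zact_id[OF Y nat_trans_closed[OF nt o]] zact_id[OF Y o'] .
    qed simp
  qed
  have "is_endo_monoid_hom X one_cat M N h \<longleftrightarrow> natural (one_base X) Z Y h \<and>
    (\<forall>p\<in>obj (one_base X). \<forall>i\<in>fobj (unit_functor X) p. h p (munit M p i) = munit N p i) \<and>
    (\<forall>p\<in>obj (one_base X). \<forall>K\<in>fobj (comp X Z Z) p. h p (mmult M p K) = mmult N p (two_cell X Y Y h h p K))"
    unfolding is_endo_monoid_hom_def Let_def Z_def Y_def ..
  also have "\<dots> \<longleftrightarrow> is_foperad_hom X P Q (underlying_hom h)"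
    unfolding is_foperad_hom_def is_operad_hom_def using nat unit mult by blast
  finally show ?thesis unfolding P_def Q_def .
qed

theorem endo_monoids_iso_foperads:
  "category_iso (endo_monoids X one_cat) (foperads X) (foperad_of X) underlying_hom"
  unfolding category_iso_def
proof (intro conjI ballI)
  show "bij_betw (foperad_of X) (obj (endo_monoids X one_cat)) (obj (foperads X :: ('a foperad, nat \<Rightarrow> 'a \<Rightarrow> 'a) category))"
    by (rule bij_betwI')
       (auto simp: endo_monoids_def foperads_def foperad_of_foperad dest: foperad_of_inject
          intro: monoid_of_monoid foperad_of_monoid_of[symmetric])
next
  fix M N :: "'a one_monoid"
  assume "M \<in> obj (endo_monoids X one_cat)" "N \<in> obj (endo_monoids X one_cat)"
  then have MN: "is_endo_monoid X one_cat M" "is_endo_monoid X one_cat N" by (simp_all add: endo_monoids_def)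
  show "bij_betw underlying_hom (hom (endo_monoids X one_cat) M N) (hom (foperads X) (foperad_of X M) (foperad_of X N))"
  proof (rule bij_betwI')
    fix h k :: "unit list \<times> unit \<Rightarrow> 'a \<Rightarrow> 'a"
    have "h p = k p" if "underlying_hom h = underlying_hom k" for p
      by (rule one_objE[of p]) (use that in \<open>simp add: underlying_hom_def fun_eq_iff\<close>)
    then show "(underlying_hom h = underlying_hom k) = (h = k)" by auto
  next
    fix h assume "h \<in> hom (endo_monoids X one_cat) M N"
    then show "underlying_hom h \<in> hom (foperads X) (foperad_of X M) (foperad_of X N)"
      by (simp add: endo_monoids_def foperads_def endo_monoid_hom_iff[OF MN])
  next
    fix k assume k: "k \<in> hom (foperads X) (foperad_of X M) (foperad_of X N)"
    have "underlying_hom (\<lambda>p. k (length (fst p))) = k" by (simp add: underlying_hom_def)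
    with k show "\<exists>h\<in>hom (endo_monoids X one_cat) M N. k = underlying_hom h"
      by (intro bexI[of _ "\<lambda>p. k (length (fst p))"]) (simp_all add: endo_monoids_def foperads_def endo_monoid_hom_iff[OF MN])
  qed
next
  fix M :: "'a one_monoid"
  show "underlying_hom (ident (endo_monoids X one_cat) M) = ident (foperads X) (foperad_of X M)"
    by (simp add: underlying_hom_def endo_monoids_def foperads_def foperad_of_sel quest_sel restrict_def)
next
  fix M N L :: "'a one_monoid" and h k
  show "underlying_hom (cmp (endo_monoids X one_cat) M N L k h) =
    cmp (foperads X) (foperad_of X M) (foperad_of X N) (foperad_of X L) (underlying_hom k) (underlying_hom h)"
    by (simp add: underlying_hom_def endo_monoids_def foperads_def foperad_of_sel quest_sel)
qed


lemma category_iso_comp: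
  assumes F: "category_iso C D F0 F1" and G: "category_iso D E G0 (\<lambda>h. h)" and H: "\<And>a. a \<in> obj C \<Longrightarrow> H0 a = G0 (F0 a)"
  shows "category_iso C E H0 F1"
proof -
  have F0: "bij_betw F0 (obj C) (obj D)" and G0: "bij_betw G0 (obj D) (obj E)"
    using F G unfolding category_iso_def by blast+
  have D: "F0 a \<in> obj D" if "a \<in> obj C" for a using F0 that by (simp add: bij_betw_apply)
  have "bij_betw H0 (obj C) (obj E)"
    using bij_betw_trans[OF F0 G0] bij_betw_cong[of "obj C" H0 "G0 \<circ> F0"] H by simp
  moreover have "bij_betw F1 (hom C a b) (hom E (H0 a) (H0 b))" if "a \<in> obj C" "b \<in> obj C" for a b
  proof -
    have "bij_betw F1 (hom C a b) (hom D (F0 a) (F0 b))" "bij_betw (\<lambda>h. h) (hom D (F0 a) (F0 b)) (hom E (G0 (F0 a)) (G0 (F0 b)))"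
      using F G that D unfolding category_iso_def by blast+
    from bij_betw_trans[OF this] show ?thesis using H that by (simp add: o_def)
  qed
  moreover have "F1 (ident C a) = ident E (H0 a)" if "a \<in> obj C" for a
    using F G D H that unfolding category_iso_def by simp
  moreover have "F1 (cmp C a b c g f) = cmp E (H0 a) (H0 b) (H0 c) (F1 g) (F1 f)"
    if "a \<in> obj C" "b \<in> obj C" "c \<in> obj C" "f \<in> hom C a b" "g \<in> hom C b c" for a b c f g
  proof -
    have "F1 f \<in> hom D (F0 a) (F0 b)" "F1 g \<in> hom D (F0 b) (F0 c)"
      using F that unfolding category_iso_def by (meson bij_betw_apply)+
    then show ?thesis using F G D H that unfolding category_iso_def by simp
  qed
  ultimately show ?thesis unfolding category_iso_def by blast
qed

lemma foperad_eqI: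
  assumes P: "is_foperad X P" and Q: "is_foperad X Q"
    and "ops P = ops Q" "oid P = oid Q" "ocomp P = ocomp Q"
    and ract: "\<And>m n f x. \<lbrakk>f \<in> xfun X m n; x \<in> ops P m\<rbrakk> \<Longrightarrow> ract P m n f x = ract Q m n f x"
  shows "P = Q"
proof -
  have "ract P m n f x = ract Q m n f x" for m n f x
    using ract[of f m n x] extensional_arb[OF foperad_extensional(1)[OF P], of f m n] extensional_arb[OF foperad_extensional(1)[OF Q], of f m n]
      extensional_arb[OF foperad_extensional(2)[OF P], of f m n x] extensional_arb[OF foperad_extensional(2)[OF Q], of f m n x] assms(3)
    by metis
  then show ?thesis using assms(3-5) by (intro foperad.equality) (auto simp: fun_eq_iff)
qed


section \<open>Non-symmetric operads\<close>

lemma operad_truncate_sel [simp]: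
  "ops (operad.truncate P) = ops P" "oid (operad.truncate P) = oid P" "ocomp (operad.truncate P) = ocomp P"
  by (simp_all add: operad.truncate_def)

lemma is_operad_truncate: "is_operad (operad.truncate P) \<longleftrightarrow> is_operad P"
  by (simp add: is_operad_def)

definition planar_foperad :: "'a operad \<Rightarrow> 'a foperad" where
  "planar_foperad P = operad.extend P \<lparr>ract = (\<lambda>m n. \<lambda>f\<in>xfun Planar m n. \<lambda>x\<in>ops P m. x)\<rparr>"

lemma planar_foperad_sel:
  "ops (planar_foperad P) = ops P" "oid (planar_foperad P) = oid P" "ocomp (planar_foperad P) = ocomp P"
  "ract (planar_foperad P) = (\<lambda>m n. \<lambda>f\<in>xfun Planar m n. \<lambda>x\<in>ops P m. x)"
  by (simp_all add: planar_foperad_def operad.extend_def)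

lemma planar_foperad:
  assumes P: "is_operad P" shows "is_foperad Planar (planar_foperad P)"
proof -
  have c: "ocomp P ns x ys \<in> ops P (sum_list ns)" if "x \<in> ops P (length ns)" "ys \<in> tuples (map (ops P) ns)" for ns x ys
    using P[unfolded is_operad_def, THEN conjunct2, THEN conjunct1] that by (simp add: PiE_iff)
  have F1: "is_operad (planar_foperad P)" using P by (simp add: is_operad_def planar_foperad_sel)
  have F2: "ract (planar_foperad P) \<in> (\<Pi>\<^sub>E m\<in>UNIV. \<Pi>\<^sub>E n\<in>UNIV. \<Pi>\<^sub>E f\<in>xfun Planar m n. ops P m \<rightarrow>\<^sub>E ops P n)"
    by (auto simp: planar_foperad_sel xfun_Planar split: if_splits intro!: PiE_I)
  have F6: "ocomp P ns x (map (\<lambda>i. ract (planar_foperad P) (ms ! i) (ns ! i) (fs ! i) (ys ! i)) [0..<length ns]) =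
          ract (planar_foperad P) (sum_list ms) (sum_list ns) (dsum ns fs) (ocomp P ms x ys)"
    if fs: "length fs = length ns" "length ms = length ns" "\<forall>i<length ns. fs ! i \<in> xfun Planar (ms ! i) (ns ! i)"
      and x: "x \<in> ops P (length ns)" and ys: "ys \<in> tuples (map (ops P) ms)" for ns ms fs x ys
  proof -
    have "ms ! i = ns ! i \<and> fs ! i = [0..<ns ! i]" if "i < length ns" for i
      using fs(3)[rule_format, OF that] by (auto simp: xfun_Planar split: if_splits)
    then have ms: "ms = ns" and fs': "fs = map (\<lambda>n. [0..<n]) ns" using fs(1,2) by (auto intro: nth_equalityI)
    have "map (\<lambda>i. ract (planar_foperad P) (ns ! i) (ns ! i) (fs ! i) (ys ! i)) [0..<length ns] = ys"
      using ys by (intro nth_equalityI) (auto simp: fs' ms tuples_iff planar_foperad_sel)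
    then show ?thesis using c[OF x ys[unfolded ms]] by (simp add: ms fs' planar_foperad_sel)
  qed
  have F5: "ocomp P ns (ract (planar_foperad P) k (length ns) g x) ys =
        ract (planar_foperad P) (sum_list (map ((!) ns) g)) (sum_list ns) (blockf ns g) (ocomp P (map ((!) ns) g) x (map ((!) ys) g))"
    if g: "g \<in> xfun Planar k (length ns)" and x: "x \<in> ops P k" and ys: "ys \<in> tuples (map (ops P) ns)" for ns k g x ys
  proof -
    have k: "k = length ns" and g': "g = [0..<length ns]" using g by (auto simp: xfun_Planar split: if_splits)
    have "map ((!) ys) g = ys" "map ((!) ns) g = ns" using ys unfolding g' by (simp_all add: map_nth_id tuples_iff)
    then show ?thesis using c[OF x[unfolded k] ys] x by (simp add: g' k planar_foperad_sel)
  qed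
  have F3: "ract (planar_foperad P) n n [0..<n] x = x" if "x \<in> ops P n" for n x
    using that by (simp add: planar_foperad_sel)
  have F4: "ract (planar_foperad P) m n g (ract (planar_foperad P) l m f x) = ract (planar_foperad P) l n (map ((!) g) f) x"
    if "f \<in> xfun Planar l m" "g \<in> xfun Planar m n" "x \<in> ops P l" for l m n f g x
    using that xfun_comp[OF that(1,2)] by (auto simp: planar_foperad_sel xfun_Planar split: if_splits)
  show ?thesis
    unfolding is_foperad_def planar_foperad_sel(1-3)
    by (intro conjI allI ballI impI F1 F2[unfolded planar_foperad_sel(1)]; (rule F3 F4 F5 F6; assumption))
qed

theorem foperads_iso_operads: "category_iso (foperads Planar) operads operad.truncate (\<lambda>h. h)"
proof -
  have "bij_betw operad.truncate (obj (foperads Planar)) (obj (operads :: ('a operad, nat \<Rightarrow> 'a \<Rightarrow> 'a) category))"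
  proof (rule bij_betwI')
    fix P Q :: "'a foperad" assume "P \<in> obj (foperads Planar)" "Q \<in> obj (foperads Planar)"
    then have PQ: "is_foperad Planar P" "is_foperad Planar Q" by (simp_all add: foperads_def)
    show "(operad.truncate P = operad.truncate Q) = (P = Q)"
    proof
      assume e: "operad.truncate P = operad.truncate Q"
      then have eq: "ops P = ops Q" "oid P = oid Q" "ocomp P = ocomp Q" by (metis operad_truncate_sel)+
      show "P = Q"
        by (rule foperad_eqI[OF PQ eq])
           (auto simp: xfun_Planar foperad_ract_id[OF PQ(1)] foperad_ract_id[OF PQ(2)] eq split: if_splits)
    qed simp
  next
    fix P :: "'a foperad" assume "P \<in> obj (foperads Planar)"
    then show "operad.truncate P \<in> obj operads" by (simp add: foperads_def operads_def is_operad_truncate foperad_operad)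
  next
    fix P :: "'a operad" assume "P \<in> obj operads"
    then have "is_foperad Planar (planar_foperad P)" by (simp add: operads_def planar_foperad)
    moreover have "P = operad.truncate (planar_foperad P)" by (simp add: operad.truncate_def planar_foperad_sel)
    ultimately show "\<exists>Q\<in>obj (foperads Planar). P = operad.truncate Q" by (auto simp: foperads_def)
  qed
  moreover have "hom (foperads Planar) P Q = hom operads (operad.truncate P) (operad.truncate Q)"
    if "P \<in> obj (foperads Planar)" "Q \<in> obj (foperads Planar)" for P Q :: "'a foperad"
  proof -
    have PQ: "is_foperad Planar P" "is_foperad Planar Q" using that by (simp_all add: foperads_def)
    have "is_foperad_hom Planar P Q = is_operad_hom (operad.truncate P) (operad.truncate Q)"
    proof (rule ext)
      fix h
      have "h n x \<in> ops Q n" if "is_operad_hom P Q h" "x \<in> ops P n" for n x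
        using that unfolding is_operad_hom_def by (auto simp: PiE_iff)
      moreover have "is_operad_hom (operad.truncate P) (operad.truncate Q) h = is_operad_hom P Q h"
        by (simp add: is_operad_hom_def)
      ultimately show "is_foperad_hom Planar P Q h = is_operad_hom (operad.truncate P) (operad.truncate Q) h"
        unfolding is_foperad_hom_def
        by (auto simp: xfun_Planar foperad_ract_id[OF PQ(1)] foperad_ract_id[OF PQ(2)] split: if_splits)
    qed
    then show ?thesis by (simp add: foperads_def operads_def)
  qed
  ultimately show ?thesis
    unfolding category_iso_def by (simp add: foperads_def operads_def bij_betw_def)
qed

lemma underlying_operad_truncate: "underlying_operad X M = operad.truncate (foperad_of X M)"
  by (simp add: foperad_of_def operad.truncate_def operad.extend_def)


section \<open>Symmetric operads\<close>

definition inv_list :: "nat \<Rightarrow> (nat \<Rightarrow> nat) \<Rightarrow> nat list" where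
  "inv_list n \<sigma> = map (inv \<sigma>) [0..<n]"

lemma perm_list_xfun: "\<sigma> permutes {..<n} \<Longrightarrow> map \<sigma> [0..<n] \<in> xfun Symmetric n n"
  by (simp add: xfun_Symmetric distinct_map permutes_inj_on lessThan_atLeast0 permutes_image)

lemma inv_list_xfun: "\<sigma> permutes {..<n} \<Longrightarrow> inv_list n \<sigma> \<in> xfun Symmetric n n"
  unfolding inv_list_def by (rule perm_list_xfun[OF permutes_inv])

lemma perm_of_list_permutes:
  assumes "f \<in> xfun Symmetric n n" shows "perm_of_list f permutes {..<n}"
proof -
  have f: "length f = n" "distinct f" "set f = {..<n}" using assms by (auto simp: xfun_Symmetric)
  have "bij_betw ((!) f) {..<n} {..<n}" using f by (simp add: bij_betw_nth_iff)
  then have "bij_betw (perm_of_list f) {..<n} {..<n}"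
    using bij_betw_cong[of "{..<n}" "perm_of_list f" "(!) f"] f(1) by (simp add: perm_of_list_def)
  then show ?thesis by (rule bij_imp_permutes) (use f(1) in \<open>simp add: perm_of_list_def\<close>)
qed

lemma map_perm_of_list: "length f = n \<Longrightarrow> map (perm_of_list f) [0..<n] = f"
  by (auto simp: perm_of_list_def intro: nth_equalityI)

lemma perm_of_list_map: "\<sigma> permutes {..<n} \<Longrightarrow> perm_of_list (map \<sigma> [0..<n]) = \<sigma>"
  by (auto simp: perm_of_list_def fun_eq_iff permutes_def)

text \<open>Permutations act on the right and maps on the left, so that a permutation is paired with the list of its
  inverse.\<close>

lemma sym_xfunE:
  assumes "f \<in> xfun Symmetric m n"
  obtains \<sigma> where "m = n" "\<sigma> permutes {..<n}" "f = inv_list n \<sigma>"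
proof (rule that)
  show m: "m = n" using assms by (auto simp: xfun_Symmetric split: if_splits)
  have f: "f \<in> xfun Symmetric n n" using assms m by simp
  show "inv (perm_of_list f) permutes {..<n}" by (rule permutes_inv[OF perm_of_list_permutes[OF f]])
  show "f = inv_list n (inv (perm_of_list f))"
    unfolding inv_list_def by (simp add: inv_inv_eq[OF permutes_bij[OF perm_of_list_permutes[OF f]]] map_perm_of_list[OF xfunD(1)[OF f]])
qed

lemma inv_list_id: "inv_list n id = [0..<n]"
  by (simp add: inv_list_def)

lemma inv_list_comp:
  assumes \<sigma>: "\<sigma> permutes {..<n}" and \<tau>: "\<tau> permutes {..<n}"
  shows "map ((!) (inv_list n \<tau>)) (inv_list n \<sigma>) = inv_list n (\<sigma> \<circ> \<tau>)"
proof -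
  have "inv (\<sigma> \<circ> \<tau>) = inv \<tau> \<circ> inv \<sigma>" using \<sigma> \<tau> by (simp add: o_inv_distrib permutes_bij)
  moreover have "inv \<sigma> i < n" if "i < n" for i using permutes_in_image[OF permutes_inv[OF \<sigma>], of i] that by simp
  ultimately show ?thesis by (simp add: inv_list_def)
qed

lemma inv_listI:
  assumes L: "L \<in> xfun Symmetric n n" and B: "B \<in> xfun Symmetric n n" and LB: "map ((!) L) B = [0..<n]"
  shows "inv_list n (perm_of_list L) = B"
proof (rule nth_equalityI)
  show "length (inv_list n (perm_of_list L)) = length B" using xfunD(1)[OF B] by (simp add: inv_list_def)
  fix i assume "i < length (inv_list n (perm_of_list L))"
  then have i: "i < n" by (simp add: inv_list_def)
  have "B ! i < n" using xfunD(3)[OF B i] .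
  moreover have "L ! (B ! i) = i" using arg_cong[OF LB, of "\<lambda>xs. xs ! i"] i xfunD(1)[OF B] by simp
  ultimately have "perm_of_list L (B ! i) = i" using xfunD(1)[OF L] by (simp add: perm_of_list_def)
  then have "inv (perm_of_list L) i = B ! i" using permutes_inj[OF perm_of_list_permutes[OF L]] by (simp add: inv_f_eq)
  then show "inv_list n (perm_of_list L) ! i = B ! i" using i by (simp add: inv_list_def)
qed

lemma sym_xfun_eq: "f \<in> xfun Symmetric m n \<Longrightarrow> m = n"
  by (simp add: xfun_Symmetric split: if_splits)

text \<open>A block permutation is the block map of \<open>\<sigma>\<close> for the permuted block sizes. Composed with the block map of the
  inverse of \<open>\<sigma>\<close> it gives the block map of an identity, so that the two are inverse to each other.\<close>

lemma block_perm_inv_list: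
  assumes \<sigma>: "\<sigma> permutes {..<length ns}"
  shows "block_perm ns \<sigma> permutes {..<sum_list ns}"
    and "blockf ns (inv_list (length ns) \<sigma>) = inv_list (sum_list ns) (block_perm ns \<sigma>)"
    and "map ((!) ns) (inv_list (length ns) \<sigma>) = permute_list_inv \<sigma> ns"
    and "sum_list (permute_list_inv \<sigma> ns) = sum_list ns"
proof -
  let ?k = "length ns" and ?g = "inv_list (length ns) \<sigma>" and ?s = "map \<sigma> [0..<length ns]"
  define ns' where "ns' = permute_list_inv \<sigma> ns"
  show ns'_eq: "map ((!) ns) ?g = permute_list_inv \<sigma> ns" by (simp add: inv_list_def permute_list_inv_def)
  have l: "length ns' = ?k" by (simp add: ns'_def permute_list_inv_def)
  have \<sigma>k: "\<sigma> i < ?k" if "i < ?k" for i using permutes_in_image[OF \<sigma>, of i] that by simp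
  have ns'\<sigma>: "ns' ! \<sigma> i = ns ! i" if "i < ?k" for i
    using \<sigma>k[OF that] permutes_inverses(2)[OF \<sigma>] by (simp add: ns'_def permute_list_inv_def)
  note s = perm_list_xfun[OF \<sigma>] and g = inv_list_xfun[OF \<sigma>]
  have ns's: "map ((!) ns') ?s = ns" using ns'\<sigma> by (intro nth_equalityI) simp_all
  have L: "concat (map (\<lambda>i. map (\<lambda>j. sum_list (take (\<sigma> i) (permute_list_inv \<sigma> ns)) + j) [0..<ns ! i]) [0..<?k]) = blockf ns' ?s"
    unfolding blockf_def wreath_def ns'_def[symmetric]
    by (rule arg_cong[where f = concat]) (simp add: ns'\<sigma>)
  have bs: "blockf ns' ?s \<in> xfun Symmetric (sum_list ns) (sum_list ns')"
    using blockf_xfun[of ?s Symmetric ?k ns'] s unfolding ns's l by simp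
  show eq: "sum_list (permute_list_inv \<sigma> ns) = sum_list ns" using sym_xfun_eq[OF bs] by (simp add: ns'_def)
  have bg: "blockf ns ?g \<in> xfun Symmetric (sum_list ns) (sum_list ns)"
    using blockf_xfun[of ?g Symmetric ?k ns] g unfolding ns'_eq eq by simp
  have bp: "block_perm ns \<sigma> = perm_of_list (blockf ns' ?s)" unfolding block_perm_def L ..
  have bs': "blockf ns' ?s \<in> xfun Symmetric (sum_list ns) (sum_list ns)" using bs eq by (simp add: ns'_def)
  show "block_perm ns \<sigma> permutes {..<sum_list ns}" unfolding bp by (rule perm_of_list_permutes[OF bs'])
  have "map ((!) ?s) ?g = [0..<?k]"
    using permutes_inverses(1)[OF \<sigma>] permutes_in_image[OF permutes_inv[OF \<sigma>]] by (intro nth_equalityI) (simp_all add: inv_list_def)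
  then have "map ((!) (blockf ns' ?s)) (blockf ns ?g) = blockf ns' [0..<?k]"
    using blockf_comp[of ?s ns' ?g] xfunD(2)[OF s] xfunD(2)[OF g] unfolding ns's l by simp
  then have "map ((!) (blockf ns' ?s)) (blockf ns ?g) = [0..<sum_list ns]"
    using blockf_id[of ns'] eq unfolding l by (simp add: ns'_def)
  then show "blockf ns ?g = inv_list (sum_list ns) (block_perm ns \<sigma>)"
    unfolding bp using inv_listI[OF bs' bg] by simp
qed

lemma direct_sum_perm_inv_list:
  assumes \<tau>: "list_all2 (\<lambda>\<tau> n. \<tau> permutes {..<n}) \<tau>s ns"
  shows "direct_sum_perm ns \<tau>s permutes {..<sum_list ns}"
    and "dsum ns (map2 inv_list ns \<tau>s) = inv_list (sum_list ns) (direct_sum_perm ns \<tau>s)"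
proof -
  have l: "length \<tau>s = length ns" and \<tau>i: "\<And>i. i < length ns \<Longrightarrow> (\<tau>s ! i) permutes {..<ns ! i}"
    using \<tau> by (auto simp: list_all2_conv_all_nth)
  let ?L = "map (\<lambda>i. map (\<tau>s ! i) [0..<ns ! i]) [0..<length ns]" and ?B = "map2 inv_list ns \<tau>s"
  have L: "dsum ns ?L \<in> xfun Symmetric (sum_list ns) (sum_list ns)"
    by (rule dsum_xfun) (simp_all add: perm_list_xfun \<tau>i)
  have B: "dsum ns ?B \<in> xfun Symmetric (sum_list ns) (sum_list ns)"
    by (rule dsum_xfun) (simp_all add: inv_list_xfun \<tau>i l)
  have dp: "direct_sum_perm ns \<tau>s = perm_of_list (dsum ns ?L)"
    unfolding direct_sum_perm_def dsum_def wreath_def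
    by (rule arg_cong[where f = "\<lambda>xs. perm_of_list (concat xs)"]) (simp add: map_zip_upt o_def)
  show "direct_sum_perm ns \<tau>s permutes {..<sum_list ns}" unfolding dp by (rule perm_of_list_permutes[OF L])
  have "map length ?L = ns" by (intro nth_equalityI) simp_all
  moreover have "map ((!) (dsum ns ?L)) (dsum (map length ?L) ?B) = dsum ns (map (\<lambda>i. map ((!) (?L ! i)) (?B ! i)) [0..<length ns])"
  proof (rule dsum_comp)
    fix i assume i: "i < length ns"
    show "set (?B ! i) \<subseteq> {..<length (?L ! i)}" using xfunD(2)[OF inv_list_xfun[OF \<tau>i[OF i]]] i l by simp
  qed (simp_all add: l)
  moreover have "map (\<lambda>i. map ((!) (?L ! i)) (?B ! i)) [0..<length ns] = map (\<lambda>n. [0..<n]) ns"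
  proof (rule nth_equalityI, goal_cases)
    case 1 then show ?case by simp
  next
    case (2 i)
    then have i: "i < length ns" by simp
    have "(\<tau>s ! i) (inv (\<tau>s ! i) j) = j \<and> inv (\<tau>s ! i) j < ns ! i" if "j < ns ! i" for j
      using permutes_inverses(1)[OF \<tau>i[OF i]] permutes_in_image[OF permutes_inv[OF \<tau>i[OF i]], of j] that by simp
    then show ?case using i l by (intro nth_equalityI) (simp_all add: inv_list_def)
  qed
  ultimately have "map ((!) (dsum ns ?L)) (dsum ns ?B) = [0..<sum_list ns]" by simp
  then show "dsum ns ?B = inv_list (sum_list ns) (direct_sum_perm ns \<tau>s)"
    unfolding dp using inv_listI[OF L B] by simp
qed

definition sym_operad_of :: "'a foperad \<Rightarrow> 'a sym_operad" where
  "sym_operad_of P = operad.extend (operad.truncate P)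
     \<lparr>act = (\<lambda>n. \<lambda>\<sigma>\<in>{\<sigma>. \<sigma> permutes {..<n}}. \<lambda>x\<in>ops P n. ract P n n (inv_list n \<sigma>) x)\<rparr>"

definition sym_foperad :: "'a sym_operad \<Rightarrow> 'a foperad" where
  "sym_foperad P = operad.extend (operad.truncate P)
     \<lparr>ract = (\<lambda>m n. \<lambda>f\<in>xfun Symmetric m n. \<lambda>x\<in>ops P m. act P n (inv (perm_of_list f)) x)\<rparr>"

lemma sym_operad_of_sel:
  "ops (sym_operad_of P) = ops P" "oid (sym_operad_of P) = oid P" "ocomp (sym_operad_of P) = ocomp P"
  "act (sym_operad_of P) = (\<lambda>n. \<lambda>\<sigma>\<in>{\<sigma>. \<sigma> permutes {..<n}}. \<lambda>x\<in>ops P n. ract P n n (inv_list n \<sigma>) x)"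
  by (simp_all add: sym_operad_of_def operad.extend_def)

lemma sym_foperad_sel:
  "ops (sym_foperad P) = ops P" "oid (sym_foperad P) = oid P" "ocomp (sym_foperad P) = ocomp P"
  "ract (sym_foperad P) = (\<lambda>m n. \<lambda>f\<in>xfun Symmetric m n. \<lambda>x\<in>ops P m. act P n (inv (perm_of_list f)) x)"
  by (simp_all add: sym_foperad_def operad.extend_def)

lemma sym_foperad_ract:
  assumes "\<sigma> permutes {..<n}" "x \<in> ops P n"
  shows "ract (sym_foperad P) n n (inv_list n \<sigma>) x = act P n \<sigma> x"
proof -
  have "inv (perm_of_list (inv_list n \<sigma>)) = \<sigma>"
    unfolding inv_list_def perm_of_list_map[OF permutes_inv[OF assms(1)]] by (rule inv_inv_eq[OF permutes_bij[OF assms(1)]])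
  then show ?thesis using assms inv_list_xfun[OF assms(1)] by (simp add: sym_foperad_sel)
qed

lemma permute_list_inv_tuples:
  fixes ns :: "nat list"
  assumes "\<sigma> permutes {..<length ns}" "ys \<in> tuples (map A ns)"
  shows "map ((!) ys) (inv_list (length ns) \<sigma>) = permute_list_inv \<sigma> ys"
    and "permute_list_inv \<sigma> ys \<in> tuples (map A (permute_list_inv \<sigma> ns))"
proof -
  show 1: "map ((!) ys) (inv_list (length ns) \<sigma>) = permute_list_inv \<sigma> ys"
    using assms(2) by (simp add: inv_list_def permute_list_inv_def tuples_iff)
  show "permute_list_inv \<sigma> ys \<in> tuples (map A (permute_list_inv \<sigma> ns))"
    using tuples_nthI[OF assms(2) xfunD(2)[OF inv_list_xfun[OF assms(1)]]]
    unfolding 1 block_perm_inv_list(3)[OF assms(1)] .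
qed

text \<open>Through \<open>block_perm_inv_list\<close> and \<open>direct_sum_perm_inv_list\<close> the two naturality axioms, for bijections, become
  the two equivariance axioms; \<open>sym_foperad\<close> reads the same translation backwards.\<close>

lemma sym_operad_of:
  assumes P: "is_foperad Symmetric P" shows "is_sym_operad (sym_operad_of P)"
proof -
  have a: "act (sym_operad_of P) n \<sigma> x = ract P n n (inv_list n \<sigma>) x" if "\<sigma> permutes {..<n}" "x \<in> ops P n" for n \<sigma> x
    using that by (simp add: sym_operad_of_sel)
  have cl: "ract P n n (inv_list n \<sigma>) x \<in> ops P n" if "\<sigma> permutes {..<n}" "x \<in> ops P n" for n \<sigma> x
    by (rule foperad_ract[OF P inv_list_xfun[OF that(1)] that(2)])
  show ?thesis
    unfolding is_sym_operad_def sym_operad_of_sel(1-3)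
  proof (intro conjI allI impI ballI)
    show "is_operad (sym_operad_of P)" using foperad_operad[OF P] by (simp add: is_operad_def sym_operad_of_sel)
    show "act (sym_operad_of P) \<in> (\<Pi>\<^sub>E n\<in>UNIV. \<Pi>\<^sub>E \<sigma>\<in>{\<sigma>. \<sigma> permutes {..<n}}. ops P n \<rightarrow>\<^sub>E ops P n)"
      using cl by (auto simp: sym_operad_of_sel intro!: PiE_I)
  next
    fix n x assume "x \<in> ops P n"
    then show "act (sym_operad_of P) n id x = x" by (simp add: a permutes_id inv_list_id foperad_ract_id[OF P])
  next
    fix n \<sigma> \<tau> x assume p: "\<sigma> permutes {..<n}" "\<tau> permutes {..<n}" and x: "x \<in> ops P n"
    show "act (sym_operad_of P) n \<tau> (act (sym_operad_of P) n \<sigma> x) = act (sym_operad_of P) n (\<sigma> \<circ> \<tau>) x"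
      unfolding a[OF p(1) x] a[OF p(2) cl[OF p(1) x]] a[OF permutes_compose[OF p(2,1)] x]
        foperad_ract_comp[OF P inv_list_xfun[OF p(1)] inv_list_xfun[OF p(2)] x] inv_list_comp[OF p] ..
  next
    fix ns \<sigma> x ys assume \<sigma>: "\<sigma> permutes {..<length ns}" and x: "x \<in> ops P (length ns)" and ys: "ys \<in> tuples (map (ops P) ns)"
    note b = block_perm_inv_list[OF \<sigma>] and t = permute_list_inv_tuples[OF \<sigma> ys]
    have x': "x \<in> ops P (length (permute_list_inv \<sigma> ns))" using x by (simp add: permute_list_inv_def)
    have c: "ocomp P (permute_list_inv \<sigma> ns) x (permute_list_inv \<sigma> ys) \<in> ops P (sum_list ns)"
      using foperad_ocomp[OF P x' t(2)] unfolding b(4) .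
    show "ocomp P ns (act (sym_operad_of P) (length ns) \<sigma> x) ys =
      act (sym_operad_of P) (sum_list ns) (block_perm ns \<sigma>) (ocomp P (permute_list_inv \<sigma> ns) x (permute_list_inv \<sigma> ys))"
      unfolding a[OF \<sigma> x] a[OF b(1) c] foperad_blockf[OF P inv_list_xfun[OF \<sigma>] x ys] b(2-4) t(1) ..
  next
    fix ns \<tau>s x ys assume \<tau>: "list_all2 (\<lambda>\<tau> n. \<tau> permutes {..<n}) \<tau>s ns" and x: "x \<in> ops P (length ns)" and ys: "ys \<in> tuples (map (ops P) ns)"
    note d = direct_sum_perm_inv_list[OF \<tau>]
    have l: "length \<tau>s = length ns" and \<tau>i: "\<And>i. i < length ns \<Longrightarrow> (\<tau>s ! i) permutes {..<ns ! i}"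
      using \<tau> by (auto simp: list_all2_conv_all_nth)
    have yi: "ys ! i \<in> ops P (ns ! i)" if "i < length ns" for i using ys that by (simp add: tuples_iff)
    have e: "map (\<lambda>i. act (sym_operad_of P) (ns ! i) (\<tau>s ! i) (ys ! i)) [0..<length ns] =
      map (\<lambda>i. ract P (ns ! i) (ns ! i) (map2 inv_list ns \<tau>s ! i) (ys ! i)) [0..<length ns]"
      using l \<tau>i yi by (intro nth_equalityI) (simp_all add: a)
    show "ocomp P ns x (map (\<lambda>i. act (sym_operad_of P) (ns ! i) (\<tau>s ! i) (ys ! i)) [0..<length ns]) =
      act (sym_operad_of P) (sum_list ns) (direct_sum_perm ns \<tau>s) (ocomp P ns x ys)"
      unfolding e a[OF d(1) foperad_ocomp[OF P x ys]] d(2)[symmetric]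
      by (rule foperad_dsum[OF P _ _ _ x ys]) (simp_all add: l inv_list_xfun \<tau>i)
  qed
qed

lemma sym_foperad:
  assumes P: "is_sym_operad P" shows "is_foperad Symmetric (sym_foperad P)"
proof -
  let ?Q = "sym_foperad P"
  note S = P[unfolded is_sym_operad_def]
  have op: "is_operad P" using S by blast
  have "act P \<in> (\<Pi>\<^sub>E n\<in>UNIV. \<Pi>\<^sub>E \<sigma>\<in>{\<sigma>. \<sigma> permutes {..<n}}. ops P n \<rightarrow>\<^sub>E ops P n)"
    by (rule S[THEN conjunct2, THEN conjunct1])
  then have acl: "act P n \<sigma> x \<in> ops P n" if "\<sigma> permutes {..<n}" "x \<in> ops P n" for n \<sigma> x
    using that by (simp add: PiE_iff)
  have c: "ocomp P ns x ys \<in> ops P (sum_list ns)" if "x \<in> ops P (length ns)" "ys \<in> tuples (map (ops P) ns)" for ns x ys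
    using op[unfolded is_operad_def, THEN conjunct2, THEN conjunct1] that by (simp add: PiE_iff)
  note r = sym_foperad_ract[of _ _ _ P]
  have F1: "is_operad ?Q" using op by (simp add: is_operad_def sym_foperad_sel)
  have F2': "ract ?Q m n f x \<in> ops P n" if "f \<in> xfun Symmetric m n" "x \<in> ops P m" for m n f x
    using that by (elim sym_xfunE) (simp add: r acl)
  have F2: "ract ?Q \<in> (\<Pi>\<^sub>E m\<in>UNIV. \<Pi>\<^sub>E n\<in>UNIV. \<Pi>\<^sub>E f\<in>xfun Symmetric m n. ops P m \<rightarrow>\<^sub>E ops P n)"
    using F2' by (intro PiE_I) (simp_all, simp_all add: sym_foperad_sel)
  have F3: "ract ?Q n n [0..<n] x = x" if "x \<in> ops P n" for n x
    using r[OF permutes_id that] S that unfolding inv_list_id by simp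
  have F4: "ract ?Q m n g (ract ?Q l m f x) = ract ?Q l n (map ((!) g) f) x"
    if "f \<in> xfun Symmetric l m" "g \<in> xfun Symmetric m n" "x \<in> ops P l" for l m n f g x
  proof -
    from that(2) obtain \<tau> where \<tau>: "m = n" "\<tau> permutes {..<n}" "g = inv_list n \<tau>" by (rule sym_xfunE)
    from that(1) obtain \<sigma> where \<sigma>: "l = n" "\<sigma> permutes {..<n}" "f = inv_list n \<sigma>" unfolding \<tau>(1) by (rule sym_xfunE)
    have x: "x \<in> ops P n" using that(3) \<sigma>(1) by simp
    show ?thesis
      unfolding \<tau>(1,3) \<sigma>(1,3) inv_list_comp[OF \<sigma>(2) \<tau>(2)] r[OF \<sigma>(2) x] r[OF \<tau>(2) acl[OF \<sigma>(2) x]]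
        r[OF permutes_compose[OF \<tau>(2) \<sigma>(2)] x]
      using S \<sigma>(2) \<tau>(2) x by blast
  qed
  have F5: "ocomp P ns (ract ?Q k (length ns) g x) ys =
        ract ?Q (sum_list (map ((!) ns) g)) (sum_list ns) (blockf ns g) (ocomp P (map ((!) ns) g) x (map ((!) ys) g))"
    if "g \<in> xfun Symmetric k (length ns)" "x \<in> ops P k" and ys: "ys \<in> tuples (map (ops P) ns)" for ns k g x ys
  proof -
    from that(1) obtain \<sigma> where \<sigma>: "k = length ns" "\<sigma> permutes {..<length ns}" "g = inv_list (length ns) \<sigma>" by (rule sym_xfunE)
    have x: "x \<in> ops P (length ns)" using that(2) \<sigma>(1) by simp
    note b = block_perm_inv_list[OF \<sigma>(2)] and t = permute_list_inv_tuples[OF \<sigma>(2) ys]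
    have x': "x \<in> ops P (length (permute_list_inv \<sigma> ns))" using x by (simp add: permute_list_inv_def)
    have oc: "ocomp P (permute_list_inv \<sigma> ns) x (permute_list_inv \<sigma> ys) \<in> ops P (sum_list ns)"
      using c[OF x' t(2)] unfolding b(4) .
    show ?thesis
      unfolding \<sigma>(1,3) b(2-4) t(1) r[OF \<sigma>(2) x] r[OF b(1) oc] using S \<sigma>(2) x ys by blast
  qed
  have F6: "ocomp P ns x (map (\<lambda>i. ract ?Q (ms ! i) (ns ! i) (fs ! i) (ys ! i)) [0..<length ns]) =
          ract ?Q (sum_list ms) (sum_list ns) (dsum ns fs) (ocomp P ms x ys)"
    if fs: "length fs = length ns" "length ms = length ns" "\<forall>i<length ns. fs ! i \<in> xfun Symmetric (ms ! i) (ns ! i)"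
      and x: "x \<in> ops P (length ns)" and ys: "ys \<in> tuples (map (ops P) ms)" for ns ms fs x ys
  proof -
    have "\<forall>i\<in>{..<length ns}. \<exists>\<tau>. ms ! i = ns ! i \<and> \<tau> permutes {..<ns ! i} \<and> fs ! i = inv_list (ns ! i) \<tau>"
      using fs(3) by (metis lessThan_iff sym_xfunE)
    then obtain T where T: "\<And>i. i < length ns \<Longrightarrow> ms ! i = ns ! i \<and> T i permutes {..<ns ! i} \<and> fs ! i = inv_list (ns ! i) (T i)"
      by (metis bchoice lessThan_iff)
    define \<tau>s where "\<tau>s = map T [0..<length ns]"
    have \<tau>: "list_all2 (\<lambda>\<tau> n. \<tau> permutes {..<n}) \<tau>s ns" using T by (simp add: \<tau>s_def list_all2_conv_all_nth)
    have ms: "ms = ns" using T fs(2) by (auto intro: nth_equalityI)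
    have fs': "fs = map2 inv_list ns \<tau>s" using T fs(1) by (intro nth_equalityI) (simp_all add: \<tau>s_def)
    have ys': "ys \<in> tuples (map (ops P) ns)" using ys unfolding ms .
    have "map (\<lambda>i. ract ?Q (ns ! i) (ns ! i) (fs ! i) (ys ! i)) [0..<length ns] = map (\<lambda>i. act P (ns ! i) (\<tau>s ! i) (ys ! i)) [0..<length ns]"
      using T ys' by (auto simp: \<tau>s_def tuples_iff r)
    note e = this
    show ?thesis
      unfolding ms e
      unfolding fs' direct_sum_perm_inv_list(2)[OF \<tau>] r[OF direct_sum_perm_inv_list(1)[OF \<tau>] c[OF x ys']]
      by (rule S[THEN conjunct2, THEN conjunct2, THEN conjunct2, THEN conjunct2, THEN conjunct2, rule_format, OF \<tau> x ys'])
  qed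
  show ?thesis
    unfolding is_foperad_def sym_foperad_sel(1-3)
    by (intro conjI allI ballI impI F1 F2; (rule F3 F4 F5 F6; assumption))
qed

theorem foperads_iso_sym_operads: "category_iso (foperads Symmetric) sym_operads sym_operad_of (\<lambda>h. h)"
proof -
  have "bij_betw sym_operad_of (obj (foperads Symmetric)) (obj (sym_operads :: ('a sym_operad, nat \<Rightarrow> 'a \<Rightarrow> 'a) category))"
  proof (rule bij_betwI')
    fix P Q :: "'a foperad" assume "P \<in> obj (foperads Symmetric)" "Q \<in> obj (foperads Symmetric)"
    then have PQ: "is_foperad Symmetric P" "is_foperad Symmetric Q" by (simp_all add: foperads_def)
    show "(sym_operad_of P = sym_operad_of Q) = (P = Q)"
    proof
      assume e: "sym_operad_of P = sym_operad_of Q"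
      then have eq: "ops P = ops Q" "oid P = oid Q" "ocomp P = ocomp Q" by (metis sym_operad_of_sel(1-3))+
      show "P = Q"
      proof (rule foperad_eqI[OF PQ eq])
        fix m n f x assume "f \<in> xfun Symmetric m n" and x: "x \<in> ops P m"
        then obtain \<sigma> where \<sigma>: "m = n" "\<sigma> permutes {..<n}" "f = inv_list n \<sigma>" by (elim sym_xfunE)
        show "ract P m n f x = ract Q m n f x"
          using arg_cong[OF e, of "\<lambda>P. act P n \<sigma> x"] x \<sigma> eq by (simp add: sym_operad_of_sel)
      qed
    qed simp
  next
    fix P :: "'a foperad" assume "P \<in> obj (foperads Symmetric)"
    then show "sym_operad_of P \<in> obj sym_operads" by (simp add: foperads_def sym_operads_def sym_operad_of)
  next
    fix P :: "'a sym_operad" assume "P \<in> obj sym_operads"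
    then have P: "is_sym_operad P" by (simp add: sym_operads_def)
    have "act P \<in> (\<Pi>\<^sub>E n\<in>UNIV. \<Pi>\<^sub>E \<sigma>\<in>{\<sigma>. \<sigma> permutes {..<n}}. ops P n \<rightarrow>\<^sub>E ops P n)"
      by (rule P[unfolded is_sym_operad_def, THEN conjunct2, THEN conjunct1])
    then have ax: "act P n \<in> extensional {\<sigma>. \<sigma> permutes {..<n}}" "\<sigma> permutes {..<n} \<Longrightarrow> act P n \<sigma> \<in> extensional (ops P n)" for n \<sigma>
      by (auto simp: PiE_iff)
    have "act (sym_operad_of (sym_foperad P)) n \<sigma> x = act P n \<sigma> x" for n \<sigma> x
      using extensional_arb[OF ax(1)[of n], of \<sigma>] extensional_arb[OF ax(2)[of \<sigma> n], of x]
      by (cases "\<sigma> permutes {..<n}"; cases "x \<in> ops P n")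
         (simp_all add: sym_operad_of_sel sym_foperad_sel(1) sym_foperad_ract)
    then have "P = sym_operad_of (sym_foperad P)"
      by (intro sym_operad.equality) (auto simp: sym_operad_of_sel(1-3) sym_foperad_sel(1-3) fun_eq_iff)
    with sym_foperad[OF P] show "\<exists>Q\<in>obj (foperads Symmetric). P = sym_operad_of Q" by (auto simp: foperads_def)
  qed
  moreover have "hom (foperads Symmetric) P Q = hom sym_operads (sym_operad_of P) (sym_operad_of Q)" for P Q :: "'a foperad"
  proof -
    have "is_foperad_hom Symmetric P Q = is_sym_operad_hom (sym_operad_of P) (sym_operad_of Q)"
    proof (rule ext)
      fix h
      have o: "is_operad_hom (sym_operad_of P) (sym_operad_of Q) h \<longleftrightarrow> is_operad_hom P Q h"
        by (simp add: is_operad_hom_def sym_operad_of_sel)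
      have "(\<forall>m n. \<forall>f\<in>xfun Symmetric m n. \<forall>x\<in>ops P m. h n (ract P m n f x) = ract Q m n f (h m x)) \<longleftrightarrow>
        (\<forall>n \<sigma>. \<sigma> permutes {..<n} \<longrightarrow> (\<forall>x\<in>ops P n. h n (ract P n n (inv_list n \<sigma>) x) = ract Q n n (inv_list n \<sigma>) (h n x)))"
        by (metis sym_xfunE inv_list_xfun)
      moreover have "h n x \<in> ops Q n" if "is_operad_hom P Q h" "x \<in> ops P n" for n x
        using that unfolding is_operad_hom_def by (auto simp: PiE_iff)
      ultimately show "is_foperad_hom Symmetric P Q h = is_sym_operad_hom (sym_operad_of P) (sym_operad_of Q) h"
        unfolding is_foperad_hom_def is_sym_operad_hom_def o by (auto simp: sym_operad_of_sel)
    qed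
    then show ?thesis by (simp add: foperads_def sym_operads_def)
  qed
  ultimately show ?thesis
    unfolding category_iso_def by (simp add: foperads_def sym_operads_def bij_betw_def sym_operad_of_sel)
qed

lemma underlying_sym_operad_eq: "underlying_sym_operad M = sym_operad_of (foperad_of Symmetric M)"
proof -
  have "zact (mcarrier M) n n (inv_list n \<sigma>) x = ract (foperad_of Symmetric M) n n (inv_list n \<sigma>) x"
    if "\<sigma> permutes {..<n}" "x \<in> underlying_ops M n" for n \<sigma> x
    using that inv_list_xfun[OF that(1)] by (simp add: foperad_of_sel underlying_ops_def)
  then show ?thesis
    unfolding underlying_sym_operad_def sym_operad_of_def underlying_operad_truncate[symmetric]
      zact_def[symmetric] inv_list_def[symmetric]
    by (intro arg_cong2[where f = operad.extend] refl)
       (auto simp: fun_eq_iff restrict_def foperad_of_sel(1) underlying_ops_def)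
qed


section \<open>Clones\<close>

text \<open>The inclusion of the \<open>i\<close>-th block into the sum of the blocks.\<close>

definition inj_list :: "nat list \<Rightarrow> nat \<Rightarrow> nat list" where
  "inj_list ns i = map (\<lambda>j. sum_list (take i ns) + j) [0..<ns ! i]"

lemma inj_list_xfun:
  assumes "i < length ns" shows "inj_list ns i \<in> xfun Cartesian (ns ! i) (sum_list ns)"
proof -
  have "set (inj_list ns i) \<subseteq> {..<sum_list ns}"
    unfolding inj_list_def set_map by (rule image_subsetI) (use offset_bound[OF assms] in simp)
  then show ?thesis by (simp add: xfun_Cartesian) (simp add: inj_list_def)
qed

lemma concat_inj_list: "concat (map (inj_list ns) [0..<length ns]) = [0..<sum_list ns]"
  using wreath_id[of ns] by (simp add: wreath_def inj_list_def[abs_def] o_def)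

lemma nth_concat_inj_list:
  assumes "i < length zss" shows "map ((!) (concat zss)) (inj_list (map length zss) i) = zss ! i"
  using assms by (intro nth_equalityI) (simp_all add: inj_list_def nth_concat_offset[of i zss])

lemma blockf_inj_list:
  assumes "set g \<subseteq> {..<length ns}" "i < length g"
  shows "map ((!) (blockf ns g)) (inj_list (map ((!) ns) g) i) = inj_list ns (g ! i)"
proof -
  have b: "blockf ns g = concat (map (inj_list ns) g)" by (simp add: blockf_def wreath_def inj_list_def[abs_def] o_def)
  have m: "map ((!) ns) g = map length (map (inj_list ns) g)" by (simp add: inj_list_def[abs_def] o_def)
  show ?thesis unfolding b m using nth_concat_inj_list[of i "map (inj_list ns) g"] assms(2) by simp
qed

lemma dsum_inj_list:
  assumes "length fs = length ns" "map length fs = ms" "set (fs ! i) \<subseteq> {..<ns ! i}" "i < length ns"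
  shows "map ((!) (dsum ns fs)) (inj_list ms i) = map ((!) (inj_list ns i)) (fs ! i)"
proof -
  have d: "dsum ns fs = concat (map (\<lambda>i. map ((+) (sum_list (take i ns))) (fs ! i)) [0..<length fs])" (is "_ = concat ?zss")
    by (simp add: dsum_def wreath_def map_zip_upt)
  have "ms = map length ?zss" unfolding assms(2)[symmetric] by (intro nth_equalityI) simp_all
  then have "map ((!) (dsum ns fs)) (inj_list ms i) = ?zss ! i"
    unfolding d using nth_concat_inj_list[of i ?zss] assms(1,4) by simp
  also have "\<dots> = map ((!) (inj_list ns i)) (fs ! i)" using assms by (auto simp: inj_list_def subset_iff)
  finally show ?thesis .
qed

lemma inj_list_concat:
  assumes "i < length nss" "j < length (nss ! i)"
  shows "map ((!) (inj_list (map sum_list nss) i)) (inj_list (nss ! i) j) =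
    inj_list (concat nss) (sum_list (take i (map length nss)) + j)"
proof -
  have "sum_list (take j (nss ! i)) + r < sum_list (nss ! i)" if "r < nss ! i ! j" for r
    using offset_bound[of j "nss ! i" r] assms that by simp
  then show ?thesis
    using assms sum_list_take_concat[of i nss j] nth_concat_offset[of i nss j] by (simp add: inj_list_def)
qed

text \<open>The codiagonal from the \<open>k\<close>-fold sum of \<open>n\<close> to \<open>n\<close>.\<close>

definition fold_list :: "nat \<Rightarrow> nat \<Rightarrow> nat list" where
  "fold_list k n = concat (replicate k [0..<n])"

lemma fold_list_xfun: "fold_list k n \<in> xfun Cartesian (sum_list (replicate k n)) n"
  by (auto simp: fold_list_def xfun_Cartesian length_concat sum_list_replicate)

lemma fold_list_blockf:
  assumes "set g \<subseteq> {..<k}"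
  shows "map ((!) (fold_list k n)) (blockf (replicate k n) g) = concat (map (\<lambda>_. [0..<n]) g)"
proof -
  have "map ((!) (concat (replicate k [0..<n]))) (blockf (map length (replicate k [0..<n])) g) = concat (map ((!) (replicate k [0..<n])) g)"
    by (rule nth_concat_blockf) (use assms in simp)
  moreover have "map ((!) (replicate k [0..<n])) g = map (\<lambda>_. [0..<n]) g" using assms by (auto simp: subset_iff)
  ultimately show ?thesis by (simp add: fold_list_def)
qed

lemma fold_list_dsum:
  assumes "length fs = k" "\<And>i. i < k \<Longrightarrow> set (fs ! i) \<subseteq> {..<n}"
  shows "map ((!) (fold_list k n)) (dsum (replicate k n) fs) = concat fs"
proof -
  have "map ((!) (concat (replicate k [0..<n]))) (dsum (map length (replicate k [0..<n])) fs) =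
      concat (map (\<lambda>i. map ((!) (replicate k [0..<n] ! i)) (fs ! i)) [0..<length (replicate k [0..<n])])"
    by (rule nth_concat_dsum) (use assms in simp_all)
  moreover have "map (\<lambda>i. map ((!) (replicate k [0..<n] ! i)) (fs ! i)) [0..<length (replicate k [0..<n])] = fs"
    using assms by (intro nth_equalityI) (simp_all add: map_nth_upt)
  ultimately show ?thesis by (simp add: fold_list_def)
qed

definition clone_of :: "'a foperad \<Rightarrow> 'a clone" where
  "clone_of P = \<lparr>cops = ops P, cproj = (\<lambda>n. \<lambda>i\<in>{..<n}. ract P 1 n [i] (oid P)),
     csub = (\<lambda>k n. \<lambda>x\<in>ops P k. \<lambda>ys\<in>tuples (replicate k (ops P n)).
       ract P (sum_list (replicate k n)) n (fold_list k n) (ocomp P (replicate k n) x ys))\<rparr>"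

lemma clone_of_sel:
  "cops (clone_of P) = ops P"
  "i < n \<Longrightarrow> cproj (clone_of P) n i = ract P 1 n [i] (oid P)"
  "\<lbrakk>x \<in> ops P k; ys \<in> tuples (replicate k (ops P n))\<rbrakk> \<Longrightarrow>
    csub (clone_of P) k n x ys = ract P (sum_list (replicate k n)) n (fold_list k n) (ocomp P (replicate k n) x ys)"
  by (simp_all add: clone_of_def)

lemma single_xfun: "i < n \<Longrightarrow> [i] \<in> xfun Cartesian 1 n"
  by (simp add: xfun_Cartesian)

lemma tuples_replicate_iff: "ys \<in> tuples (replicate k A) \<longleftrightarrow> length ys = k \<and> (\<forall>i<k. ys ! i \<in> A)"
  by (auto simp: tuples_iff)

text \<open>Naturality in the inner arguments, followed by the codiagonal. Suitable maps \<open>fs\<close> recover the operad with its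
  action from the clone: maps out of 1 give the action (\<open>foperad_ract_clone\<close>), and inclusions of blocks give the
  composition (\<open>foperad_ocomp_clone\<close>).\<close>

lemma clone_of_csub:
  assumes P: "is_foperad Cartesian P" and l: "length fs = length ms"
    and fs: "\<And>i. i < length ms \<Longrightarrow> fs ! i \<in> xfun Cartesian (ms ! i) n"
    and x: "x \<in> ops P (length ms)" and ys: "ys \<in> tuples (map (ops P) ms)"
  shows "csub (clone_of P) (length ms) n x (map (\<lambda>i. ract P (ms ! i) n (fs ! i) (ys ! i)) [0..<length ms]) =
    ract P (sum_list ms) n (concat fs) (ocomp P ms x ys)"
proof -
  let ?k = "length ms" and ?ys = "map (\<lambda>i. ract P (ms ! i) n (fs ! i) (ys ! i)) [0..<length ms]"
  have fs': "fs ! i \<in> xfun Cartesian (ms ! i) (replicate ?k n ! i)" if "i < length (replicate ?k n)" for i using fs that by simp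
  have ys': "?ys \<in> tuples (replicate ?k (ops P n))"
    using ys fs by (simp add: tuples_iff foperad_ract[OF P])
  have d: "dsum (replicate ?k n) fs \<in> xfun Cartesian (sum_list ms) (sum_list (replicate ?k n))"
    by (rule dsum_xfun) (use l fs in simp_all)
  have e0: "map (\<lambda>i. ract P (ms ! i) (replicate ?k n ! i) (fs ! i) (ys ! i)) [0..<length (replicate ?k n)] = ?ys"
    by simp
  have e: "ocomp P (replicate ?k n) x ?ys = ract P (sum_list ms) (sum_list (replicate ?k n)) (dsum (replicate ?k n) fs) (ocomp P ms x ys)"
    unfolding e0[symmetric] by (rule foperad_dsum[OF P _ _ fs' _ ys]) (use l x in simp_all)
  have f: "map ((!) (fold_list ?k n)) (dsum (replicate ?k n) fs) = concat fs"
    by (rule fold_list_dsum[OF l xfunD(2)[OF fs]])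
  show ?thesis
    unfolding clone_of_sel(3)[OF x ys'] e foperad_ract_comp[OF P d fold_list_xfun foperad_ocomp[OF P x ys]] f ..
qed

lemma foperad_ract_clone:
  assumes P: "is_foperad Cartesian P" and f: "f \<in> xfun Cartesian m n" and x: "x \<in> ops P m"
  shows "ract P m n f x = csub (clone_of P) m n x (map (cproj (clone_of P) n) f)"
proof -
  let ?ms = "replicate m (1 :: nat)" and ?fs = "map (\<lambda>i. [f ! i]) [0..<m]" and ?ys = "replicate m (oid P)"
  have lf: "length f = m" and fi: "\<And>i. i < m \<Longrightarrow> f ! i < n" using xfunD[OF f] by auto
  have "map (\<lambda>i. ract P (?ms ! i) n (?fs ! i) (?ys ! i)) [0..<length ?ms] = map (cproj (clone_of P) n) f"
    using lf fi by (intro nth_equalityI) (simp_all add: clone_of_sel)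
  moreover have "concat ?fs = f" by (simp add: map_nth[of f, unfolded lf] concat_map_singleton)
  moreover have "?ys \<in> tuples (map (ops P) ?ms)" using foperad_oid[OF P] by (simp add: tuples_iff)
  moreover have "?fs ! i \<in> xfun Cartesian (?ms ! i) n" if "i < length ?ms" for i
    using single_xfun[OF fi[of i]] that by simp
  ultimately show ?thesis
    using clone_of_csub[OF P, of ?fs ?ms n x ?ys] x foperad_right[OF P x] by (simp add: sum_list_replicate)
qed

lemma foperad_ocomp_clone:
  assumes P: "is_foperad Cartesian P" and x: "x \<in> ops P (length ns)" and ys: "ys \<in> tuples (map (ops P) ns)"
  shows "ocomp P ns x ys = csub (clone_of P) (length ns) (sum_list ns) x
    (map (\<lambda>i. ract P (ns ! i) (sum_list ns) (inj_list ns i) (ys ! i)) [0..<length ns])"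
proof -
  let ?fs = "map (inj_list ns) [0..<length ns]"
  have e: "map (\<lambda>i. ract P (ns ! i) (sum_list ns) (?fs ! i) (ys ! i)) [0..<length ns] =
      map (\<lambda>i. ract P (ns ! i) (sum_list ns) (inj_list ns i) (ys ! i)) [0..<length ns]" by simp
  have "csub (clone_of P) (length ns) (sum_list ns) x (map (\<lambda>i. ract P (ns ! i) (sum_list ns) (?fs ! i) (ys ! i)) [0..<length ns]) =
      ract P (sum_list ns) (sum_list ns) (concat ?fs) (ocomp P ns x ys)"
    by (rule clone_of_csub[OF P _ _ x ys]) (simp_all add: inj_list_xfun)
  then show ?thesis
    unfolding e concat_inj_list foperad_ract_id[OF P foperad_ocomp[OF P x ys]] by simp
qed

text \<open>For associativity, moving the codiagonal out of the head of the outer substitution copies its arguments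
  \<open>k\<close> times; then operadic associativity applies, and the two codiagonals agree on the \<open>k\<close>-fold sum of the
  \<open>m\<close>-fold sum of \<open>n\<close>.\<close>

lemma clone_of:
  assumes P: "is_foperad Cartesian P" shows "is_clone (clone_of P)"
  unfolding is_clone_def clone_of_sel(1)
proof (intro conjI allI ballI impI)
  have "ract P 1 n [i] (oid P) \<in> ops P n" if "i < n" for n i
    by (rule foperad_ract[OF P single_xfun[OF that] foperad_oid[OF P]])
  then show "cproj (clone_of P) \<in> (\<Pi>\<^sub>E n\<in>UNIV. {..<n} \<rightarrow>\<^sub>E ops P n)"
    by (auto simp: clone_of_def split: if_splits)
  have "ract P (sum_list (replicate k n)) n (fold_list k n) (ocomp P (replicate k n) x ys) \<in> ops P n"
    if "x \<in> ops P k" "ys \<in> tuples (replicate k (ops P n))" for k n x ys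
    by (rule foperad_ract[OF P fold_list_xfun foperad_ocomp[OF P]]) (use that in simp_all)
  then show "csub (clone_of P) \<in> (\<Pi>\<^sub>E k\<in>UNIV. \<Pi>\<^sub>E n\<in>UNIV. ops P k \<rightarrow>\<^sub>E tuples (replicate k (ops P n)) \<rightarrow>\<^sub>E ops P n)"
    by (auto simp: clone_of_def intro!: PiE_I)
next
  fix k n i ys assume ys: "ys \<in> tuples (replicate k (ops P n))" and i: "i < k"
  note s = single_xfun[OF i] and o = foperad_oid[OF P]
  have yi: "ys ! i \<in> ops P n" using ys i by (simp add: tuples_iff)
  have s': "[i] \<in> xfun Cartesian 1 (length (replicate k n))" using s by simp
  have ys': "ys \<in> tuples (map (ops P) (replicate k n))" using ys by simp
  have b: "blockf (replicate k n) [i] \<in> xfun Cartesian n (sum_list (replicate k n))"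
    using blockf_xfun[OF s'] i by simp
  have "csub (clone_of P) k n (cproj (clone_of P) k i) ys =
    ract P (sum_list (replicate k n)) n (fold_list k n) (ocomp P (replicate k n) (ract P 1 k [i] (oid P)) ys)"
    unfolding clone_of_sel(2)[OF i] by (rule clone_of_sel(3)[OF foperad_ract[OF P s o] ys])
  also have "ocomp P (replicate k n) (ract P 1 k [i] (oid P)) ys = ract P n (sum_list (replicate k n)) (blockf (replicate k n) [i]) (ys ! i)"
    using foperad_blockf[OF P s' o ys'] foperad_left[OF P yi] i by simp
  also have "ract P (sum_list (replicate k n)) n (fold_list k n) \<dots> = ys ! i"
    unfolding foperad_ract_comp[OF P b fold_list_xfun yi]
    using fold_list_blockf[of "[i]" k n] foperad_ract_id[OF P yi] i by simp
  finally show "csub (clone_of P) k n (cproj (clone_of P) k i) ys = ys ! i" .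
next
  fix n x assume x: "x \<in> ops P n"
  show "csub (clone_of P) n n x (map (cproj (clone_of P) n) [0..<n]) = x"
    using foperad_ract_clone[OF P xfun_id x] foperad_ract_id[OF P x] by simp
next
  fix k m n x ys zs
  assume x: "x \<in> ops P k" and ys: "ys \<in> tuples (replicate k (ops P m))" and zs: "zs \<in> tuples (replicate m (ops P n))"
  define F1 where "F1 = fold_list k m"
  define F2 where "F2 = fold_list m n"
  define A where "A = ocomp P (replicate k m) x ys"
  define nss where "nss = replicate k (replicate m n)"
  define S where "S = sum_list (replicate m n)"
  define W where "W = map (\<lambda>i. ocomp P (nss ! i) (ys ! i) (replicate k zs ! i)) [0..<length nss]"
  have F1: "F1 \<in> xfun Cartesian (sum_list (replicate k m)) m" unfolding F1_def by (rule fold_list_xfun)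
  have F1': "F1 \<in> xfun Cartesian (sum_list (replicate k m)) (length (replicate m n))" using F1 by simp
  have F2: "F2 \<in> xfun Cartesian S n" unfolding F2_def S_def by (rule fold_list_xfun)
  have A: "A \<in> ops P (sum_list (replicate k m))" unfolding A_def by (rule foperad_ocomp[OF P]) (use x ys in simp_all)
  have zs': "zs \<in> tuples (map (ops P) (replicate m n))" using zs by simp
  have lz: "length zs = m" using zs by (simp add: tuples_iff)
  have yi: "ys ! i \<in> ops P m" if "i < k" for i using ys that by (simp add: tuples_iff)
  have W_eq: "W = map (\<lambda>i. ocomp P (replicate m n) (ys ! i) zs) [0..<k]" by (simp add: W_def nss_def)
  have W: "W \<in> tuples (map (ops P) (replicate k S))"
    unfolding W_eq S_def using foperad_ocomp[OF P _ zs'] yi by (simp add: tuples_iff)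
  have c1: "map ((!) (replicate m n)) F1 = concat nss" and c2: "map ((!) zs) F1 = concat (replicate k zs)"
    using lz by (simp_all add: F1_def fold_list_def nss_def map_concat map_nth[of zs, unfolded lz] map_nth_id)
  have sn: "sum_list (concat nss) = sum_list (map sum_list nss)" by (simp add: sum_list_map_concat[of id, simplified])
  have ms: "map sum_list nss = replicate k S" by (simp add: nss_def S_def)
  have b: "blockf (replicate m n) F1 \<in> xfun Cartesian (sum_list (concat nss)) (sum_list (replicate m n))"
    using blockf_xfun[OF F1'] unfolding c1 .
  have as: "ocomp P (concat nss) A (concat (replicate k zs)) = ocomp P (map sum_list nss) x W"
    using foperad_assoc[OF P, of x nss ys "replicate k zs"] x ys zs' unfolding W_def A_def
    by (simp add: nss_def tuples_replicate_iff)
  have x': "x \<in> ops P (length (replicate k S))" using x by simp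
  have oW: "ocomp P (replicate k S) x W \<in> ops P (sum_list (replicate k S))" by (rule foperad_ocomp[OF P x' W])
  have csA: "csub (clone_of P) k m x ys = ract P (sum_list (replicate k m)) m F1 A"
    unfolding F1_def A_def by (rule clone_of_sel(3)[OF x ys])
  have fb: "map ((!) F2) (blockf (replicate m n) F1) = concat (replicate k F2)"
  proof -
    have r: "map (\<lambda>_. [0..<n]) [0..<m] = replicate m [0..<n]" by (simp add: map_replicate_const)
    show ?thesis
      unfolding F2_def fold_list_blockf[OF xfunD(2)[OF F1]]
      unfolding F1_def fold_list_def concat_map_concat map_replicate r ..
  qed
  have "csub (clone_of P) m n (csub (clone_of P) k m x ys) zs =
      ract P S n F2 (ocomp P (replicate m n) (ract P (sum_list (replicate k m)) (length (replicate m n)) F1 A) zs)"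
    unfolding csA S_def F2_def using clone_of_sel(3)[OF foperad_ract[OF P F1 A] zs] by simp
  also have "\<dots> = ract P S n F2 (ract P (sum_list (concat nss)) S (blockf (replicate m n) F1) (ocomp P (replicate k S) x W))"
    unfolding foperad_blockf[OF P F1' A zs'] c1 c2 as ms S_def ..
  also have "\<dots> = ract P (sum_list (replicate k S)) n (concat (replicate k F2)) (ocomp P (replicate k S) x W)"
    using foperad_ract_comp[OF P b F2[unfolded S_def]] oW fb unfolding sn ms S_def by simp
  also have "\<dots> = csub (clone_of P) k n x (map (\<lambda>i. ract P (replicate k S ! i) n (replicate k F2 ! i) (W ! i)) [0..<k])"
    using clone_of_csub[OF P, of "replicate k F2" "replicate k S" n x W] x W F2 by simp
  also have "map (\<lambda>i. ract P (replicate k S ! i) n (replicate k F2 ! i) (W ! i)) [0..<k] = map (\<lambda>y. csub (clone_of P) m n y zs) ys"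
    using ys yi by (intro nth_equalityI)
      (simp_all add: tuples_replicate_iff W_eq clone_of_sel(3)[OF _ zs] F2_def S_def)
  finally show "csub (clone_of P) m n (csub (clone_of P) k m x ys) zs = csub (clone_of P) k n x (map (\<lambda>y. csub (clone_of P) m n y zs) ys)" .
qed

text \<open>Maps act by substituting projections; the composition first includes the arities of all arguments into their
  sum, and then substitutes.\<close>

definition clone_foperad :: "'a clone \<Rightarrow> 'a foperad" where
  "clone_foperad C = \<lparr>ops = cops C, oid = cproj C 1 0,
     ocomp = (\<lambda>ns. \<lambda>x\<in>cops C (length ns). \<lambda>ys\<in>tuples (map (cops C) ns).
       csub C (length ns) (sum_list ns) x
         (map (\<lambda>i. csub C (ns ! i) (sum_list ns) (ys ! i) (map (cproj C (sum_list ns)) (inj_list ns i))) [0..<length ns])),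
     ract = (\<lambda>m n. \<lambda>f\<in>xfun Cartesian m n. \<lambda>x\<in>cops C m. csub C m n x (map (cproj C n) f))\<rparr>"

lemma clone_foperad_sel:
  "ops (clone_foperad C) = cops C" "oid (clone_foperad C) = cproj C 1 0"
  "\<lbrakk>f \<in> xfun Cartesian m n; x \<in> cops C m\<rbrakk> \<Longrightarrow> ract (clone_foperad C) m n f x = csub C m n x (map (cproj C n) f)"
  by (simp_all add: clone_foperad_def)

lemma clone_foperad_ocomp:
  assumes x: "x \<in> cops C (length ns)" and ys: "ys \<in> tuples (map (cops C) ns)"
  shows "ocomp (clone_foperad C) ns x ys = csub C (length ns) (sum_list ns) x
    (map (\<lambda>i. ract (clone_foperad C) (ns ! i) (sum_list ns) (inj_list ns i) (ys ! i)) [0..<length ns])"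
proof -
  have e: "map (\<lambda>i. ract (clone_foperad C) (ns ! i) (sum_list ns) (inj_list ns i) (ys ! i)) [0..<length ns] =
      map (\<lambda>i. csub C (ns ! i) (sum_list ns) (ys ! i) (map (cproj C (sum_list ns)) (inj_list ns i))) [0..<length ns]"
    using ys by (simp add: clone_foperad_sel(3)[OF inj_list_xfun] tuples_iff)
  show ?thesis unfolding e using x ys by (simp add: clone_foperad_def)
qed

context
  fixes C :: "'a clone" assumes C: "is_clone C"
begin

lemma cproj_closed: "i < n \<Longrightarrow> cproj C n i \<in> cops C n"
  using C unfolding is_clone_def by (auto simp: PiE_iff)

lemma csub_closed: "x \<in> cops C k \<Longrightarrow> ys \<in> tuples (replicate k (cops C n)) \<Longrightarrow> csub C k n x ys \<in> cops C n"
  using C[unfolded is_clone_def, THEN conjunct2, THEN conjunct1] by (simp add: PiE_iff)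

lemma csub_proj: "i < k \<Longrightarrow> ys \<in> tuples (replicate k (cops C n)) \<Longrightarrow> csub C k n (cproj C k i) ys = ys ! i"
  using C unfolding is_clone_def by blast

lemma csub_id: "x \<in> cops C n \<Longrightarrow> csub C n n x (map (cproj C n) [0..<n]) = x"
  using C unfolding is_clone_def by blast

lemma csub_assoc: "\<lbrakk>x \<in> cops C k; ys \<in> tuples (replicate k (cops C m)); zs \<in> tuples (replicate m (cops C n))\<rbrakk> \<Longrightarrow>
    csub C m n (csub C k m x ys) zs = csub C k n x (map (\<lambda>y. csub C m n y zs) ys)"
  using C unfolding is_clone_def by blast

lemma projs_tuples: "f \<in> xfun Cartesian m n \<Longrightarrow> map (cproj C n) f \<in> tuples (replicate m (cops C n))"
  using xfunD[of f Cartesian m n] by (auto simp: tuples_replicate_iff intro!: cproj_closed)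

lemma clone_ract_closed: "\<lbrakk>f \<in> xfun Cartesian m n; x \<in> cops C m\<rbrakk> \<Longrightarrow> ract (clone_foperad C) m n f x \<in> cops C n"
  by (simp add: clone_foperad_sel csub_closed projs_tuples)

lemma clone_ract_id: "x \<in> cops C n \<Longrightarrow> ract (clone_foperad C) n n [0..<n] x = x"
  by (simp add: clone_foperad_sel csub_id)

text \<open>Substituting into an element on which \<open>f\<close> acted reindexes the arguments, while an action after a substitution
  (\<open>clone_sub_ract\<close>) passes to the arguments. With these two rules every axiom becomes an identity between maps out
  of the blocks.\<close>

lemma clone_ract_sub:
  assumes f: "f \<in> xfun Cartesian m n" and x: "x \<in> cops C m" and zs: "zs \<in> tuples (replicate n (cops C k))"
  shows "csub C n k (ract (clone_foperad C) m n f x) zs = csub C m k x (map ((!) zs) f)"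
proof -
  have e: "map (\<lambda>y. csub C n k y zs) (map (cproj C n) f) = map ((!) zs) f"
    using xfunD(2)[OF f] csub_proj[OF _ zs] by auto
  show ?thesis
    unfolding clone_foperad_sel(3)[OF f x] csub_assoc[OF x projs_tuples[OF f] zs] e ..
qed

lemma clone_sub_ract:
  assumes g: "g \<in> xfun Cartesian n n'" and x: "x \<in> cops C k" and ys: "ys \<in> tuples (replicate k (cops C n))"
  shows "ract (clone_foperad C) n n' g (csub C k n x ys) = csub C k n' x (map (ract (clone_foperad C) n n' g) ys)"
proof -
  have e: "map (\<lambda>y. csub C n n' y (map (cproj C n') g)) ys = map (ract (clone_foperad C) n n' g) ys"
    using ys by (intro nth_equalityI) (simp_all add: tuples_replicate_iff clone_foperad_sel(3)[OF g])
  show ?thesis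
    unfolding clone_foperad_sel(3)[OF g csub_closed[OF x ys]] csub_assoc[OF x ys projs_tuples[OF g]] e ..
qed

lemma clone_ract_comp:
  assumes f: "f \<in> xfun Cartesian l m" and g: "g \<in> xfun Cartesian m n" and x: "x \<in> cops C l"
  shows "ract (clone_foperad C) m n g (ract (clone_foperad C) l m f x) = ract (clone_foperad C) l n (map ((!) g) f) x"
proof -
  have e: "map ((!) (map (cproj C n) g)) f = map (cproj C n) (map ((!) g) f)"
    using map_nth_map_nth[of f g "cproj C n"] xfunD(2)[OF f] xfunD(1)[OF g] by simp
  show ?thesis
    unfolding clone_foperad_sel(3)[OF g clone_ract_closed[OF f x]] clone_foperad_sel(3)[OF xfun_comp[OF f g] x]
      clone_ract_sub[OF f x projs_tuples[OF g]] e ..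
qed

lemma clone_injs_tuples:
  assumes "ys \<in> tuples (map (cops C) ns)"
  shows "map (\<lambda>i. ract (clone_foperad C) (ns ! i) (sum_list ns) (inj_list ns i) (ys ! i)) [0..<length ns] \<in> tuples (replicate (length ns) (cops C (sum_list ns)))"
  using assms by (simp add: tuples_iff clone_ract_closed[OF inj_list_xfun])

lemma clone_ocomp_closed:
  "\<lbrakk>x \<in> cops C (length ns); ys \<in> tuples (map (cops C) ns)\<rbrakk> \<Longrightarrow> ocomp (clone_foperad C) ns x ys \<in> cops C (sum_list ns)"
  by (simp add: clone_foperad_ocomp csub_closed clone_injs_tuples)

lemma clone_foperad_operad: "is_operad (clone_foperad C)"
  unfolding is_operad_def clone_foperad_sel(1)
proof (intro conjI allI ballI)
  show "oid (clone_foperad C) \<in> cops C 1" by (simp add: clone_foperad_sel(2) cproj_closed)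
  show "ocomp (clone_foperad C) \<in> (\<Pi>\<^sub>E ns\<in>UNIV. cops C (length ns) \<rightarrow>\<^sub>E tuples (map (cops C) ns) \<rightarrow>\<^sub>E cops C (sum_list ns))"
    by (intro PiE_I) (simp_all add: clone_ocomp_closed, simp_all add: clone_foperad_def)
next
  fix n x assume x: "x \<in> cops C n"
  have i: "inj_list [n] 0 = [0..<n]" by (simp add: inj_list_def map_idI)
  have o: "cproj C 1 0 \<in> cops C 1" by (simp add: cproj_closed)
  have "ocomp (clone_foperad C) [n] (oid (clone_foperad C)) [x] = csub C 1 n (cproj C 1 0) [x]"
    using clone_foperad_ocomp[of "oid (clone_foperad C)" C "[n]" "[x]"] x o by (simp add: clone_foperad_sel(2) tuples_Cons i clone_ract_id)
  also have "\<dots> = x" using csub_proj[of 0 1 "[x]" n] x by (simp add: tuples_Cons)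
  finally show "ocomp (clone_foperad C) [n] (oid (clone_foperad C)) [x] = x" .
next
  fix n x assume x: "x \<in> cops C n"
  let ?ns = "replicate n (1 :: nat)" and ?ys = "replicate n (oid (clone_foperad C))"
  have o: "oid (clone_foperad C) \<in> cops C 1" by (simp add: clone_foperad_sel(2) cproj_closed)
  have ys: "?ys \<in> tuples (map (cops C) ?ns)" using o by (simp add: tuples_iff)
  have s: "sum_list ?ns = n" by (simp add: sum_list_replicate)
  have r: "ract (clone_foperad C) (?ns ! i) n (inj_list ?ns i) (?ys ! i) = cproj C n i" if "i < n" for i
  proof -
    have inj: "inj_list ?ns i = [i]" using that by (simp add: inj_list_def sum_list_replicate)
    show ?thesis
      using that clone_foperad_sel(3)[OF single_xfun[OF that] o] csub_proj[of 0 1 "[cproj C n i]" n] cproj_closed[OF that]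
      by (simp add: inj[unfolded One_nat_def] clone_foperad_sel(2) tuples_Cons)
  qed
  have e: "map (\<lambda>i. ract (clone_foperad C) (?ns ! i) (sum_list ?ns) (inj_list ?ns i) (?ys ! i)) [0..<length ?ns] =
      map (cproj C n) [0..<n]"
    unfolding s length_replicate by (rule map_cong[OF refl]) (rule r, simp)
  have x': "x \<in> cops C (length ?ns)" using x by simp
  show "ocomp (clone_foperad C) ?ns x ?ys = x"
    unfolding clone_foperad_ocomp[OF x' ys] e unfolding s length_replicate by (rule csub_id[OF x])
next
  fix nss x ys zss
  assume x: "x \<in> cops C (length nss)" and ys: "ys \<in> tuples (map (\<lambda>ns. cops C (length ns)) nss)"
    and zss: "zss \<in> tuples (map (\<lambda>ns. tuples (map (cops C) ns)) nss)"
  let ?ms = "map length nss" and ?ps = "concat nss" and ?zs = "concat zss" and ?N = "sum_list (concat nss)" and ?k = "length nss"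
  have N: "?N = sum_list (map sum_list nss)" by (simp add: sum_list_map_concat[of id, simplified])
  have lp: "length ?ps = sum_list ?ms" by (simp add: length_concat)
  have ys': "ys \<in> tuples (map (cops C) ?ms)" using ys by (simp add: o_def)
  have zl: "length zss = ?k" and zi: "\<And>i. i < ?k \<Longrightarrow> zss ! i \<in> tuples (map (cops C) (nss ! i))"
    using zss by (auto simp: tuples_iff)
  have yi: "ys ! i \<in> cops C (length (nss ! i))" if "i < ?k" for i using ys that by (simp add: tuples_iff)
  have mlz: "map length zss = ?ms" using zl zi by (intro nth_equalityI) (simp_all add: tuples_iff)
  have zs': "?zs \<in> tuples (map (cops C) ?ps)"
    using zss tuples_concat[of zss "map (map (cops C)) nss"] by (simp add: map_concat o_def)
  let ?Z = "map (\<lambda>p. ract (clone_foperad C) (?ps ! p) ?N (inj_list ?ps p) (?zs ! p)) [0..<length ?ps]"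
  note Z = clone_injs_tuples[OF zs']
  have Z': "?Z \<in> tuples (replicate (sum_list ?ms) (cops C ?N))" using Z lp by simp
  let ?Y = "map (\<lambda>i. ract (clone_foperad C) (?ms ! i) (sum_list ?ms) (inj_list ?ms i) (ys ! i)) [0..<length ?ms]"
  note Y = clone_injs_tuples[OF ys']
  have xm: "x \<in> cops C (length ?ms)" using x by simp
  have "ocomp (clone_foperad C) ?ps (ocomp (clone_foperad C) ?ms x ys) ?zs = csub C (length ?ps) ?N (csub C (length ?ms) (sum_list ?ms) x ?Y) ?Z"
    using clone_foperad_ocomp[OF _ zs', of "ocomp (clone_foperad C) ?ms x ys"] clone_ocomp_closed[OF xm ys'] lp
    unfolding clone_foperad_ocomp[OF xm ys'] by simp
  also have "\<dots> = csub C (length ?ms) ?N x (map (\<lambda>y. csub C (sum_list ?ms) ?N y ?Z) ?Y)"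
    unfolding lp by (rule csub_assoc[OF xm Y]) (use Z' lp in simp)
  also have "map (\<lambda>y. csub C (sum_list ?ms) ?N y ?Z) ?Y =
    map (\<lambda>i. ract (clone_foperad C) (sum_list (nss ! i)) ?N (inj_list (map sum_list nss) i) (ocomp (clone_foperad C) (nss ! i) (ys ! i) (zss ! i))) [0..<?k]"
  proof (rule nth_equalityI, goal_cases)
    case 1 then show ?case by simp
  next
    case (2 i)
    then have i: "i < ?k" by simp
    let ?ns = "nss ! i" and ?J = "inj_list (map sum_list nss) i"
    have J: "?J \<in> xfun Cartesian (sum_list ?ns) ?N" using inj_list_xfun[of i "map sum_list nss"] i N by simp
    have J0: "inj_list ?ms i \<in> xfun Cartesian (length ?ns) (sum_list ?ms)" using inj_list_xfun[of i ?ms] i by simp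
    have zij: "zss ! i ! j \<in> cops C (?ns ! j)" if "j < length ?ns" for j using zi[OF i] that by (simp add: tuples_iff)
    have "csub C (sum_list ?ms) ?N (ract (clone_foperad C) (length ?ns) (sum_list ?ms) (inj_list ?ms i) (ys ! i)) ?Z =
        csub C (length ?ns) ?N (ys ! i) (map ((!) ?Z) (inj_list ?ms i))"
      by (rule clone_ract_sub[OF J0 yi[OF i] Z'])
    also have "map ((!) ?Z) (inj_list ?ms i) = map (ract (clone_foperad C) (sum_list ?ns) ?N ?J) (map (\<lambda>j. ract (clone_foperad C) (?ns ! j) (sum_list ?ns) (inj_list ?ns j) (zss ! i ! j)) [0..<length ?ns])"
    proof (rule nth_equalityI, goal_cases)
      case 1 then show ?case using i by (simp add: inj_list_def)
    next
      case (2 j)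
      then have j: "j < length ?ns" using i by (simp add: inj_list_def)
      let ?p = "sum_list (take i ?ms) + j"
      have p: "?p < length ?ps" using offset_bound[of i ?ms j] i j by (simp add: lp)
      have "map ((!) ?Z) (inj_list ?ms i) ! j = ract (clone_foperad C) (?ns ! j) ?N (inj_list ?ps ?p) (zss ! i ! j)"
        using i j p nth_concat_offset[of i nss j] nth_concat_offset[of i zss j] zl zi[OF i] unfolding mlz
        by (simp add: inj_list_def[of ?ms] tuples_iff del: take_map)
      also have "\<dots> = ract (clone_foperad C) (sum_list ?ns) ?N ?J (ract (clone_foperad C) (?ns ! j) (sum_list ?ns) (inj_list ?ns j) (zss ! i ! j))"
        unfolding clone_ract_comp[OF inj_list_xfun[OF j] J zij[OF j]] inj_list_concat[OF i j] ..
      finally show ?case using j by simp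
    qed
    also have "csub C (length ?ns) ?N (ys ! i) \<dots> = ract (clone_foperad C) (sum_list ?ns) ?N ?J (ocomp (clone_foperad C) ?ns (ys ! i) (zss ! i))"
      unfolding clone_foperad_ocomp[OF yi[OF i] zi[OF i]]
      by (rule clone_sub_ract[OF J yi[OF i] clone_injs_tuples[OF zi[OF i]], symmetric])
    finally show ?case using i by simp
  qed
  also have "csub C (length ?ms) ?N x \<dots> = ocomp (clone_foperad C) (map sum_list nss) x (map (\<lambda>i. ocomp (clone_foperad C) (nss ! i) (ys ! i) (zss ! i)) [0..<?k])"
  proof -
    have x': "x \<in> cops C (length (map sum_list nss))" using x by simp
    have w: "map (\<lambda>i. ocomp (clone_foperad C) (nss ! i) (ys ! i) (zss ! i)) [0..<?k] \<in> tuples (map (cops C) (map sum_list nss))"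
      by (subst tuples_iff) (simp add: clone_ocomp_closed yi zi)
    have e: "map (\<lambda>i. ract (clone_foperad C) (map sum_list nss ! i) (sum_list (map sum_list nss)) (inj_list (map sum_list nss) i)
        (map (\<lambda>i. ocomp (clone_foperad C) (nss ! i) (ys ! i) (zss ! i)) [0..<?k] ! i)) [0..<length (map sum_list nss)] =
      map (\<lambda>i. ract (clone_foperad C) (sum_list (nss ! i)) (sum_list (map sum_list nss)) (inj_list (map sum_list nss) i)
        (ocomp (clone_foperad C) (nss ! i) (ys ! i) (zss ! i))) [0..<?k]" by simp
    show ?thesis unfolding clone_foperad_ocomp[OF x' w] e N by simp
  qed
  finally show "ocomp (clone_foperad C) ?ps (ocomp (clone_foperad C) ?ms x ys) ?zs = ocomp (clone_foperad C) (map sum_list nss) x (map (\<lambda>i. ocomp (clone_foperad C) (nss ! i) (ys ! i) (zss ! i)) [0..<?k])" .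
qed

lemma clone_foperad: "is_foperad Cartesian (clone_foperad C)"
proof -
  have F2: "ract (clone_foperad C) \<in> (\<Pi>\<^sub>E m\<in>UNIV. \<Pi>\<^sub>E n\<in>UNIV. \<Pi>\<^sub>E f\<in>xfun Cartesian m n. cops C m \<rightarrow>\<^sub>E cops C n)"
    by (intro PiE_I) (simp_all add: clone_ract_closed, simp_all add: clone_foperad_def)
  have F5: "ocomp (clone_foperad C) ns (ract (clone_foperad C) k (length ns) g x) ys =
        ract (clone_foperad C) (sum_list (map ((!) ns) g)) (sum_list ns) (blockf ns g) (ocomp (clone_foperad C) (map ((!) ns) g) x (map ((!) ys) g))"
    if g: "g \<in> xfun Cartesian k (length ns)" and x: "x \<in> cops C k" and ys: "ys \<in> tuples (map (cops C) ns)" for ns k g x ys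
  proof -
    let ?ns = "map ((!) ns) g" and ?ys = "map ((!) ys) g"
    let ?Y = "map (\<lambda>i. ract (clone_foperad C) (ns ! i) (sum_list ns) (inj_list ns i) (ys ! i)) [0..<length ns]"
    have lg: "length g = k" and gi: "\<And>i. i < k \<Longrightarrow> g ! i < length ns" using xfunD[OF g] by auto
    note b = blockf_xfun[OF g] and ys' = tuples_nthI[OF ys xfunD(2)[OF g]]
    have x': "x \<in> cops C (length ?ns)" using x lg by simp
    have yi: "ys ! i \<in> cops C (ns ! i)" if "i < length ns" for i using ys that by (simp add: tuples_iff)
    have "ocomp (clone_foperad C) ns (ract (clone_foperad C) k (length ns) g x) ys = csub C k (sum_list ns) x (map ((!) ?Y) g)"
      unfolding clone_foperad_ocomp[OF clone_ract_closed[OF g x] ys] by (rule clone_ract_sub[OF g x clone_injs_tuples[OF ys]])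
    also have "map ((!) ?Y) g = map (ract (clone_foperad C) (sum_list ?ns) (sum_list ns) (blockf ns g))
        (map (\<lambda>i. ract (clone_foperad C) (?ns ! i) (sum_list ?ns) (inj_list ?ns i) (?ys ! i)) [0..<length ?ns])"
    proof (rule nth_equalityI, goal_cases)
      case 1 then show ?case by simp
    next
      case (2 i)
      then have i: "i < k" using lg by simp
      have j: "inj_list ?ns i \<in> xfun Cartesian (?ns ! i) (sum_list ?ns)" by (rule inj_list_xfun) (use i lg in simp)
      have y: "?ys ! i \<in> cops C (?ns ! i)" using yi[OF gi[OF i]] i lg by simp
      show ?case
        using i lg gi[OF i] clone_ract_comp[OF j b y] blockf_inj_list[OF xfunD(2)[OF g], of i] by simp
    qed
    also have "csub C k (sum_list ns) x \<dots> = ract (clone_foperad C) (sum_list ?ns) (sum_list ns) (blockf ns g) (ocomp (clone_foperad C) ?ns x ?ys)"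
      unfolding clone_foperad_ocomp[OF x' ys'] using clone_sub_ract[OF b x' clone_injs_tuples[OF ys']] lg by simp
    finally show ?thesis .
  qed
  have F6: "ocomp (clone_foperad C) ns x (map (\<lambda>i. ract (clone_foperad C) (ms ! i) (ns ! i) (fs ! i) (ys ! i)) [0..<length ns]) =
          ract (clone_foperad C) (sum_list ms) (sum_list ns) (dsum ns fs) (ocomp (clone_foperad C) ms x ys)"
    if fs: "length fs = length ns" "length ms = length ns" "\<forall>i<length ns. fs ! i \<in> xfun Cartesian (ms ! i) (ns ! i)"
      and x: "x \<in> cops C (length ns)" and ys: "ys \<in> tuples (map (cops C) ms)" for ns ms fs x ys
  proof -
    let ?ys = "map (\<lambda>i. ract (clone_foperad C) (ms ! i) (ns ! i) (fs ! i) (ys ! i)) [0..<length ns]"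
    have fi: "fs ! i \<in> xfun Cartesian (ms ! i) (ns ! i)" if "i < length ns" for i using fs(3) that by blast
    have yi: "ys ! i \<in> cops C (ms ! i)" if "i < length ns" for i using ys that fs(2) by (simp add: tuples_iff)
    have ys': "?ys \<in> tuples (map (cops C) ns)" by (simp add: tuples_iff clone_ract_closed[OF fi yi])
    have d: "dsum ns fs \<in> xfun Cartesian (sum_list ms) (sum_list ns)" by (rule dsum_xfun[OF fs(1,2) fi])
    have lfs: "map length fs = ms" using fs xfunD(1)[OF fi] by (intro nth_equalityI) simp_all
    have x': "x \<in> cops C (length ms)" using x fs(2) by simp
    have e: "map (\<lambda>i. ract (clone_foperad C) (ns ! i) (sum_list ns) (inj_list ns i) (?ys ! i)) [0..<length ns] =
      map (ract (clone_foperad C) (sum_list ms) (sum_list ns) (dsum ns fs)) (map (\<lambda>i. ract (clone_foperad C) (ms ! i) (sum_list ms) (inj_list ms i) (ys ! i)) [0..<length ms])"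
    proof (rule nth_equalityI, goal_cases)
      case 1 then show ?case using fs(2) by simp
    next
      case (2 i)
      then have i: "i < length ns" by simp
      have j: "inj_list ms i \<in> xfun Cartesian (ms ! i) (sum_list ms)" by (rule inj_list_xfun) (use i fs(2) in simp)
      show ?case
        using i fs(2) clone_ract_comp[OF fi[OF i] inj_list_xfun[OF i] yi[OF i]] clone_ract_comp[OF j d yi[OF i]]
          dsum_inj_list[OF fs(1) lfs xfunD(2)[OF fi[OF i]] i] by simp
    qed
    show ?thesis
      unfolding clone_foperad_ocomp[OF x ys'] clone_foperad_ocomp[OF x' ys] e
      using clone_sub_ract[OF d x' clone_injs_tuples[OF ys]] unfolding fs(2) by simp
  qed
  show ?thesis
    unfolding is_foperad_def clone_foperad_sel(1)
    by (intro conjI allI ballI impI clone_foperad_operad F2; (rule clone_ract_id clone_ract_comp F5 F6; assumption))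
qed

lemma clone_of_clone_foperad: "clone_of (clone_foperad C) = C"
proof -
  have o: "cproj C 1 0 \<in> cops C 1" by (simp add: cproj_closed)
  have "ract (clone_foperad C) 1 n [i] (oid (clone_foperad C)) = cproj C n i" if "i < n" for n i
    using clone_foperad_sel(3)[OF single_xfun[OF that] o] csub_proj[of 0 1 "[cproj C n i]" n] cproj_closed[OF that]
    by (simp add: clone_foperad_sel(2) tuples_Cons)
  moreover have "cproj C \<in> (\<Pi>\<^sub>E n\<in>UNIV. {..<n} \<rightarrow>\<^sub>E cops C n)" by (rule C[unfolded is_clone_def, THEN conjunct1])
  then have "cproj C n \<in> extensional {..<n}" for n by (auto simp: PiE_iff)
  ultimately have p: "cproj (clone_of (clone_foperad C)) = cproj C"
    by (auto simp: clone_of_def fun_eq_iff restrict_def extensional_def)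
  have "ract (clone_foperad C) (sum_list (replicate k n)) n (fold_list k n) (ocomp (clone_foperad C) (replicate k n) x ys) = csub C k n x ys"
    if x: "x \<in> cops C k" and ys: "ys \<in> tuples (replicate k (cops C n))" for k n x ys
  proof -
    let ?ns = "replicate k n"
    have x': "x \<in> cops C (length ?ns)" and ys': "ys \<in> tuples (map (cops C) ?ns)" using x ys by simp_all
    have "map (ract (clone_foperad C) (sum_list ?ns) n (fold_list k n)) (map (\<lambda>i. ract (clone_foperad C) (?ns ! i) (sum_list ?ns) (inj_list ?ns i) (ys ! i)) [0..<length ?ns]) = ys"
    proof (rule nth_equalityI, goal_cases)
      case 1 then show ?case using ys by (simp add: tuples_iff)
    next
      case (2 i)
      then have i: "i < k" by simp
      have yi: "ys ! i \<in> cops C (?ns ! i)" using ys i by (simp add: tuples_iff)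
      have j: "inj_list ?ns i \<in> xfun Cartesian (?ns ! i) (sum_list ?ns)" by (rule inj_list_xfun) (use i in simp)
      have "map ((!) (fold_list k n)) (inj_list ?ns i) = [0..<n]"
        using nth_concat_inj_list[of i "replicate k [0..<n]"] i by (simp add: fold_list_def)
      then show ?case
        using i clone_ract_comp[OF j fold_list_xfun yi] clone_ract_id[of "ys ! i" n] yi by simp
    qed
    then show ?thesis
      unfolding clone_foperad_ocomp[OF x' ys'] clone_sub_ract[OF fold_list_xfun x' clone_injs_tuples[OF ys']] by simp
  qed
  moreover have "csub C \<in> (\<Pi>\<^sub>E k\<in>UNIV. \<Pi>\<^sub>E n\<in>UNIV. cops C k \<rightarrow>\<^sub>E tuples (replicate k (cops C n)) \<rightarrow>\<^sub>E cops C n)"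
    by (rule C[unfolded is_clone_def, THEN conjunct2, THEN conjunct1])
  then have "csub C k n \<in> extensional (cops C k)" "x \<in> cops C k \<Longrightarrow> csub C k n x \<in> extensional (tuples (replicate k (cops C n)))" for k n x
    by (auto simp: PiE_iff)
  ultimately have s: "csub (clone_of (clone_foperad C)) = csub C"
    by (auto simp: clone_of_def clone_foperad_sel(1) fun_eq_iff restrict_def extensional_def)
  show ?thesis
    using p s by (intro clone.equality) (simp_all add: clone_of_sel(1) clone_foperad_sel(1))
qed

end

lemma clone_of_inject:
  assumes P: "is_foperad Cartesian P" and Q: "is_foperad Cartesian Q" and eq: "clone_of P = clone_of Q"
  shows "P = Q"
proof -
  have ops: "ops P = ops Q" using arg_cong[OF eq, of cops] by (simp add: clone_of_sel)
  have ract: "ract P m n f x = ract Q m n f x" if "f \<in> xfun Cartesian m n" "x \<in> ops P m" for m n f x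
    using foperad_ract_clone[OF P that] foperad_ract_clone[OF Q that(1)] that(2) ops eq by simp
  have "oid R = cproj (clone_of R) 1 0" if "is_foperad Cartesian R" for R :: "'a foperad"
    using foperad_ract_id[OF that foperad_oid[OF that]] by (simp add: clone_of_sel)
  then have oid: "oid P = oid Q" using P Q eq by simp
  have ocomp: "ocomp P ns x ys = ocomp Q ns x ys" for ns x ys
  proof (cases "x \<in> ops P (length ns) \<and> ys \<in> tuples (map (ops P) ns)")
    case True
    then have x: "x \<in> ops P (length ns)" and ys: "ys \<in> tuples (map (ops P) ns)" by auto
    have e: "map (\<lambda>i. ract P (ns ! i) (sum_list ns) (inj_list ns i) (ys ! i)) [0..<length ns] =
        map (\<lambda>i. ract Q (ns ! i) (sum_list ns) (inj_list ns i) (ys ! i)) [0..<length ns]"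
      using ys by (simp add: tuples_iff ract inj_list_xfun)
    show ?thesis
      unfolding foperad_ocomp_clone[OF P x ys] foperad_ocomp_clone[OF Q x[unfolded ops] ys[unfolded ops]] e eq ..
  next
    case False
    then show ?thesis
      using extensional_arb[OF foperad_ocomp_extensional(1)[OF P], of x ns] extensional_arb[OF foperad_ocomp_extensional(1)[OF Q], of x ns]
        extensional_arb[OF foperad_ocomp_extensional(2)[OF P], of x ns ys] extensional_arb[OF foperad_ocomp_extensional(2)[OF Q], of x ns ys] ops
      by metis
  qed
  show ?thesis by (rule foperad_eqI[OF P Q ops oid _ ract]) (auto simp: fun_eq_iff ocomp)
qed

text \<open>Either structure is expressed by the other one, so that preserving one means preserving the other.\<close>

lemma clone_hom_iff:
  assumes P: "is_foperad Cartesian P" and Q: "is_foperad Cartesian Q"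
  shows "is_foperad_hom Cartesian P Q h \<longleftrightarrow> is_clone_hom (clone_of P) (clone_of Q) h"
proof
  assume h: "is_foperad_hom Cartesian P Q h"
  have ty: "h \<in> (\<Pi>\<^sub>E n\<in>UNIV. ops P n \<rightarrow>\<^sub>E ops Q n)" and hid: "h 1 (oid P) = oid Q"
    and hc: "\<And>ns x ys. \<lbrakk>x \<in> ops P (length ns); ys \<in> tuples (map (ops P) ns)\<rbrakk> \<Longrightarrow>
      h (sum_list ns) (ocomp P ns x ys) = ocomp Q ns (h (length ns) x) (map2 h ns ys)"
    and hr: "\<And>m n f x. \<lbrakk>f \<in> xfun Cartesian m n; x \<in> ops P m\<rbrakk> \<Longrightarrow> h n (ract P m n f x) = ract Q m n f (h m x)"
    using h unfolding is_foperad_hom_def is_operad_hom_def by blast+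
  have hcl: "h n x \<in> ops Q n" if "x \<in> ops P n" for n x using ty that by (auto simp: PiE_iff)
  show "is_clone_hom (clone_of P) (clone_of Q) h"
    unfolding is_clone_hom_def clone_of_sel(1)
  proof (intro conjI allI ballI impI ty)
    fix n i :: nat assume "i < n"
    then show "h n (cproj (clone_of P) n i) = cproj (clone_of Q) n i"
      using hr[OF single_xfun foperad_oid[OF P], of i n] hid by (simp add: clone_of_sel(2))
  next
    fix k n x ys assume x: "x \<in> ops P k" and ys: "ys \<in> tuples (replicate k (ops P n))"
    have m: "map2 h (replicate k n) ys = map (h n) ys" using ys by (intro nth_equalityI) (simp_all add: tuples_iff)
    have ys': "map (h n) ys \<in> tuples (replicate k (ops Q n))" using ys hcl by (simp add: tuples_replicate_iff)
    have x': "x \<in> ops P (length (replicate k n))" and ys'': "ys \<in> tuples (map (ops P) (replicate k n))" using x ys by simp_all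
    show "h n (csub (clone_of P) k n x ys) = csub (clone_of Q) k n (h k x) (map (h n) ys)"
      unfolding clone_of_sel(3)[OF x ys] clone_of_sel(3)[OF hcl[OF x] ys']
        hr[OF fold_list_xfun foperad_ocomp[OF P x' ys'']] hc[OF x' ys''] m by simp
  qed
next
  assume h: "is_clone_hom (clone_of P) (clone_of Q) h"
  have ty: "h \<in> (\<Pi>\<^sub>E n\<in>UNIV. ops P n \<rightarrow>\<^sub>E ops Q n)"
    and hp: "\<And>n i. i < n \<Longrightarrow> h n (cproj (clone_of P) n i) = cproj (clone_of Q) n i"
    and hs: "\<And>k n x ys. \<lbrakk>x \<in> ops P k; ys \<in> tuples (replicate k (ops P n))\<rbrakk> \<Longrightarrow>
      h n (csub (clone_of P) k n x ys) = csub (clone_of Q) k n (h k x) (map (h n) ys)"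
    using h unfolding is_clone_hom_def clone_of_sel(1) by blast+
  have hcl: "h n x \<in> ops Q n" if "x \<in> ops P n" for n x using ty that by (auto simp: PiE_iff)
  have oid: "oid R = cproj (clone_of R) 1 0" if "is_foperad Cartesian R" for R :: "'a foperad"
    using foperad_ract_id[OF that foperad_oid[OF that]] by (simp add: clone_of_sel)
  have hr: "h n (ract P m n f x) = ract Q m n f (h m x)" if f: "f \<in> xfun Cartesian m n" and x: "x \<in> ops P m" for m n f x
  proof -
    have pr: "map (cproj (clone_of P) n) f \<in> tuples (replicate m (ops P n))"
      using projs_tuples[OF clone_of[OF P] f] by (simp add: clone_of_sel(1))
    have e: "map (h n) (map (cproj (clone_of P) n) f) = map (cproj (clone_of Q) n) f"
      using xfunD(2)[OF f] hp by auto
    show ?thesis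
      unfolding foperad_ract_clone[OF P f x] foperad_ract_clone[OF Q f hcl[OF x]] hs[OF x pr] e ..
  qed
  have hc: "h (sum_list ns) (ocomp P ns x ys) = ocomp Q ns (h (length ns) x) (map2 h ns ys)"
    if x: "x \<in> ops P (length ns)" and ys: "ys \<in> tuples (map (ops P) ns)" for ns x ys
  proof -
    let ?Y = "map (\<lambda>i. ract P (ns ! i) (sum_list ns) (inj_list ns i) (ys ! i)) [0..<length ns]"
    have yi: "ys ! i \<in> ops P (ns ! i)" if "i < length ns" for i using ys that by (simp add: tuples_iff)
    have Y: "?Y \<in> tuples (replicate (length ns) (ops P (sum_list ns)))"
      by (simp add: tuples_replicate_iff foperad_ract[OF P inj_list_xfun yi])
    have ys': "map2 h ns ys \<in> tuples (map (ops Q) ns)" using ys by (simp add: tuples_iff hcl)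
    have e: "map (h (sum_list ns)) ?Y = map (\<lambda>i. ract Q (ns ! i) (sum_list ns) (inj_list ns i) (map2 h ns ys ! i)) [0..<length ns]"
      using ys by (intro nth_equalityI) (simp_all add: tuples_iff hr[OF inj_list_xfun])
    show ?thesis
      unfolding foperad_ocomp_clone[OF P x ys] foperad_ocomp_clone[OF Q hcl[OF x] ys'] hs[OF x Y] e ..
  qed
  have "h 1 (oid P) = oid Q" using hp[of 0 1] oid[OF P] oid[OF Q] by simp
  then show "is_foperad_hom Cartesian P Q h"
    unfolding is_foperad_hom_def is_operad_hom_def using ty hr hc by blast
qed

theorem foperads_iso_clones: "category_iso (foperads Cartesian) clones clone_of (\<lambda>h. h)"
proof -
  have "bij_betw clone_of (obj (foperads Cartesian)) (obj (clones :: ('a clone, nat \<Rightarrow> 'a \<Rightarrow> 'a) category))"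
    by (rule bij_betwI')
       (auto simp: foperads_def clones_def clone_of dest: clone_of_inject intro: clone_foperad clone_of_clone_foperad[symmetric])
  moreover have "hom (foperads Cartesian) P Q = hom clones (clone_of P) (clone_of Q)"
    if "P \<in> obj (foperads Cartesian)" "Q \<in> obj (foperads Cartesian)" for P Q :: "'a foperad"
  proof -
    have "is_foperad_hom Cartesian P Q = is_clone_hom (clone_of P) (clone_of Q)"
      by (rule ext, rule clone_hom_iff) (use that in \<open>simp_all add: foperads_def\<close>)
    then show ?thesis by (simp add: foperads_def clones_def)
  qed
  ultimately show ?thesis
    unfolding category_iso_def by (simp add: foperads_def clones_def bij_betw_def clone_of_sel(1))
qed

lemma underlying_clone_eq:
  assumes M: "is_endo_monoid Cartesian one_cat M"
  shows "underlying_clone M = clone_of (foperad_of Cartesian M)"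
proof -
  let ?P = "foperad_of Cartesian M" and ?Z = "mcarrier M"
  have ops: "underlying_ops M = ops ?P" by (simp add: foperad_of_sel underlying_ops_def[abs_def])
  have "munit M (num n) (function_arr [i]) = ract ?P 1 n [i] (oid ?P)" if "i < n" for n i
    using monoid_unit_eq[OF M single_xfun[OF that]] single_xfun[OF that] nat_trans_closed[OF monoid_unit(1)[OF M] zero_unit]
    by (simp add: foperad_of_sel)
  moreover have "substitute Cartesian M (replicate k n) n x ys (concat (replicate k [0..<n])) =
      ract ?P (sum_list (replicate k n)) n (fold_list k n) (ocomp ?P (replicate k n) x ys)"
    if "x \<in> ops ?P k" "ys \<in> tuples (replicate k (ops ?P n))" for k n x ys
  proof -
    have x: "x \<in> fobj ?Z (num (length (replicate k n)))" using that(1) by (simp add: foperad_of_sel)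
    have ys: "ys \<in> nfam ?Z (replicate k n)" using that(2) by (simp add: nfam_def foperad_of_sel)
    show ?thesis
      unfolding substitute_cls fold_list_def[symmetric] monoid_mult_eq[OF M x ys fold_list_xfun]
      using fold_list_xfun monoid_ocomp_closed[OF M x ys] by (simp add: foperad_of_sel(4))
  qed
  ultimately show ?thesis
    unfolding underlying_clone_def clone_of_def ops by (auto simp: fun_eq_iff restrict_def)
qed


theorem mainTheorem3:
  shows "category_iso (endo_monoids Planar one_cat) (operads :: ('a operad, nat \<Rightarrow> 'a \<Rightarrow> 'a) category)
           (underlying_operad Planar) underlying_hom \<and>
         category_iso (endo_monoids Symmetric one_cat) (sym_operads :: ('a sym_operad, nat \<Rightarrow> 'a \<Rightarrow> 'a) category)
           underlying_sym_operad underlying_hom \<and>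
         category_iso (endo_monoids Cartesian one_cat) (clones :: ('a clone, nat \<Rightarrow> 'a \<Rightarrow> 'a) category)
           underlying_clone underlying_hom"
proof (intro conjI)
  show "category_iso (endo_monoids Planar one_cat) (operads :: ('a operad, nat \<Rightarrow> 'a \<Rightarrow> 'a) category)
      (underlying_operad Planar) underlying_hom"
    by (rule category_iso_comp[OF endo_monoids_iso_foperads foperads_iso_operads]) (rule underlying_operad_truncate)
  show "category_iso (endo_monoids Symmetric one_cat) (sym_operads :: ('a sym_operad, nat \<Rightarrow> 'a \<Rightarrow> 'a) category)
      underlying_sym_operad underlying_hom"
    by (rule category_iso_comp[OF endo_monoids_iso_foperads foperads_iso_sym_operads]) (rule underlying_sym_operad_eq)
  show "category_iso (endo_monoids Cartesian one_cat) (clones :: ('a clone, nat \<Rightarrow> 'a \<Rightarrow> 'a) category)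
      underlying_clone underlying_hom"
    by (rule category_iso_comp[OF endo_monoids_iso_foperads foperads_iso_clones])
       (simp add: endo_monoids_def underlying_clone_eq)
qed

end
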